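(* Let $B\subseteq A$ be an extension of Artin algebras and let $I$ be an ideal in $B$ such that $I\,\mathrm{rad}(B)$ is a left ideal in $A$ and the full subcategory of $B/I$-modules (viewed inside the category of $B$-modules) is $B$-syzygy-finite. If $A$ is torsionless-finite (for example, representation-finite or hereditary), then $\mathrm{fin.dim}(B)<\infty$.
   Context: An Artin algebra is an algebra that is finitely generated as a module over a commutative Artin ring. All modules are finitely generated left modules; $A\text{-mod}$ is the category of finitely generated left $A$-modules. An extension $B\subseteq A$ of Artin algebras means that $B$ is a subalgebra of $A$ with the same identity. $\mathrm{rad}(B)$ is the Jacobson radical of $B$. The finitistic dimension $\mathrm{fin.dim}(B)$ is the supremum of the projective dimensions of those $X\in B\text{-mod}$ with finite projective dimension. For an Artin algebra $\Lambda$, an integer $m\ge 0$ and a full subcategory $\mathcal C$ of $\Lambda\text{-mod}$, $\Omega^m(\mathcal C)$ is the full subcategory of $\Lambda\text{-mod}$ consisting of those $\Lambda$-modules that are either projective or direct summands of $m$-th syzygies (over $\Lambda$) of modules in $\mathcal C$. $\mathcal C$ is $m$-syzygy-finite if there are only finitely many non-isomorphic indecomposable modules in $\Omega^m(\mathcal C)$, and $\Lambda$-syzygy-finite if it is $m$-syzygy-finite for some $m\ge 0$. The algebra $\Lambda$ is representation-finite (respectively, torsionless-finite) if $\Lambda\text{-mod}$ is $0$-syzygy-finite (respectively, $1$-syzygy-finite). *)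

theory Defs
  imports "HOL-Algebra.Ideal_Product" "HOL-Algebra.QuotRing" "HOL-Algebra.Subrings" "HOL-Library.Extended_Nat"
begin

section \<open>Left modules over a not necessarily commutative ring\<close>

text \<open>
  The locale \<^locale>\<open>module\<close> of the library requires a commutative ring of scalars. The locale
  below drops commutativity and keeps the record type \<^typ>\<open>('a, 'b) module\<close> (whose multiplication
  and unit fields are irrelevant). The library notion \<^const>\<open>submodule\<close> does not depend on
  commutativity and is reused.
\<close>

locale left_module = R?: ring R + M?: abelian_group M
  for R :: "('a, 'r) ring_scheme" (structure)
    and M :: "('a, 'b, 'm) module_scheme" (structure) +
  assumes smult_closed:
      "\<lbrakk>a \<in> carrier R; x \<in> carrier M\<rbrakk> \<Longrightarrow> a \<odot>\<^bsub>M\<^esub> x \<in> carrier M"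
    and smult_l_distr:
      "\<lbrakk>a \<in> carrier R; b \<in> carrier R; x \<in> carrier M\<rbrakk> \<Longrightarrow>
        (a \<oplus>\<^bsub>R\<^esub> b) \<odot>\<^bsub>M\<^esub> x = a \<odot>\<^bsub>M\<^esub> x \<oplus>\<^bsub>M\<^esub> b \<odot>\<^bsub>M\<^esub> x"
    and smult_r_distr:
      "\<lbrakk>a \<in> carrier R; x \<in> carrier M; y \<in> carrier M\<rbrakk> \<Longrightarrow>
        a \<odot>\<^bsub>M\<^esub> (x \<oplus>\<^bsub>M\<^esub> y) = a \<odot>\<^bsub>M\<^esub> x \<oplus>\<^bsub>M\<^esub> a \<odot>\<^bsub>M\<^esub> y"
    and smult_assoc1:
      "\<lbrakk>a \<in> carrier R; b \<in> carrier R; x \<in> carrier M\<rbrakk> \<Longrightarrow>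
        (a \<otimes>\<^bsub>R\<^esub> b) \<odot>\<^bsub>M\<^esub> x = a \<odot>\<^bsub>M\<^esub> (b \<odot>\<^bsub>M\<^esub> x)"
    and smult_one:
      "x \<in> carrier M \<Longrightarrow> \<one>\<^bsub>R\<^esub> \<odot>\<^bsub>M\<^esub> x = x"

definition fin_gen :: "('a, 'r) ring_scheme \<Rightarrow> ('a, 'b, 'm) module_scheme \<Rightarrow> bool" where
  "fin_gen R M \<longleftrightarrow>
     (\<exists>S. finite S \<and> S \<subseteq> carrier M \<and>
          (\<forall>H. submodule H R M \<and> S \<subseteq> H \<longrightarrow> H = carrier M))"

definition mod_hom ::
  "('a, 'r) ring_scheme \<Rightarrow> ('a, 'b, 'm) module_scheme \<Rightarrow> ('a, 'c, 'n) module_scheme \<Rightarrow> ('b \<Rightarrow> 'c) set"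
where
  "mod_hom R M N =
     {f \<in> carrier M \<rightarrow> carrier N.
        (\<forall>x \<in> carrier M. \<forall>y \<in> carrier M. f (x \<oplus>\<^bsub>M\<^esub> y) = f x \<oplus>\<^bsub>N\<^esub> f y) \<and>
        (\<forall>a \<in> carrier R. \<forall>x \<in> carrier M. f (a \<odot>\<^bsub>M\<^esub> x) = a \<odot>\<^bsub>N\<^esub> f x)}"

definition mod_iso ::
  "('a, 'r) ring_scheme \<Rightarrow> ('a, 'b, 'm) module_scheme \<Rightarrow> ('a, 'c, 'n) module_scheme \<Rightarrow> bool"
where
  "mod_iso R M N \<longleftrightarrow> (\<exists>f \<in> mod_hom R M N. bij_betw f (carrier M) (carrier N))"

text \<open>The module is the internal direct sum of two submodules.\<close>

definition direct_decomp ::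
  "('a, 'r) ring_scheme \<Rightarrow> ('a, 'b, 'm) module_scheme \<Rightarrow> 'b set \<Rightarrow> 'b set \<Rightarrow> bool"
where
  "direct_decomp R M H K \<longleftrightarrow>
     submodule H R M \<and> submodule K R M \<and> H <+>\<^bsub>M\<^esub> K = carrier M \<and> H \<inter> K = {\<zero>\<^bsub>M\<^esub>}"

text \<open>Being a direct summand is understood up to isomorphism.\<close>

definition direct_summand ::
  "('a, 'r) ring_scheme \<Rightarrow> ('a, 'b, 'm) module_scheme \<Rightarrow> ('a, 'c) module \<Rightarrow> bool"
where
  "direct_summand R M N \<longleftrightarrow>
     (\<exists>H K. direct_decomp R N H K \<and> mod_iso R M (N\<lparr>carrier := H\<rparr>))"

definition indecomposable :: "('a, 'r) ring_scheme \<Rightarrow> ('a, 'b, 'm) module_scheme \<Rightarrow> bool" where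
  "indecomposable R M \<longleftrightarrow>
     carrier M \<noteq> {\<zero>\<^bsub>M\<^esub>} \<and>
     (\<forall>H K. direct_decomp R M H K \<longrightarrow> H = {\<zero>\<^bsub>M\<^esub>} \<or> K = {\<zero>\<^bsub>M\<^esub>})"


section \<open>The category of finitely generated left modules\<close>

text \<open>
  A definition cannot quantify over all types, so the objects of the category of finitely generated
  left modules are taken with carriers in one fixed type, that of lists of ring elements. Choosing
  for every element of a module its coefficients with respect to a fixed finite generating system
  shows that nothing is lost: every finitely generated left module, on whatever type, is isomorphic
  to a module of this kind (lemma \<open>fg_mods_universal\<close> below).
\<close>

definition fg_mods :: "('a, 'r) ring_scheme \<Rightarrow> ('a, 'a list) module set" where
  "fg_mods R = {M. left_module R M \<and> fin_gen R M}"

context left_module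
begin

lemma smult_zero_left:
  assumes x: "x \<in> carrier M" shows "\<zero>\<^bsub>R\<^esub> \<odot>\<^bsub>M\<^esub> x = \<zero>\<^bsub>M\<^esub>"
proof -
  have c: "\<zero>\<^bsub>R\<^esub> \<odot>\<^bsub>M\<^esub> x \<in> carrier M" using x by (simp add: smult_closed)
  have "\<zero>\<^bsub>R\<^esub> \<odot>\<^bsub>M\<^esub> x = \<zero>\<^bsub>R\<^esub> \<odot>\<^bsub>M\<^esub> x \<oplus>\<^bsub>M\<^esub> \<zero>\<^bsub>R\<^esub> \<odot>\<^bsub>M\<^esub> x"
    using smult_l_distr[of "\<zero>\<^bsub>R\<^esub>" "\<zero>\<^bsub>R\<^esub>" x] x by simp
  then show ?thesis using c by (metis M.add.r_cancel_one')
qed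

lemma smult_zero_right:
  assumes a: "a \<in> carrier R" shows "a \<odot>\<^bsub>M\<^esub> \<zero>\<^bsub>M\<^esub> = \<zero>\<^bsub>M\<^esub>"
proof -
  have c: "a \<odot>\<^bsub>M\<^esub> \<zero>\<^bsub>M\<^esub> \<in> carrier M" using a by (simp add: smult_closed)
  have "a \<odot>\<^bsub>M\<^esub> \<zero>\<^bsub>M\<^esub> = a \<odot>\<^bsub>M\<^esub> \<zero>\<^bsub>M\<^esub> \<oplus>\<^bsub>M\<^esub> a \<odot>\<^bsub>M\<^esub> \<zero>\<^bsub>M\<^esub>"
    using smult_r_distr[of a "\<zero>\<^bsub>M\<^esub>" "\<zero>\<^bsub>M\<^esub>"] a by simp
  then show ?thesis using c by (metis M.add.r_cancel_one')
qed

lemma smult_minus_left: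
  assumes a: "a \<in> carrier R" and x: "x \<in> carrier M"
  shows "(\<ominus>\<^bsub>R\<^esub> a) \<odot>\<^bsub>M\<^esub> x = \<ominus>\<^bsub>M\<^esub> (a \<odot>\<^bsub>M\<^esub> x)"
proof -
  have "(\<ominus>\<^bsub>R\<^esub> a) \<odot>\<^bsub>M\<^esub> x \<oplus>\<^bsub>M\<^esub> a \<odot>\<^bsub>M\<^esub> x = \<zero>\<^bsub>M\<^esub>"
    using smult_l_distr[of "\<ominus>\<^bsub>R\<^esub> a" a x] a x by (simp add: R.l_neg smult_zero_left)
  then show ?thesis using a x by (simp add: M.minus_equality smult_closed)
qed

lemma left_submoduleI:
  assumes sub: "H \<subseteq> carrier M" and z: "\<zero>\<^bsub>M\<^esub> \<in> H"
    and add: "\<And>x y. x \<in> H \<Longrightarrow> y \<in> H \<Longrightarrow> x \<oplus>\<^bsub>M\<^esub> y \<in> H"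
    and sm: "\<And>a x. a \<in> carrier R \<Longrightarrow> x \<in> H \<Longrightarrow> a \<odot>\<^bsub>M\<^esub> x \<in> H"
  shows "submodule H R M"
proof -
  have neg: "\<ominus>\<^bsub>M\<^esub> x \<in> H" if x: "x \<in> H" for x
  proof -
    have xM: "x \<in> carrier M" using x sub by blast
    have "(\<ominus>\<^bsub>R\<^esub> \<one>\<^bsub>R\<^esub>) \<odot>\<^bsub>M\<^esub> x = \<ominus>\<^bsub>M\<^esub> x"
      using smult_minus_left[of "\<one>\<^bsub>R\<^esub>" x] xM by (simp add: smult_one)
    then show ?thesis using sm[of "\<ominus>\<^bsub>R\<^esub> \<one>\<^bsub>R\<^esub>" x] x by simp
  qed
  show ?thesis
    using sub z add sm neg
    by (intro submodule.intro submodule_axioms.intro M.add.subgroupI) (auto simp: a_inv_def)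
qed

lemma ex_list_span:
  assumes "set ss \<subseteq> carrier M"
  shows "\<exists>H e. submodule H R M \<and> set ss \<subseteq> H \<and> H \<subseteq> range (e :: 'a list \<Rightarrow> 'b)"
  using assms
proof (induction ss)
  case Nil
  have "submodule {\<zero>\<^bsub>M\<^esub>} R M" by (rule left_submoduleI) (auto simp: smult_zero_right)
  moreover have "{\<zero>\<^bsub>M\<^esub>} \<subseteq> range (\<lambda>_ :: 'a list. \<zero>\<^bsub>M\<^esub>)" by auto
  ultimately show ?case by (metis empty_set empty_subsetI)
next
  case (Cons s ss)
  then obtain H and e :: "'a list \<Rightarrow> 'b"
    where H: "submodule H R M" "set ss \<subseteq> H" "H \<subseteq> range e" by auto
  have s: "s \<in> carrier M" using Cons.prems by simp
  have sg: "subgroup H (add_monoid M)" using H(1) by (rule submodule.axioms)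
  have HM: "H \<subseteq> carrier M" and H0: "\<zero>\<^bsub>M\<^esub> \<in> H"
    using subgroup.subset[OF sg] subgroup.one_closed[OF sg] by auto
  have Hadd: "\<And>x y. x \<in> H \<Longrightarrow> y \<in> H \<Longrightarrow> x \<oplus>\<^bsub>M\<^esub> y \<in> H"
    using subgroup.m_closed[OF sg] by simp
  have Hsm: "\<And>a x. a \<in> carrier R \<Longrightarrow> x \<in> H \<Longrightarrow> a \<odot>\<^bsub>M\<^esub> x \<in> H"
    using submodule.smult_closed[OF H(1)] .
  define K where "K = {r \<odot>\<^bsub>M\<^esub> s \<oplus>\<^bsub>M\<^esub> x | r x. r \<in> carrier R \<and> x \<in> H}"
  define e' where "e' l = hd l \<odot>\<^bsub>M\<^esub> s \<oplus>\<^bsub>M\<^esub> e (tl l)" for l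
  have KI: "r \<odot>\<^bsub>M\<^esub> s \<oplus>\<^bsub>M\<^esub> x \<in> K" if "r \<in> carrier R" "x \<in> H" for r x
    using that unfolding K_def by blast
  have "submodule K R M"
  proof (rule left_submoduleI)
    show "K \<subseteq> carrier M" unfolding K_def using s HM by (auto simp: smult_closed)
    show "\<zero>\<^bsub>M\<^esub> \<in> K" using KI[of "\<zero>\<^bsub>R\<^esub>" "\<zero>\<^bsub>M\<^esub>"] H0 s by (simp add: smult_zero_left)
  next
    fix x y assume "x \<in> K" "y \<in> K"
    then obtain a x' b y' where d: "x = a \<odot>\<^bsub>M\<^esub> s \<oplus>\<^bsub>M\<^esub> x'" "y = b \<odot>\<^bsub>M\<^esub> s \<oplus>\<^bsub>M\<^esub> y'"
      "a \<in> carrier R" "b \<in> carrier R" "x' \<in> H" "y' \<in> H" unfolding K_def by blast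
    have m: "x' \<in> carrier M" "y' \<in> carrier M" "a \<odot>\<^bsub>M\<^esub> s \<in> carrier M" "b \<odot>\<^bsub>M\<^esub> s \<in> carrier M"
      using d HM s by (auto simp: smult_closed)
    have "x \<oplus>\<^bsub>M\<^esub> y = (a \<oplus>\<^bsub>R\<^esub> b) \<odot>\<^bsub>M\<^esub> s \<oplus>\<^bsub>M\<^esub> (x' \<oplus>\<^bsub>M\<^esub> y')"
      using d s m by (simp add: smult_l_distr M.a_ac)
    then show "x \<oplus>\<^bsub>M\<^esub> y \<in> K" using d Hadd by (simp add: KI)
  next
    fix a x assume a: "a \<in> carrier R" and "x \<in> K"
    then obtain b y where d: "x = b \<odot>\<^bsub>M\<^esub> s \<oplus>\<^bsub>M\<^esub> y" "b \<in> carrier R" "y \<in> H"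
      unfolding K_def by blast
    have "a \<odot>\<^bsub>M\<^esub> x = (a \<otimes>\<^bsub>R\<^esub> b) \<odot>\<^bsub>M\<^esub> s \<oplus>\<^bsub>M\<^esub> a \<odot>\<^bsub>M\<^esub> y"
      using a d s HM by (simp add: smult_r_distr smult_assoc1 smult_closed subset_iff)
    then show "a \<odot>\<^bsub>M\<^esub> x \<in> K" using a d Hsm by (simp add: KI)
  qed
  moreover have "s \<in> K" using KI[of "\<one>\<^bsub>R\<^esub>" "\<zero>\<^bsub>M\<^esub>"] H0 s by (simp add: smult_one)
  moreover have "H \<subseteq> K"
  proof
    fix x assume "x \<in> H"
    then show "x \<in> K" using KI[of "\<zero>\<^bsub>R\<^esub>" x] s HM by (simp add: smult_zero_left subset_iff)
  qed
  moreover have "K \<subseteq> range e'"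
  proof
    fix x assume "x \<in> K"
    then obtain r y where d: "x = r \<odot>\<^bsub>M\<^esub> s \<oplus>\<^bsub>M\<^esub> y" "y \<in> H" unfolding K_def by blast
    obtain l where "y = e l" using d H(3) by blast
    then have "x = e' (r # l)" using d by (simp add: e'_def)
    then show "x \<in> range e'" by blast
  qed
  ultimately have "submodule K R M \<and> set (s # ss) \<subseteq> K \<and> K \<subseteq> range e'"
    using H(2) by auto
  then show ?case by blast
qed

end

lemma fg_mods_universal:
  fixes R :: "('a, 'r) ring_scheme" and M :: "('a, 'b, 'm) module_scheme"
  assumes lm: "left_module R M" and fg: "fin_gen R M"
  shows "\<exists>N \<in> fg_mods R. mod_iso R M N"
proof -
  interpret left_module R M by (rule lm)
  obtain S where S: "finite S" "S \<subseteq> carrier M"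
    "\<And>H. submodule H R M \<Longrightarrow> S \<subseteq> H \<Longrightarrow> H = carrier M"
    using fg unfolding fin_gen_def by blast
  obtain ss where ss: "set ss = S" using S(1) finite_list by blast
  obtain e :: "'a list \<Rightarrow> 'b" where e: "carrier M \<subseteq> range e"
    using ex_list_span[of ss] ss S by blast
  define g where "g = inv_into UNIV e"
  have inj: "inj_on g (carrier M)" unfolding g_def using e by (rule inj_on_inv_into)
  define h where "h = inv_into (carrier M) g"
  have hg: "h (g x) = x" if "x \<in> carrier M" for x
    using inj that unfolding h_def by simp
  define N :: "('a, 'a list) module" where
    "N = \<lparr>carrier = g ` carrier M, mult = undefined, one = undefined, zero = g \<zero>\<^bsub>M\<^esub>,
          add = (\<lambda>x y. g (h x \<oplus>\<^bsub>M\<^esub> h y)), smult = (\<lambda>r x. g (r \<odot>\<^bsub>M\<^esub> h x))\<rparr>"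
  have Ns: "carrier N = g ` carrier M" "\<zero>\<^bsub>N\<^esub> = g \<zero>\<^bsub>M\<^esub>"
    "\<And>x y. x \<oplus>\<^bsub>N\<^esub> y = g (h x \<oplus>\<^bsub>M\<^esub> h y)" "\<And>r x. r \<odot>\<^bsub>N\<^esub> x = g (r \<odot>\<^bsub>M\<^esub> h x)"
    by (simp_all add: N_def)
  have ag: "abelian_group N"
  proof (rule abelian_groupI, goal_cases)
    case (6 x)
    then obtain y where y: "y \<in> carrier M" "x = g y" by (auto simp: Ns)
    then have "g (\<ominus>\<^bsub>M\<^esub> y) \<in> carrier N \<and> g (\<ominus>\<^bsub>M\<^esub> y) \<oplus>\<^bsub>N\<^esub> x = \<zero>\<^bsub>N\<^esub>"
      by (simp add: Ns hg M.l_neg)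
    then show ?case by blast
  qed (auto simp: Ns hg M.a_ac)
  have lN: "left_module R N"
    by (intro left_module.intro left_module_axioms.intro R.ring_axioms ag)
      (auto simp: Ns hg smult_closed smult_l_distr smult_r_distr smult_assoc1 smult_one)
  have "fin_gen R N"
    unfolding fin_gen_def
  proof (intro exI[of _ "g ` S"] conjI allI impI)
    show "finite (g ` S)" "g ` S \<subseteq> carrier N" using S by (auto simp: Ns)
    fix H assume "submodule H R N \<and> g ` S \<subseteq> H"
    then have H: "submodule H R N" and SH: "g ` S \<subseteq> H" by auto
    have sg: "subgroup H (add_monoid N)" using H by (rule submodule.axioms)
    have HN: "H \<subseteq> carrier N" and H0: "\<zero>\<^bsub>N\<^esub> \<in> H"
      using subgroup.subset[OF sg] subgroup.one_closed[OF sg] by auto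
    have Hadd: "\<And>x y. x \<in> H \<Longrightarrow> y \<in> H \<Longrightarrow> x \<oplus>\<^bsub>N\<^esub> y \<in> H"
      using subgroup.m_closed[OF sg] by simp
    have Hsm: "\<And>a x. a \<in> carrier R \<Longrightarrow> x \<in> H \<Longrightarrow> a \<odot>\<^bsub>N\<^esub> x \<in> H"
      using submodule.smult_closed[OF H] .
    let ?H = "{x \<in> carrier M. g x \<in> H}"
    have "submodule ?H R M"
    proof (rule left_submoduleI)
      show "\<zero>\<^bsub>M\<^esub> \<in> ?H" using H0 by (simp add: Ns)
      show "x \<oplus>\<^bsub>M\<^esub> y \<in> ?H" if "x \<in> ?H" "y \<in> ?H" for x y
        using that Hadd[of "g x" "g y"] by (simp add: Ns hg)
      show "a \<odot>\<^bsub>M\<^esub> x \<in> ?H" if "a \<in> carrier R" "x \<in> ?H" for a x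
        using that Hsm[of a "g x"] by (simp add: Ns hg smult_closed)
    qed auto
    moreover have "S \<subseteq> ?H" using S(2) SH by auto
    ultimately have "?H = carrier M" by (rule S(3))
    then show "H = carrier N" using HN by (auto simp: Ns)
  qed
  with lN have "N \<in> fg_mods R" by (simp add: fg_mods_def)
  moreover have "mod_iso R M N"
    unfolding mod_iso_def mod_hom_def using inj
    by (intro bexI[of _ g]) (auto simp: bij_betw_def Ns hg)
  ultimately show ?thesis by blast
qed


section \<open>Projective modules and dimensions\<close>

definition projective :: "('a, 'r) ring_scheme \<Rightarrow> ('a, 'a list) module \<Rightarrow> bool" where
  "projective R P \<longleftrightarrow>
     P \<in> fg_mods R \<and>
     (\<forall>M \<in> fg_mods R. \<forall>N \<in> fg_mods R. \<forall>g \<in> mod_hom R M N. \<forall>f \<in> mod_hom R P N.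
        g ` carrier M = carrier N \<longrightarrow>
        (\<exists>h \<in> mod_hom R P M. \<forall>x \<in> carrier P. g (h x) = f x))"

text \<open>
  An exact sequence $0 \to P_n \to \dots \to P_0 \to X \to 0$ with projective $P_i$, indexed so that
  $Q_0 = X$, $Q_{i+1} = P_i$ and $d_i : Q_{i+1} \to Q_i$.
\<close>

definition has_proj_resolution ::
  "('a, 'r) ring_scheme \<Rightarrow> ('a, 'a list) module \<Rightarrow> nat \<Rightarrow> bool"
where
  "has_proj_resolution R X n \<longleftrightarrow>
     (\<exists>Q d. Q 0 = X \<and>
        (\<forall>i \<le> n. projective R (Q (Suc i)) \<and> d i \<in> mod_hom R (Q (Suc i)) (Q i)) \<and>
        d 0 ` carrier (Q (Suc 0)) = carrier X \<and>
        (\<forall>i < n. d (Suc i) ` carrier (Q (Suc (Suc i))) = a_kernel (Q (Suc i)) (Q i) (d i)) \<and>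
        inj_on (d n) (carrier (Q (Suc n))))"

definition proj_dim :: "('a, 'r) ring_scheme \<Rightarrow> ('a, 'a list) module \<Rightarrow> enat" where
  "proj_dim R X = (INF n \<in> {n. has_proj_resolution R X n}. enat n)"

definition fin_dim :: "('a, 'r) ring_scheme \<Rightarrow> enat" where
  "fin_dim R = (SUP X \<in> {X \<in> fg_mods R. proj_dim R X < \<infinity>}. proj_dim R X)"


section \<open>Syzygies and syzygy-finiteness\<close>

text \<open>A projective cover is a surjection from a projective module with superfluous kernel.\<close>

definition projective_cover ::
  "('a, 'r) ring_scheme \<Rightarrow> ('a, 'a list) module \<Rightarrow> ('a, 'a list) module \<Rightarrow>
     ('a list \<Rightarrow> 'a list) \<Rightarrow> bool"
where
  "projective_cover R P X f \<longleftrightarrow>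
     projective R P \<and> f \<in> mod_hom R P X \<and> f ` carrier P = carrier X \<and>
     (\<forall>U. submodule U R P \<and> U <+>\<^bsub>P\<^esub> a_kernel P X f = carrier P \<longrightarrow> U = carrier P)"

text \<open>
  Syzygies are kernels of projective covers; they are determined only up to isomorphism, so
  this is a relation.
\<close>

inductive nth_syzygy ::
  "('a, 'r) ring_scheme \<Rightarrow> nat \<Rightarrow> ('a, 'a list) module \<Rightarrow> ('a, 'a list) module \<Rightarrow> bool"
  for R :: "('a, 'r) ring_scheme"
where
  zero: "nth_syzygy R 0 X X"
| Suc: "\<lbrakk>projective_cover R P X f; nth_syzygy R m (P\<lparr>carrier := a_kernel P X f\<rparr>) Z\<rbrakk>
        \<Longrightarrow> nth_syzygy R (Suc m) X Z"

text \<open>A full subcategory is given by the set of its objects.\<close>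

definition syzygy_cat ::
  "('a, 'r) ring_scheme \<Rightarrow> nat \<Rightarrow> ('a, 'a list) module set \<Rightarrow> ('a, 'a list) module set"
where
  "syzygy_cat R m C =
     {M \<in> fg_mods R. projective R M \<or>
        (\<exists>X \<in> C. \<exists>Z. nth_syzygy R m X Z \<and> direct_summand R M Z)}"

definition m_syzygy_finite ::
  "('a, 'r) ring_scheme \<Rightarrow> nat \<Rightarrow> ('a, 'a list) module set \<Rightarrow> bool"
where
  "m_syzygy_finite R m C \<longleftrightarrow>
     (\<exists>F :: ('a, 'a list) module set. finite F \<and>
        (\<forall>M \<in> syzygy_cat R m C. indecomposable R M \<longrightarrow> (\<exists>N \<in> F. mod_iso R M N)))"

definition syzygy_finite :: "('a, 'r) ring_scheme \<Rightarrow> ('a, 'a list) module set \<Rightarrow> bool" where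
  "syzygy_finite R C \<longleftrightarrow> (\<exists>m. m_syzygy_finite R m C)"

definition torsionless_finite :: "('a, 'r) ring_scheme \<Rightarrow> bool" where
  "torsionless_finite R \<longleftrightarrow> m_syzygy_finite R 1 (fg_mods R)"

definition restrict_scalars :: "('a \<Rightarrow> 'c) \<Rightarrow> ('c, 'b) module \<Rightarrow> ('a, 'b) module" where
  "restrict_scalars \<phi> N =
     \<lparr>carrier = carrier N, mult = mult N, one = one N, zero = zero N, add = add N,
      smult = (\<lambda>a x. \<phi> a \<odot>\<^bsub>N\<^esub> x)\<rparr>"

text \<open>
  The finitely generated modules over $R/I$, viewed as $R$-modules along $R \to R/I$ (closed under
  isomorphism). They are finitely generated over $R$, so carriers consisting of lists over \<open>R\<close>
  suffice for the $R/I$-modules as well.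
\<close>

definition quotient_mods :: "('a, 'r) ring_scheme \<Rightarrow> 'a set \<Rightarrow> ('a, 'a list) module set" where
  "quotient_mods R I =
     {M \<in> fg_mods R. \<exists>N :: ('a set, 'a list) module.
        left_module (R Quot I) N \<and> fin_gen (R Quot I) N \<and>
        mod_iso R M (restrict_scalars (\<lambda>r. I +>\<^bsub>R\<^esub> r) N)}"


section \<open>Left ideals, the Jacobson radical and Artin algebras\<close>

definition left_ideal :: "'a set \<Rightarrow> ('a, 'r) ring_scheme \<Rightarrow> bool" where
  "left_ideal L R \<longleftrightarrow>
     additive_subgroup L R \<and> (\<forall>a \<in> carrier R. \<forall>x \<in> L. a \<otimes>\<^bsub>R\<^esub> x \<in> L)"

definition maximal_left_ideal :: "'a set \<Rightarrow> ('a, 'r) ring_scheme \<Rightarrow> bool" where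
  "maximal_left_ideal L R \<longleftrightarrow>
     left_ideal L R \<and> L \<noteq> carrier R \<and>
     (\<forall>J. left_ideal J R \<and> L \<subseteq> J \<longrightarrow> J = L \<or> J = carrier R)"

definition jacobson_radical :: "('a, 'r) ring_scheme \<Rightarrow> 'a set" where
  "jacobson_radical R = {x \<in> carrier R. \<forall>L. maximal_left_ideal L R \<longrightarrow> x \<in> L}"

definition artinian_cring :: "('k, 'r) ring_scheme \<Rightarrow> bool" where
  "artinian_cring k \<longleftrightarrow>
     cring k \<and>
     (\<forall>J :: nat \<Rightarrow> 'k set. (\<forall>n. ideal (J n) k \<and> J (Suc n) \<subseteq> J n) \<longrightarrow> (\<exists>n. \<forall>m \<ge> n. J m = J n))"

text \<open>
  The library locale \<^locale>\<open>algebra\<close> is restricted to commutative algebras. In the record of an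
  algebra the scalar multiplication is that of the base ring.
\<close>

definition artin_algebra :: "('k, 'r) ring_scheme \<Rightarrow> ('k, 'a) module \<Rightarrow> bool" where
  "artin_algebra k A \<longleftrightarrow>
     artinian_cring k \<and> ring A \<and> module k A \<and>
     (\<forall>c \<in> carrier k. \<forall>x \<in> carrier A. \<forall>y \<in> carrier A.
        (c \<odot>\<^bsub>A\<^esub> x) \<otimes>\<^bsub>A\<^esub> y = c \<odot>\<^bsub>A\<^esub> (x \<otimes>\<^bsub>A\<^esub> y) \<and>
        x \<otimes>\<^bsub>A\<^esub> (c \<odot>\<^bsub>A\<^esub> y) = c \<odot>\<^bsub>A\<^esub> (x \<otimes>\<^bsub>A\<^esub> y)) \<and>
     fin_gen k A"

text \<open>A \<^const>\<open>subring\<close> contains the identity of the ambient ring.\<close>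

definition artin_extension :: "('k, 'r) ring_scheme \<Rightarrow> 'a set \<Rightarrow> ('k, 'a) module \<Rightarrow> bool" where
  "artin_extension k B A \<longleftrightarrow>
     artin_algebra k A \<and> artin_algebra k (A\<lparr>carrier := B\<rparr>) \<and> subring B A \<and> submodule B k A"

end

theory Submission
  imports Defs "HOL-Library.Multiset"
begin

text \<open>
  Let \<open>X\<close> be a \<open>B\<close>-module of finite projective dimension and let \<open>Y \<subseteq> B\<^sup>n\<close> be its second syzygy,
  formed with projective covers, so that its elements have coordinates in \<open>rad(B)\<close>. The elements of
  \<open>Y\<close> with coordinates in \<open>I rad(B)\<close> form an \<open>A\<close>-submodule \<open>H\<close> of \<open>A\<^sup>n\<close>, and \<open>Y/H\<close> is annihilated by \<open>I\<close>.
  Hence \<open>H\<close> is a direct sum of copies of finitely many \<open>A\<close>-modules that do not depend on \<open>X\<close>,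
  and so is, up to projective summands, the \<open>m\<close>-th syzygy of \<open>Y/H\<close> over \<open>B\<close> for a fixed \<open>m\<close>.
  Rotating the exact sequence of syzygies of \<open>H\<close>, \<open>Y\<close> and \<open>Y/H\<close> exhibits the \<open>m\<close>-th syzygy of \<open>Y\<close> as
  the cokernel of a map between direct sums of modules from a finite set.

  The projective dimension of such a cokernel, if finite, is bounded by an argument of Igusa and
  Todorov: after finitely many syzygies the two direct sums are stably isomorphic. The number of
  syzygies needed is bounded, since the multiplicities involved are governed by an ascending chain of
  subgroups of a finitely generated free abelian group. The cokernel is then that of an endomorphism
  in the stable category, and Fitting's lemma reduces it to a direct summand which has itself finite
  projective dimension. There are only finitely many indecomposable summands to consider.
\<close>

section \<open>Submodules and homomorphisms\<close>

text \<open>The second syzygy is used because the relations that cut it out have entries in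
  \<open>B\<close>: the cover of the first syzygy maps into a module that sits inside a free module.
  Such relations make sense over \<open>A\<close> as well. Minimality puts the coordinates into the
  radical, so that \<open>I\<close> carries \<open>Y\<close> into \<open>H\<close>. Neither
  \<open>H\<close> nor \<open>Y/H\<close> need have finite projective dimension over
  \<open>B\<close>. Rotation therefore moves the term of finite projective dimension to the end,
  where both other terms are sums of modules from a fixed finite set. Syzygies are unique only up to
  projective summands, so most of the work is done up to \<open>stab\<close>. The exception is
  \<open>H\<close>, which is decomposed up to isomorphism over \<open>A\<close>, since projective
  \<open>A\<close>-modules need not be projective over \<open>B\<close>. The use of Fitting's lemma
  rests on the fact that the endomorphisms whose cone has finite projective dimension are closed
  under composition. A power of the endomorphism vanishes on the part that remains, and the module
  representing the cone of this power has that part as a direct summand.\<close>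

context left_module
begin

lemma diff_eq_zero_iff:
  assumes "x \<in> carrier M" "y \<in> carrier M"
  shows "x \<ominus>\<^bsub>M\<^esub> y = \<zero>\<^bsub>M\<^esub> \<longleftrightarrow> x = y"
proof
  assume "x \<ominus>\<^bsub>M\<^esub> y = \<zero>\<^bsub>M\<^esub>"
  then have "\<ominus>\<^bsub>M\<^esub> (\<ominus>\<^bsub>M\<^esub> y) = x" using assms by (intro M.minus_equality) (auto simp: a_minus_def)
  then show "x = y" using assms by simp
qed (use assms in \<open>simp add: a_minus_def M.r_neg\<close>)

lemma diff_zero: "x \<in> carrier M \<Longrightarrow> x \<ominus>\<^bsub>M\<^esub> \<zero>\<^bsub>M\<^esub> = x"
  using M.minus_equality[of "\<zero>\<^bsub>M\<^esub>" "\<zero>\<^bsub>M\<^esub>"] by (simp add: a_minus_def)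

end

text \<open>Multiplication by the negative of the unit gives additive inverses, so the subgroup
  condition hidden in \<open>submodule\<close> reduces to closure under sums.\<close>

lemma submodule_iff:
  assumes "left_module R M"
  shows "submodule H R M \<longleftrightarrow> H \<subseteq> carrier M \<and> \<zero>\<^bsub>M\<^esub> \<in> H \<and> (\<forall>x\<in>H. \<forall>y\<in>H. x \<oplus>\<^bsub>M\<^esub> y \<in> H) \<and>
     (\<forall>a\<in>carrier R. \<forall>x\<in>H. a \<odot>\<^bsub>M\<^esub> x \<in> H)"
proof -
  interpret left_module R M by fact
  show ?thesis
  proof
    assume H: "submodule H R M"
    then have sg: "subgroup H (add_monoid M)" by (rule submodule.axioms)
    show "H \<subseteq> carrier M \<and> \<zero>\<^bsub>M\<^esub> \<in> H \<and> (\<forall>x\<in>H. \<forall>y\<in>H. x \<oplus>\<^bsub>M\<^esub> y \<in> H) \<and>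
     (\<forall>a\<in>carrier R. \<forall>x\<in>H. a \<odot>\<^bsub>M\<^esub> x \<in> H)"
      using subgroup.subset[OF sg] subgroup.one_closed[OF sg] subgroup.m_closed[OF sg]
        submodule.smult_closed[OF H] by auto
  qed (auto intro!: left_submoduleI)
qed

lemma submodule_minus:
  assumes "left_module R M" "submodule H R M" "x \<in> H"
  shows "\<ominus>\<^bsub>M\<^esub> x \<in> H"
proof -
  interpret left_module R M by fact
  have "subgroup H (add_monoid M)" using assms(2) by (rule submodule.axioms)
  from subgroup.m_inv_closed[OF this assms(3)] show ?thesis by (simp add: a_inv_def)
qed

lemma submodule_diff:
  assumes "left_module R M" "submodule H R M" "x \<in> H" "y \<in> H"
  shows "x \<ominus>\<^bsub>M\<^esub> y \<in> H"
  using submodule_minus[OF assms(1,2,4)] assms submodule_iff[OF assms(1)] by (auto simp: a_minus_def)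

lemma submodule_carrier: "left_module R M \<Longrightarrow> submodule (carrier M) R M"
  by (simp add: submodule_iff left_module.smult_closed abelian_groupE(1,2) left_module.axioms(2))

lemma submodule_zero: "left_module R M \<Longrightarrow> submodule {\<zero>\<^bsub>M\<^esub>} R M"
proof -
  assume "left_module R M"
  then interpret left_module R M .
  show ?thesis by (rule left_submoduleI) (auto simp: smult_zero_right)
qed

lemma submodule_Int:
  "left_module R M \<Longrightarrow> submodule H R M \<Longrightarrow> submodule K R M \<Longrightarrow> submodule (H \<inter> K) R M"
  by (auto simp: submodule_iff)

lemma set_add_iff: "x \<in> H <+>\<^bsub>M\<^esub> K \<longleftrightarrow> (\<exists>h\<in>H. \<exists>k\<in>K. x = h \<oplus>\<^bsub>M\<^esub> k)"
  by (auto simp: set_add_def set_mult_def)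

lemma submodule_sum:
  assumes "left_module R M" "submodule H R M" "submodule K R M"
  shows "submodule (H <+>\<^bsub>M\<^esub> K) R M"
proof -
  interpret left_module R M by fact
  note H = assms(2)[unfolded submodule_iff[OF assms(1)]]
  note K = assms(3)[unfolded submodule_iff[OF assms(1)]]
  have HM: "x \<in> carrier M" if "x \<in> H" for x using H that by blast
  have KM: "x \<in> carrier M" if "x \<in> K" for x using K that by blast
  show ?thesis
  proof (rule left_submoduleI)
    show "H <+>\<^bsub>M\<^esub> K \<subseteq> carrier M" using HM KM by (auto simp: set_add_iff)
    have "\<zero>\<^bsub>M\<^esub> = \<zero>\<^bsub>M\<^esub> \<oplus>\<^bsub>M\<^esub> \<zero>\<^bsub>M\<^esub>" by simp
    then show "\<zero>\<^bsub>M\<^esub> \<in> H <+>\<^bsub>M\<^esub> K" using H K unfolding set_add_iff by blast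
  next
    fix x y assume "x \<in> H <+>\<^bsub>M\<^esub> K" "y \<in> H <+>\<^bsub>M\<^esub> K"
    then obtain a b c d where d: "a \<in> H" "b \<in> K" "c \<in> H" "d \<in> K" "x = a \<oplus>\<^bsub>M\<^esub> b" "y = c \<oplus>\<^bsub>M\<^esub> d"
      unfolding set_add_iff by blast
    have "x \<oplus>\<^bsub>M\<^esub> y = (a \<oplus>\<^bsub>M\<^esub> c) \<oplus>\<^bsub>M\<^esub> (b \<oplus>\<^bsub>M\<^esub> d)"
      using d HM KM by (simp add: M.a_ac)
    then show "x \<oplus>\<^bsub>M\<^esub> y \<in> H <+>\<^bsub>M\<^esub> K" using d H K unfolding set_add_iff by blast
  next
    fix a x assume a: "a \<in> carrier R" and "x \<in> H <+>\<^bsub>M\<^esub> K"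
    then obtain h k where d: "h \<in> H" "k \<in> K" "x = h \<oplus>\<^bsub>M\<^esub> k"
      unfolding set_add_iff by blast
    have "a \<odot>\<^bsub>M\<^esub> x = a \<odot>\<^bsub>M\<^esub> h \<oplus>\<^bsub>M\<^esub> a \<odot>\<^bsub>M\<^esub> k"
      using d HM KM a by (simp add: smult_r_distr)
    then show "a \<odot>\<^bsub>M\<^esub> x \<in> H <+>\<^bsub>M\<^esub> K" using d H K a unfolding set_add_iff by blast
  qed
qed

lemma subset_set_add:
  assumes "left_module R M" "submodule H R M" "submodule K R M"
  shows "H \<subseteq> H <+>\<^bsub>M\<^esub> K" "K \<subseteq> H <+>\<^bsub>M\<^esub> K"
proof -
  interpret left_module R M by fact
  note H = assms(2)[unfolded submodule_iff[OF assms(1)]]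
  note K = assms(3)[unfolded submodule_iff[OF assms(1)]]
  show "H \<subseteq> H <+>\<^bsub>M\<^esub> K"
  proof
    fix x assume "x \<in> H"
    moreover then have "x = x \<oplus>\<^bsub>M\<^esub> \<zero>\<^bsub>M\<^esub>" using H by auto
    ultimately show "x \<in> H <+>\<^bsub>M\<^esub> K" using K unfolding set_add_iff by blast
  qed
  show "K \<subseteq> H <+>\<^bsub>M\<^esub> K"
  proof
    fix x assume "x \<in> K"
    moreover then have "x = \<zero>\<^bsub>M\<^esub> \<oplus>\<^bsub>M\<^esub> x" using K by auto
    ultimately show "x \<in> H <+>\<^bsub>M\<^esub> K" using H unfolding set_add_iff by blast
  qed
qed

lemma set_add_least:
  assumes "left_module R M" "submodule L R M" "H \<subseteq> L" "K \<subseteq> L"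
  shows "H <+>\<^bsub>M\<^esub> K \<subseteq> L"
  using assms(3,4) assms(2)[unfolded submodule_iff[OF assms(1)]] by (auto simp: set_add_iff subset_iff)

subsection \<open>Homomorphisms\<close>

lemma mod_homI:
  assumes "\<And>x. x \<in> carrier M \<Longrightarrow> f x \<in> carrier N"
    "\<And>x y. x \<in> carrier M \<Longrightarrow> y \<in> carrier M \<Longrightarrow> f (x \<oplus>\<^bsub>M\<^esub> y) = f x \<oplus>\<^bsub>N\<^esub> f y"
    "\<And>a x. a \<in> carrier R \<Longrightarrow> x \<in> carrier M \<Longrightarrow> f (a \<odot>\<^bsub>M\<^esub> x) = a \<odot>\<^bsub>N\<^esub> f x"
  shows "f \<in> mod_hom R M N"
  using assms by (auto simp: mod_hom_def)

lemma mod_hom_closed: "f \<in> mod_hom R M N \<Longrightarrow> x \<in> carrier M \<Longrightarrow> f x \<in> carrier N"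
  and mod_hom_add: "f \<in> mod_hom R M N \<Longrightarrow> x \<in> carrier M \<Longrightarrow> y \<in> carrier M \<Longrightarrow>
    f (x \<oplus>\<^bsub>M\<^esub> y) = f x \<oplus>\<^bsub>N\<^esub> f y"
  and mod_hom_smult: "f \<in> mod_hom R M N \<Longrightarrow> a \<in> carrier R \<Longrightarrow> x \<in> carrier M \<Longrightarrow>
    f (a \<odot>\<^bsub>M\<^esub> x) = a \<odot>\<^bsub>N\<^esub> f x"
  by (auto simp: mod_hom_def)

lemma mod_hom_zero:
  assumes "left_module R M" "left_module R N" "f \<in> mod_hom R M N"
  shows "f \<zero>\<^bsub>M\<^esub> = \<zero>\<^bsub>N\<^esub>"
proof -
  interpret M: left_module R M by fact
  interpret N: left_module R N by fact
  have "f \<zero>\<^bsub>M\<^esub> = f (\<zero>\<^bsub>R\<^esub> \<odot>\<^bsub>M\<^esub> \<zero>\<^bsub>M\<^esub>)" by (simp add: M.smult_zero_left)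
  also have "\<dots> = \<zero>\<^bsub>N\<^esub>"
    using assms(3) by (simp add: mod_hom_smult[OF assms(3)] mod_hom_closed N.smult_zero_left)
  finally show ?thesis .
qed

lemma mod_hom_minus:
  assumes "left_module R M" "left_module R N" "f \<in> mod_hom R M N" "x \<in> carrier M"
  shows "f (\<ominus>\<^bsub>M\<^esub> x) = \<ominus>\<^bsub>N\<^esub> f x"
proof -
  interpret M: left_module R M by fact
  interpret N: left_module R N by fact
  have "f (\<ominus>\<^bsub>M\<^esub> x) \<oplus>\<^bsub>N\<^esub> f x = \<zero>\<^bsub>N\<^esub>"
    using assms by (simp flip: mod_hom_add add: M.M.l_neg mod_hom_zero)
  then show ?thesis using assms by (metis M.M.a_inv_closed N.M.minus_equality mod_hom_closed)
qed

lemma mod_hom_diff: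
  assumes "left_module R M" "left_module R N" "f \<in> mod_hom R M N" "x \<in> carrier M" "y \<in> carrier M"
  shows "f (x \<ominus>\<^bsub>M\<^esub> y) = f x \<ominus>\<^bsub>N\<^esub> f y"
proof -
  interpret M: left_module R M by fact
  show ?thesis using assms by (simp add: a_minus_def mod_hom_add mod_hom_minus)
qed

lemma mod_hom_id: "(\<lambda>x. x) \<in> mod_hom R M M"
  by (auto intro: mod_homI)

lemma mod_hom_incl: "H \<subseteq> carrier M \<Longrightarrow> (\<lambda>x. x) \<in> mod_hom R (M\<lparr>carrier := H\<rparr>) M"
  by (auto intro!: mod_homI)

lemma mod_hom_restrict:
  "f \<in> mod_hom R M N \<Longrightarrow> H \<subseteq> carrier M \<Longrightarrow> f ` H \<subseteq> K \<Longrightarrow>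
    f \<in> mod_hom R (M\<lparr>carrier := H\<rparr>) (N\<lparr>carrier := K\<rparr>)"
  by (auto intro!: mod_homI simp: mod_hom_add mod_hom_smult subset_iff)

lemma mod_hom_comp:
  "f \<in> mod_hom R M N \<Longrightarrow> g \<in> mod_hom R N L \<Longrightarrow> (\<lambda>x. g (f x)) \<in> mod_hom R M L"
  by (auto intro!: mod_homI simp: mod_hom_closed mod_hom_add mod_hom_smult)

lemma mod_hom_plus:
  assumes "left_module R N" "f \<in> mod_hom R M N" "g \<in> mod_hom R M N"
  shows "(\<lambda>x. f x \<oplus>\<^bsub>N\<^esub> g x) \<in> mod_hom R M N"
proof -
  interpret N: left_module R N by fact
  show ?thesis
  proof (rule mod_homI)
    fix x y assume "x \<in> carrier M" "y \<in> carrier M"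
    then have m: "f x \<in> carrier N" "f y \<in> carrier N" "g x \<in> carrier N" "g y \<in> carrier N"
      and e: "f (x \<oplus>\<^bsub>M\<^esub> y) = f x \<oplus>\<^bsub>N\<^esub> f y" "g (x \<oplus>\<^bsub>M\<^esub> y) = g x \<oplus>\<^bsub>N\<^esub> g y"
      using assms by (auto simp: mod_hom_closed mod_hom_add)
    show "f (x \<oplus>\<^bsub>M\<^esub> y) \<oplus>\<^bsub>N\<^esub> g (x \<oplus>\<^bsub>M\<^esub> y) = f x \<oplus>\<^bsub>N\<^esub> g x \<oplus>\<^bsub>N\<^esub> (f y \<oplus>\<^bsub>N\<^esub> g y)"
      unfolding e using m by (simp add: N.M.a_ac)
  qed (use assms in \<open>auto simp: mod_hom_closed mod_hom_smult N.smult_r_distr\<close>)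
qed

lemma submodule_image:
  assumes "left_module R M" "left_module R N" "f \<in> mod_hom R M N" "submodule H R M"
  shows "submodule (f ` H) R N"
proof -
  interpret M: left_module R M by fact
  interpret N: left_module R N by fact
  note H = assms(4)[unfolded submodule_iff[OF assms(1)]]
  have HM: "x \<in> carrier M" if "x \<in> H" for x using H that by blast
  show ?thesis unfolding submodule_iff[OF assms(2)]
  proof (intro conjI ballI)
    show "f ` H \<subseteq> carrier N" using HM assms(3) by (auto simp: mod_hom_closed)
    show "\<zero>\<^bsub>N\<^esub> \<in> f ` H" using H mod_hom_zero[OF assms(1,2,3)] by (metis imageI)
  next
    fix x y assume "x \<in> f ` H" "y \<in> f ` H"
    then show "x \<oplus>\<^bsub>N\<^esub> y \<in> f ` H" using H HM mod_hom_add[OF assms(3), symmetric] by auto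
  next
    fix a x assume "a \<in> carrier R" "x \<in> f ` H"
    then show "a \<odot>\<^bsub>N\<^esub> x \<in> f ` H" using H HM mod_hom_smult[OF assms(3), symmetric] by auto
  qed
qed

lemma submodule_preimage:
  assumes "left_module R M" "left_module R N" "f \<in> mod_hom R M N" "submodule K R N"
  shows "submodule {x \<in> carrier M. f x \<in> K} R M"
proof -
  interpret M: left_module R M by fact
  show ?thesis
    using assms(4) mod_hom_zero[OF assms(1-3)] assms(3)
    by (auto simp: submodule_iff[OF assms(1)] submodule_iff[OF assms(2)] mod_hom_add mod_hom_smult
        M.smult_closed)
qed

lemma submodule_kernel:
  assumes "left_module R M" "left_module R N" "f \<in> mod_hom R M N"
  shows "submodule {x \<in> carrier M. f x = \<zero>\<^bsub>N\<^esub>} R M"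
  using submodule_preimage[OF assms submodule_zero[OF assms(2)]] by simp

lemma left_module_sub:
  assumes "left_module R M" "submodule H R M"
  shows "left_module R (M\<lparr>carrier := H\<rparr>)"
proof -
  interpret left_module R M by fact
  note H = assms(2)[unfolded submodule_iff[OF assms(1)]]
  have HM: "x \<in> carrier M" if "x \<in> H" for x using H that by blast
  have ag: "abelian_group (M\<lparr>carrier := H\<rparr>)"
  proof (rule abelian_groupI)
    fix x assume "x \<in> carrier (M\<lparr>carrier := H\<rparr>)"
    then have "\<ominus>\<^bsub>M\<^esub> x \<in> H" "\<ominus>\<^bsub>M\<^esub> x \<oplus>\<^bsub>M\<^esub> x = \<zero>\<^bsub>M\<^esub>"
      using submodule_minus[OF assms] HM by (auto simp: M.l_neg)
    then show "\<exists>y\<in>carrier (M\<lparr>carrier := H\<rparr>). y \<oplus>\<^bsub>M\<lparr>carrier := H\<rparr>\<^esub> x = \<zero>\<^bsub>M\<lparr>carrier := H\<rparr>\<^esub>"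
      by auto
  qed (use H HM in \<open>auto simp: M.a_ac\<close>)
  show ?thesis
    by (intro left_module.intro left_module_axioms.intro R.ring_axioms ag)
      (use H HM in \<open>auto simp: smult_l_distr smult_r_distr smult_assoc1 smult_one\<close>)
qed

lemma submodule_sub_iff:
  assumes "left_module R M" "submodule H R M"
  shows "submodule K R (M\<lparr>carrier := H\<rparr>) \<longleftrightarrow> submodule K R M \<and> K \<subseteq> H"
  using assms(2) unfolding submodule_iff[OF assms(1)] submodule_iff[OF left_module_sub[OF assms]] by auto

lemma inj_on_hom_iff:
  assumes "left_module R M" "left_module R N" "f \<in> mod_hom R M N"
  shows "inj_on f (carrier M) \<longleftrightarrow> (\<forall>x\<in>carrier M. f x = \<zero>\<^bsub>N\<^esub> \<longrightarrow> x = \<zero>\<^bsub>M\<^esub>)"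
proof -
  interpret M: left_module R M by fact
  interpret N: left_module R N by fact
  have *: "x = y" if "\<forall>x\<in>carrier M. f x = \<zero>\<^bsub>N\<^esub> \<longrightarrow> x = \<zero>\<^bsub>M\<^esub>" "x \<in> carrier M" "y \<in> carrier M" "f x = f y" for x y
  proof -
    have "f (x \<ominus>\<^bsub>M\<^esub> y) = \<zero>\<^bsub>N\<^esub>" using that mod_hom_diff[OF assms] mod_hom_closed[OF assms(3)] by (simp add: a_minus_def N.M.r_neg)
    then have "x \<ominus>\<^bsub>M\<^esub> y = \<zero>\<^bsub>M\<^esub>" using that by simp
    then show ?thesis using that by (simp add: M.diff_eq_zero_iff)
  qed
  show ?thesis
    using * mod_hom_zero[OF assms] unfolding inj_on_def by (metis M.M.zero_closed)
qed

subsection \<open>Isomorphisms\<close>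

lemma mod_isoI:
  "f \<in> mod_hom R M N \<Longrightarrow> inj_on f (carrier M) \<Longrightarrow> f ` carrier M = carrier N \<Longrightarrow> mod_iso R M N"
  unfolding mod_iso_def bij_betw_def by blast

lemma mod_iso_refl: "mod_iso R M M"
  by (rule mod_isoI[OF mod_hom_id]) auto

lemma inv_into_mod_hom:
  assumes "left_module R M" "f \<in> mod_hom R M N" "inj_on f (carrier M)" "f ` carrier M = carrier N"
  shows "inv_into (carrier M) f \<in> mod_hom R N M"
proof -
  interpret left_module R M by fact
  define g where "g = inv_into (carrier M) f"
  have gf: "g (f x) = x" if "x \<in> carrier M" for x using assms(3) that by (simp add: g_def)
  show ?thesis unfolding g_def[symmetric]
  proof (rule mod_homI)
    show "g x \<in> carrier M" if "x \<in> carrier N" for x using that gf unfolding assms(4)[symmetric] by auto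
    show "g (x \<oplus>\<^bsub>N\<^esub> y) = g x \<oplus>\<^bsub>M\<^esub> g y" if "x \<in> carrier N" "y \<in> carrier N" for x y
      using that unfolding assms(4)[symmetric] by (auto simp: gf mod_hom_add[OF assms(2),symmetric])
    show "g (a \<odot>\<^bsub>N\<^esub> x) = a \<odot>\<^bsub>M\<^esub> g x" if "a \<in> carrier R" "x \<in> carrier N" for a x
      using that unfolding assms(4)[symmetric] by (auto simp: gf smult_closed mod_hom_smult[OF assms(2),symmetric])
  qed
qed

lemma mod_isoE:
  assumes "mod_iso R M N" "left_module R M"
  obtains f g where "f \<in> mod_hom R M N" "g \<in> mod_hom R N M"
    "\<And>x. x \<in> carrier M \<Longrightarrow> g (f x) = x" "\<And>y. y \<in> carrier N \<Longrightarrow> f (g y) = y"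
proof -
  obtain f where f: "f \<in> mod_hom R M N" "inj_on f (carrier M)" "f ` carrier M = carrier N"
    using assms unfolding mod_iso_def bij_betw_def by blast
  show ?thesis
    by (rule that[OF f(1) inv_into_mod_hom[OF assms(2) f]]) (use f in \<open>auto simp: f_inv_into_f\<close>)
qed

lemma mod_isoI2:
  assumes "f \<in> mod_hom R M N" "g \<in> mod_hom R N M"
    "\<And>x. x \<in> carrier M \<Longrightarrow> g (f x) = x" "\<And>y. y \<in> carrier N \<Longrightarrow> f (g y) = y"
  shows "mod_iso R M N"
proof (rule mod_isoI[OF assms(1)])
  show "inj_on f (carrier M)" using assms(3) by (metis inj_onI)
  show "f ` carrier M = carrier N"
    using assms mod_hom_closed[OF assms(1)] mod_hom_closed[OF assms(2)] by (auto simp: image_iff) metis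
qed

lemma mod_iso_sym: "mod_iso R M N \<Longrightarrow> left_module R M \<Longrightarrow> mod_iso R N M"
  by (metis mod_isoE mod_isoI2)

lemma mod_iso_trans:
  assumes "mod_iso R M N" "mod_iso R N L"
  shows "mod_iso R M L"
proof -
  obtain f where f: "f \<in> mod_hom R M N" "inj_on f (carrier M)" "f ` carrier M = carrier N"
    using assms(1) unfolding mod_iso_def bij_betw_def by blast
  obtain g where g: "g \<in> mod_hom R N L" "inj_on g (carrier N)" "g ` carrier N = carrier L"
    using assms(2) unfolding mod_iso_def bij_betw_def by blast
  show ?thesis
  proof (rule mod_isoI[OF mod_hom_comp[OF f(1) g(1)]])
    show "inj_on (\<lambda>x. g (f x)) (carrier M)" using comp_inj_on[OF f(2)] g(2) f(3) by (simp add: comp_def)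
    show "(\<lambda>x. g (f x)) ` carrier M = carrier L" using f g by (metis image_image)
  qed
qed

section \<open>Transport of module structures, and quotients\<close>

lemma induced_module:
  fixes M :: "('a, 'b, 'm) module_scheme" and \<rho> :: "'b \<Rightarrow> 'c"
  assumes "left_module R M"
    and add: "\<And>x x' y y'. \<lbrakk>x \<in> carrier M; x' \<in> carrier M; y \<in> carrier M; y' \<in> carrier M; \<rho> x = \<rho> x'; \<rho> y = \<rho> y'\<rbrakk>
       \<Longrightarrow> \<rho> (x \<oplus>\<^bsub>M\<^esub> y) = \<rho> (x' \<oplus>\<^bsub>M\<^esub> y')"
    and sm: "\<And>a x x'. \<lbrakk>a \<in> carrier R; x \<in> carrier M; x' \<in> carrier M; \<rho> x = \<rho> x'\<rbrakk>
       \<Longrightarrow> \<rho> (a \<odot>\<^bsub>M\<^esub> x) = \<rho> (a \<odot>\<^bsub>M\<^esub> x')"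
  shows "\<exists>N :: ('a, 'c) module. left_module R N \<and> carrier N = \<rho> ` carrier M \<and> \<zero>\<^bsub>N\<^esub> = \<rho> \<zero>\<^bsub>M\<^esub> \<and> \<rho> \<in> mod_hom R M N"
proof -
  interpret left_module R M by fact
  define h where "h = inv_into (carrier M) \<rho>"
  have hc: "h (\<rho> x) \<in> carrier M" "\<rho> (h (\<rho> x)) = \<rho> x" if "x \<in> carrier M" for x
    using that unfolding h_def by (auto intro: inv_into_into f_inv_into_f)
  define N :: "('a, 'c) module" where
    "N = \<lparr>carrier = \<rho> ` carrier M, monoid.mult = undefined, one = undefined, zero = \<rho> \<zero>\<^bsub>M\<^esub>,
          add = (\<lambda>x y. \<rho> (h x \<oplus>\<^bsub>M\<^esub> h y)), smult = (\<lambda>r x. \<rho> (r \<odot>\<^bsub>M\<^esub> h x))\<rparr>"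
  have c: "carrier N = \<rho> ` carrier M" and z: "\<zero>\<^bsub>N\<^esub> = \<rho> \<zero>\<^bsub>M\<^esub>" by (simp_all add: N_def)
  have a: "\<rho> x \<oplus>\<^bsub>N\<^esub> \<rho> y = \<rho> (x \<oplus>\<^bsub>M\<^esub> y)" if "x \<in> carrier M" "y \<in> carrier M" for x y
    unfolding N_def using that hc by (auto intro!: add)
  have s: "r \<odot>\<^bsub>N\<^esub> \<rho> x = \<rho> (r \<odot>\<^bsub>M\<^esub> x)" if "r \<in> carrier R" "x \<in> carrier M" for r x
    unfolding N_def using that hc by (auto intro!: sm)
  have ag: "abelian_group N"
  proof (rule abelian_groupI, goal_cases)
    case (6 x)
    then obtain y where y: "y \<in> carrier M" "x = \<rho> y" by (auto simp: c)
    then have "\<rho> (\<ominus>\<^bsub>M\<^esub> y) \<in> carrier N \<and> \<rho> (\<ominus>\<^bsub>M\<^esub> y) \<oplus>\<^bsub>N\<^esub> x = \<zero>\<^bsub>N\<^esub>"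
      by (simp add: c z a M.l_neg)
    then show ?case by blast
  qed (auto simp: c z a M.a_ac)
  have "left_module R N"
    by (intro left_module.intro left_module_axioms.intro R.ring_axioms ag)
      (auto simp: c z a s smult_closed smult_l_distr smult_r_distr smult_assoc1 smult_one)
  moreover have "\<rho> \<in> mod_hom R M N" by (rule mod_homI) (auto simp: c a s)
  ultimately show ?thesis using c z by blast
qed

text \<open>The quotient lives on coset representatives instead of cosets and thus keeps the carrier
  type of \<open>M\<close>. Quotients of modules on lists are then again modules on lists, as
  \<open>fg_mods\<close> demands.\<close>

lemma ex_quotient:
  fixes M :: "('a, 'b, 'm) module_scheme"
  assumes "left_module R M" "submodule H R M"
  shows "\<exists>N :: ('a, 'b) module. \<exists>p \<in> mod_hom R M N. left_module R N \<and> p ` carrier M = carrier N \<and>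
    {x \<in> carrier M. p x = \<zero>\<^bsub>N\<^esub>} = H"
proof -
  interpret left_module R M by fact
  note H = assms(2)[unfolded submodule_iff[OF assms(1)]]
  have HM: "x \<in> carrier M" if "x \<in> H" for x using H that by blast
  \<comment> \<open>The choice depends on \<open>x\<close> only through its coset: congruent
    elements satisfy the same predicate, so \<open>SOME\<close> returns the same
    representative.\<close>
  define \<rho> where "\<rho> x = (SOME y. y \<in> carrier M \<and> x \<ominus>\<^bsub>M\<^esub> y \<in> H)" for x
  have 1: "\<rho> x \<in> carrier M" "x \<ominus>\<^bsub>M\<^esub> \<rho> x \<in> H" if "x \<in> carrier M" for x
  proof -
    have "x \<in> carrier M \<and> x \<ominus>\<^bsub>M\<^esub> x \<in> H" using that H by (simp add: a_minus_def M.r_neg)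
    then show "\<rho> x \<in> carrier M" "x \<ominus>\<^bsub>M\<^esub> \<rho> x \<in> H"
      unfolding \<rho>_def by (metis (mono_tags, lifting) someI_ex)+
  qed
  have tr: "x \<ominus>\<^bsub>M\<^esub> z \<in> H" if "x \<ominus>\<^bsub>M\<^esub> y \<in> H" "y \<ominus>\<^bsub>M\<^esub> z \<in> H" "x \<in> carrier M" "y \<in> carrier M" "z \<in> carrier M" for x y z
  proof -
    have "x \<ominus>\<^bsub>M\<^esub> z = (x \<ominus>\<^bsub>M\<^esub> y) \<oplus>\<^bsub>M\<^esub> (y \<ominus>\<^bsub>M\<^esub> z)"
      using that by (simp add: a_minus_def M.a_assoc) (metis M.a_assoc M.a_inv_closed M.l_neg M.l_zero)
    then show ?thesis using H that by auto
  qed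
  have sy: "y \<ominus>\<^bsub>M\<^esub> x \<in> H" if "x \<ominus>\<^bsub>M\<^esub> y \<in> H" "x \<in> carrier M" "y \<in> carrier M" for x y
  proof -
    have "y \<ominus>\<^bsub>M\<^esub> x = \<ominus>\<^bsub>M\<^esub> (x \<ominus>\<^bsub>M\<^esub> y)"
      using that by (simp add: a_minus_def M.minus_add M.a_comm)
    then show ?thesis using submodule_minus[OF assms that(1)] by simp
  qed
  have eq: "\<rho> x = \<rho> y \<longleftrightarrow> x \<ominus>\<^bsub>M\<^esub> y \<in> H" if "x \<in> carrier M" "y \<in> carrier M" for x y
  proof
    assume "\<rho> x = \<rho> y" then show "x \<ominus>\<^bsub>M\<^esub> y \<in> H" using 1[OF that(1)] 1[OF that(2)] that tr sy by metis
  next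
    assume "x \<ominus>\<^bsub>M\<^esub> y \<in> H"
    then have "(z \<in> carrier M \<and> x \<ominus>\<^bsub>M\<^esub> z \<in> H) = (z \<in> carrier M \<and> y \<ominus>\<^bsub>M\<^esub> z \<in> H)" for z
      using that tr sy by blast
    then show "\<rho> x = \<rho> y" by (simp add: \<rho>_def)
  qed
  have "\<exists>N :: ('a, 'b) module. left_module R N \<and> carrier N = \<rho> ` carrier M \<and> \<zero>\<^bsub>N\<^esub> = \<rho> \<zero>\<^bsub>M\<^esub> \<and> \<rho> \<in> mod_hom R M N"
  proof (rule induced_module[OF assms(1)])
    fix x x' y y' assume *: "x \<in> carrier M" "x' \<in> carrier M" "y \<in> carrier M" "y' \<in> carrier M" "\<rho> x = \<rho> x'" "\<rho> y = \<rho> y'"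
    have "(x \<oplus>\<^bsub>M\<^esub> y) \<ominus>\<^bsub>M\<^esub> (x' \<oplus>\<^bsub>M\<^esub> y') = (x \<ominus>\<^bsub>M\<^esub> x') \<oplus>\<^bsub>M\<^esub> (y \<ominus>\<^bsub>M\<^esub> y')"
      using * by (simp add: a_minus_def M.minus_add M.a_ac)
    then show "\<rho> (x \<oplus>\<^bsub>M\<^esub> y) = \<rho> (x' \<oplus>\<^bsub>M\<^esub> y')" using * eq H by auto
  next
    fix a x x' assume *: "a \<in> carrier R" "x \<in> carrier M" "x' \<in> carrier M" "\<rho> x = \<rho> x'"
    have hom: "(\<lambda>x. a \<odot>\<^bsub>M\<^esub> x) (x \<ominus>\<^bsub>M\<^esub> x') \<oplus>\<^bsub>M\<^esub> a \<odot>\<^bsub>M\<^esub> x' = a \<odot>\<^bsub>M\<^esub> x"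
      using * by (simp flip: smult_r_distr add: a_minus_def M.a_assoc M.l_neg)
    have "a \<odot>\<^bsub>M\<^esub> x \<ominus>\<^bsub>M\<^esub> a \<odot>\<^bsub>M\<^esub> x' = a \<odot>\<^bsub>M\<^esub> (x \<ominus>\<^bsub>M\<^esub> x')"
      unfolding hom[symmetric] using * by (simp add: a_minus_def M.a_assoc M.r_neg smult_closed)
    then show "\<rho> (a \<odot>\<^bsub>M\<^esub> x) = \<rho> (a \<odot>\<^bsub>M\<^esub> x')" using * eq H by (auto simp: smult_closed)
  qed
  then obtain N :: "('a, 'b) module" where N: "left_module R N" "carrier N = \<rho> ` carrier M" "\<zero>\<^bsub>N\<^esub> = \<rho> \<zero>\<^bsub>M\<^esub>" "\<rho> \<in> mod_hom R M N"
    by blast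
  have "{x \<in> carrier M. \<rho> x = \<zero>\<^bsub>N\<^esub>} = H" using N(3) eq HM by (auto simp: diff_zero)
  then show ?thesis using N by (intro exI[of _ N] bexI[of _ \<rho>]) auto
qed

section \<open>Chain conditions on submodules\<close>

text \<open>One flag covers ascending and descending chains, so that arguments common to both chain
  conditions are carried out once.\<close>

definition chain_le :: "bool \<Rightarrow> 'b set \<Rightarrow> 'b set \<Rightarrow> bool" where
  "chain_le asc A B \<longleftrightarrow> (if asc then A \<subseteq> B else B \<subseteq> A)"

lemma chain_le_simps [simp]: "chain_le True A B \<longleftrightarrow> A \<subseteq> B" "chain_le False A B \<longleftrightarrow> B \<subseteq> A"
  by (auto simp: chain_le_def)

lemma chain_le_chain:
  assumes "\<And>n. chain_le asc (H n) (H (Suc n))" "n \<le> m"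
  shows "chain_le asc (H n) (H m)"
  using assms(2,1) by (induction rule: dec_induct) (cases asc; fastforce)+

text \<open>An interval of submodules between \<open>L\<close> and \<open>U\<close> takes the place
  of the subquotient \<open>U/L\<close>. Filtrations can thus be treated layer by layer inside one
  module.\<close>

definition chain_cond ::
  "bool \<Rightarrow> ('a, 'r) ring_scheme \<Rightarrow> ('a, 'b, 'm) module_scheme \<Rightarrow> 'b set \<Rightarrow> 'b set \<Rightarrow> bool"
where
  "chain_cond asc R M L U \<longleftrightarrow>
     (\<forall>H :: nat \<Rightarrow> 'b set.
        (\<forall>n. submodule (H n) R M \<and> L \<subseteq> H n \<and> H n \<subseteq> U \<and> chain_le asc (H n) (H (Suc n))) \<longrightarrow>
        (\<exists>n. \<forall>m\<ge>n. H m = H n))"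

lemma chain_condD:
  assumes "chain_cond asc R M L U"
    "\<And>n. submodule (H n) R M" "\<And>n. L \<subseteq> H n" "\<And>n. H n \<subseteq> U" "\<And>n. chain_le asc (H n) (H (Suc n))"
  shows "\<exists>n. \<forall>m\<ge>n. H m = H n"
  using assms unfolding chain_cond_def by blast

lemma set_add_mono: "H \<subseteq> H' \<Longrightarrow> H <+>\<^bsub>M\<^esub> K \<subseteq> H' <+>\<^bsub>M\<^esub> K"
  unfolding set_add_def set_mult_def by auto

text \<open>Modular law. An element of \<open>B\<close> is \<open>a + n\<close> with
  \<open>a\<close> in \<open>A\<close> and \<open>n\<close> in \<open>N\<close>; here
  \<open>n\<close> is a difference of elements of \<open>B\<close>, so it lies in
  \<open>B \<inter> N = A \<inter> N\<close>, and the sum lies in \<open>A\<close>.\<close>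

lemma submodule_modular:
  assumes lm: "left_module R M" and A: "submodule A R M" and B: "submodule B R M" and N: "submodule N R M"
    and "A \<subseteq> B" "A \<inter> N = B \<inter> N" "A <+>\<^bsub>M\<^esub> N = B <+>\<^bsub>M\<^esub> N"
  shows "A = B"
proof
  interpret left_module R M by fact
  show "B \<subseteq> A"
  proof
    fix b assume b: "b \<in> B"
    then have "b \<in> A <+>\<^bsub>M\<^esub> N" using subset_set_add(1)[OF lm B N] assms by auto
    then obtain a n where d: "a \<in> A" "n \<in> N" "b = a \<oplus>\<^bsub>M\<^esub> n" unfolding set_add_iff by blast
    have c: "a \<in> carrier M" "n \<in> carrier M" "b \<in> carrier M"
      using d b A B N by (auto simp: submodule_iff[OF lm])
    have "b \<ominus>\<^bsub>M\<^esub> a = n" using d c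
      by (simp add: a_minus_def M.a_ac) (metis M.a_assoc M.a_inv_closed M.a_lcomm M.l_neg M.r_neg M.r_zero)
    moreover have "b \<ominus>\<^bsub>M\<^esub> a \<in> B" using submodule_diff[OF lm B b] d assms by blast
    ultimately have "n \<in> A" using assms d by blast
    then show "b \<in> A" using d A by (auto simp: submodule_iff[OF lm])
  qed
qed fact

text \<open>A chain in the long interval yields one in each short interval, by intersection with
  \<open>N\<close> and by addition of \<open>N\<close>. Where both are stationary, the modular law
  makes the given chain stationary.\<close>

lemma chain_cond_extension:
  assumes lm: "left_module R M"
    and N: "submodule N R M" and U: "submodule U R M" and "L \<subseteq> N" "N \<subseteq> U"
    and 1: "chain_cond asc R M L N" and 2: "chain_cond asc R M N U"
  shows "chain_cond asc R M L U"
  unfolding chain_cond_def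
proof (intro allI impI)
  fix H assume "\<forall>n. submodule (H n) R M \<and> L \<subseteq> H n \<and> H n \<subseteq> U \<and> chain_le asc (H n) (H (Suc n))"
  then have H: "\<And>n. submodule (H n) R M" "\<And>n. L \<subseteq> H n" "\<And>n. H n \<subseteq> U" "\<And>n. chain_le asc (H n) (H (Suc n))" by auto
  have "\<exists>n. \<forall>m\<ge>n. H m \<inter> N = H n \<inter> N"
  proof (rule chain_condD[OF 1 submodule_Int[OF lm H(1) N]])
    show "chain_le asc (H n \<inter> N) (H (Suc n) \<inter> N)" for n
      using H(4)[of n] by (cases asc) auto
  qed (use H(2) \<open>L \<subseteq> N\<close> in auto)
  then obtain n1 where n1: "\<And>m. m \<ge> n1 \<Longrightarrow> H m \<inter> N = H n1 \<inter> N" by blast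
  have mono: "chain_le asc (H n <+>\<^bsub>M\<^esub> N) (H (Suc n) <+>\<^bsub>M\<^esub> N)" for n
    using H(4)[of n] by (cases asc) (simp_all add: set_add_mono)
  have "\<exists>n. \<forall>m\<ge>n. H m <+>\<^bsub>M\<^esub> N = H n <+>\<^bsub>M\<^esub> N"
    by (rule chain_condD[OF 2 submodule_sum[OF lm H(1) N] subset_set_add(2)[OF lm H(1) N]
          set_add_least[OF lm U H(3) \<open>N \<subseteq> U\<close>]]) (rule mono)
  then obtain n2 where n2: "\<And>m. m \<ge> n2 \<Longrightarrow> H m <+>\<^bsub>M\<^esub> N = H n2 <+>\<^bsub>M\<^esub> N" by blast
  define n where "n = max n1 n2"
  have "H m = H n" if "m \<ge> n" for m
  proof -
    have e: "H m \<inter> N = H n \<inter> N" "H m <+>\<^bsub>M\<^esub> N = H n <+>\<^bsub>M\<^esub> N"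
      using n1[of m] n1[of n] n2[of m] n2[of n] that by (auto simp: n_def)
    have "chain_le asc (H n) (H m)" using chain_le_chain[where H = H, OF H(4) that] .
    then show ?thesis
      using submodule_modular[OF lm H(1) H(1) N _ e] submodule_modular[OF lm H(1) H(1) N _ e[symmetric]]
      by (cases asc) auto
  qed
  then show "\<exists>n. \<forall>m\<ge>n. H m = H n" by blast
qed

lemma chain_cond_trivial: "chain_cond asc R M L L"
  unfolding chain_cond_def by (metis subset_antisym)

lemma chain_cond_mono: "chain_cond asc R M L U \<Longrightarrow> L \<subseteq> L' \<Longrightarrow> U' \<subseteq> U \<Longrightarrow> chain_cond asc R M L' U'"
  unfolding chain_cond_def by (meson order_trans)

text \<open>Without such an element, a function moving each member of \<open>S\<close> strictly
  further could be iterated into a chain that never stops.\<close>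

lemma chain_cond_extremal:
  assumes "chain_cond asc R M L U" "S \<noteq> {}"
    "\<And>H. H \<in> S \<Longrightarrow> submodule H R M \<and> L \<subseteq> H \<and> H \<subseteq> U"
  shows "\<exists>H\<in>S. \<forall>K\<in>S. chain_le asc H K \<longrightarrow> K = H"
proof (rule ccontr)
  assume "\<not> ?thesis"
  then have "\<exists>f. \<forall>H\<in>S. f H \<in> S \<and> chain_le asc H (f H) \<and> f H \<noteq> H" by metis
  then obtain f where f: "\<And>H. H \<in> S \<Longrightarrow> f H \<in> S \<and> chain_le asc H (f H) \<and> f H \<noteq> H" by blast
  obtain H0 where "H0 \<in> S" using assms by blast
  then have S: "(f ^^ n) H0 \<in> S" for n by (induction n) (auto simp: f)
  have "\<exists>n. \<forall>m\<ge>n. (f ^^ m) H0 = (f ^^ n) H0"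
    by (rule chain_condD[OF assms(1)]) (use assms(3)[OF S] f[OF S] in auto)
  then obtain n where "(f ^^ Suc n) H0 = (f ^^ n) H0" by (metis le_SucI order_refl)
  then show False using f[OF S[of n]] by simp
qed

lemmas chain_cond_maximal = chain_cond_extremal[where asc = True, unfolded chain_le_simps]
  and chain_cond_minimal = chain_cond_extremal[where asc = False, unfolded chain_le_simps]

section \<open>The regular module and cyclic submodules\<close>

definition self_mod :: "('a, 'r) ring_scheme \<Rightarrow> ('a, 'a) module" where
  "self_mod R = \<lparr>carrier = carrier R, monoid.mult = monoid.mult R, one = one R, zero = zero R, add = add R, smult = monoid.mult R\<rparr>"

lemma self_mod_simps [simp]:
  "carrier (self_mod R) = carrier R" "\<zero>\<^bsub>self_mod R\<^esub> = \<zero>\<^bsub>R\<^esub>"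
  "x \<oplus>\<^bsub>self_mod R\<^esub> y = x \<oplus>\<^bsub>R\<^esub> y" "x \<odot>\<^bsub>self_mod R\<^esub> y = x \<otimes>\<^bsub>R\<^esub> y"
  by (simp_all add: self_mod_def)

lemma left_module_self: "ring R \<Longrightarrow> left_module R (self_mod R)"
proof -
  assume "ring R"
  then interpret ring R .
  have "abelian_group (self_mod R)"
    by (rule abelian_groupI) (auto simp: a_ac intro: bexI[of _ "\<ominus>\<^bsub>R\<^esub> _"] l_neg)
  then show ?thesis
    by (intro left_module.intro left_module_axioms.intro ring_axioms)
      (auto simp: l_distr r_distr m_assoc)
qed

definition cyclic :: "('a, 'r) ring_scheme \<Rightarrow> ('a, 'b, 'm) module_scheme \<Rightarrow> 'b \<Rightarrow> 'b set" where
  "cyclic R M x = (\<lambda>a. a \<odot>\<^bsub>M\<^esub> x) ` carrier R"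

lemma hom_self_mod:
  "left_module R M \<Longrightarrow> x \<in> carrier M \<Longrightarrow> (\<lambda>a. a \<odot>\<^bsub>M\<^esub> x) \<in> mod_hom R (self_mod R) M"
  by (auto intro!: mod_homI simp: left_module.smult_closed left_module.smult_l_distr left_module.smult_assoc1)

lemma submodule_cyclic:
  assumes "left_module R M" "x \<in> carrier M"
  shows "submodule (cyclic R M x) R M" "x \<in> cyclic R M x"
proof -
  interpret left_module R M by fact
  have lr: "left_module R (self_mod R)" by (rule left_module_self) (rule R.ring_axioms)
  show "submodule (cyclic R M x) R M" unfolding cyclic_def
    using submodule_image[OF lr assms(1) hom_self_mod[OF assms] submodule_carrier[OF lr]] by simp
  have "x = \<one>\<^bsub>R\<^esub> \<odot>\<^bsub>M\<^esub> x" using assms by (simp add: smult_one)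
  then show "x \<in> cyclic R M x" unfolding cyclic_def by blast
qed

text \<open>A submodule \<open>H\<close> between \<open>N\<close> and \<open>N + R x\<close> is
  recovered from the left ideal of scalars \<open>a\<close> with \<open>a x\<close> in
  \<open>H\<close>. The chain condition of the ring therefore passes to this interval.\<close>

lemma chain_cond_cyclic:
  assumes lm: "left_module R M" and x: "x \<in> carrier M" and N: "submodule N R M"
    and c: "chain_cond asc R (self_mod R) {\<zero>\<^bsub>R\<^esub>} (carrier R)"
  shows "chain_cond asc R M N (N <+>\<^bsub>M\<^esub> cyclic R M x)"
  unfolding chain_cond_def
proof (intro allI impI)
  interpret left_module R M by fact
  have lr: "left_module R (self_mod R)" by (rule left_module_self) (rule R.ring_axioms)
  fix H assume "\<forall>n. submodule (H n) R M \<and> N \<subseteq> H n \<and> H n \<subseteq> N <+>\<^bsub>M\<^esub> cyclic R M x \<and> chain_le asc (H n) (H (Suc n))"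
  then have H: "\<And>n. submodule (H n) R M" "\<And>n. N \<subseteq> H n" "\<And>n. H n \<subseteq> N <+>\<^bsub>M\<^esub> cyclic R M x" "\<And>n. chain_le asc (H n) (H (Suc n))" by auto
  define J where "J n = {a \<in> carrier R. a \<odot>\<^bsub>M\<^esub> x \<in> H n}" for n
  have "\<exists>n. \<forall>m\<ge>n. J m = J n"
  proof (rule chain_condD[OF c])
    show sJ: "submodule (J n) R (self_mod R)" for n
      unfolding J_def using submodule_preimage[OF lr lm hom_self_mod[OF lm x] H(1)] by simp
    show "{\<zero>\<^bsub>R\<^esub>} \<subseteq> J n" for n using sJ[of n] unfolding submodule_iff[OF lr] by simp
    show "J n \<subseteq> carrier R" for n by (auto simp: J_def)
    show "chain_le asc (J n) (J (Suc n))" for n using H(4)[of n] by (cases asc) (auto simp: J_def)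
  qed
  moreover have "H n = N <+>\<^bsub>M\<^esub> (\<lambda>a. a \<odot>\<^bsub>M\<^esub> x) ` J n" for n
  proof
    show "N <+>\<^bsub>M\<^esub> (\<lambda>a. a \<odot>\<^bsub>M\<^esub> x) ` J n \<subseteq> H n"
      by (rule set_add_least[OF lm H(1) H(2)]) (auto simp: J_def)
    show "H n \<subseteq> N <+>\<^bsub>M\<^esub> (\<lambda>a. a \<odot>\<^bsub>M\<^esub> x) ` J n"
    proof
      fix h assume h: "h \<in> H n"
      then obtain y a where d: "y \<in> N" "a \<in> carrier R" "h = y \<oplus>\<^bsub>M\<^esub> a \<odot>\<^bsub>M\<^esub> x"
        using H(3) unfolding cyclic_def set_add_iff subset_iff by blast
      have c: "y \<in> carrier M" "a \<odot>\<^bsub>M\<^esub> x \<in> carrier M"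
        using d x N by (auto simp: submodule_iff[OF lm] smult_closed)
      have "h \<ominus>\<^bsub>M\<^esub> y = a \<odot>\<^bsub>M\<^esub> x" using d c
        by (simp add: a_minus_def M.a_ac) (metis M.a_assoc M.a_inv_closed M.a_lcomm M.l_neg M.r_neg M.r_zero)
      moreover have "h \<ominus>\<^bsub>M\<^esub> y \<in> H n" using submodule_diff[OF lm H(1) h] d H(2) by blast
      ultimately have "a \<in> J n" using d by (simp add: J_def)
      then show "h \<in> N <+>\<^bsub>M\<^esub> (\<lambda>a. a \<odot>\<^bsub>M\<^esub> x) ` J n" using d unfolding set_add_iff by blast
    qed
  qed
  ultimately show "\<exists>n. \<forall>m\<ge>n. H m = H n" by metis
qed

lemma chain_cond_fin_gen:
  assumes lm: "left_module R M" and fg: "fin_gen R M"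
    and c: "chain_cond asc R (self_mod R) {\<zero>\<^bsub>R\<^esub>} (carrier R)"
  shows "chain_cond asc R M {\<zero>\<^bsub>M\<^esub>} (carrier M)"
proof -
  interpret left_module R M by fact
  obtain S where S: "finite S" "S \<subseteq> carrier M" "\<And>H. submodule H R M \<Longrightarrow> S \<subseteq> H \<Longrightarrow> H = carrier M"
    using fg unfolding fin_gen_def by blast
  from S(1,2) have "\<exists>H. submodule H R M \<and> S \<subseteq> H \<and> chain_cond asc R M {\<zero>\<^bsub>M\<^esub>} H"
  proof (induction S)
    case empty
    then show ?case using chain_cond_trivial submodule_zero[OF lm] by blast
  next
    case (insert x S)
    then obtain H where H: "submodule H R M" "S \<subseteq> H" "chain_cond asc R M {\<zero>\<^bsub>M\<^esub>} H" by auto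
    have x: "x \<in> carrier M" using insert by simp
    note cy = submodule_cyclic[OF lm x]
    have "chain_cond asc R M {\<zero>\<^bsub>M\<^esub>} (H <+>\<^bsub>M\<^esub> cyclic R M x)"
      by (rule chain_cond_extension[OF lm H(1) submodule_sum[OF lm H(1) cy(1)] _ _ H(3)
            chain_cond_cyclic[OF lm x H(1) c]])
        (use H(1) subset_set_add(1)[OF lm H(1) cy(1)] in \<open>auto simp: submodule_iff[OF lm]\<close>)
    then show ?case using submodule_sum[OF lm H(1) cy(1)] subset_set_add[OF lm H(1) cy(1)] H(2) cy(2) by blast
  qed
  then show ?thesis using S(3) by blast
qed

subsection \<open>Artinian commutative rings are Noetherian\<close>

text \<open>Serves two purposes: with the unit as \<open>x\<close> it yields maximal ideals, and
  inside a module it cuts off a simple layer.\<close>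

lemma ex_maximal_avoiding:
  assumes lm: "left_module R M" and L: "submodule L R M" and x: "x \<notin> L"
  shows "\<exists>W. submodule W R M \<and> L \<subseteq> W \<and> x \<notin> W \<and>
    (\<forall>V. submodule V R M \<and> W \<subseteq> V \<and> x \<notin> V \<longrightarrow> V = W)"
proof -
  let ?A = "{W. submodule W R M \<and> L \<subseteq> W \<and> x \<notin> W}"
  have "\<exists>W\<in>?A. \<forall>V\<in>?A. W \<subseteq> V \<longrightarrow> V = W"
  proof (rule subset_Zorn)
    fix C assume C: "subset.chain ?A C"
    show "\<exists>U\<in>?A. \<forall>X\<in>C. X \<subseteq> U"
    proof (cases "C = {}")
      case True
      then show ?thesis using L x by blast
    next
      case False
      have CA: "\<And>X. X \<in> C \<Longrightarrow> submodule X R M \<and> L \<subseteq> X \<and> x \<notin> X"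
        and lin: "\<And>X Y. X \<in> C \<Longrightarrow> Y \<in> C \<Longrightarrow> X \<subseteq> Y \<or> Y \<subseteq> X"
        using C unfolding subset.chain_def by auto
      have CS: "X \<subseteq> carrier M" "\<zero>\<^bsub>M\<^esub> \<in> X" "\<And>x y. x \<in> X \<Longrightarrow> y \<in> X \<Longrightarrow> x \<oplus>\<^bsub>M\<^esub> y \<in> X"
        "\<And>a x. a \<in> carrier R \<Longrightarrow> x \<in> X \<Longrightarrow> a \<odot>\<^bsub>M\<^esub> x \<in> X" if "X \<in> C" for X
        using CA[OF that] by (simp_all add: submodule_iff[OF lm])
      have "submodule (\<Union>C) R M" unfolding submodule_iff[OF lm]
      proof (intro conjI ballI)
        show "\<Union>C \<subseteq> carrier M" using CS(1) by (rule Union_least)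
        show "\<zero>\<^bsub>M\<^esub> \<in> \<Union>C" using CS(2) False by fast
      next
        fix a y assume a: "a \<in> carrier R" and "y \<in> \<Union>C"
        then obtain X where "X \<in> C" "y \<in> X" by blast
        then show "a \<odot>\<^bsub>M\<^esub> y \<in> \<Union>C" using CS(4)[OF _ a] by (intro UnionI)
      next
        fix y z assume "y \<in> \<Union>C" "z \<in> \<Union>C"
        then obtain X where "X \<in> C" "y \<in> X" "z \<in> X" using lin by blast
        then show "y \<oplus>\<^bsub>M\<^esub> z \<in> \<Union>C" using CS(3) by (intro UnionI)
      qed
      then show ?thesis using CA False by blast
    qed
  qed
  then show ?thesis by auto (metis order_trans)
qed

text \<open>On a layer killed by \<open>m\<close> the scalars act like a field. A minimal
  \<open>V\<close> such that the interval up to \<open>Q\<close> satisfies the ascending condition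
  must be \<open>L\<close>: otherwise a submodule maximal among those avoiding some \<open>x\<close>
  of \<open>V\<close> meets \<open>V\<close> in a smaller submodule with simple factor, which could
  replace \<open>V\<close>.\<close>

lemma artinian_noetherian_layer:
  assumes lm: "left_module R M" and L: "submodule L R M" and Q: "submodule Q R M" and LQ: "L \<subseteq> Q"
    and m: "\<And>a. a \<in> carrier R \<Longrightarrow> a \<notin> m \<Longrightarrow> \<exists>r\<in>carrier R. \<exists>b\<in>m. r \<otimes>\<^bsub>R\<^esub> a \<oplus>\<^bsub>R\<^esub> b = \<one>\<^bsub>R\<^esub>"
    and mc: "m \<subseteq> carrier R"
    and mQ: "\<And>a y. a \<in> m \<Longrightarrow> y \<in> Q \<Longrightarrow> a \<odot>\<^bsub>M\<^esub> y \<in> L"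
    and dcc: "chain_cond False R M L Q"
  shows "chain_cond True R M L Q"
proof -
  interpret left_module R M by fact
  note sub = submodule_iff[OF lm]
  let ?S = "{V. submodule V R M \<and> L \<subseteq> V \<and> V \<subseteq> Q \<and> chain_cond True R M V Q}"
  have "\<exists>V\<in>?S. \<forall>K\<in>?S. K \<subseteq> V \<longrightarrow> K = V"
  proof (rule chain_cond_minimal[OF dcc])
    have "Q \<in> ?S" by (simp add: Q LQ chain_cond_trivial)
    then show "?S \<noteq> {}" by force
  qed simp
  then obtain V where VS: "V \<in> ?S" and minV: "\<forall>K\<in>?S. K \<subseteq> V \<longrightarrow> K = V" by (rule bexE)
  have V: "submodule V R M" "L \<subseteq> V" "V \<subseteq> Q" "chain_cond True R M V Q" using VS by simp_all
  have min: "K = V" if "submodule K R M" "L \<subseteq> K" "K \<subseteq> V" "chain_cond True R M K Q" for K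
    using bspec[OF minV, of K] that V(3) by simp
  have "V = L"
  proof (rule ccontr)
    assume "V \<noteq> L"
    then obtain x where x: "x \<in> V" "x \<notin> L" using V by blast
    obtain W where W: "submodule W R M" "L \<subseteq> W" "x \<notin> W"
      and Wmax: "\<And>V. submodule V R M \<Longrightarrow> W \<subseteq> V \<Longrightarrow> x \<notin> V \<Longrightarrow> V = W"
      using ex_maximal_avoiding[OF lm L x(2)] by blast
    \<comment> \<open>\<open>V\<close> modulo this intersection is simple: a submodule in between
      either contains \<open>x\<close> and is \<open>V\<close>, by \<open>two\<close>, or avoids
      \<open>x\<close> and is the intersection.\<close>
    let ?K = "W \<inter> V"
    have K: "submodule ?K R M" using submodule_Int[OF lm W(1) V(1)] .
    have xM: "x \<in> carrier M" using x V by (auto simp: sub)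
    have two: "y \<in> V \<Longrightarrow> y \<notin> W \<Longrightarrow> submodule H R M \<Longrightarrow> ?K \<subseteq> H \<Longrightarrow> x \<in> H \<Longrightarrow> y \<in> H" for y H
    proof -
      assume y: "y \<in> V" "y \<notin> W" and H: "submodule H R M" "?K \<subseteq> H" "x \<in> H"
      have yM: "y \<in> carrier M" using y V by (auto simp: sub)
      note cy = submodule_cyclic[OF lm yM]
      have "x \<in> W <+>\<^bsub>M\<^esub> cyclic R M y"
        using Wmax[OF submodule_sum[OF lm W(1) cy(1)]] subset_set_add[OF lm W(1) cy(1)] y cy(2) by blast
      then obtain w c where d: "w \<in> W" "c \<in> carrier R" "x = w \<oplus>\<^bsub>M\<^esub> c \<odot>\<^bsub>M\<^esub> y"
        unfolding set_add_iff cyclic_def by blast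
      have "c \<notin> m"
      proof
        assume "c \<in> m"
        then have "c \<odot>\<^bsub>M\<^esub> y \<in> W" using mQ y V W by blast
        then show False using d W by (auto simp: sub)
      qed
      \<comment> \<open>\<open>r\<close> inverts \<open>c\<close> modulo \<open>m\<close>. This
        recovers \<open>y\<close> from \<open>c y = x - w\<close> up to \<open>b y\<close>, which
        lies in \<open>L\<close>.\<close>
      then obtain r b where rb: "r \<in> carrier R" "b \<in> m" "r \<otimes>\<^bsub>R\<^esub> c \<oplus>\<^bsub>R\<^esub> b = \<one>\<^bsub>R\<^esub>" using m d by blast
      have b: "b \<in> carrier R" using rb mc by blast
      have wM: "w \<in> carrier M" using d W by (auto simp: sub)
      have "y = (r \<otimes>\<^bsub>R\<^esub> c \<oplus>\<^bsub>R\<^esub> b) \<odot>\<^bsub>M\<^esub> y" using rb yM by (simp add: smult_one)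
      also have "\<dots> = r \<odot>\<^bsub>M\<^esub> (c \<odot>\<^bsub>M\<^esub> y) \<oplus>\<^bsub>M\<^esub> b \<odot>\<^bsub>M\<^esub> y"
        using rb(1) b d(2) yM by (simp add: smult_l_distr smult_assoc1)
      finally have y1: "y = r \<odot>\<^bsub>M\<^esub> (c \<odot>\<^bsub>M\<^esub> y) \<oplus>\<^bsub>M\<^esub> b \<odot>\<^bsub>M\<^esub> y" .
      have cy': "c \<odot>\<^bsub>M\<^esub> y \<in> V" using y d V by (auto simp: sub)
      have "x \<ominus>\<^bsub>M\<^esub> (c \<odot>\<^bsub>M\<^esub> y) \<in> V" by (rule submodule_diff[OF lm V(1) x(1) cy'])
      moreover have "x \<ominus>\<^bsub>M\<^esub> (c \<odot>\<^bsub>M\<^esub> y) = w" using d wM yM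
        by (simp add: a_minus_def M.a_assoc M.r_neg smult_closed)
      ultimately have "w \<in> ?K" using d by simp
      then have wH: "w \<in> H" using H by blast
      have "x \<ominus>\<^bsub>M\<^esub> w \<in> H" by (rule submodule_diff[OF lm H(1) H(3) wH])
      moreover have "x \<ominus>\<^bsub>M\<^esub> w = c \<odot>\<^bsub>M\<^esub> y" using d wM yM
        by (simp add: a_minus_def M.a_comm[of w] M.a_assoc M.r_neg smult_closed)
      ultimately have 1: "c \<odot>\<^bsub>M\<^esub> y \<in> H" by simp
      have 2: "b \<odot>\<^bsub>M\<^esub> y \<in> H" using mQ[of b y] rb y V W H by auto
      show "y \<in> H" using 1 2 H(1) rb y1 unfolding sub by metis
    qed
    have "chain_cond True R M ?K V"
      unfolding chain_cond_def
    proof (intro allI impI)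
      fix H assume "\<forall>n. submodule (H n) R M \<and> ?K \<subseteq> H n \<and> H n \<subseteq> V \<and> chain_le True (H n) (H (Suc n))"
      then have H: "\<And>n. submodule (H n) R M" "\<And>n. ?K \<subseteq> H n" "\<And>n. H n \<subseteq> V" "\<And>n. H n \<subseteq> H (Suc n)" by auto
      show "\<exists>n. \<forall>m\<ge>n. H m = H n"
      proof (cases "\<exists>n. x \<in> H n")
        case True
        then obtain n where n: "x \<in> H n" by blast
        have VH: "V \<subseteq> H m" if "m \<ge> n" for m
        proof -
          have "x \<in> H m" using chain_le_chain[of True H n m] H(4) that n by auto
          then show ?thesis using two[OF _ _ H(1,2), of _ m] H(2)[of m] by blast
        qed
        have "H m = V" if "m \<ge> n" for m using VH[OF that] H(3)[of m] by (rule subset_antisym[rotated])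
        then show ?thesis by (intro exI[of _ n]) simp
      next
        case False
        \<comment> \<open>An element \<open>y\<close> of \<open>H n\<close> outside \<open>W\<close>
          gives \<open>x = w + c y\<close> by maximality of \<open>W\<close>. Then \<open>w\<close>
          lies in \<open>W\<close> and in \<open>V\<close>, hence in \<open>H n\<close>, which
          forces \<open>x\<close> into \<open>H n\<close>.\<close>
        have "H n = ?K" for n
        proof -
          have "y \<in> ?K" if y: "y \<in> H n" for y
          proof (rule ccontr)
            assume "y \<notin> ?K"
            then have yV: "y \<in> V" "y \<notin> W" using y H(3)[of n] by auto
            have yM: "y \<in> carrier M" using yV V by (auto simp: sub)
            note cy = submodule_cyclic[OF lm yM]
            have "x \<in> W <+>\<^bsub>M\<^esub> cyclic R M y"
              using Wmax[OF submodule_sum[OF lm W(1) cy(1)]] subset_set_add[OF lm W(1) cy(1)] yV cy(2) by blast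
            then obtain w c where d: "w \<in> W" "c \<in> carrier R" "x = w \<oplus>\<^bsub>M\<^esub> c \<odot>\<^bsub>M\<^esub> y"
              unfolding set_add_iff cyclic_def by blast
            have wM: "w \<in> carrier M" using d W by (auto simp: sub)
            have cyH: "c \<odot>\<^bsub>M\<^esub> y \<in> H n" using y d H(1)[of n] by (auto simp: sub)
            have "x \<ominus>\<^bsub>M\<^esub> (c \<odot>\<^bsub>M\<^esub> y) \<in> V"
              by (rule submodule_diff[OF lm V(1) x(1)]) (use cyH H(3)[of n] in blast)
            moreover have "x \<ominus>\<^bsub>M\<^esub> (c \<odot>\<^bsub>M\<^esub> y) = w" using d wM yM
              by (simp add: a_minus_def M.a_assoc M.r_neg smult_closed)
            ultimately have "w \<in> H n" using H(2)[of n] d by auto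
            then have "x \<in> H n" using d cyH H(1)[of n] by (auto simp: sub)
            then show False using False by blast
          qed
          then show ?thesis using H(2)[of n] by blast
        qed
        then show ?thesis by simp
      qed
    qed
    from chain_cond_extension[OF lm V(1) Q _ V(3) this V(4)]
    have "chain_cond True R M ?K Q" by blast
    then have "?K = V" using min[OF K] V W by blast
    then show False using x W by blast
  qed
  then show ?thesis using V(4) by simp
qed

lemma (in cring) submodule_self_iff: "submodule J R (self_mod R) \<longleftrightarrow> ideal J R"
proof
  have lr: "left_module R (self_mod R)" by (rule left_module_self) (rule ring_axioms)
  show "ideal J R" if J: "submodule J R (self_mod R)"
  proof (rule idealI)
    show "subgroup J (add_monoid R)"
    proof (rule add.subgroupI)
      have "a_inv (self_mod R) = a_inv R" by (simp add: fun_eq_iff a_inv_def m_inv_def self_mod_def)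
      then show "\<ominus> x \<in> J" if "x \<in> J" for x
        using submodule_minus[OF lr J that] by simp
    qed (use J in \<open>auto simp: submodule_iff[OF lr]\<close>)
    show "a \<in> J \<Longrightarrow> x \<in> carrier R \<Longrightarrow> x \<otimes> a \<in> J" for a x
      using J unfolding submodule_iff[OF lr] by simp
    then show "a \<in> J \<Longrightarrow> x \<in> carrier R \<Longrightarrow> a \<otimes> x \<in> J" for a x
      using J unfolding submodule_iff[OF lr] by (metis m_comm self_mod_simps(1) subsetD)
  qed (rule ring_axioms)
  show "submodule J R (self_mod R)" if J: "ideal J R"
  proof -
    interpret J: ideal J R by fact
    show ?thesis unfolding submodule_iff[OF lr] using J.Icarr J.I_l_closed by auto
  qed
qed

subsection \<open>Artin algebras satisfy both chain conditions\<close>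

lemma (in cring) ex_maximalideal:
  assumes J: "ideal J R" "\<one> \<notin> J"
  shows "\<exists>m. maximalideal m R \<and> J \<subseteq> m"
proof -
  have lr: "left_module R (self_mod R)" by (rule left_module_self) (rule ring_axioms)
  obtain W where W: "ideal W R" "J \<subseteq> W" "\<one> \<notin> W" "\<And>V. ideal V R \<Longrightarrow> W \<subseteq> V \<Longrightarrow> \<one> \<notin> V \<Longrightarrow> V = W"
    using ex_maximal_avoiding[OF lr, of J \<one>] J unfolding submodule_self_iff by auto
  have "maximalideal W R"
  proof (rule maximalidealI[OF W(1)])
    show "carrier R \<noteq> W" using W(3) by blast
    show "V = W \<or> V = carrier R" if "ideal V R" "W \<subseteq> V" "V \<subseteq> carrier R" for V
      using W(4)[OF that(1,2)] ideal.one_imp_carrier[OF that(1)] by blast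
  qed
  then show ?thesis using W by blast
qed

text \<open>The empty product is the whole ring. Adding one factor at a time produces layers
  \<open>Q / Q m\<close> on which the scalars act through the field of residues modulo
  \<open>m\<close>.\<close>

inductive_set maximal_products :: "('a, 'r) ring_scheme \<Rightarrow> 'a set set" for R where
  base: "carrier R \<in> maximal_products R"
| step: "Q \<in> maximal_products R \<Longrightarrow> maximalideal m R \<Longrightarrow> Q \<cdot>\<^bsub>R\<^esub> m \<in> maximal_products R"

lemma (in cring) maximal_products_ideal: "Q \<in> maximal_products R \<Longrightarrow> ideal Q R"
  by (induction rule: maximal_products.induct)
    (auto simp: oneideal maximalideal.axioms(1) intro: ideal_prod_is_ideal)

lemma (in cring) maximal_products_mult:
  assumes "Q \<in> maximal_products R" "P \<in> maximal_products R"
  shows "P \<cdot> Q \<in> maximal_products R"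
  using assms(1)
proof (induction rule: maximal_products.induct)
  case base
  then show ?case using ideal_prod_one[OF maximal_products_ideal[OF assms(2)]] assms(2)
    by simp
next
  case (step Q m)
  then have e: "P \<cdot> (Q \<cdot> m) = (P \<cdot> Q) \<cdot> m"
    using assms maximal_products_ideal maximalideal.axioms(1)
    by (intro ideal_prod_assoc[symmetric]) auto
  show ?case unfolding e by (rule maximal_products.step) (use step in auto)
qed

text \<open>A minimal product \<open>P\<close> of maximal ideals is idempotent and lies in every
  maximal ideal. If it were nonzero, an ideal minimal among those not killed by \<open>P\<close>
  would have the form \<open>n P\<close>, so that \<open>n = n p'\<close> with \<open>p'\<close> in
  \<open>P\<close>. As \<open>p'\<close> lies in every maximal ideal, \<open>1 - p'\<close> lies in
  none, yet it kills \<open>n\<close>.\<close>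

lemma (in cring) maximal_products_zero:
  assumes dcc: "chain_cond False R (self_mod R) {\<zero>} (carrier R)"
  shows "{\<zero>} \<in> maximal_products R"
proof -
  have bds: "ideal J R \<Longrightarrow> submodule J R (self_mod R) \<and> {\<zero>} \<subseteq> J \<and> J \<subseteq> carrier R" for J
    using submodule_self_iff[of J] additive_subgroup.zero_closed[OF ideal.axioms(1), of J R] ideal.Icarr[of J R] by blast
  have "\<exists>P\<in>maximal_products R. \<forall>K\<in>maximal_products R. K \<subseteq> P \<longrightarrow> K = P"
  proof (rule chain_cond_minimal[OF dcc])
    show "maximal_products R \<noteq> {}" using maximal_products.base[of R] by auto
  qed (use maximal_products_ideal bds in auto)
  then obtain P where P: "P \<in> maximal_products R" "\<And>K. K \<in> maximal_products R \<Longrightarrow> K \<subseteq> P \<Longrightarrow> K = P" by auto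
  have iP: "ideal P R" using maximal_products_ideal P by blast
  interpret P: ideal P R by fact
  have Pm: "P \<subseteq> m" if "maximalideal m R" for m
  proof -
    have "P \<cdot> m \<subseteq> P \<inter> m" using ideal_prod_inter iP that maximalideal.axioms(1) by blast
    moreover have "P \<cdot> m = P" using P(2)[OF maximal_products.step[OF P(1) that]] calculation by blast
    ultimately show ?thesis by blast
  qed
  have PP: "P \<cdot> P = P"
    using P(2)[OF maximal_products_mult[OF P(1) P(1)]] ideal_prod_inter[OF iP iP] by blast
  have "P = {\<zero>}"
  proof (rule ccontr)
    assume "P \<noteq> {\<zero>}"
    then obtain p0 where p0: "p0 \<in> P" "p0 \<noteq> \<zero>" using P.zero_closed by blast
    let ?N = "{N. ideal N R \<and> (\<exists>n\<in>N. \<exists>p\<in>P. n \<otimes> p \<noteq> \<zero>)}"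
    have "\<one> \<otimes> p0 \<noteq> \<zero>" using p0 P.Icarr by simp
    then have "carrier R \<in> ?N" using p0 oneideal by blast
    then have ne: "?N \<noteq> {}" by force
    have "\<exists>N\<in>?N. \<forall>K\<in>?N. K \<subseteq> N \<longrightarrow> K = N"
      by (rule chain_cond_minimal[OF dcc ne]) (use bds in simp)
    then obtain N where NN: "N \<in> ?N" and minN: "\<forall>K\<in>?N. K \<subseteq> N \<longrightarrow> K = N" by (rule bexE)
    from NN obtain n p where N: "ideal N R" "n \<in> N" "p \<in> P" "n \<otimes> p \<noteq> \<zero>" by auto
    have min: "K = N" if "ideal K R" "K \<subseteq> N" "\<exists>n\<in>K. \<exists>p\<in>P. n \<otimes> p \<noteq> \<zero>" for K
      using bspec[OF minN, of K] that by simp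
    interpret N: ideal N R by fact
    have n: "n \<in> carrier R" using N N.Icarr by blast
    define K where "K = (\<lambda>q. n \<otimes> q) ` P"
    have KN: "K \<subseteq> N" using N n P.Icarr by (auto simp: K_def N.I_r_closed)
    have lr: "left_module R (self_mod R)" by (rule left_module_self) (rule ring_axioms)
    have "(\<lambda>q. n \<otimes> q) \<in> mod_hom R (self_mod R) (self_mod R)"
      using n by (auto intro!: mod_homI simp: r_distr m_lcomm)
    from submodule_image[OF lr lr this, of P] have iK: "ideal K R"
      using iP by (simp add: submodule_self_iff K_def)
    \<comment> \<open>If \<open>P\<close> annihilated \<open>n P\<close>, then \<open>n\<close>
      would annihilate \<open>P P = P\<close>, against the choice of \<open>n\<close>. So
      \<open>n P\<close> competes with \<open>N\<close> and equals it.\<close>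
    have "\<exists>q\<in>P. \<exists>q'\<in>P. n \<otimes> q \<otimes> q' \<noteq> \<zero>"
    proof (rule ccontr)
      assume a: "\<not> ?thesis"
      have "n \<otimes> q = \<zero> \<and> q \<in> carrier R" if "q \<in> P \<cdot> P" for q
        using that
      proof (induction rule: ideal_prod.induct)
        case (prod i j)
        then show ?case using a n P.Icarr by (simp add: m_assoc[symmetric])
      next
        case (sum s1 s2)
        then show ?case using n by (simp add: r_distr)
      qed
      then show False using N(3,4) PP by blast
    qed
    then have "K = N" by (intro min[OF iK KN]) (auto simp: K_def)
    then obtain p' where p': "p' \<in> P" "n = n \<otimes> p'" using N(2) by (auto simp: K_def)
    have p'c: "p' \<in> carrier R" using p' P.Icarr by blast
    \<comment> \<open>The annihilator of \<open>n\<close> is proper and contains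
      \<open>1 - p'\<close>. A maximal ideal above it contains \<open>1 - p'\<close> and also
      \<open>p'\<close>.\<close>
    define J where "J = {c \<in> carrier R. c \<otimes> n = \<zero>}"
    have "(\<lambda>q. q \<otimes> n) \<in> mod_hom R (self_mod R) (self_mod R)"
      using n by (auto intro!: mod_homI simp: l_distr m_assoc)
    from submodule_kernel[OF lr lr this] have iJ: "ideal J R"
      by (simp add: submodule_self_iff J_def)
    have "n \<noteq> \<zero>" using N P.Icarr by auto
    then have "\<one> \<notin> J" using n by (simp add: J_def)
    then obtain m where m: "maximalideal m R" "J \<subseteq> m" using ex_maximalideal[OF iJ] by blast
    interpret m: maximalideal m R by fact
    have "(\<one> \<ominus> p') \<otimes> n = n \<ominus> n \<otimes> p'" using n p'c by (simp add: a_minus_def l_distr l_minus m_comm[of p' n])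
    also have "\<dots> = \<zero>" unfolding p'(2)[symmetric] using n by simp
    finally have "(\<one> \<ominus> p') \<otimes> n = \<zero>" .
    then have "\<one> \<ominus> p' \<in> m" using m p'c by (auto simp: J_def)
    moreover have "p' \<in> m" using Pm[OF m(1)] p' by blast
    ultimately have "(\<one> \<ominus> p') \<oplus> p' \<in> m" by (rule m.a_closed)
    moreover have "(\<one> \<ominus> p') \<oplus> p' = \<one>" using p'c by (simp add: a_minus_def a_assoc l_neg)
    ultimately show False using m.one_imp_carrier m.I_notcarr by simp
  qed
  then show ?thesis using P by simp
qed

text \<open>Since some product of maximal ideals vanishes, the ring has a finite filtration with
  layers \<open>Q / Q m\<close>. Each is handled by \<open>artinian_noetherian_layer\<close>, and
  \<open>chain_cond_extension\<close> puts the layers together.\<close>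

theorem (in cring) artinian_noetherian:
  assumes dcc: "chain_cond False R (self_mod R) {\<zero>} (carrier R)"
  shows "chain_cond True R (self_mod R) {\<zero>} (carrier R)"
proof -
  have lr: "left_module R (self_mod R)" by (rule left_module_self) (rule ring_axioms)
  have "chain_cond True R (self_mod R) Q (carrier R)" if "Q \<in> maximal_products R" for Q
    using that
  proof (induction rule: maximal_products.induct)
    case base
    show ?case by (rule chain_cond_trivial)
  next
    case (step Q m)
    interpret m: maximalideal m R by fact
    have iQ: "ideal Q R" using maximal_products_ideal step by blast
    interpret Q: ideal Q R by fact
    have iQm: "ideal (Q \<cdot> m) R" using ideal_prod_is_ideal[OF iQ m.is_ideal] .
    have QmQ: "Q \<cdot> m \<subseteq> Q" using ideal_prod_inter[OF iQ m.is_ideal] by blast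
    \<comment> \<open>Invertibility modulo \<open>m\<close>: the ideal generated by \<open>m\<close>
      and \<open>a\<close> is the whole ring.\<close>
    have inv: "\<exists>r\<in>carrier R. \<exists>b\<in>m. r \<otimes> a \<oplus> b = \<one>" if a: "a \<in> carrier R" "a \<notin> m" for a
    proof -
      have "ideal (m <+>\<^bsub>R\<^esub> PIdl a) R" using add_ideals[OF m.is_ideal cgenideal_ideal[OF a(1)]] .
      moreover have "m \<subseteq> m <+>\<^bsub>R\<^esub> PIdl a" "a \<in> m <+>\<^bsub>R\<^esub> PIdl a"
      proof -
        have "m \<subseteq> m <+>\<^bsub>self_mod R\<^esub> PIdl a" "PIdl a \<subseteq> m <+>\<^bsub>self_mod R\<^esub> PIdl a"
          using subset_set_add[OF lr, of m "PIdl a"] m.is_ideal cgenideal_ideal[OF a(1)]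
          by (simp_all add: submodule_self_iff)
        moreover have "m <+>\<^bsub>self_mod R\<^esub> PIdl a = m <+>\<^bsub>R\<^esub> PIdl a"
          by (simp add: set_add_def set_mult_def self_mod_def)
        ultimately show "m \<subseteq> m <+>\<^bsub>R\<^esub> PIdl a" "a \<in> m <+>\<^bsub>R\<^esub> PIdl a" using cgenideal_self[OF a(1)] by auto
      qed
      ultimately have "m <+>\<^bsub>R\<^esub> PIdl a = carrier R"
        using m.I_maximal[of "m <+>\<^bsub>R\<^esub> PIdl a"] a(2) ideal.Icarr[of "m <+>\<^bsub>R\<^esub> PIdl a" R]
        by (metis subsetI)
      then have "\<one> \<in> m <+>\<^bsub>R\<^esub> PIdl a" by simp
      then obtain b r where "b \<in> m" "r \<in> carrier R" "\<one> = b \<oplus> r \<otimes> a"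
        unfolding set_add_iff cgenideal_def by blast
      then have "r \<otimes> a \<oplus> b = \<one>" using a(1) m.Icarr[of b] a_comm[of b "r \<otimes> a"] by simp
      then show ?thesis using \<open>b \<in> m\<close> \<open>r \<in> carrier R\<close> by (intro bexI)
    qed
    have "chain_cond True R (self_mod R) (Q \<cdot> m) Q"
    proof (rule artinian_noetherian_layer[OF lr])
      show "submodule (Q \<cdot> m) R (self_mod R)" "submodule Q R (self_mod R)"
        using iQ iQm by (simp_all add: submodule_self_iff)
      show "Q \<cdot> m \<subseteq> Q" by fact
      show "m \<subseteq> carrier R" using m.Icarr by blast
      show "chain_cond False R (self_mod R) (Q \<cdot> m) Q"
        by (rule chain_cond_mono[OF dcc])
          (use Q.Icarr additive_subgroup.zero_closed[OF ideal.axioms(1)[OF iQm]] in auto)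
      show "a \<odot>\<^bsub>self_mod R\<^esub> y \<in> Q \<cdot> m" if "a \<in> m" "y \<in> Q" for a y
        using ideal_prod.prod[OF that(2,1), of R] that m.Icarr Q.Icarr by (simp add: m_comm)
    qed (use inv in auto)
    then show ?case
      by (intro chain_cond_extension[OF lr _ _ QmQ _ _ step.IH])
        (use iQ Q.Icarr oneideal in \<open>auto simp: submodule_self_iff\<close>)
  qed
  then show ?thesis using maximal_products_zero[OF dcc] by blast
qed

lemma artinian_cring_chain_cond:
  assumes "artinian_cring k"
  shows "chain_cond asc k (self_mod k) {\<zero>\<^bsub>k\<^esub>} (carrier k)"
proof -
  interpret cring k using assms by (simp add: artinian_cring_def)
  have "chain_cond False k (self_mod k) {\<zero>\<^bsub>k\<^esub>} (carrier k)"
    using assms unfolding chain_cond_def artinian_cring_def submodule_self_iff by simp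
  then show ?thesis using artinian_noetherian by (cases asc) auto
qed

text \<open>Left ideals of \<open>A\<close> are submodules over the base ring.\<close>

lemma artin_algebra_chain_cond:
  assumes "artin_algebra k A"
  shows "chain_cond asc A (self_mod A) {\<zero>\<^bsub>A\<^esub>} (carrier A)"
proof -
  have k: "artinian_cring k" "ring A" "module k A" "fin_gen k A"
    and bil: "\<And>c x y. c \<in> carrier k \<Longrightarrow> x \<in> carrier A \<Longrightarrow> y \<in> carrier A \<Longrightarrow> (c \<odot>\<^bsub>A\<^esub> x) \<otimes>\<^bsub>A\<^esub> y = c \<odot>\<^bsub>A\<^esub> (x \<otimes>\<^bsub>A\<^esub> y)"
    using assms by (auto simp: artin_algebra_def)
  interpret A: ring A by fact
  interpret m: module k A by fact
  have lm: "left_module k A"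
    by (intro left_module.intro left_module_axioms.intro m.ring_axioms A.abelian_group_axioms)
      (auto simp: m.smult_l_distr m.smult_r_distr m.smult_assoc1)
  have la: "left_module A (self_mod A)" by (rule left_module_self) fact
  have "chain_cond asc k A {\<zero>\<^bsub>A\<^esub>} (carrier A)"
    by (rule chain_cond_fin_gen[OF lm k(4) artinian_cring_chain_cond[OF k(1)]])
  moreover have "submodule H k A" if H: "submodule H A (self_mod A)" for H
    unfolding submodule_iff[OF lm]
  proof (intro conjI ballI)
    note H = H[unfolded submodule_iff[OF la]]
    show "H \<subseteq> carrier A" "\<zero>\<^bsub>A\<^esub> \<in> H" using H by auto
    show "x \<oplus>\<^bsub>A\<^esub> y \<in> H" if "x \<in> H" "y \<in> H" for x y using H that by simp
    show "c \<odot>\<^bsub>A\<^esub> x \<in> H" if "c \<in> carrier k" "x \<in> H" for c x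
    proof -
      have "c \<odot>\<^bsub>A\<^esub> x = (c \<odot>\<^bsub>A\<^esub> \<one>\<^bsub>A\<^esub>) \<otimes>\<^bsub>A\<^esub> x" using bil[of c "\<one>\<^bsub>A\<^esub>" x] H that by auto
      then show ?thesis using H that by auto
    qed
  qed
  ultimately show ?thesis unfolding chain_cond_def by simp
qed

section \<open>Finitely generated modules\<close>

lemma mod_isoD:
  assumes "mod_iso R M N" "left_module R M"
  shows "\<exists>f\<in>mod_hom R M N. \<exists>g\<in>mod_hom R N M.
    (\<forall>x\<in>carrier M. g (f x) = x) \<and> (\<forall>y\<in>carrier N. f (g y) = y)"
  by (rule mod_isoE[OF assms]) auto

text \<open>In contrast to \<open>fg_mods\<close>, the carrier type is arbitrary: products and
  pullbacks have carriers of pairs.\<close>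

definition fg :: "('a, 'r) ring_scheme \<Rightarrow> ('a, 'b) module \<Rightarrow> bool" where
  "fg R M \<longleftrightarrow> left_module R M \<and> fin_gen R M"

lemma fgD: "fg R M \<Longrightarrow> left_module R M" "fg R M \<Longrightarrow> fin_gen R M"
  by (auto simp: fg_def)

lemma fg_mods_iff: "M \<in> fg_mods R \<longleftrightarrow> fg R M"
  by (simp add: fg_mods_def fg_def)

lemma fg_image:
  assumes "fg R M" "left_module R N" "f \<in> mod_hom R M N" "f ` carrier M = carrier N"
  shows "fg R N"
proof -
  note lm = fgD(1)[OF assms(1)]
  obtain S where S: "finite S" "S \<subseteq> carrier M" "\<And>H. submodule H R M \<Longrightarrow> S \<subseteq> H \<Longrightarrow> H = carrier M"
    using fgD(2)[OF assms(1)] unfolding fin_gen_def by auto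
  have "fin_gen R N" unfolding fin_gen_def
  proof (intro exI[of _ "f ` S"] conjI allI impI)
    show "finite (f ` S)" "f ` S \<subseteq> carrier N" using S assms(4) by auto
    fix H assume H: "submodule H R N \<and> f ` S \<subseteq> H"
    have "{x \<in> carrier M. f x \<in> H} = carrier M"
      using H S(2) by (intro S(3) submodule_preimage[OF lm assms(2,3)]) auto
    then have "carrier N \<subseteq> H" unfolding assms(4)[symmetric] by auto
    moreover have "H \<subseteq> carrier N" using H unfolding submodule_iff[OF assms(2)] by simp
    ultimately show "H = carrier N" by simp
  qed
  then show ?thesis using assms(2) by (simp add: fg_def)
qed

lemma fg_iso: "fg R M \<Longrightarrow> mod_iso R M N \<Longrightarrow> left_module R N \<Longrightarrow> fg R N"
  unfolding mod_iso_def bij_betw_def by (auto intro: fg_image)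

section \<open>Binary products of modules\<close>

definition prodm :: "('a, 'b) module \<Rightarrow> ('a, 'c) module \<Rightarrow> ('a, 'b \<times> 'c) module" (infixr \<open>\<times>\<^sub>M\<close> 75) where
  "X \<times>\<^sub>M Y = \<lparr>carrier = carrier X \<times> carrier Y, monoid.mult = undefined, one = undefined,
     zero = (\<zero>\<^bsub>X\<^esub>, \<zero>\<^bsub>Y\<^esub>), add = (\<lambda>p q. (fst p \<oplus>\<^bsub>X\<^esub> fst q, snd p \<oplus>\<^bsub>Y\<^esub> snd q)),
     smult = (\<lambda>a p. (a \<odot>\<^bsub>X\<^esub> fst p, a \<odot>\<^bsub>Y\<^esub> snd p))\<rparr>"

lemma prodm_simps [simp]:
  "carrier (X \<times>\<^sub>M Y) = carrier X \<times> carrier Y" "\<zero>\<^bsub>X \<times>\<^sub>M Y\<^esub> = (\<zero>\<^bsub>X\<^esub>, \<zero>\<^bsub>Y\<^esub>)"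
  "p \<oplus>\<^bsub>X \<times>\<^sub>M Y\<^esub> q = (fst p \<oplus>\<^bsub>X\<^esub> fst q, snd p \<oplus>\<^bsub>Y\<^esub> snd q)"
  "a \<odot>\<^bsub>X \<times>\<^sub>M Y\<^esub> p = (a \<odot>\<^bsub>X\<^esub> fst p, a \<odot>\<^bsub>Y\<^esub> snd p)"
  by (simp_all add: prodm_def)

lemma left_module_prodm:
  assumes "left_module R X" "left_module R Y"
  shows "left_module R (X \<times>\<^sub>M Y)"
proof -
  interpret X: left_module R X by fact
  interpret Y: left_module R Y by fact
  have ag: "abelian_group (X \<times>\<^sub>M Y)"
  proof (rule abelian_groupI)
    fix p assume p: "p \<in> carrier (X \<times>\<^sub>M Y)"
    show "\<exists>q\<in>carrier (X \<times>\<^sub>M Y). q \<oplus>\<^bsub>X \<times>\<^sub>M Y\<^esub> p = \<zero>\<^bsub>X \<times>\<^sub>M Y\<^esub>"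
      by (rule bexI[of _ "(\<ominus>\<^bsub>X\<^esub> fst p, \<ominus>\<^bsub>Y\<^esub> snd p)"]) (use p in \<open>auto simp: X.M.l_neg Y.M.l_neg\<close>)
  qed (auto simp: X.M.a_ac Y.M.a_ac)
  show ?thesis
    by (intro left_module.intro left_module_axioms.intro X.R.ring_axioms ag)
      (auto simp: X.smult_closed Y.smult_closed X.smult_l_distr Y.smult_l_distr X.smult_r_distr
        Y.smult_r_distr X.smult_assoc1 Y.smult_assoc1 X.smult_one Y.smult_one)
qed

lemma mod_hom_fst: "fst \<in> mod_hom R (X \<times>\<^sub>M Y) X"
  and mod_hom_snd: "snd \<in> mod_hom R (X \<times>\<^sub>M Y) Y"
  by (auto intro!: mod_homI)

lemma mod_hom_Pair:
  "f \<in> mod_hom R M X \<Longrightarrow> g \<in> mod_hom R M Y \<Longrightarrow> (\<lambda>x. (f x, g x)) \<in> mod_hom R M (X \<times>\<^sub>M Y)"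
  by (auto intro!: mod_homI simp: mod_hom_closed mod_hom_add mod_hom_smult)

lemma mod_hom_const_zero:
  assumes "left_module R N"
  shows "(\<lambda>x. \<zero>\<^bsub>N\<^esub>) \<in> mod_hom R M N"
proof -
  interpret N: left_module R N by fact
  show ?thesis by (auto intro!: mod_homI simp: N.smult_zero_right)
qed

lemma mod_hom_inl: "left_module R Y \<Longrightarrow> (\<lambda>x. (x, \<zero>\<^bsub>Y\<^esub>)) \<in> mod_hom R X (X \<times>\<^sub>M Y)"
  and mod_hom_inr: "left_module R X \<Longrightarrow> (\<lambda>y. (\<zero>\<^bsub>X\<^esub>, y)) \<in> mod_hom R Y (X \<times>\<^sub>M Y)"
  by (rule mod_hom_Pair[OF mod_hom_id mod_hom_const_zero], assumption)
    (rule mod_hom_Pair[OF mod_hom_const_zero mod_hom_id], assumption)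

lemma fg_prodm:
  assumes "fg R X" "fg R Y"
  shows "fg R (X \<times>\<^sub>M Y)"
proof -
  note lX = fgD(1)[OF assms(1)] and lY = fgD(1)[OF assms(2)]
  note lP = left_module_prodm[OF lX lY]
  interpret X: left_module R X by fact
  interpret Y: left_module R Y by fact
  obtain S where S: "finite S" "S \<subseteq> carrier X" "\<And>H. submodule H R X \<Longrightarrow> S \<subseteq> H \<Longrightarrow> H = carrier X"
    using fgD(2)[OF assms(1)] unfolding fin_gen_def by auto
  obtain T where T: "finite T" "T \<subseteq> carrier Y" "\<And>H. submodule H R Y \<Longrightarrow> T \<subseteq> H \<Longrightarrow> H = carrier Y"
    using fgD(2)[OF assms(2)] unfolding fin_gen_def by auto
  let ?G = "(\<lambda>x. (x, \<zero>\<^bsub>Y\<^esub>)) ` S \<union> (\<lambda>y. (\<zero>\<^bsub>X\<^esub>, y)) ` T"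
  have "fin_gen R (X \<times>\<^sub>M Y)" unfolding fin_gen_def
  proof (intro exI[of _ ?G] conjI allI impI)
    show "finite ?G" "?G \<subseteq> carrier (X \<times>\<^sub>M Y)" using S T by auto
    fix H assume H: "submodule H R (X \<times>\<^sub>M Y) \<and> ?G \<subseteq> H"
    have 1: "{x \<in> carrier X. (x, \<zero>\<^bsub>Y\<^esub>) \<in> H} = carrier X"
      using H S(2) by (intro S(3) submodule_preimage[OF lX lP mod_hom_inl[OF lY]]) auto
    have 2: "{y \<in> carrier Y. (\<zero>\<^bsub>X\<^esub>, y) \<in> H} = carrier Y"
      using H T(2) by (intro T(3) submodule_preimage[OF lY lP mod_hom_inr[OF lX]]) auto
    have HP: "H \<subseteq> carrier (X \<times>\<^sub>M Y)"
      and Hadd: "\<And>p q. p \<in> H \<Longrightarrow> q \<in> H \<Longrightarrow> p \<oplus>\<^bsub>X \<times>\<^sub>M Y\<^esub> q \<in> H"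
      using H unfolding submodule_iff[OF lP] by auto
    have "(x, y) \<in> H" if "x \<in> carrier X" "y \<in> carrier Y" for x y
      using Hadd[of "(x, \<zero>\<^bsub>Y\<^esub>)" "(\<zero>\<^bsub>X\<^esub>, y)"] 1 2 that by auto
    then show "H = carrier (X \<times>\<^sub>M Y)" using HP by auto
  qed
  then show ?thesis using lP by (simp add: fg_def)
qed

lemma mod_iso_prodm:
  assumes "mod_iso R X X'" "mod_iso R Y Y'" "left_module R X" "left_module R Y"
  shows "mod_iso R (X \<times>\<^sub>M Y) (X' \<times>\<^sub>M Y')"
proof -
  obtain f f' where f: "f \<in> mod_hom R X X'" "f' \<in> mod_hom R X' X"
    "\<And>x. x \<in> carrier X \<Longrightarrow> f' (f x) = x" "\<And>y. y \<in> carrier X' \<Longrightarrow> f (f' y) = y"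
    using mod_isoD[OF assms(1,3)] by auto
  obtain g g' where g: "g \<in> mod_hom R Y Y'" "g' \<in> mod_hom R Y' Y"
    "\<And>x. x \<in> carrier Y \<Longrightarrow> g' (g x) = x" "\<And>y. y \<in> carrier Y' \<Longrightarrow> g (g' y) = y"
    using mod_isoD[OF assms(2,4)] by auto
  show ?thesis
    by (rule mod_isoI2[of "\<lambda>p. (f (fst p), g (snd p))" _ _ _ "\<lambda>p. (f' (fst p), g' (snd p))"];
        (intro mod_hom_Pair mod_hom_comp[OF mod_hom_fst] mod_hom_comp[OF mod_hom_snd] f g)?)
      (use f g in auto)
qed

lemma mod_iso_prodm_comm: "mod_iso R (X \<times>\<^sub>M Y) (Y \<times>\<^sub>M X)"
  by (rule mod_isoI2[of "\<lambda>p. (snd p, fst p)" _ _ _ "\<lambda>p. (snd p, fst p)"])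
    (auto intro!: mod_homI)

lemma mod_iso_prodm_assoc: "mod_iso R ((X \<times>\<^sub>M Y) \<times>\<^sub>M Z) (X \<times>\<^sub>M Y \<times>\<^sub>M Z)"
  by (rule mod_isoI2[of "\<lambda>p. (fst (fst p), snd (fst p), snd p)" _ _ _ "\<lambda>p. ((fst p, fst (snd p)), snd (snd p))"])
    (auto intro!: mod_homI)

lemma mod_iso_prodm_assoc': "mod_iso R (X \<times>\<^sub>M Y \<times>\<^sub>M Z) ((X \<times>\<^sub>M Y) \<times>\<^sub>M Z)"
  by (rule mod_isoI2[of "\<lambda>p. ((fst p, fst (snd p)), snd (snd p))" _ _ _ "\<lambda>p. (fst (fst p), snd (fst p), snd p)"])
    (auto intro!: mod_homI)

lemma mod_iso_prodm_swap: "mod_iso R ((X \<times>\<^sub>M Y) \<times>\<^sub>M Z) ((X \<times>\<^sub>M Z) \<times>\<^sub>M Y)"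
  by (rule mod_isoI2[of "\<lambda>p. ((fst (fst p), snd p), snd (fst p))" _ _ _ "\<lambda>p. ((fst (fst p), snd p), snd (fst p))"])
    (auto intro!: mod_homI)

lemma mod_iso_prodm_zero:
  assumes "left_module R X" "left_module R Z" "carrier Z = {\<zero>\<^bsub>Z\<^esub>}"
  shows "mod_iso R (X \<times>\<^sub>M Z) X"
  by (rule mod_isoI2[OF mod_hom_fst mod_hom_inl[OF assms(2)]]) (use assms(3) in auto)

text \<open>Brings a module on another type, such as a product, back to lists, where
  \<open>projective\<close> is defined. Such a copy exists by
  \<open>fg_mods_universal\<close>.\<close>

definition rep :: "('a, 'r) ring_scheme \<Rightarrow> ('a, 'b) module \<Rightarrow> ('a, 'a list) module" where
  "rep R M = (SOME N. N \<in> fg_mods R \<and> mod_iso R M N)"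

lemma rep:
  assumes "fg R M"
  shows "fg R (rep R M)" "mod_iso R M (rep R M)" "mod_iso R (rep R M) M"
proof -
  have "\<exists>N. N \<in> fg_mods R \<and> mod_iso R M N" using fg_mods_universal assms by (auto simp: fg_def)
  then have "rep R M \<in> fg_mods R \<and> mod_iso R M (rep R M)" unfolding rep_def by (rule someI_ex)
  then show "fg R (rep R M)" "mod_iso R M (rep R M)" "mod_iso R (rep R M) M"
    using fgD(1)[OF assms] by (auto simp: fg_mods_iff mod_iso_sym)
qed

text \<open>The flag \<open>asc\<close> is universally quantified, so the assumption comprises both
  chain conditions on left ideals. The homological part is developed at this level, without a base
  ring.\<close>

locale finite_length_ring = ring R for R :: "('a, 'r) ring_scheme" (structure) +
  assumes chain_cond_self: "chain_cond asc R (self_mod R) {\<zero>} (carrier R)"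
begin

lemma fg_chain_cond: "fg R M \<Longrightarrow> chain_cond asc R M {\<zero>\<^bsub>M\<^esub>} (carrier M)"
  by (rule chain_cond_fin_gen[OF _ _ chain_cond_self]) (auto simp: fg_def)

text \<open>Some submodule of \<open>H\<close> is maximal among the finitely generated ones. Any
  further element of \<open>H\<close> could be adjoined to it, so it is \<open>H\<close>. Generation
  is phrased inside \<open>M\<close>, which keeps the ambient module fixed.\<close>

lemma fg_submodule:
  assumes "fg R M" and H: "submodule H R M"
  shows "fg R (M\<lparr>carrier := H\<rparr>)"
proof -
  note lm = fgD(1)[OF assms(1)]
  interpret left_module R M by fact
  note sub = submodule_iff[OF lm]
  let ?F = "{K. submodule K R M \<and> K \<subseteq> H \<and>
    (\<exists>S. finite S \<and> S \<subseteq> K \<and> (\<forall>L. submodule L R M \<and> S \<subseteq> L \<longrightarrow> K \<subseteq> L))}"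
  have "{\<zero>\<^bsub>M\<^esub>} \<in> ?F" using H submodule_zero[OF lm] by (auto simp: sub intro!: exI[of _ "{}"])
  then have "?F \<noteq> {}" by force
  then have "\<exists>K\<in>?F. \<forall>L\<in>?F. K \<subseteq> L \<longrightarrow> L = K"
  proof (rule chain_cond_maximal[OF fg_chain_cond[OF assms(1)]])
    fix K assume "K \<in> ?F"
    then have "submodule K R M" by simp
    then show "submodule K R M \<and> {\<zero>\<^bsub>M\<^esub>} \<subseteq> K \<and> K \<subseteq> carrier M" by (simp add: sub)
  qed
  then obtain K where KF: "K \<in> ?F" and max: "\<forall>L\<in>?F. K \<subseteq> L \<longrightarrow> L = K" by (rule bexE)
  from KF obtain S where K: "submodule K R M" "K \<subseteq> H" and S: "finite S" "S \<subseteq> K"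
    "\<And>L. submodule L R M \<Longrightarrow> S \<subseteq> L \<Longrightarrow> K \<subseteq> L" by auto
  have "K = H"
  proof (rule ccontr)
    assume "K \<noteq> H"
    then obtain x where x: "x \<in> H" "x \<notin> K" using K by blast
    have xM: "x \<in> carrier M" using x H by (auto simp: sub)
    note cy = submodule_cyclic[OF lm xM]
    let ?L = "K <+>\<^bsub>M\<^esub> cyclic R M x"
    note sL = submodule_sum[OF lm K(1) cy(1)] and KL = subset_set_add[OF lm K(1) cy(1)]
    have "cyclic R M x \<subseteq> H" using x H by (auto simp: cyclic_def sub)
    then have "?L \<subseteq> H" using set_add_least[OF lm H K(2)] by simp
    moreover have "?L \<subseteq> L" if "submodule L R M" "insert x S \<subseteq> L" for L
    proof (rule set_add_least[OF lm that(1)])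
      show "K \<subseteq> L" using S(3) that by simp
      show "cyclic R M x \<subseteq> L" using that by (auto simp: cyclic_def sub)
    qed
    moreover have "finite (insert x S)" "insert x S \<subseteq> ?L" using S KL cy(2) by auto
    ultimately have "?L \<in> ?F" using sL by (intro CollectI conjI exI[of _ "insert x S"]) auto
    then have "?L = K" using bspec[OF max, of ?L] KL by simp
    then show False using x KL cy(2) by auto
  qed
  have "fin_gen R (M\<lparr>carrier := H\<rparr>)"
    unfolding fin_gen_def submodule_sub_iff[OF lm H]
    using S K by (intro exI[of _ S]) (auto simp: \<open>K = H\<close>)
  then show ?thesis using left_module_sub[OF lm H] by (simp add: fg_def)
qed

lemma fg_self: "fg R (self_mod R)"
proof -
  have lr: "left_module R (self_mod R)" by (rule left_module_self) (rule ring_axioms)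
  have "fin_gen R (self_mod R)" unfolding fin_gen_def
  proof (intro exI[of _ "{\<one>}"] conjI allI impI)
    fix H assume "submodule H R (self_mod R) \<and> {\<one>} \<subseteq> H"
    then have H: "H \<subseteq> carrier R" "\<one> \<in> H" "\<And>a x. a \<in> carrier R \<Longrightarrow> x \<in> H \<Longrightarrow> a \<otimes> x \<in> H"
      by (auto simp: submodule_iff[OF lr])
    have "x \<in> H" if "x \<in> carrier R" for x using H(3)[OF that H(2)] that by simp
    then show "H = carrier (self_mod R)" using H(1) by auto
  qed auto
  then show ?thesis using lr by (simp add: fg_def)
qed

subsection \<open>Projective modules\<close>

text \<open>\<open>projective\<close> speaks about modules on lists; this is its closure under
  isomorphism over all carrier types.\<close>

definition pj :: "('a, 'b) module \<Rightarrow> bool" where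
  "pj P \<longleftrightarrow> left_module R P \<and> (\<exists>Q. projective R Q \<and> mod_iso R P Q)"

lemma projective_fg: "projective R P \<Longrightarrow> fg R P"
  by (simp add: projective_def fg_mods_iff)

lemma pj_fg:
  assumes "pj P" shows "fg R P"
proof -
  obtain Q where "projective R Q" "mod_iso R P Q" "left_module R P" using assms by (auto simp: pj_def)
  then show ?thesis by (intro fg_iso[OF projective_fg mod_iso_sym])
qed

lemma projective_pj: "projective R P \<Longrightarrow> pj P"
  unfolding pj_def using mod_iso_refl[of R P] fgD(1)[OF projective_fg, of P] by blast

text \<open>The lifting property against modules on arbitrary types: the diagram is moved to the
  copies \<open>rep\<close>, lifted there and moved back.\<close>

lemma pj_lift:
  assumes P: "pj P" and M: "fg R M" and N: "fg R N" and g: "g \<in> mod_hom R M N" "g ` carrier M = carrier N"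
    and f: "f \<in> mod_hom R P N"
  shows "\<exists>h\<in>mod_hom R P M. \<forall>x\<in>carrier P. g (h x) = f x"
proof -
  obtain Q where Q: "projective R Q" "mod_iso R P Q" "left_module R P" using P by (auto simp: pj_def)
  note lM = fgD(1)[OF M] and lN = fgD(1)[OF N]
  obtain a a' where a: "a \<in> mod_hom R P Q" "a' \<in> mod_hom R Q P"
    "\<And>x. x \<in> carrier P \<Longrightarrow> a' (a x) = x" "\<And>y. y \<in> carrier Q \<Longrightarrow> a (a' y) = y" using mod_isoD[OF Q(2,3)] by auto
  obtain b b' where b: "b \<in> mod_hom R M (rep R M)" "b' \<in> mod_hom R (rep R M) M"
    "\<And>x. x \<in> carrier M \<Longrightarrow> b' (b x) = x" "\<And>y. y \<in> carrier (rep R M) \<Longrightarrow> b (b' y) = y"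
    using mod_isoD[OF rep(2)[OF M] lM] by auto
  obtain c c' where c: "c \<in> mod_hom R N (rep R N)" "c' \<in> mod_hom R (rep R N) N"
    "\<And>x. x \<in> carrier N \<Longrightarrow> c' (c x) = x" "\<And>y. y \<in> carrier (rep R N) \<Longrightarrow> c (c' y) = y"
    using mod_isoD[OF rep(2)[OF N] lN] by auto
  let ?g = "\<lambda>x. c (g (b' x))" and ?f = "\<lambda>x. c (f (a' x))"
  have g': "?g \<in> mod_hom R (rep R M) (rep R N)" by (intro mod_hom_comp[OF b(2)] mod_hom_comp[OF g(1) c(1)])
  have f': "?f \<in> mod_hom R Q (rep R N)" by (intro mod_hom_comp[OF a(2)] mod_hom_comp[OF f c(1)])
  have s: "?g ` carrier (rep R M) = carrier (rep R N)"
  proof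
    show "?g ` carrier (rep R M) \<subseteq> carrier (rep R N)" by (rule image_subsetI) (rule mod_hom_closed[OF g'])
    show "carrier (rep R N) \<subseteq> ?g ` carrier (rep R M)"
    proof
      fix y assume y: "y \<in> carrier (rep R N)"
      then have "c' y \<in> g ` carrier M" using mod_hom_closed[OF c(2)] g(2) by simp
      then obtain x where x: "x \<in> carrier M" "c' y = g x" by auto
      then have "y = ?g (b x)" using b(3)[OF x(1)] c(4)[OF y] by simp
      then show "y \<in> ?g ` carrier (rep R M)" using mod_hom_closed[OF b(1) x(1)] by (rule image_eqI)
    qed
  qed
  have "rep R M \<in> fg_mods R" "rep R N \<in> fg_mods R"
    using rep(1)[OF M] rep(1)[OF N] by (simp_all add: fg_mods_iff)
  then have "\<exists>h\<in>mod_hom R Q (rep R M). \<forall>x\<in>carrier Q. ?g (h x) = ?f x"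
    using Q(1)[unfolded projective_def, THEN conjunct2, rule_format, OF _ _ g' f' s] by simp
  then obtain h where h: "h \<in> mod_hom R Q (rep R M)" "\<And>x. x \<in> carrier Q \<Longrightarrow> ?g (h x) = ?f x"
    by auto
  have "(\<lambda>x. b' (h (a x))) \<in> mod_hom R P M" by (intro mod_hom_comp[OF a(1)] mod_hom_comp[OF h(1) b(2)])
  moreover have "g (b' (h (a x))) = f x" if x: "x \<in> carrier P" for x
  proof -
    have "c (g (b' (h (a x)))) = c (f x)" using h(2)[OF mod_hom_closed[OF a(1) x]] a(3)[OF x] by simp
    moreover have "g (b' (h (a x))) \<in> carrier N"
      by (rule mod_hom_closed[OF g(1) mod_hom_closed[OF b(2) mod_hom_closed[OF h(1) mod_hom_closed[OF a(1) x]]]])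
    moreover have "f x \<in> carrier N" by (rule mod_hom_closed[OF f x])
    ultimately show ?thesis using c(3) by metis
  qed
  ultimately show ?thesis by (intro bexI[of _ "\<lambda>x. b' (h (a x))"] ballI)
qed

lemma pjI:
  assumes P: "fg R P"
    and lift: "\<And>M N g f. \<lbrakk>M \<in> fg_mods R; N \<in> fg_mods R; g \<in> mod_hom R M N; f \<in> mod_hom R P N;
       g ` carrier M = carrier N\<rbrakk> \<Longrightarrow> \<exists>h\<in>mod_hom R P M. \<forall>x\<in>carrier P. g (h x) = f x"
  shows "pj P"
proof -
  obtain a a' where a: "a \<in> mod_hom R P (rep R P)" "a' \<in> mod_hom R (rep R P) P"
    "\<And>x. x \<in> carrier P \<Longrightarrow> a' (a x) = x" "\<And>y. y \<in> carrier (rep R P) \<Longrightarrow> a (a' y) = y"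
    using mod_isoD[OF rep(2)[OF P] fgD(1)[OF P]] by auto
  have "projective R (rep R P)" unfolding projective_def
  proof (intro conjI ballI impI)
    show "rep R P \<in> fg_mods R" using rep(1)[OF P] by (simp add: fg_mods_iff)
    fix M N g f assume *: "M \<in> fg_mods R" "N \<in> fg_mods R" "g \<in> mod_hom R M N" "f \<in> mod_hom R (rep R P) N"
       "g ` carrier M = carrier N"
    obtain h where h: "h \<in> mod_hom R P M" "\<And>x. x \<in> carrier P \<Longrightarrow> g (h x) = f (a x)"
      using lift[OF *(1,2,3) mod_hom_comp[OF a(1) *(4)] *(5)] by auto
    show "\<exists>h\<in>mod_hom R (rep R P) M. \<forall>x\<in>carrier (rep R P). g (h x) = f x"
      by (rule bexI[OF _ mod_hom_comp[OF a(2) h(1)]]) (use h(2) a in \<open>auto simp: mod_hom_closed\<close>)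
  qed
  then show ?thesis using rep(2)[OF P] fgD(1)[OF P] unfolding pj_def by blast
qed

lemma pj_projective:
  fixes P :: "('a, 'a list) module"
  assumes "pj P" shows "projective R P"
  unfolding projective_def using pj_fg[OF assms] pj_lift[OF assms] by (auto simp: fg_mods_iff)

section \<open>Retracts, the form in which direct summands are handled up to isomorphism\<close>

definition retract :: "('a, 'b) module \<Rightarrow> ('a, 'c) module \<Rightarrow> bool" where
  "retract Y X \<longleftrightarrow> (\<exists>i\<in>mod_hom R Y X. \<exists>p\<in>mod_hom R X Y. \<forall>y\<in>carrier Y. p (i y) = y)"

lemma retract_fg:
  assumes "retract Y X" "fg R X" "left_module R Y" shows "fg R Y"
proof -
  obtain i p where ip: "i \<in> mod_hom R Y X" "p \<in> mod_hom R X Y" "\<And>y. y \<in> carrier Y \<Longrightarrow> p (i y) = y"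
    using assms(1) by (auto simp: retract_def)
  have "p ` carrier X = carrier Y"
    using ip mod_hom_closed[OF ip(1)] mod_hom_closed[OF ip(2)] by (auto simp: image_iff) metis
  then show ?thesis using fg_image[OF assms(2,3) ip(2)] by simp
qed

lemma retract_trans: "retract X Y \<Longrightarrow> retract Y Z \<Longrightarrow> retract X Z"
proof -
  assume "retract X Y" "retract Y Z"
  then obtain i p j q where *: "i \<in> mod_hom R X Y" "p \<in> mod_hom R Y X" "\<And>y. y \<in> carrier X \<Longrightarrow> p (i y) = y"
    "j \<in> mod_hom R Y Z" "q \<in> mod_hom R Z Y" "\<And>y. y \<in> carrier Y \<Longrightarrow> q (j y) = y"
    unfolding retract_def by auto
  show ?thesis unfolding retract_def
    by (rule bexI[OF bexI[OF _ mod_hom_comp[OF *(5,2)]] mod_hom_comp[OF *(1,4)]])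
      (use * in \<open>auto simp: mod_hom_closed\<close>)
qed

lemma retract_iso: "mod_iso R X Y \<Longrightarrow> left_module R X \<Longrightarrow> retract X Y"
  unfolding retract_def by (metis mod_isoE)

lemma retract_prodm: "left_module R X \<Longrightarrow> left_module R Y \<Longrightarrow> retract X (X \<times>\<^sub>M Y)"
    "left_module R X \<Longrightarrow> left_module R Y \<Longrightarrow> retract Y (X \<times>\<^sub>M Y)"
  unfolding retract_def
  by (rule bexI[OF bexI[OF _ mod_hom_fst] mod_hom_inl], auto)
    (rule bexI[OF bexI[OF _ mod_hom_snd] mod_hom_inr], auto)

lemma pj_retract:
  assumes "retract Q P" "pj P" "left_module R Q"
  shows "pj Q"
proof (rule pjI)
  show "fg R Q" using retract_fg[OF assms(1) pj_fg[OF assms(2)] assms(3)] .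
  obtain i p where ip: "i \<in> mod_hom R Q P" "p \<in> mod_hom R P Q" "\<And>y. y \<in> carrier Q \<Longrightarrow> p (i y) = y"
    using assms(1) by (auto simp: retract_def)
  fix M N g f assume *: "M \<in> fg_mods R" "N \<in> fg_mods R" "g \<in> mod_hom R M N" "f \<in> mod_hom R Q N"
       "g ` carrier M = carrier N"
  then obtain h where h: "h \<in> mod_hom R P M" "\<And>x. x \<in> carrier P \<Longrightarrow> g (h x) = f (p x)"
    using pj_lift[OF assms(2) _ _ *(3,5) mod_hom_comp[OF ip(2) *(4)]] by (auto simp: fg_mods_iff)
  show "\<exists>h\<in>mod_hom R Q M. \<forall>x\<in>carrier Q. g (h x) = f x"
    by (rule bexI[OF _ mod_hom_comp[OF ip(1) h(1)]]) (use h(2) ip in \<open>auto simp: mod_hom_closed\<close>)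
qed

lemma pj_iso: "pj P \<Longrightarrow> mod_iso R P Q \<Longrightarrow> left_module R Q \<Longrightarrow> pj Q"
  by (rule pj_retract[OF retract_iso[OF mod_iso_sym[OF _ fgD(1)[OF pj_fg]]]])

lemma pj_prodm:
  assumes "pj P" "pj Q" shows "pj (P \<times>\<^sub>M Q)"
proof (rule pjI)
  have l: "left_module R P" "left_module R Q" using assms by (simp_all add: pj_def)
  show "fg R (P \<times>\<^sub>M Q)" by (rule fg_prodm[OF pj_fg[OF assms(1)] pj_fg[OF assms(2)]])
  fix M N g f assume *: "M \<in> fg_mods R" "N \<in> fg_mods R" "g \<in> mod_hom R M N" "f \<in> mod_hom R (P \<times>\<^sub>M Q) N"
       "g ` carrier M = carrier N"
  have lM: "left_module R M" and fM: "fg R M" "fg R N" using *(1,2) by (simp_all add: fg_mods_iff fgD(1))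
  interpret P: left_module R P by fact
  interpret Q: left_module R Q by fact
  obtain h1 where h1: "h1 \<in> mod_hom R P M" "\<And>x. x \<in> carrier P \<Longrightarrow> g (h1 x) = f (x, \<zero>\<^bsub>Q\<^esub>)"
    using pj_lift[OF assms(1) fM *(3,5) mod_hom_comp[OF mod_hom_inl[OF l(2)] *(4)]] by auto
  obtain h2 where h2: "h2 \<in> mod_hom R Q M" "\<And>x. x \<in> carrier Q \<Longrightarrow> g (h2 x) = f (\<zero>\<^bsub>P\<^esub>, x)"
    using pj_lift[OF assms(2) fM *(3,5) mod_hom_comp[OF mod_hom_inr[OF l(1)] *(4)]] by auto
  show "\<exists>h\<in>mod_hom R (P \<times>\<^sub>M Q) M. \<forall>x\<in>carrier (P \<times>\<^sub>M Q). g (h x) = f x"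
  proof (rule bexI[OF _ mod_hom_plus[OF lM mod_hom_comp[OF mod_hom_fst h1(1)] mod_hom_comp[OF mod_hom_snd h2(1)]]], intro ballI)
    fix x assume "x \<in> carrier (P \<times>\<^sub>M Q)"
    then obtain u v where x: "x = (u, v)" "u \<in> carrier P" "v \<in> carrier Q" by auto
    have "f x = f (u, \<zero>\<^bsub>Q\<^esub>) \<oplus>\<^bsub>N\<^esub> f (\<zero>\<^bsub>P\<^esub>, v)"
      using mod_hom_add[OF *(4), of "(u, \<zero>\<^bsub>Q\<^esub>)" "(\<zero>\<^bsub>P\<^esub>, v)"] x by simp
    also have "\<dots> = g (h1 u) \<oplus>\<^bsub>N\<^esub> g (h2 v)" by (simp only: h1(2)[OF x(2)] h2(2)[OF x(3)])
    also have "\<dots> = g (h1 u \<oplus>\<^bsub>M\<^esub> h2 v)"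
      by (rule mod_hom_add[OF *(3) mod_hom_closed[OF h1(1) x(2)] mod_hom_closed[OF h2(1) x(3)], symmetric])
    finally show "g (h1 (fst x) \<oplus>\<^bsub>M\<^esub> h2 (snd x)) = f x" using x(1) by simp
  qed
qed

lemma pj_self: "pj (self_mod R)"
proof (rule pjI[OF fg_self])
  fix M N g f assume *: "M \<in> fg_mods R" "N \<in> fg_mods R" "g \<in> mod_hom R M N" "f \<in> mod_hom R (self_mod R) N"
       "g ` carrier M = carrier N"
  have lM: "left_module R M" using * by (simp add: fg_mods_def)
  have "f \<one> \<in> carrier N" using *(4) by (simp add: mod_hom_closed)
  then obtain m where m: "m \<in> carrier M" "g m = f \<one>" using *(5) by (metis imageE)
  show "\<exists>h\<in>mod_hom R (self_mod R) M. \<forall>x\<in>carrier (self_mod R). g (h x) = f x"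
  proof (rule bexI[OF _ hom_self_mod[OF lM m(1)]], intro ballI)
    fix x assume "x \<in> carrier (self_mod R)"
    then show "g (x \<odot>\<^bsub>M\<^esub> m) = f x"
      using mod_hom_smult[OF *(3)] m mod_hom_smult[OF *(4), of x \<one>] by simp
  qed
qed

lemma pj_zero:
  assumes "left_module R Z" "carrier Z = {\<zero>\<^bsub>Z\<^esub>}" shows "pj Z"
proof (rule pj_retract[OF _ pj_self assms(1)])
  have lr: "left_module R (self_mod R)" using fg_self fgD by blast
  show "retract Z (self_mod R)" unfolding retract_def
    by (rule bexI[OF bexI[OF _ mod_hom_const_zero[OF assms(1)]] mod_hom_const_zero[OF lr]]) (use assms(2) in auto)
qed

subsection \<open>Free modules\<close>

text \<open>Vectors are lists, so free modules already have the carrier type of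
  \<open>fg_mods\<close>. Free modules over a subring are subsets of those over the large ring, with
  the same operations.\<close>

definition freem :: "nat \<Rightarrow> ('a, 'a list) module" where
  "freem n = \<lparr>carrier = {xs. length xs = n \<and> set xs \<subseteq> carrier R}, monoid.mult = undefined, one = undefined,
     zero = replicate n \<zero>, add = (\<lambda>xs ys. map2 (\<oplus>) xs ys), smult = (\<lambda>a xs. map ((\<otimes>) a) xs)\<rparr>"

lemma freem_simps [simp]:
  "carrier (freem n) = {xs. length xs = n \<and> set xs \<subseteq> carrier R}" "\<zero>\<^bsub>freem n\<^esub> = replicate n \<zero>"
  "xs \<oplus>\<^bsub>freem n\<^esub> ys = map2 (\<oplus>) xs ys" "a \<odot>\<^bsub>freem n\<^esub> xs = map ((\<otimes>) a) xs"
  by (simp_all add: freem_def)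

lemma left_module_freem: "left_module R (freem n)"
proof -
  have ag: "abelian_group (freem n)"
  proof (rule abelian_groupI)
    fix xs ys zs assume xs: "xs \<in> carrier (freem n)" and ys: "ys \<in> carrier (freem n)"
    show "xs \<oplus>\<^bsub>freem n\<^esub> ys \<in> carrier (freem n)"
      using xs ys by (auto simp: set_zip subset_iff) 
    show "xs \<oplus>\<^bsub>freem n\<^esub> ys = ys \<oplus>\<^bsub>freem n\<^esub> xs"
      using xs ys by (auto intro!: nth_equalityI a_comm simp: subset_iff)
    show "\<zero>\<^bsub>freem n\<^esub> \<oplus>\<^bsub>freem n\<^esub> xs = xs"
      using xs by (auto intro!: nth_equalityI simp: subset_iff)
    show "\<exists>ys\<in>carrier (freem n). ys \<oplus>\<^bsub>freem n\<^esub> xs = \<zero>\<^bsub>freem n\<^esub>"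
      by (rule bexI[of _ "map (a_inv R) xs"]) (use xs in \<open>auto intro!: nth_equalityI simp: subset_iff l_neg\<close>)
    assume zs: "zs \<in> carrier (freem n)"
    show "xs \<oplus>\<^bsub>freem n\<^esub> ys \<oplus>\<^bsub>freem n\<^esub> zs = xs \<oplus>\<^bsub>freem n\<^esub> (ys \<oplus>\<^bsub>freem n\<^esub> zs)"
      using xs ys zs by (auto intro!: nth_equalityI a_assoc simp: subset_iff)
  qed auto
  show ?thesis
    by (intro left_module.intro left_module_axioms.intro ring_axioms ag)
      (auto intro!: nth_equalityI simp: subset_iff l_distr r_distr m_assoc)
qed

lemma freem_Suc_iso: "mod_iso R (self_mod R \<times>\<^sub>M freem n) (freem (Suc n))"
proof (rule mod_isoI2[of "\<lambda>p. fst p # snd p" _ _ _ "\<lambda>xs. (hd xs, tl xs)"])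
  show "(\<lambda>xs. (hd xs, tl xs)) \<in> mod_hom R (freem (Suc n)) (self_mod R \<times>\<^sub>M freem n)"
    by (rule mod_homI) (auto simp: length_Suc_conv)
qed (auto intro!: mod_homI simp: length_Suc_conv)

lemma pj_freem: "pj (freem n)"
proof (induction n)
  case 0
  show ?case by (rule pj_zero) (auto simp: left_module_freem)
next
  case (Suc n)
  show ?case by (rule pj_iso[OF pj_prodm[OF pj_self Suc] freem_Suc_iso left_module_freem])
qed

lemma fg_freem: "fg R (freem n)"
  by (rule pj_fg[OF pj_freem])

lemma freem_surj:
  assumes M: "fg R M"
  shows "\<exists>n. \<exists>f\<in>mod_hom R (freem n) M. f ` carrier (freem n) = carrier M"
proof -
  note lm = fgD(1)[OF M]
  interpret M: left_module R M by fact
  obtain S where S: "finite S" "S \<subseteq> carrier M" "\<And>H. submodule H R M \<Longrightarrow> S \<subseteq> H \<Longrightarrow> H = carrier M"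
    using fgD(2)[OF M] unfolding fin_gen_def by auto
  from S(1,2) have "\<exists>n. \<exists>f\<in>mod_hom R (freem n) M. S \<subseteq> f ` carrier (freem n)"
  proof (induction S)
    case empty
    show ?case by (intro exI[of _ 0] bexI[OF _ mod_hom_const_zero[OF lm]]) simp
  next
    case (insert x S)
    then obtain n f where f: "f \<in> mod_hom R (freem n) M" "S \<subseteq> f ` carrier (freem n)" by auto
    have x: "x \<in> carrier M" using insert by simp
    define g where "g xs = hd xs \<odot>\<^bsub>M\<^esub> x \<oplus>\<^bsub>M\<^esub> f (tl xs)" for xs
    have hd: "hd \<in> mod_hom R (freem (Suc n)) (self_mod R)" and tl: "tl \<in> mod_hom R (freem (Suc n)) (freem n)"
      by (auto intro!: mod_homI simp: length_Suc_conv subset_iff)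
    have g: "g \<in> mod_hom R (freem (Suc n)) M"
      unfolding g_def by (intro mod_hom_plus[OF lm] mod_hom_comp[OF hd hom_self_mod[OF lm x]] mod_hom_comp[OF tl f(1)])
    have "x = g (\<one> # replicate n \<zero>)"
      using mod_hom_zero[OF left_module_freem lm f(1)] x by (simp add: g_def M.smult_one)
    then have "x \<in> g ` carrier (freem (Suc n))" by (rule image_eqI) auto
    moreover have "f ys = g (\<zero> # ys)" if "ys \<in> carrier (freem n)" for ys
      using mod_hom_closed[OF f(1) that] x by (simp add: g_def M.smult_zero_left)
    then have "f ` carrier (freem n) \<subseteq> g ` carrier (freem (Suc n))"
      by (intro image_subsetI image_eqI[of _ g "\<zero> # _"]) auto
    ultimately have "insert x S \<subseteq> g ` carrier (freem (Suc n))" using f(2) by simp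
    then show ?case using g by (intro exI bexI)
  qed
  then obtain n f where f: "f \<in> mod_hom R (freem n) M" "S \<subseteq> f ` carrier (freem n)" by auto
  have "f ` carrier (freem n) = carrier M"
    by (rule S(3)[OF submodule_image[OF left_module_freem lm f(1) submodule_carrier[OF left_module_freem]] f(2)])
  then show ?thesis using f by blast
qed

lemma pj_retract_freem:
  assumes "pj P" shows "\<exists>n. retract P (freem n)"
proof -
  obtain n f where f: "f \<in> mod_hom R (freem n) P" "f ` carrier (freem n) = carrier P"
    using freem_surj[OF pj_fg[OF assms]] by auto
  obtain h where "h \<in> mod_hom R P (freem n)" "\<And>x. x \<in> carrier P \<Longrightarrow> f (h x) = x"
    using pj_lift[OF assms fg_freem pj_fg[OF assms] f mod_hom_id] by auto
  then show ?thesis unfolding retract_def using f(1) by blast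
qed

end

section \<open>Exact sequences and projective dimension\<close>

context finite_length_ring
begin

text \<open>The maps are quantified away. Exactness becomes a relation between modules, possibly on
  three types, that can be moved along isomorphisms in each place.\<close>

definition ses :: "('a, 'b) module \<Rightarrow> ('a, 'c) module \<Rightarrow> ('a, 'd) module \<Rightarrow> bool" where
  "ses X Y Z \<longleftrightarrow> fg R X \<and> fg R Y \<and> fg R Z \<and>
     (\<exists>i\<in>mod_hom R X Y. \<exists>p\<in>mod_hom R Y Z. inj_on i (carrier X) \<and> p ` carrier Y = carrier Z \<and>
        i ` carrier X = {y \<in> carrier Y. p y = \<zero>\<^bsub>Z\<^esub>})"

lemma sesI:
  assumes "fg R X" "fg R Y" "fg R Z" "i \<in> mod_hom R X Y" "p \<in> mod_hom R Y Z" "inj_on i (carrier X)"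
    "p ` carrier Y = carrier Z" "i ` carrier X = {y \<in> carrier Y. p y = \<zero>\<^bsub>Z\<^esub>}"
  shows "ses X Y Z"
  unfolding ses_def by (intro conjI assms(1-3) bexI[OF _ assms(4)] bexI[OF _ assms(5)] assms(6-8))

lemma ses_fg: "ses X Y Z \<Longrightarrow> fg R X" "ses X Y Z \<Longrightarrow> fg R Y" "ses X Y Z \<Longrightarrow> fg R Z"
  by (simp_all add: ses_def)

lemma ses_lm:
  assumes "ses X Y Z"
  shows "left_module R X" "left_module R Y" "left_module R Z"
  using ses_fg[OF assms] by (simp_all add: fgD)

lemma sesE:
  assumes "ses X Y Z"
  obtains i p where "i \<in> mod_hom R X Y" "p \<in> mod_hom R Y Z" "inj_on i (carrier X)"
    "p ` carrier Y = carrier Z" "i ` carrier X = {y \<in> carrier Y. p y = \<zero>\<^bsub>Z\<^esub>}"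
  using assms unfolding ses_def by auto

lemma ses_kernel:
  assumes Y: "fg R Y" and Z: "left_module R Z" and p: "p \<in> mod_hom R Y Z" "p ` carrier Y = carrier Z"
  shows "ses (Y\<lparr>carrier := {y \<in> carrier Y. p y = \<zero>\<^bsub>Z\<^esub>}\<rparr>) Y Z"
proof (rule sesI)
  show "fg R (Y\<lparr>carrier := {y \<in> carrier Y. p y = \<zero>\<^bsub>Z\<^esub>}\<rparr>)"
    by (rule fg_submodule[OF Y submodule_kernel[OF fgD(1)[OF Y] Z p(1)]])
  show "fg R Z" by (rule fg_image[OF Y Z p])
  show "(\<lambda>x. x) \<in> mod_hom R (Y\<lparr>carrier := {y \<in> carrier Y. p y = \<zero>\<^bsub>Z\<^esub>}\<rparr>) Y"
    by (rule mod_hom_incl) simp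
qed (use Y p in auto)

lemma ses_iso1:
  assumes s: "ses X Y Z" and h: "mod_iso R X' X" and X': "left_module R X'"
  shows "ses X' Y Z"
proof -
  obtain i p where ip: "i \<in> mod_hom R X Y" "p \<in> mod_hom R Y Z" "inj_on i (carrier X)"
    "p ` carrier Y = carrier Z" "i ` carrier X = {y \<in> carrier Y. p y = \<zero>\<^bsub>Z\<^esub>}" by (rule sesE[OF s])
  obtain f where f: "f \<in> mod_hom R X' X" "inj_on f (carrier X')" "f ` carrier X' = carrier X"
    using h unfolding mod_iso_def bij_betw_def by auto
  show ?thesis
  proof (rule sesI[OF _ ses_fg(2,3)[OF s] mod_hom_comp[OF f(1) ip(1)] ip(2) _ ip(4)])
    show "fg R X'" by (rule fg_iso[OF ses_fg(1)[OF s] mod_iso_sym[OF h X'] X'])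
    show "inj_on (\<lambda>x. i (f x)) (carrier X')" using comp_inj_on[OF f(2)] ip(3) f(3) by (simp add: comp_def)
    show "(\<lambda>x. i (f x)) ` carrier X' = {y \<in> carrier Y. p y = \<zero>\<^bsub>Z\<^esub>}"
      unfolding ip(5)[symmetric] f(3)[symmetric] by (simp add: image_image)
  qed
qed

lemma ses_iso2:
  assumes s: "ses X Y Z" and h: "mod_iso R Y Y'" and Y': "left_module R Y'"
  shows "ses X Y' Z"
proof -
  obtain i p where ip: "i \<in> mod_hom R X Y" "p \<in> mod_hom R Y Z" "inj_on i (carrier X)"
    "p ` carrier Y = carrier Z" "i ` carrier X = {y \<in> carrier Y. p y = \<zero>\<^bsub>Z\<^esub>}" by (rule sesE[OF s])
  obtain f g where fg: "f \<in> mod_hom R Y Y'" "g \<in> mod_hom R Y' Y"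
    "\<And>x. x \<in> carrier Y \<Longrightarrow> g (f x) = x" "\<And>y. y \<in> carrier Y' \<Longrightarrow> f (g y) = y"
    using mod_isoD[OF h ses_lm(2)[OF s]] by auto
  have fi: "g (f (i x)) = i x" if "x \<in> carrier X" for x
    by (rule fg(3)[OF mod_hom_closed[OF ip(1) that]])
  show ?thesis
  proof (rule sesI[OF ses_fg(1)[OF s] _ ses_fg(3)[OF s] mod_hom_comp[OF ip(1) fg(1)] mod_hom_comp[OF fg(2) ip(2)]])
    show "fg R Y'" by (rule fg_iso[OF ses_fg(2)[OF s] h Y'])
    show "inj_on (\<lambda>x. f (i x)) (carrier X)"
    proof (rule inj_onI)
      fix x y assume *: "x \<in> carrier X" "y \<in> carrier X" "f (i x) = f (i y)"
      then have "i x = i y" using fi[OF *(1)] fi[OF *(2)] by metis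
      then show "x = y" using ip(3) * by (simp add: inj_on_eq_iff)
    qed
    have gY: "g ` carrier Y' = carrier Y"
    proof
      show "g ` carrier Y' \<subseteq> carrier Y" using mod_hom_closed[OF fg(2)] by (rule image_subsetI)
      show "carrier Y \<subseteq> g ` carrier Y'"
      proof
        fix y assume y: "y \<in> carrier Y"
        show "y \<in> g ` carrier Y'"
          using mod_hom_closed[OF fg(1) y] by (intro image_eqI[where x = "f y"]) (simp_all add: fg(3)[OF y])
      qed
    qed
    show "(\<lambda>y. p (g y)) ` carrier Y' = carrier Z"
      unfolding ip(4)[symmetric] gY[symmetric] image_image by (rule refl)
    show "(\<lambda>x. f (i x)) ` carrier X = {y \<in> carrier Y'. p (g y) = \<zero>\<^bsub>Z\<^esub>}"
    proof (rule Set.set_eqI, rule iffI)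
      fix y assume "y \<in> (\<lambda>x. f (i x)) ` carrier X"
      then obtain x where x: "x \<in> carrier X" "y = f (i x)" by auto
      have "i x \<in> {y \<in> carrier Y. p y = \<zero>\<^bsub>Z\<^esub>}" unfolding ip(5)[symmetric] using x(1) by (rule imageI)
      then show "y \<in> {y \<in> carrier Y'. p (g y) = \<zero>\<^bsub>Z\<^esub>}"
        using fi[OF x(1)] mod_hom_closed[OF fg(1), of "i x"] unfolding x(2) by simp
    next
      fix y assume y: "y \<in> {y \<in> carrier Y'. p (g y) = \<zero>\<^bsub>Z\<^esub>}"
      then have "g y \<in> i ` carrier X" unfolding ip(5) using mod_hom_closed[OF fg(2), of y] by simp
      then obtain x where "x \<in> carrier X" "g y = i x" by (elim imageE)
      then have "y = f (i x)" using fg(4)[of y] y by simp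
      then show "y \<in> (\<lambda>x. f (i x)) ` carrier X" using \<open>x \<in> carrier X\<close> by (rule image_eqI)
    qed
  qed
qed

lemma ses_iso3:
  assumes s: "ses X Y Z" and h: "mod_iso R Z Z'" and Z': "left_module R Z'"
  shows "ses X Y Z'"
proof -
  obtain i p where ip: "i \<in> mod_hom R X Y" "p \<in> mod_hom R Y Z" "inj_on i (carrier X)"
    "p ` carrier Y = carrier Z" "i ` carrier X = {y \<in> carrier Y. p y = \<zero>\<^bsub>Z\<^esub>}" by (rule sesE[OF s])
  obtain f where f: "f \<in> mod_hom R Z Z'" "inj_on f (carrier Z)" "f ` carrier Z = carrier Z'"
    using h unfolding mod_iso_def bij_betw_def by auto
  have "f z = \<zero>\<^bsub>Z'\<^esub> \<longleftrightarrow> z = \<zero>\<^bsub>Z\<^esub>" if "z \<in> carrier Z" for z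
    using inj_on_hom_iff[OF ses_lm(3)[OF s] Z' f(1)] f(2) that mod_hom_zero[OF ses_lm(3)[OF s] Z' f(1)] by auto
  then have "i ` carrier X = {y \<in> carrier Y. f (p y) = \<zero>\<^bsub>Z'\<^esub>}"
    unfolding ip(5) using mod_hom_closed[OF ip(2)] by auto
  moreover have "(\<lambda>y. f (p y)) ` carrier Y = carrier Z'"
    unfolding f(3)[symmetric] ip(4)[symmetric] image_image by (rule refl)
  ultimately show ?thesis
    by (intro sesI[OF ses_fg(1,2)[OF s] fg_iso[OF ses_fg(3)[OF s] h Z'] ip(1) mod_hom_comp[OF ip(2) f(1)] ip(3)])
qed

lemma ses_prodm:
  assumes "ses X Y Z" "ses X' Y' Z'"
  shows "ses (X \<times>\<^sub>M X') (Y \<times>\<^sub>M Y') (Z \<times>\<^sub>M Z')"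
proof -
  obtain i p where ip: "i \<in> mod_hom R X Y" "p \<in> mod_hom R Y Z" "inj_on i (carrier X)"
    "p ` carrier Y = carrier Z" "i ` carrier X = {y \<in> carrier Y. p y = \<zero>\<^bsub>Z\<^esub>}" by (rule sesE[OF assms(1)])
  obtain j q where jq: "j \<in> mod_hom R X' Y'" "q \<in> mod_hom R Y' Z'" "inj_on j (carrier X')"
    "q ` carrier Y' = carrier Z'" "j ` carrier X' = {y \<in> carrier Y'. q y = \<zero>\<^bsub>Z'\<^esub>}" by (rule sesE[OF assms(2)])
  have eq: "map_prod f g = (\<lambda>x. (f (fst x), g (snd x)))" for f g by (auto simp: map_prod_def)
  show ?thesis
  proof (rule sesI)
    show "map_prod i j \<in> mod_hom R (X \<times>\<^sub>M X') (Y \<times>\<^sub>M Y')" unfolding eq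
      by (intro mod_hom_Pair mod_hom_comp[OF mod_hom_fst ip(1)] mod_hom_comp[OF mod_hom_snd jq(1)])
    show "map_prod p q \<in> mod_hom R (Y \<times>\<^sub>M Y') (Z \<times>\<^sub>M Z')" unfolding eq
      by (intro mod_hom_Pair mod_hom_comp[OF mod_hom_fst ip(2)] mod_hom_comp[OF mod_hom_snd jq(2)])
    show "inj_on (map_prod i j) (carrier (X \<times>\<^sub>M X'))"
      using map_prod_inj_on[OF ip(3) jq(3)] by simp
    have im: "map_prod f g ` (A \<times> B) = f ` A \<times> g ` B" for f g A B by auto
    show "map_prod p q ` carrier (Y \<times>\<^sub>M Y') = carrier (Z \<times>\<^sub>M Z')"
      using ip(4) jq(4) im[of p q "carrier Y" "carrier Y'"] by simp
    show "map_prod i j ` carrier (X \<times>\<^sub>M X') =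
      {y \<in> carrier (Y \<times>\<^sub>M Y'). map_prod p q y = \<zero>\<^bsub>Z \<times>\<^sub>M Z'\<^esub>}"
      using im[of i j "carrier X" "carrier X'"] ip(5) jq(5) by auto
  qed (use ses_fg[OF assms(1)] ses_fg[OF assms(2)] fg_prodm in auto)
qed

lemma zero_mod_fg: "fg R (freem 0)" and zero_mod_carrier: "carrier (freem 0) = {\<zero>\<^bsub>freem 0\<^esub>}"
  by (auto simp: fg_freem)

lemma fg_zero_closed: "fg R E \<Longrightarrow> \<zero>\<^bsub>E\<^esub> \<in> carrier E"
  by (rule abelian_groupE(2)[OF left_module.axioms(2)[OF fgD(1)]])

lemma ses_id_right: "fg R E \<Longrightarrow> ses (freem 0) E E"
  by (rule sesI[OF zero_mod_fg _ _ mod_hom_const_zero mod_hom_id])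
    (auto simp: fg_zero_closed fgD inj_on_def)

lemma ses_id_left: "fg R E \<Longrightarrow> ses E E (freem 0)"
  by (rule sesI[OF _ _ zero_mod_fg mod_hom_id mod_hom_const_zero[OF left_module_freem]])
    (use fg_zero_closed[of E] in auto)

lemma mod_iso_prodm_freem0:
  assumes "left_module R X" shows "mod_iso R (X \<times>\<^sub>M freem 0) X" "mod_iso R X (X \<times>\<^sub>M freem 0)"
proof -
  show 1: "mod_iso R (X \<times>\<^sub>M freem 0) X"
    by (rule mod_iso_prodm_zero[OF assms left_module_freem zero_mod_carrier])
  show "mod_iso R X (X \<times>\<^sub>M freem 0)"
    by (rule mod_iso_sym[OF 1 left_module_prodm[OF assms left_module_freem]])
qed

lemma ses_add_left:
  assumes "ses X Y Z" "fg R E" shows "ses (X \<times>\<^sub>M E) (Y \<times>\<^sub>M E) Z"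
  by (rule ses_iso3[OF ses_prodm[OF assms(1) ses_id_left[OF assms(2)]] mod_iso_prodm_freem0(1)])
    (use ses_lm[OF assms(1)] in auto)

lemma ses_add_right:
  assumes "ses X Y Z" "fg R E" shows "ses X (Y \<times>\<^sub>M E) (Z \<times>\<^sub>M E)"
  by (rule ses_iso1[OF ses_prodm[OF assms(1) ses_id_right[OF assms(2)]] mod_iso_prodm_freem0(2)])
    (use ses_lm[OF assms(1)] in auto)

text \<open>\<open>W\<close> is the pullback of the two surjections onto \<open>X\<close>.\<close>

lemma ses_pullback:
  fixes Y :: "('a, 'c) module" and Y' :: "('a, 'd) module"
  assumes s: "ses K Y X" and s': "ses K' Y' X"
  shows "\<exists>W :: ('a, 'c \<times> 'd) module. ses K W Y' \<and> ses K' W Y"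
proof -
  obtain i p where ip: "i \<in> mod_hom R K Y" "p \<in> mod_hom R Y X" "inj_on i (carrier K)"
    "p ` carrier Y = carrier X" "i ` carrier K = {y \<in> carrier Y. p y = \<zero>\<^bsub>X\<^esub>}" by (rule sesE[OF s])
  obtain j q where jq: "j \<in> mod_hom R K' Y'" "q \<in> mod_hom R Y' X" "inj_on j (carrier K')"
    "q ` carrier Y' = carrier X" "j ` carrier K' = {y \<in> carrier Y'. q y = \<zero>\<^bsub>X\<^esub>}" by (rule sesE[OF s'])
  note l = ses_lm[OF s] and l' = ses_lm[OF s']
  interpret X: left_module R X by fact
  interpret Y: left_module R Y by (rule l)
  interpret Y': left_module R Y' by (rule l')
  have lP: "left_module R (Y \<times>\<^sub>M Y')" by (rule left_module_prodm[OF l(2) l'(2)])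
  let ?W = "{w \<in> carrier (Y \<times>\<^sub>M Y'). p (fst w) = q (snd w)}"
  have sW: "submodule ?W R (Y \<times>\<^sub>M Y')" unfolding submodule_iff[OF lP]
    using mod_hom_zero[OF l(2,3) ip(2)] mod_hom_zero[OF l'(2) l(3) jq(2)]
    by (auto simp: mod_hom_add[OF ip(2)] mod_hom_add[OF jq(2)] mod_hom_smult[OF ip(2)] mod_hom_smult[OF jq(2)]
        Y.smult_closed Y'.smult_closed)
  let ?WM = "(Y \<times>\<^sub>M Y')\<lparr>carrier := ?W\<rparr>"
  have fW: "fg R ?WM" by (rule fg_submodule[OF fg_prodm[OF ses_fg(2)[OF s] ses_fg(2)[OF s']] sW])
  have pi0: "p (i k) = \<zero>\<^bsub>X\<^esub>" "i k \<in> carrier Y" if "k \<in> carrier K" for k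
    using ip(5) that by (auto simp: set_eq_iff image_iff)
  have qj0: "q (j k) = \<zero>\<^bsub>X\<^esub>" "j k \<in> carrier Y'" if "k \<in> carrier K'" for k
    using jq(5) that by (auto simp: set_eq_iff image_iff)
  have p0: "p \<zero>\<^bsub>Y\<^esub> = \<zero>\<^bsub>X\<^esub>" and q0: "q \<zero>\<^bsub>Y'\<^esub> = \<zero>\<^bsub>X\<^esub>"
    using mod_hom_zero[OF l(2,3) ip(2)] mod_hom_zero[OF l'(2) l(3) jq(2)] by auto
  have "ses K ?WM Y'"
  proof (rule sesI[OF ses_fg(1)[OF s] fW ses_fg(2)[OF s']])
    show "(\<lambda>k. (i k, \<zero>\<^bsub>Y'\<^esub>)) \<in> mod_hom R K ?WM"
      by (rule mod_homI)
        (auto simp: pi0 q0 mod_hom_add[OF ip(1)] mod_hom_smult[OF ip(1)] Y'.smult_zero_right)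
    show "snd \<in> mod_hom R ?WM Y'" by (rule mod_homI) auto
    show "inj_on (\<lambda>k. (i k, \<zero>\<^bsub>Y'\<^esub>)) (carrier K)" using ip(3) by (auto simp: inj_on_def)
    show "snd ` carrier ?WM = carrier Y'"
    proof
      show "carrier Y' \<subseteq> snd ` carrier ?WM"
      proof
        fix y assume y: "y \<in> carrier Y'"
        then have "q y \<in> p ` carrier Y" using mod_hom_closed[OF jq(2)] ip(4) by simp
        then obtain z where z: "z \<in> carrier Y" "p z = q y" by auto
        show "y \<in> snd ` carrier ?WM" by (rule image_eqI[of _ _ "(z, y)"]) (use y z in auto)
      qed
    qed auto
    show "(\<lambda>k. (i k, \<zero>\<^bsub>Y'\<^esub>)) ` carrier K = {y \<in> carrier ?WM. snd y = \<zero>\<^bsub>Y'\<^esub>}"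
    proof (rule Set.set_eqI, rule iffI)
      fix w assume "w \<in> {y \<in> carrier ?WM. snd y = \<zero>\<^bsub>Y'\<^esub>}"
      then obtain y where w: "w = (y, \<zero>\<^bsub>Y'\<^esub>)" "y \<in> carrier Y" "p y = \<zero>\<^bsub>X\<^esub>" using q0 by auto
      then have "y \<in> i ` carrier K" unfolding ip(5) by simp
      then show "w \<in> (\<lambda>k. (i k, \<zero>\<^bsub>Y'\<^esub>)) ` carrier K" using w(1) by auto
    qed (auto simp: pi0 q0)
  qed
  moreover have "ses K' ?WM Y"
  proof (rule sesI[OF ses_fg(1)[OF s'] fW ses_fg(2)[OF s]])
    show "(\<lambda>k. (\<zero>\<^bsub>Y\<^esub>, j k)) \<in> mod_hom R K' ?WM"
      by (rule mod_homI)
        (auto simp: qj0 p0 mod_hom_add[OF jq(1)] mod_hom_smult[OF jq(1)] Y.smult_zero_right)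
    show "fst \<in> mod_hom R ?WM Y" by (rule mod_homI) auto
    show "inj_on (\<lambda>k. (\<zero>\<^bsub>Y\<^esub>, j k)) (carrier K')" using jq(3) by (auto simp: inj_on_def)
    show "fst ` carrier ?WM = carrier Y"
    proof
      show "carrier Y \<subseteq> fst ` carrier ?WM"
      proof
        fix y assume y: "y \<in> carrier Y"
        then have "p y \<in> q ` carrier Y'" using mod_hom_closed[OF ip(2)] jq(4) by simp
        then obtain z where z: "z \<in> carrier Y'" "p y = q z" by auto
        show "y \<in> fst ` carrier ?WM" by (rule image_eqI[of _ _ "(y, z)"]) (use y z in auto)
      qed
    qed auto
    show "(\<lambda>k. (\<zero>\<^bsub>Y\<^esub>, j k)) ` carrier K' = {y \<in> carrier ?WM. fst y = \<zero>\<^bsub>Y\<^esub>}"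
    proof (rule Set.set_eqI, rule iffI)
      fix w assume "w \<in> {y \<in> carrier ?WM. fst y = \<zero>\<^bsub>Y\<^esub>}"
      then obtain y where w: "w = (\<zero>\<^bsub>Y\<^esub>, y)" "y \<in> carrier Y'" "q y = \<zero>\<^bsub>X\<^esub>" using p0 by auto
      then have "y \<in> j ` carrier K'" unfolding jq(5) by simp
      then show "w \<in> (\<lambda>k. (\<zero>\<^bsub>Y\<^esub>, j k)) ` carrier K'" using w(1) by auto
    qed (auto simp: qj0 p0)
  qed
  ultimately show ?thesis by (intro exI[of _ ?WM] conjI)
qed

lemma ses_split:
  assumes s: "ses K W P" and P: "pj P"
  shows "mod_iso R (K \<times>\<^sub>M P) W"
proof -
  obtain i p where ip: "i \<in> mod_hom R K W" "p \<in> mod_hom R W P" "inj_on i (carrier K)"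
    "p ` carrier W = carrier P" "i ` carrier K = {y \<in> carrier W. p y = \<zero>\<^bsub>P\<^esub>}" by (rule sesE[OF s])
  note l = ses_lm[OF s]
  interpret W: left_module R W by (rule l)
  interpret P: left_module R P by (rule l)
  interpret K: left_module R K by (rule l)
  obtain h where h: "h \<in> mod_hom R P W" "\<And>x. x \<in> carrier P \<Longrightarrow> p (h x) = x"
    using pj_lift[OF P ses_fg(2,3)[OF s] ip(2,4) mod_hom_id] by auto
  have pi0: "p (i k) = \<zero>\<^bsub>P\<^esub>" "i k \<in> carrier W" if "k \<in> carrier K" for k
    using ip(5) that by (auto simp: set_eq_iff image_iff)
  have hW: "h x \<in> carrier W" if "x \<in> carrier P" for x by (rule mod_hom_closed[OF h(1) that])
  let ?f = "\<lambda>w. i (fst w) \<oplus>\<^bsub>W\<^esub> h (snd w)"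
  have f: "?f \<in> mod_hom R (K \<times>\<^sub>M P) W"
    by (intro mod_hom_plus[OF l(2)] mod_hom_comp[OF mod_hom_fst ip(1)] mod_hom_comp[OF mod_hom_snd h(1)])
  have pf: "p (i k \<oplus>\<^bsub>W\<^esub> h x) = x" if "k \<in> carrier K" "x \<in> carrier P" for k x
    using that by (simp add: mod_hom_add[OF ip(2)] pi0 hW h(2))
  show ?thesis
  proof (rule mod_isoI[OF f])
    show "inj_on ?f (carrier (K \<times>\<^sub>M P))"
    proof (rule inj_onI)
      fix u v assume "u \<in> carrier (K \<times>\<^sub>M P)" "v \<in> carrier (K \<times>\<^sub>M P)" "?f u = ?f v"
      then obtain a b c d where *: "u = (a, b)" "v = (c, d)" "a \<in> carrier K" "c \<in> carrier K" "b \<in> carrier P"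
        "d \<in> carrier P" "i a \<oplus>\<^bsub>W\<^esub> h b = i c \<oplus>\<^bsub>W\<^esub> h d" by auto
      have "b = d" using pf[OF *(3,5)] pf[OF *(4,6)] *(7) by metis
      moreover then have "i a = i c" using * pi0 hW by simp
      then have "a = c" using ip(3) * by (simp add: inj_on_eq_iff)
      ultimately show "u = v" using * by simp
    qed
    show "?f ` carrier (K \<times>\<^sub>M P) = carrier W"
    proof
      show "?f ` carrier (K \<times>\<^sub>M P) \<subseteq> carrier W" by (rule image_subsetI) (rule mod_hom_closed[OF f])
      show "carrier W \<subseteq> ?f ` carrier (K \<times>\<^sub>M P)"
      proof
        fix w assume w: "w \<in> carrier W"
        have pw: "p w \<in> carrier P" by (rule mod_hom_closed[OF ip(2) w])
        have "p (w \<ominus>\<^bsub>W\<^esub> h (p w)) = \<zero>\<^bsub>P\<^esub>"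
          using mod_hom_diff[OF l(2,3) ip(2) w hW[OF pw]] h(2)[OF pw] pw by (simp add: a_minus_def P.M.r_neg)
        then have "w \<ominus>\<^bsub>W\<^esub> h (p w) \<in> i ` carrier K" unfolding ip(5) using w hW[OF pw] by simp
        then obtain k where k: "k \<in> carrier K" "w \<ominus>\<^bsub>W\<^esub> h (p w) = i k" by auto
        have "w = i k \<oplus>\<^bsub>W\<^esub> h (p w)" unfolding k(2)[symmetric]
          using w hW[OF pw] by (simp add: a_minus_def W.M.a_assoc W.M.l_neg)
        then show "w \<in> ?f ` carrier (K \<times>\<^sub>M P)" using k pw by (intro image_eqI[of _ _ "(k, p w)"]) auto
      qed
    qed
  qed
qed

subsection \<open>Stable equivalence and syzygies\<close>

text \<open>Isomorphism in the stable category, expressed by adding projectives on both sides. They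
  are taken on lists since a definition cannot quantify over types; \<open>stabI\<close> accepts
  projectives on any type.\<close>

definition stab :: "('a, 'b) module \<Rightarrow> ('a, 'c) module \<Rightarrow> bool" where
  "stab X Y \<longleftrightarrow> fg R X \<and> fg R Y \<and>
     (\<exists>P Q. projective R P \<and> projective R Q \<and> mod_iso R (X \<times>\<^sub>M P) (Y \<times>\<^sub>M Q))"

lemma pj_rep: "pj P \<Longrightarrow> projective R (rep R P)"
  by (rule pj_projective[OF pj_iso[OF _ rep(2)[OF pj_fg] fgD(1)[OF rep(1)[OF pj_fg]]]])

lemma stabI:
  assumes X: "fg R X" and Y: "fg R Y" and P: "pj P" and Q: "pj Q" and i: "mod_iso R (X \<times>\<^sub>M P) (Y \<times>\<^sub>M Q)"
  shows "stab X Y"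
proof -
  note l = fgD(1)[OF X] fgD(1)[OF Y] fgD(1)[OF pj_fg[OF P]] fgD(1)[OF pj_fg[OF Q]]
  have 1: "mod_iso R (X \<times>\<^sub>M rep R P) (X \<times>\<^sub>M P)"
    by (rule mod_iso_prodm[OF mod_iso_refl rep(3)[OF pj_fg[OF P]] l(1) fgD(1)[OF rep(1)[OF pj_fg[OF P]]]])
  have 2: "mod_iso R (Y \<times>\<^sub>M Q) (Y \<times>\<^sub>M rep R Q)"
    by (rule mod_iso_prodm[OF mod_iso_refl rep(2)[OF pj_fg[OF Q]] l(2) l(4)])
  have "mod_iso R (X \<times>\<^sub>M rep R P) (Y \<times>\<^sub>M rep R Q)"
    by (rule mod_iso_trans[OF mod_iso_trans[OF 1 i] 2])
  then show ?thesis unfolding stab_def using X Y pj_rep[OF P] pj_rep[OF Q] by auto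
qed

lemma stab_fg: "stab X Y \<Longrightarrow> fg R X" "stab X Y \<Longrightarrow> fg R Y"
  by (simp_all add: stab_def)

lemma stabE:
  assumes "stab X Y"
  obtains P Q where "projective R P" "projective R Q" "mod_iso R (X \<times>\<^sub>M P) (Y \<times>\<^sub>M Q)"
  using assms unfolding stab_def by auto

lemma pj_freem0: "pj (freem 0)" by (rule pj_freem)

lemma stab_refl: "fg R X \<Longrightarrow> stab X X"
  by (rule stabI[OF _ _ pj_freem0 pj_freem0 mod_iso_refl])

lemma stab_sym:
  assumes "stab X Y" shows "stab Y X"
proof -
  obtain P Q where *: "projective R P" "projective R Q" "mod_iso R (X \<times>\<^sub>M P) (Y \<times>\<^sub>M Q)" by (rule stabE[OF assms])
  show ?thesis
    by (rule stabI[OF stab_fg(2,1)[OF assms] projective_pj[OF *(2)] projective_pj[OF *(1)]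
          mod_iso_sym[OF *(3) fgD(1)[OF fg_prodm[OF stab_fg(1)[OF assms] projective_fg[OF *(1)]]]]])
qed

lemma stab_iso: "mod_iso R X Y \<Longrightarrow> fg R X \<Longrightarrow> left_module R Y \<Longrightarrow> stab X Y"
  by (rule stabI[OF _ fg_iso pj_freem0 pj_freem0
        mod_iso_prodm[OF _ mod_iso_refl fgD(1) left_module_freem]])

lemma stab_trans:
  assumes "stab X Y" "stab Y Z" shows "stab X Z"
proof -
  obtain P Q where 1: "projective R P" "projective R Q" "mod_iso R (X \<times>\<^sub>M P) (Y \<times>\<^sub>M Q)" by (rule stabE[OF assms(1)])
  obtain P' Q' where 2: "projective R P'" "projective R Q'" "mod_iso R (Y \<times>\<^sub>M P') (Z \<times>\<^sub>M Q')" by (rule stabE[OF assms(2)])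
  note l = fgD(1)[OF stab_fg(1)[OF assms(1)]] fgD(1)[OF stab_fg(2)[OF assms(1)]] fgD(1)[OF stab_fg(2)[OF assms(2)]]
    fgD(1)[OF projective_fg[OF 1(1)]] fgD(1)[OF projective_fg[OF 1(2)]]
    fgD(1)[OF projective_fg[OF 2(1)]] fgD(1)[OF projective_fg[OF 2(2)]]
  note lp = left_module_prodm
  have "mod_iso R (X \<times>\<^sub>M P \<times>\<^sub>M P') ((X \<times>\<^sub>M P) \<times>\<^sub>M P')" by (rule mod_iso_prodm_assoc')
  from mod_iso_trans[OF this mod_iso_prodm[OF 1(3) mod_iso_refl lp[OF l(1,4)] l(6)]]
  have "mod_iso R (X \<times>\<^sub>M P \<times>\<^sub>M P') ((Y \<times>\<^sub>M Q) \<times>\<^sub>M P')" .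
  from mod_iso_trans[OF this mod_iso_prodm_swap]
  have "mod_iso R (X \<times>\<^sub>M P \<times>\<^sub>M P') ((Y \<times>\<^sub>M P') \<times>\<^sub>M Q)" .
  from mod_iso_trans[OF this mod_iso_prodm[OF 2(3) mod_iso_refl lp[OF l(2,6)] l(5)]]
  have "mod_iso R (X \<times>\<^sub>M P \<times>\<^sub>M P') ((Z \<times>\<^sub>M Q') \<times>\<^sub>M Q)" .
  from mod_iso_trans[OF this mod_iso_prodm_assoc]
  have "mod_iso R (X \<times>\<^sub>M P \<times>\<^sub>M P') (Z \<times>\<^sub>M Q' \<times>\<^sub>M Q)" .
  then show ?thesis
    by (rule stabI[OF stab_fg(1)[OF assms(1)] stab_fg(2)[OF assms(2)]
          pj_prodm[OF projective_pj[OF 1(1)] projective_pj[OF 2(1)]]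
          pj_prodm[OF projective_pj[OF 2(2)] projective_pj[OF 1(2)]]])
qed

lemma stab_pj_prodm:
  assumes X: "fg R X" and P: "pj P" shows "stab (X \<times>\<^sub>M P) X"
proof -
  note l = fgD(1)[OF X] fgD(1)[OF pj_fg[OF P]]
  show ?thesis
    by (rule stabI[OF fg_prodm[OF X pj_fg[OF P]] X pj_freem0 P mod_iso_prodm_freem0(1)[OF left_module_prodm[OF l]]])
qed

lemma mod_iso_prodm_middle: "mod_iso R ((X \<times>\<^sub>M P) \<times>\<^sub>M (Y \<times>\<^sub>M Q)) ((X \<times>\<^sub>M Y) \<times>\<^sub>M (P \<times>\<^sub>M Q))"
  by (rule mod_isoI2[of "\<lambda>p. ((fst (fst p), fst (snd p)), (snd (fst p), snd (snd p)))" _ _ _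
        "\<lambda>p. ((fst (fst p), fst (snd p)), (snd (fst p), snd (snd p)))"])
    (auto intro!: mod_homI)

lemma stab_prodm:
  assumes "stab X X'" "stab Y Y'" shows "stab (X \<times>\<^sub>M Y) (X' \<times>\<^sub>M Y')"
proof -
  obtain P Q where 1: "projective R P" "projective R Q" "mod_iso R (X \<times>\<^sub>M P) (X' \<times>\<^sub>M Q)" by (rule stabE[OF assms(1)])
  obtain P' Q' where 2: "projective R P'" "projective R Q'" "mod_iso R (Y \<times>\<^sub>M P') (Y' \<times>\<^sub>M Q')" by (rule stabE[OF assms(2)])
  note l = fgD(1)[OF stab_fg(1)[OF assms(1)]] fgD(1)[OF stab_fg(1)[OF assms(2)]]
    fgD(1)[OF projective_fg[OF 1(1)]] fgD(1)[OF projective_fg[OF 2(1)]]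
  have "mod_iso R ((X \<times>\<^sub>M Y) \<times>\<^sub>M (P \<times>\<^sub>M P')) ((X \<times>\<^sub>M P) \<times>\<^sub>M (Y \<times>\<^sub>M P'))" by (rule mod_iso_prodm_middle)
  from mod_iso_trans[OF this mod_iso_prodm[OF 1(3) 2(3) left_module_prodm[OF l(1,3)] left_module_prodm[OF l(2,4)]]]
  have "mod_iso R ((X \<times>\<^sub>M Y) \<times>\<^sub>M (P \<times>\<^sub>M P')) ((X' \<times>\<^sub>M Q) \<times>\<^sub>M (Y' \<times>\<^sub>M Q'))" .
  from mod_iso_trans[OF this mod_iso_prodm_middle]
  have "mod_iso R ((X \<times>\<^sub>M Y) \<times>\<^sub>M (P \<times>\<^sub>M P')) ((X' \<times>\<^sub>M Y') \<times>\<^sub>M (Q \<times>\<^sub>M Q'))" .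
  then show ?thesis
    by (rule stabI[OF fg_prodm[OF stab_fg(1)[OF assms(1)] stab_fg(1)[OF assms(2)]]
          fg_prodm[OF stab_fg(2)[OF assms(1)] stab_fg(2)[OF assms(2)]]
          pj_prodm[OF projective_pj[OF 1(1)] projective_pj[OF 2(1)]]
          pj_prodm[OF projective_pj[OF 1(2)] projective_pj[OF 2(2)]]])
qed

text \<open>Kernels of arbitrary surjections from projectives, not only of projective covers. They
  are unique up to \<open>stab\<close>, which is enough for projective dimensions.\<close>

definition syz :: "('a, 'b) module \<Rightarrow> ('a, 'c) module \<Rightarrow> bool" where
  "syz X K \<longleftrightarrow> (\<exists>P. projective R P \<and> ses K P X)"

lemma syzI:
  assumes "pj P" "ses K P X" shows "syz X K"
  unfolding syz_def using pj_rep[OF assms(1)]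
    ses_iso2[OF assms(2) rep(2)[OF pj_fg[OF assms(1)]] fgD(1)[OF rep(1)[OF pj_fg[OF assms(1)]]]] by auto

lemma syzE:
  assumes "syz X K" obtains P where "projective R P" "ses K P X"
  using assms unfolding syz_def by auto

lemma syz_fg: "syz X K \<Longrightarrow> fg R X" "syz X K \<Longrightarrow> fg R K"
  unfolding syz_def using ses_fg by auto

lemma syz_exists:
  assumes "fg R X" shows "\<exists>K :: ('a, 'a list) module. syz X K"
proof -
  obtain n f where f: "f \<in> mod_hom R (freem n) X" "f ` carrier (freem n) = carrier X"
    using freem_surj[OF assms] by auto
  show ?thesis by (rule exI, rule syzI[OF pj_freem ses_kernel[OF fg_freem fgD(1)[OF assms] f]])
qed

lemma syz_prodm:
  assumes "syz X K" "syz Y L" shows "syz (X \<times>\<^sub>M Y) (K \<times>\<^sub>M L)"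
proof -
  obtain P where P: "projective R P" "ses K P X" by (rule syzE[OF assms(1)])
  obtain Q where Q: "projective R Q" "ses L Q Y" by (rule syzE[OF assms(2)])
  show ?thesis by (rule syzI[OF pj_prodm[OF projective_pj[OF P(1)] projective_pj[OF Q(1)]] ses_prodm[OF P(2) Q(2)]])
qed

lemma syz_iso1:
  assumes "syz X K" "mod_iso R X Y" "left_module R Y" shows "syz Y K"
proof -
  obtain P where P: "projective R P" "ses K P X" by (rule syzE[OF assms(1)])
  show ?thesis by (rule syzI[OF projective_pj[OF P(1)] ses_iso3[OF P(2) assms(2,3)]])
qed

lemma syz_iso2:
  assumes "syz X K" "mod_iso R L K" "left_module R L" shows "syz X L"
proof -
  obtain P where P: "projective R P" "ses K P X" by (rule syzE[OF assms(1)])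
  show ?thesis by (rule syzI[OF projective_pj[OF P(1)] ses_iso1[OF P(2) assms(2,3)]])
qed

lemma syz_add_pj:
  assumes "syz X K" "pj P" shows "syz (X \<times>\<^sub>M P) K"
proof -
  obtain Q where Q: "projective R Q" "ses K Q X" by (rule syzE[OF assms(1)])
  show ?thesis by (rule syzI[OF pj_prodm[OF projective_pj[OF Q(1)] assms(2)] ses_add_right[OF Q(2) pj_fg[OF assms(2)]]])
qed

text \<open>Schanuel's lemma. After projectives are added, both modules become isomorphic. The
  pullback of the two presentations then splits over either projective, which compares the
  kernels.\<close>

lemma syz_stab:
  assumes "stab X Y" "syz X K" "syz Y L" shows "stab K L"
proof -
  obtain P Q where 1: "projective R P" "projective R Q" "mod_iso R (X \<times>\<^sub>M P) (Y \<times>\<^sub>M Q)" by (rule stabE[OF assms(1)])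
  note l = fgD(1)[OF fg_prodm[OF stab_fg(2)[OF assms(1)] projective_fg[OF 1(2)]]]
  have "syz (Y \<times>\<^sub>M Q) K" by (rule syz_iso1[OF syz_add_pj[OF assms(2) projective_pj[OF 1(1)]] 1(3) l])
  then obtain T where T: "projective R T" "ses K T (Y \<times>\<^sub>M Q)" by (rule syzE)
  obtain T' where T': "projective R T'" "ses L T' (Y \<times>\<^sub>M Q)"
    by (rule syzE[OF syz_add_pj[OF assms(3) projective_pj[OF 1(2)]]])
  obtain W :: "('a, 'a list \<times> 'a list) module" where W: "ses K W T'" "ses L W T"
    using ses_pullback[OF T(2) T'(2)] by auto
  have "mod_iso R (K \<times>\<^sub>M T') W" by (rule ses_split[OF W(1) projective_pj[OF T'(1)]])
  moreover have "mod_iso R W (L \<times>\<^sub>M T)"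
    by (rule mod_iso_sym[OF ses_split[OF W(2) projective_pj[OF T(1)]]
          left_module_prodm[OF ses_lm(1)[OF W(2)] fgD(1)[OF projective_fg[OF T(1)]]]])
  ultimately show ?thesis
    by (rule stabI[OF ses_fg(1)[OF W(1)] ses_fg(1)[OF W(2)] projective_pj[OF T'(1)] projective_pj[OF T(1)] mod_iso_trans])
qed

subsection \<open>Projective dimension\<close>

primrec pdle :: "nat \<Rightarrow> ('a, 'a list) module \<Rightarrow> bool" where
  "pdle 0 X \<longleftrightarrow> projective R X"
| "pdle (Suc n) X \<longleftrightarrow> (\<exists>K. syz X K \<and> pdle n K)"

text \<open>Modules on arbitrary types are replaced by isomorphic ones on lists, for which syzygies are again modules on lists.\<close>

definition pd :: "nat \<Rightarrow> ('a, 'b) module \<Rightarrow> bool" where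
  "pd n X \<longleftrightarrow> (\<exists>Y :: ('a, 'a list) module. stab X Y \<and> pdle n Y)"

lemma pj_stab:
  assumes "stab X Y" "pj X" shows "pj Y"
proof -
  obtain P Q where 1: "projective R P" "projective R Q" "mod_iso R (X \<times>\<^sub>M P) (Y \<times>\<^sub>M Q)" by (rule stabE[OF assms(1)])
  note l = fgD(1)[OF stab_fg(2)[OF assms(1)]] fgD(1)[OF projective_fg[OF 1(2)]]
  have "pj (Y \<times>\<^sub>M Q)"
    by (rule pj_iso[OF pj_prodm[OF assms(2) projective_pj[OF 1(1)]] 1(3) left_module_prodm[OF l]])
  then show ?thesis using pj_retract[OF retract_prodm(1)[OF l] _ l(1)] by simp
qed

lemma pdle_stab: "pdle n X \<Longrightarrow> stab X Y \<Longrightarrow> pdle n Y"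
proof (induction n arbitrary: X Y)
  case 0
  have "projective R X" using 0(1) by simp
  from pj_projective[OF pj_stab[OF 0(2) projective_pj[OF this]]] show ?case by simp
next
  case (Suc n)
  then obtain K where K: "syz X K" "pdle n K" by auto
  obtain L :: "('a, 'a list) module" where L: "syz Y L" using syz_exists[OF stab_fg(2)[OF Suc.prems(2)]] by auto
  have "pdle n L" by (rule Suc.IH[OF K(2) syz_stab[OF Suc.prems(2) K(1) L]])
  then show ?case using L by auto
qed

lemma pd_stab: "pd n X \<Longrightarrow> stab X Y \<Longrightarrow> pd n Y"
  unfolding pd_def by (elim exE conjE) (rule exI, rule conjI, rule stab_trans[OF stab_sym])

lemma pd_fg: "pd n X \<Longrightarrow> fg R X"
  unfolding pd_def by (elim exE conjE) (rule stab_fg(1))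

lemma pd_iso: "pd n X \<Longrightarrow> mod_iso R X Y \<Longrightarrow> left_module R Y \<Longrightarrow> pd n Y"
  by (rule pd_stab[OF _ stab_iso[OF _ pd_fg]])

lemma pd_pdle:
  assumes "fg R X" shows "pd n X \<longleftrightarrow> pdle n X"
proof
  assume "pd n X"
  then obtain Y :: "('a, 'a list) module" where "stab X Y" "pdle n Y" unfolding pd_def by auto
  then show "pdle n X" by (rule pdle_stab[OF _ stab_sym, rotated])
next
  assume "pdle n X"
  with stab_refl[OF assms] show "pd n X" unfolding pd_def by (intro exI conjI)
qed

lemma pd_0: "pd 0 X \<longleftrightarrow> pj X"
proof
  assume "pd 0 X"
  then obtain Y :: "('a, 'a list) module" where Y: "stab X Y" "projective R Y" unfolding pd_def by auto
  show "pj X" by (rule pj_stab[OF stab_sym[OF Y(1)] projective_pj[OF Y(2)]])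
next
  assume X: "pj X"
  have "stab X (rep R X)"
    by (rule stab_iso[OF rep(2)[OF pj_fg[OF X]] pj_fg[OF X] fgD(1)[OF rep(1)[OF pj_fg[OF X]]]])
  then show "pd 0 X" unfolding pd_def pdle.simps using pj_rep[OF X] by (intro exI conjI)
qed

text \<open>\<open>pdle\<close> only asks for some syzygy; by Schanuel's lemma any one will do.
  Dimension shifting thus becomes an equivalence.\<close>

lemma pd_Suc:
  assumes "syz X K" shows "pd (Suc n) X \<longleftrightarrow> pd n K"
proof
  assume "pd (Suc n) X"
  then obtain Y L :: "('a, 'a list) module" where Y: "stab X Y" "syz Y L" "pdle n L" unfolding pd_def by auto
  have "stab K L" by (rule syz_stab[OF Y(1) assms Y(2)])
  then show "pd n K" unfolding pd_def using Y(3) by (intro exI conjI)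
next
  assume "pd n K"
  then obtain L :: "('a, 'a list) module" where L: "stab K L" "pdle n L" unfolding pd_def by auto
  have X: "stab X (rep R X)"
    by (rule stab_iso[OF rep(2) syz_fg(1)[OF assms] fgD(1)[OF rep(1)]]) (rule syz_fg(1)[OF assms])+
  obtain L' :: "('a, 'a list) module" where L': "syz (rep R X) L'" using syz_exists[OF stab_fg(2)[OF X]] by auto
  have "pdle n L'" by (rule pdle_stab[OF L(2) stab_trans[OF stab_sym[OF L(1)] syz_stab[OF X assms L']]])
  then show "pd (Suc n) X" unfolding pd_def pdle.simps using X L' by (intro exI conjI)
qed

lemma syz_pj:
  assumes "pj X" "syz X K" shows "pj K"
proof -
  have "stab K (freem 0)"
    by (rule syz_stab[OF stab_refl[OF pj_fg[OF assms(1)]] assms(2)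
          syzI[OF assms(1) ses_id_right[OF pj_fg[OF assms(1)]]]])
  then show ?thesis by (rule pj_stab[OF stab_sym pj_freem0])
qed

lemma pd_mono1: "pd n X \<Longrightarrow> pd (Suc n) X" for X :: "('a, 'b) module"
proof -
  \<comment> \<open>Syzygies are taken on lists, so the induction runs over modules on lists. A
    module on another type is replaced by a stably isomorphic one afterwards.\<close>
  have *: "pd n X \<Longrightarrow> pd (Suc n) X" for X :: "('a, 'a list) module"
  proof (induction n arbitrary: X)
    case 0
    obtain K :: "('a, 'a list) module" where K: "syz X K" using syz_exists[OF pd_fg[OF 0]] by auto
    show ?case using syz_pj[OF _ K] 0 pd_Suc[OF K, of 0] by (simp add: pd_0)
  next
    case (Suc n)
    obtain K :: "('a, 'a list) module" where K: "syz X K" using syz_exists[OF pd_fg[OF Suc.prems]] by auto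
    show ?case using Suc.IH[of K] Suc.prems unfolding pd_Suc[OF K] by simp
  qed
  assume X: "pd n X"
  then obtain Y :: "('a, 'a list) module" where Y: "stab X Y" "pdle n Y" unfolding pd_def by auto
  have "pd n Y" by (rule pd_stab[OF X Y(1)])
  from pd_stab[OF *[OF this] stab_sym[OF Y(1)]] show "pd (Suc n) X" .
qed

lemma pd_mono: "pd n X \<Longrightarrow> n \<le> m \<Longrightarrow> pd m X"
  by (induction m rule: nat_induct) (auto simp: le_Suc_eq pd_mono1)

text \<open>A product of syzygies is a syzygy of the product, so the claim descends to dimension
  zero, where retracts of projective modules are projective.\<close>

lemma pd_prodm_left:
  fixes X :: "('a, 'b) module" and Y :: "('a, 'c) module"
  assumes "pd n (X \<times>\<^sub>M Y)" "fg R X" "fg R Y"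
  shows "pd n X"
proof -
  have *: "pd n (X \<times>\<^sub>M Y) \<Longrightarrow> fg R X \<Longrightarrow> fg R Y \<Longrightarrow> pd n X" for X Y :: "('a, 'a list) module"
  proof (induction n arbitrary: X Y)
    case 0
    then show ?case
      using pj_retract[OF retract_prodm(1)[OF fgD(1)[OF 0(2)] fgD(1)[OF 0(3)]] _ fgD(1)[OF 0(2)]]
      by (simp add: pd_0)
  next
    case (Suc n)
    obtain K :: "('a, 'a list) module" where K: "syz X K" using syz_exists[OF Suc.prems(2)] by auto
    obtain L :: "('a, 'a list) module" where L: "syz Y L" using syz_exists[OF Suc.prems(3)] by auto
    have "pd n (K \<times>\<^sub>M L)" using Suc.prems(1) pd_Suc[OF syz_prodm[OF K L]] by simp
    then have "pd n K" by (rule Suc.IH[OF _ syz_fg(2)[OF K] syz_fg(2)[OF L]])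
    then show ?case using pd_Suc[OF K] by simp
  qed
  note r = rep(2)[OF assms(2)] rep(2)[OF assms(3)]
  note l = fgD(1)[OF assms(2)] fgD(1)[OF assms(3)] fgD(1)[OF rep(1)[OF assms(2)]] fgD(1)[OF rep(1)[OF assms(3)]]
  have "pd n (rep R X \<times>\<^sub>M rep R Y)"
    by (rule pd_iso[OF assms(1) mod_iso_prodm[OF r l(1,2)] left_module_prodm[OF l(3,4)]])
  from pd_iso[OF *[OF this rep(1)[OF assms(2)] rep(1)[OF assms(3)]] rep(3)[OF assms(2)] l(1)]
  show ?thesis .
qed

lemma retract_iso_prodm:
  assumes X: "fg R X" and Y: "left_module R Y"
    and i: "i \<in> mod_hom R Y X" and p: "p \<in> mod_hom R X Y" and pi: "\<And>y. y \<in> carrier Y \<Longrightarrow> p (i y) = y"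
  shows "mod_iso R (Y \<times>\<^sub>M (X\<lparr>carrier := {x \<in> carrier X. p x = \<zero>\<^bsub>Y\<^esub>}\<rparr>)) X"
proof -
  note lX = fgD(1)[OF X]
  interpret X: left_module R X by fact
  interpret Y: left_module R Y by fact
  let ?K = "X\<lparr>carrier := {x \<in> carrier X. p x = \<zero>\<^bsub>Y\<^esub>}\<rparr>"
  let ?f = "\<lambda>w. i (fst w) \<oplus>\<^bsub>X\<^esub> snd w"
  have iX: "i y \<in> carrier X" if "y \<in> carrier Y" for y by (rule mod_hom_closed[OF i that])
  have incl: "(\<lambda>x. x) \<in> mod_hom R ?K X" by (rule mod_hom_incl) simp
  have f: "?f \<in> mod_hom R (Y \<times>\<^sub>M ?K) X"
    by (intro mod_hom_plus[OF lX] mod_hom_comp[OF mod_hom_fst i] mod_hom_comp[OF mod_hom_snd incl])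
  have sub: "p (x \<ominus>\<^bsub>X\<^esub> i (p x)) = \<zero>\<^bsub>Y\<^esub>" if "x \<in> carrier X" for x
    using mod_hom_diff[OF lX Y p that iX[OF mod_hom_closed[OF p that]]] pi[OF mod_hom_closed[OF p that]]
      mod_hom_closed[OF p that] by (simp add: a_minus_def Y.M.r_neg)
  have pf: "p (i y \<oplus>\<^bsub>X\<^esub> k) = y" if "y \<in> carrier Y" "k \<in> carrier X" "p k = \<zero>\<^bsub>Y\<^esub>" for y k
    using that by (simp add: mod_hom_add[OF p] iX pi)
  show ?thesis
  proof (rule mod_isoI[OF f])
    show "inj_on ?f (carrier (Y \<times>\<^sub>M ?K))"
    proof (rule inj_onI)
      fix u v assume *: "u \<in> carrier (Y \<times>\<^sub>M ?K)" "v \<in> carrier (Y \<times>\<^sub>M ?K)" "?f u = ?f v"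
      have "p (?f u) = fst u" "p (?f v) = fst v" using *(1,2) by (auto simp: pf)
      then have "fst u = fst v" using *(3) by metis
      moreover have "snd u = snd v" using * calculation iX by auto
      ultimately show "u = v" by (rule prod_eqI)
    qed
    show "?f ` carrier (Y \<times>\<^sub>M ?K) = carrier X"
    proof
      show "?f ` carrier (Y \<times>\<^sub>M ?K) \<subseteq> carrier X" by (rule image_subsetI) (rule mod_hom_closed[OF f])
      show "carrier X \<subseteq> ?f ` carrier (Y \<times>\<^sub>M ?K)"
      proof
        fix x assume x: "x \<in> carrier X"
        have c: "p x \<in> carrier Y" "i (p x) \<in> carrier X" using mod_hom_closed[OF p x] iX by auto
        have "x = i (p x) \<oplus>\<^bsub>X\<^esub> (x \<ominus>\<^bsub>X\<^esub> i (p x))"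
          using x c(2) by (simp add: a_minus_def X.M.a_lcomm X.M.r_neg)
        then show "x \<in> ?f ` carrier (Y \<times>\<^sub>M ?K)"
          using x c sub[OF x] by (intro image_eqI[of _ _ "(p x, x \<ominus>\<^bsub>X\<^esub> i (p x))"]) auto
      qed
    qed
  qed
qed

lemma pd_retract:
  assumes "retract Y X" "pd n X" "left_module R Y"
  shows "pd n Y"
proof -
  note X = pd_fg[OF assms(2)]
  obtain i p where ip: "i \<in> mod_hom R Y X" "p \<in> mod_hom R X Y" "\<And>y. y \<in> carrier Y \<Longrightarrow> p (i y) = y"
    using assms(1) unfolding retract_def by auto
  let ?K = "X\<lparr>carrier := {x \<in> carrier X. p x = \<zero>\<^bsub>Y\<^esub>}\<rparr>"
  have Y: "fg R Y" by (rule retract_fg[OF assms(1) X assms(3)])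
  have K: "fg R ?K" by (rule fg_submodule[OF X submodule_kernel[OF fgD(1)[OF X] assms(3) ip(2)]])
  have "mod_iso R (Y \<times>\<^sub>M ?K) X" by (rule retract_iso_prodm[OF X assms(3) ip])
  then have "mod_iso R X (Y \<times>\<^sub>M ?K)"
    by (rule mod_iso_sym) (rule left_module_prodm[OF assms(3) fgD(1)[OF K]])
  from pd_iso[OF assms(2) this left_module_prodm[OF assms(3) fgD(1)[OF K]]]
  show ?thesis by (rule pd_prodm_left) (fact Y K)+
qed

subsection \<open>Triangles\<close>

text \<open>Short exact sequences up to stable equivalence: the distinguished triangles of the stable module category.\<close>

definition tri :: "('a, 'b) module \<Rightarrow> ('a, 'c) module \<Rightarrow> ('a, 'd) module \<Rightarrow> bool" where
  "tri U V W \<longleftrightarrow> (\<exists>(U' :: ('a, 'a list) module) (V' :: ('a, 'a list) module) (W' :: ('a, 'a list) module). ses U' V' W' \<and> stab U U' \<and> stab V V' \<and> stab W W')"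

lemma stab_rep: "fg R X \<Longrightarrow> stab X (rep R X)"
  by (rule stab_iso[OF rep(2) _ fgD(1)[OF rep(1)]])

lemma ses_rep:
  assumes "ses U V W" shows "ses (rep R U) (rep R V) (rep R W)"
  by (rule ses_iso1[OF ses_iso2[OF ses_iso3[OF assms rep(2) fgD(1)[OF rep(1)]] rep(2) fgD(1)[OF rep(1)]] rep(3) fgD(1)[OF rep(1)]])
    (use ses_fg[OF assms] in auto)

lemma ses_tri:
  assumes "ses U V W" shows "tri U V W"
  unfolding tri_def using ses_rep[OF assms] stab_rep ses_fg[OF assms] by metis

lemma triE:
  assumes "tri U V W"
  obtains U' V' W' :: "('a, 'a list) module" where "ses U' V' W'" "stab U U'" "stab V V'" "stab W W'"
  using assms unfolding tri_def by auto

lemma tri_fg: "tri U V W \<Longrightarrow> fg R U" "tri U V W \<Longrightarrow> fg R V" "tri U V W \<Longrightarrow> fg R W"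
  unfolding tri_def using stab_fg(1) by auto

lemma tri_stab:
  assumes "tri U V W" "stab U U1" "stab V V1" "stab W W1" shows "tri U1 V1 W1"
proof -
  obtain U' V' W' :: "('a, 'a list) module" where *: "ses U' V' W'" "stab U U'" "stab V V'" "stab W W'"
    by (rule triE[OF assms(1)])
  show ?thesis unfolding tri_def
    using *(1) stab_trans[OF stab_sym[OF assms(2)] *(2)] stab_trans[OF stab_sym[OF assms(3)] *(3)]
      stab_trans[OF stab_sym[OF assms(4)] *(4)] by auto
qed

text \<open>The pullback of \<open>B \<rightarrow> C\<close> along a projective presentation of
  \<open>C\<close> is an extension of a projective module by \<open>A\<close>, hence stably
  \<open>A\<close>. At the same time it is an extension of \<open>B\<close> by the syzygy of
  \<open>C\<close>.\<close>

lemma tri_rotate: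
  assumes "tri U V W" "syz W W'" shows "tri W' U V"
proof -
  obtain A B C :: "('a, 'a list) module" where *: "ses A B C" "stab U A" "stab V B" "stab W C"
    by (rule triE[OF assms(1)])
  obtain C' :: "('a, 'a list) module" where C': "syz C C'" using syz_exists[OF stab_fg(2)[OF *(4)]] by auto
  obtain P where P: "projective R P" "ses C' P C" by (rule syzE[OF C'])
  obtain Z :: "('a, 'a list \<times> 'a list) module" where Z: "ses A Z P" "ses C' Z B"
    using ses_pullback[OF *(1) P(2)] by auto
  have "mod_iso R (A \<times>\<^sub>M P) Z" by (rule ses_split[OF Z(1) projective_pj[OF P(1)]])
  then have "stab (A \<times>\<^sub>M P) Z"
    by (rule stab_iso[OF _ fg_prodm[OF ses_fg(1)[OF *(1)] projective_fg[OF P(1)]] ses_lm(2)[OF Z(1)]])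
  then have "stab A Z" by (rule stab_trans[OF stab_sym[OF stab_pj_prodm[OF ses_fg(1)[OF *(1)] projective_pj[OF P(1)]]]])
  then have "stab Z U" by (rule stab_sym[OF stab_trans[OF *(2)]])
  moreover have "stab C' W'" by (rule syz_stab[OF stab_sym[OF *(4)] C' assms(2)])
  ultimately show ?thesis by (intro tri_stab[OF ses_tri[OF Z(2)] _ _ stab_sym[OF *(3)]])
qed

text \<open>Three rotations replace every term by its syzygy.\<close>

lemma tri_syz:
  assumes "tri U V W" "syz U U'" "syz V V'" "syz W W'" shows "tri U' V' W'"
  by (rule tri_rotate[OF tri_rotate[OF tri_rotate[OF assms(1,4)] assms(3)] assms(2)])

lemma tri_pj:
  assumes "tri U V W" "pj W" shows "stab U V"
proof -
  obtain A B C :: "('a, 'a list) module" where *: "ses A B C" "stab U A" "stab V B" "stab W C"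
    by (rule triE[OF assms(1)])
  have C: "pj C" by (rule pj_stab[OF *(4) assms(2)])
  have "stab (A \<times>\<^sub>M C) B"
    by (rule stab_iso[OF ses_split[OF *(1) C] fg_prodm[OF ses_fg(1,3)[OF *(1)]] ses_lm(2)[OF *(1)]])
  then have "stab A B" by (rule stab_trans[OF stab_sym[OF stab_pj_prodm[OF ses_fg(1)[OF *(1)] C]]])
  then show ?thesis by (rule stab_trans[OF *(2) stab_trans[OF _ stab_sym[OF *(3)]]])
qed

text \<open>Passing to syzygies lowers the dimensions of the first two terms together until both are
  projective; they then form a resolution of length one of the third.\<close>

lemma tri_pd_cokernel:
  assumes "tri U V W" "pd n U" "pd n V" shows "pd (Suc n) W"
proof -
  have *: "pd (Suc n) W" if "tri U V W" "pd n U" "pd n V" for n and U V W :: "('a, 'a list) module"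
    using that
  proof (induction n arbitrary: U V W)
    case 0
    obtain A B C :: "('a, 'a list) module" where *: "ses A B C" "stab U A" "stab V B" "stab W C"
      by (rule triE[OF 0(1)])
    have "pj A" "pj B" using pj_stab[OF *(2)] pj_stab[OF *(3)] 0 by (auto simp: pd_0)
    then have "pd (Suc 0) C" using pd_Suc[OF syzI[OF _ *(1)], of 0] by (simp add: pd_0)
    then show ?case by (rule pd_stab[OF _ stab_sym[OF *(4)]])
  next
    case (Suc n)
    obtain U' :: "('a, 'a list) module" where U': "syz U U'" using syz_exists[OF tri_fg(1)[OF Suc.prems(1)]] by auto
    obtain V' :: "('a, 'a list) module" where V': "syz V V'" using syz_exists[OF tri_fg(2)[OF Suc.prems(1)]] by auto
    obtain W' :: "('a, 'a list) module" where W': "syz W W'" using syz_exists[OF tri_fg(3)[OF Suc.prems(1)]] by auto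
    have "pd (Suc n) W'" using Suc.IH[OF tri_syz[OF Suc.prems(1) U' V' W']] Suc.prems(2,3)
      by (simp add: pd_Suc[OF U'] pd_Suc[OF V'])
    then show ?case using pd_Suc[OF W'] by simp
  qed
  obtain A B C :: "('a, 'a list) module" where abc: "ses A B C" "stab U A" "stab V B" "stab W C"
    by (rule triE[OF assms(1)])
  show ?thesis
    by (rule pd_stab[OF *[OF ses_tri[OF abc(1)] pd_stab[OF assms(2) abc(2)] pd_stab[OF assms(3) abc(3)]] stab_sym[OF abc(4)]])
qed

section \<open>Modules of finite projective dimension in triangles\<close>

definition pd_fin :: "('a, 'b) module \<Rightarrow> bool" where
  "pd_fin X \<longleftrightarrow> (\<exists>n. pd n X)"

lemma pd_fin_stab: "pd_fin X \<Longrightarrow> stab X Y \<Longrightarrow> pd_fin Y"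
  unfolding pd_fin_def using pd_stab by auto

lemma pd_fin_syz: "syz X K \<Longrightarrow> pd_fin X \<longleftrightarrow> pd_fin K"
proof -
  assume K: "syz X K"
  have "pd_fin X \<longleftrightarrow> (\<exists>n. pd (Suc n) X)" unfolding pd_fin_def using pd_mono1 by auto
  then show ?thesis by (simp add: pd_fin_def pd_Suc[OF K])
qed

lemma pd_fin_retract: "retract Y X \<Longrightarrow> pd_fin X \<Longrightarrow> left_module R Y \<Longrightarrow> pd_fin Y"
  unfolding pd_fin_def using pd_retract by auto

lemma pd_fin_cokernel:
  assumes "tri U V W" "pd_fin U" "pd_fin V" shows "pd_fin W"
proof -
  obtain n m where "pd n U" "pd m V" using assms(2,3) unfolding pd_fin_def by auto
  then have "pd (max n m) U" "pd (max n m) V" by (auto intro: pd_mono)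
  then show ?thesis unfolding pd_fin_def using tri_pd_cokernel[OF assms(1)] by auto
qed

text \<open>After a rotation \<open>V\<close> is the last term of a triangle that begins with a
  syzygy of \<open>W\<close> and \<open>U\<close>, both of finite projective dimension.\<close>

lemma pd_fin_extension:
  assumes "tri U V W" "pd_fin U" "pd_fin W" shows "pd_fin V"
proof -
  obtain W' :: "('a, 'a list) module" where W': "syz W W'" using syz_exists[OF tri_fg(3)[OF assms(1)]] by auto
  show ?thesis by (rule pd_fin_cokernel[OF tri_rotate[OF assms(1) W']]) (use assms pd_fin_syz[OF W'] in auto)
qed

end

section \<open>Decompositions into indecomposable modules\<close>

lemma eq_singletonI: "(\<And>y. y \<in> L \<Longrightarrow> y = z) \<Longrightarrow> z \<in> L \<Longrightarrow> L = {z}"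
  by blast

context finite_length_ring
begin

section \<open>Internal direct sums and their projections\<close>

lemma direct_decompI:
  assumes lm: "left_module R X" and H: "submodule H R X" and K: "submodule K R X"
    and sum: "\<And>x. x \<in> carrier X \<Longrightarrow> \<exists>h\<in>H. \<exists>k\<in>K. x = h \<oplus>\<^bsub>X\<^esub> k"
    and int: "\<And>x. x \<in> H \<Longrightarrow> x \<in> K \<Longrightarrow> x = \<zero>\<^bsub>X\<^esub>"
  shows "direct_decomp R X H K"
proof -
  note s = H[unfolded submodule_iff[OF lm]] K[unfolded submodule_iff[OF lm]]
  have "H <+>\<^bsub>X\<^esub> K \<subseteq> carrier X"
    by (rule set_add_least[OF lm submodule_carrier[OF lm]]) (use s in auto)
  moreover have "carrier X \<subseteq> H <+>\<^bsub>X\<^esub> K" using sum by (auto simp: set_add_iff)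
  moreover have "H \<inter> K = {\<zero>\<^bsub>X\<^esub>}" using s int by auto
  ultimately show ?thesis unfolding direct_decomp_def using H K by auto
qed

lemma direct_decompD:
  assumes lm: "left_module R X" and d: "direct_decomp R X H K"
  shows "submodule H R X" "submodule K R X"
    "\<And>x. x \<in> carrier X \<Longrightarrow> \<exists>h\<in>H. \<exists>k\<in>K. x = h \<oplus>\<^bsub>X\<^esub> k"
    "\<And>x. x \<in> H \<Longrightarrow> x \<in> K \<Longrightarrow> x = \<zero>\<^bsub>X\<^esub>"
proof -
  show "submodule H R X" "submodule K R X" using d by (simp_all add: direct_decomp_def)
  show "\<exists>h\<in>H. \<exists>k\<in>K. x = h \<oplus>\<^bsub>X\<^esub> k" if "x \<in> carrier X" for x
    using d that unfolding direct_decomp_def set_add_iff[symmetric] by simp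
  show "x = \<zero>\<^bsub>X\<^esub>" if "x \<in> H" "x \<in> K" for x
  proof -
    have "x \<in> H \<inter> K" using that by simp
    also have "H \<inter> K = {\<zero>\<^bsub>X\<^esub>}" using d by (simp add: direct_decomp_def)
    finally show ?thesis by simp
  qed
qed

lemma direct_decomp_commute:
  assumes lm: "left_module R X" and d: "direct_decomp R X H K" shows "direct_decomp R X K H"
proof -
  interpret X: left_module R X by fact
  note d = direct_decompD[OF lm d]
  note s = d(1,2)[unfolded submodule_iff[OF lm]]
  show ?thesis
  proof (rule direct_decompI[OF lm d(2,1)])
    fix x assume "x \<in> carrier X"
    from d(3)[OF this] obtain h k where hk: "h \<in> H" "k \<in> K" "x = h \<oplus>\<^bsub>X\<^esub> k" by auto
    have c: "h \<in> carrier X" "k \<in> carrier X" using hk s by auto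
    then have "x = k \<oplus>\<^bsub>X\<^esub> h" using hk(3) by (simp add: X.M.a_comm)
    then show "\<exists>h\<in>K. \<exists>k\<in>H. x = h \<oplus>\<^bsub>X\<^esub> k" using hk by auto
  qed (rule d(4))
qed

lemma direct_decomp_proj:
  assumes lm: "left_module R X" and d: "direct_decomp R X H K"
  shows "\<exists>\<rho>\<in>mod_hom R X (X\<lparr>carrier := H\<rparr>). (\<forall>x\<in>H. \<rho> x = x) \<and> (\<forall>x\<in>K. \<rho> x = \<zero>\<^bsub>X\<^esub>) \<and>
    (\<forall>x\<in>carrier X. x \<ominus>\<^bsub>X\<^esub> \<rho> x \<in> K)"
proof -
  interpret X: left_module R X by fact
  note d = direct_decompD[OF lm d]
  note s = d(1,2)[unfolded submodule_iff[OF lm]]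
  have HX: "h \<in> carrier X" if "h \<in> H" for h using that s by auto
  have KX: "h \<in> carrier X" if "h \<in> K" for h using that s by auto
  \<comment> \<open>The difference of two decompositions lies in \<open>H\<close> and in
    \<open>K\<close>. Components are therefore unique, and the choice by \<open>SOME\<close> below
    is the projection along \<open>K\<close>.\<close>
  have uniq: "h = h'" if "h \<in> H" "h' \<in> H" "k \<in> K" "k' \<in> K" "h \<oplus>\<^bsub>X\<^esub> k = h' \<oplus>\<^bsub>X\<^esub> k'" for h h' k k'
  proof -
    have c: "h \<in> carrier X" "h' \<in> carrier X" "k \<in> carrier X" "k' \<in> carrier X" using that HX KX by auto
    have "k' = \<ominus>\<^bsub>X\<^esub> h' \<oplus>\<^bsub>X\<^esub> (h' \<oplus>\<^bsub>X\<^esub> k')" using c by (simp add: X.M.r_neg1 X.M.r_neg2)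
    then have "k' = \<ominus>\<^bsub>X\<^esub> h' \<oplus>\<^bsub>X\<^esub> (h \<oplus>\<^bsub>X\<^esub> k)" by (simp only: that(5))
    then have "k' \<ominus>\<^bsub>X\<^esub> k = (\<ominus>\<^bsub>X\<^esub> h' \<oplus>\<^bsub>X\<^esub> (h \<oplus>\<^bsub>X\<^esub> k)) \<ominus>\<^bsub>X\<^esub> k" by simp
    also have "\<dots> = \<ominus>\<^bsub>X\<^esub> h' \<oplus>\<^bsub>X\<^esub> h" using c by (simp add: a_minus_def X.M.a_assoc X.M.r_neg)
    also have "\<dots> = h \<ominus>\<^bsub>X\<^esub> h'" unfolding a_minus_def by (rule X.M.a_comm) (use c in simp_all)
    finally have "h \<ominus>\<^bsub>X\<^esub> h' = k' \<ominus>\<^bsub>X\<^esub> k" by simp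
    moreover have "h \<ominus>\<^bsub>X\<^esub> h' \<in> H" "k' \<ominus>\<^bsub>X\<^esub> k \<in> K"
      by (rule submodule_diff[OF lm d(1) that(1,2)]) (rule submodule_diff[OF lm d(2) that(4,3)])
    ultimately have "h \<ominus>\<^bsub>X\<^esub> h' = \<zero>\<^bsub>X\<^esub>" using d(4) by simp
    then show ?thesis using X.diff_eq_zero_iff that HX by simp
  qed
  define \<rho> where "\<rho> x = (SOME h. h \<in> H \<and> (\<exists>k\<in>K. x = h \<oplus>\<^bsub>X\<^esub> k))" for x
  have ex: "\<rho> x \<in> H \<and> (\<exists>k\<in>K. x = \<rho> x \<oplus>\<^bsub>X\<^esub> k)" if "x \<in> carrier X" for x
    unfolding \<rho>_def by (rule someI_ex) (use d(3)[OF that] in auto)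
  have eq: "\<rho> x = h" if "x = h \<oplus>\<^bsub>X\<^esub> k" "h \<in> H" "k \<in> K" for x h k
  proof -
    have "x \<in> carrier X" using that HX KX by simp
    from ex[OF this] obtain k' where "\<rho> x \<in> H" "k' \<in> K" "x = \<rho> x \<oplus>\<^bsub>X\<^esub> k'" by auto
    then show ?thesis using uniq[of "\<rho> x" h k' k] that by simp
  qed
  have hom: "\<rho> \<in> mod_hom R X (X\<lparr>carrier := H\<rparr>)"
  proof (rule mod_homI)
    show "\<rho> x \<in> carrier (X\<lparr>carrier := H\<rparr>)" if "x \<in> carrier X" for x using ex[OF that] by simp
  next
    fix x y assume "x \<in> carrier X" "y \<in> carrier X"
    from ex[OF this(1)] ex[OF this(2)] obtain k k' where
      *: "\<rho> x \<in> H" "k \<in> K" "x = \<rho> x \<oplus>\<^bsub>X\<^esub> k" "\<rho> y \<in> H" "k' \<in> K" "y = \<rho> y \<oplus>\<^bsub>X\<^esub> k'" by auto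
    have "x \<oplus>\<^bsub>X\<^esub> y = (\<rho> x \<oplus>\<^bsub>X\<^esub> k) \<oplus>\<^bsub>X\<^esub> (\<rho> y \<oplus>\<^bsub>X\<^esub> k')" using *(3,6) by simp
    also have "\<dots> = (\<rho> x \<oplus>\<^bsub>X\<^esub> \<rho> y) \<oplus>\<^bsub>X\<^esub> (k \<oplus>\<^bsub>X\<^esub> k')" using *(1,2,4,5) HX KX by (simp add: X.M.a_ac)
    finally show "\<rho> (x \<oplus>\<^bsub>X\<^esub> y) = \<rho> x \<oplus>\<^bsub>X\<lparr>carrier := H\<rparr>\<^esub> \<rho> y"
      using eq[of "x \<oplus>\<^bsub>X\<^esub> y" "\<rho> x \<oplus>\<^bsub>X\<^esub> \<rho> y" "k \<oplus>\<^bsub>X\<^esub> k'"] * s by simp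
  next
    fix a x assume a: "a \<in> carrier R" and "x \<in> carrier X"
    from ex[OF this(2)] obtain k where *: "\<rho> x \<in> H" "k \<in> K" "x = \<rho> x \<oplus>\<^bsub>X\<^esub> k" by auto
    have "a \<odot>\<^bsub>X\<^esub> x = a \<odot>\<^bsub>X\<^esub> (\<rho> x \<oplus>\<^bsub>X\<^esub> k)" using *(3) by simp
    also have "\<dots> = a \<odot>\<^bsub>X\<^esub> \<rho> x \<oplus>\<^bsub>X\<^esub> a \<odot>\<^bsub>X\<^esub> k" by (rule X.smult_r_distr[OF a HX[OF *(1)] KX[OF *(2)]])
    finally show "\<rho> (a \<odot>\<^bsub>X\<^esub> x) = a \<odot>\<^bsub>X\<lparr>carrier := H\<rparr>\<^esub> \<rho> x"
      using eq[of "a \<odot>\<^bsub>X\<^esub> x" "a \<odot>\<^bsub>X\<^esub> \<rho> x" "a \<odot>\<^bsub>X\<^esub> k"] * s a by simp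
  qed
  show ?thesis
  proof (intro bexI[OF _ hom] conjI ballI)
    show "\<rho> x = x" if "x \<in> H" for x using eq[of x x "\<zero>\<^bsub>X\<^esub>"] s that HX by simp
    show "\<rho> x = \<zero>\<^bsub>X\<^esub>" if "x \<in> K" for x using eq[of x "\<zero>\<^bsub>X\<^esub>" x] s that KX by simp
    show "x \<ominus>\<^bsub>X\<^esub> \<rho> x \<in> K" if xX: "x \<in> carrier X" for x
    proof -
      obtain k where k: "\<rho> x \<in> H" "k \<in> K" "x = \<rho> x \<oplus>\<^bsub>X\<^esub> k" using ex[OF xX] by auto
      have "x \<ominus>\<^bsub>X\<^esub> \<rho> x = (k \<oplus>\<^bsub>X\<^esub> \<rho> x) \<ominus>\<^bsub>X\<^esub> \<rho> x" using k HX KX X.M.a_comm by metis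
      also have "\<dots> = k" using HX[OF k(1)] KX[OF k(2)] by (simp add: a_minus_def X.M.a_assoc X.M.r_neg)
      finally show ?thesis using k(2) by simp
    qed
  qed
qed

lemma direct_decomp_iso:
  assumes X: "fg R X" and d: "direct_decomp R X H K"
  shows "mod_iso R ((X\<lparr>carrier := H\<rparr>) \<times>\<^sub>M (X\<lparr>carrier := K\<rparr>)) X"
proof -
  note lm = fgD(1)[OF X]
  interpret X: left_module R X by fact
  note dd = direct_decompD[OF lm d]
  note s = dd(1,2)[unfolded submodule_iff[OF lm]]
  obtain \<rho> where \<rho>: "\<rho> \<in> mod_hom R X (X\<lparr>carrier := H\<rparr>)" "\<And>x. x \<in> H \<Longrightarrow> \<rho> x = x" "\<And>x. x \<in> K \<Longrightarrow> \<rho> x = \<zero>\<^bsub>X\<^esub>"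
    "\<And>x. x \<in> carrier X \<Longrightarrow> x \<ominus>\<^bsub>X\<^esub> \<rho> x \<in> K" using direct_decomp_proj[OF lm d] by auto
  have "{x \<in> carrier X. \<rho> x = \<zero>\<^bsub>X\<^esub>} = K"
    using \<rho>(3,4) s by (auto simp: X.diff_zero[symmetric]) (metis X.diff_zero)
  moreover have "mod_iso R ((X\<lparr>carrier := H\<rparr>) \<times>\<^sub>M
      (X\<lparr>carrier := {x \<in> carrier X. \<rho> x = \<zero>\<^bsub>X\<lparr>carrier := H\<rparr>\<^esub>}\<rparr>)) X"
    by (rule retract_iso_prodm[OF X left_module_sub[OF lm dd(1)] mod_hom_incl \<rho>(1)]) (use s \<rho>(2) in auto)
  ultimately show ?thesis by simp
qed

lemma direct_decomp_retract:
  assumes lm: "left_module R X" and d: "direct_decomp R X H K"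
  shows "retract (X\<lparr>carrier := H\<rparr>) X"
proof -
  have H: "H \<subseteq> carrier X" using direct_decompD(1)[OF lm d] unfolding submodule_iff[OF lm] by simp
  obtain \<rho> where \<rho>: "\<rho> \<in> mod_hom R X (X\<lparr>carrier := H\<rparr>)" "\<And>x. x \<in> H \<Longrightarrow> \<rho> x = x"
    using direct_decomp_proj[OF lm d] by auto
  show ?thesis unfolding retract_def
    by (rule bexI[OF bexI[OF _ \<rho>(1)] mod_hom_incl[OF H]]) (use \<rho>(2) in auto)
qed

lemma retract_direct_decomp:
  assumes X: "left_module R X" and Y: "left_module R Y"
    and i: "i \<in> mod_hom R Y X" and p: "p \<in> mod_hom R X Y" and pi: "\<And>y. y \<in> carrier Y \<Longrightarrow> p (i y) = y"
  shows "direct_decomp R X (i ` carrier Y) {x \<in> carrier X. p x = \<zero>\<^bsub>Y\<^esub>}"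
    "mod_iso R Y (X\<lparr>carrier := i ` carrier Y\<rparr>)"
proof -
  interpret X: left_module R X by fact
  interpret Y: left_module R Y by fact
  show "direct_decomp R X (i ` carrier Y) {x \<in> carrier X. p x = \<zero>\<^bsub>Y\<^esub>}"
  proof (rule direct_decompI[OF X submodule_image[OF Y X i submodule_carrier[OF Y]] submodule_kernel[OF X Y p]])
    fix x assume x: "x \<in> carrier X"
    have c: "p x \<in> carrier Y" "i (p x) \<in> carrier X" by (rule mod_hom_closed[OF p x], rule mod_hom_closed[OF i mod_hom_closed[OF p x]])
    have "p (x \<ominus>\<^bsub>X\<^esub> i (p x)) = \<zero>\<^bsub>Y\<^esub>"
      using mod_hom_diff[OF X Y p x c(2)] pi[OF c(1)] c(1) by (simp add: a_minus_def Y.M.r_neg)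
    moreover have "x = i (p x) \<oplus>\<^bsub>X\<^esub> (x \<ominus>\<^bsub>X\<^esub> i (p x))"
      using x c(2) by (simp add: a_minus_def X.M.a_lcomm X.M.r_neg)
    ultimately show "\<exists>h\<in>i ` carrier Y. \<exists>k\<in>{x \<in> carrier X. p x = \<zero>\<^bsub>Y\<^esub>}. x = h \<oplus>\<^bsub>X\<^esub> k"
      using x c by (intro bexI[of _ "i (p x)"] bexI[of _ "x \<ominus>\<^bsub>X\<^esub> i (p x)"]) auto
  next
    fix x assume "x \<in> i ` carrier Y" "x \<in> {x \<in> carrier X. p x = \<zero>\<^bsub>Y\<^esub>}"
    then obtain y where "y \<in> carrier Y" "x = i y" "p (i y) = \<zero>\<^bsub>Y\<^esub>" by auto
    then show "x = \<zero>\<^bsub>X\<^esub>" using pi[of y] mod_hom_zero[OF Y X i] by simp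
  qed
  show "mod_iso R Y (X\<lparr>carrier := i ` carrier Y\<rparr>)"
  proof (rule mod_isoI)
    show "i \<in> mod_hom R Y (X\<lparr>carrier := i ` carrier Y\<rparr>)"
      using i by (auto intro!: mod_homI simp: mod_hom_add mod_hom_smult)
    show "inj_on i (carrier Y)" using pi by (rule inj_on_inverseI)
  qed simp
qed

lemma retract_direct_summand:
  fixes X :: "('a, 'a list) module"
  assumes "retract Y X" "left_module R X" "left_module R Y"
  shows "direct_summand R Y X"
proof -
  obtain i p where ip: "i \<in> mod_hom R Y X" "p \<in> mod_hom R X Y" "\<And>y. y \<in> carrier Y \<Longrightarrow> p (i y) = y"
    using assms(1) unfolding retract_def by auto
  show ?thesis unfolding direct_summand_def using retract_direct_decomp[OF assms(2,3) ip] by auto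
qed

subsection \<open>Fitting's lemma\<close>

lemma mod_hom_funpow: "g \<in> mod_hom R X X \<Longrightarrow> g ^^ n \<in> mod_hom R X X"
proof (induction n)
  case 0
  show ?case using mod_hom_id by (simp add: id_def)
next
  case (Suc n)
  show ?case using mod_hom_comp[OF Suc.IH[OF Suc.prems] Suc.prems] by (simp add: comp_def)
qed

text \<open>Kernels of powers grow and images shrink. Once both are stationary at \<open>m\<close>,
  the kernel meets the image trivially because the power \<open>2m\<close> has no larger kernel, and
  together they fill \<open>X\<close> because it has no smaller image.\<close>

lemma fitting:
  assumes X: "fg R X" and g: "g \<in> mod_hom R X X"
  shows "\<exists>m>0. direct_decomp R X {x \<in> carrier X. (g ^^ m) x = \<zero>\<^bsub>X\<^esub>} ((g ^^ m) ` carrier X) \<and>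
     inj_on g ((g ^^ m) ` carrier X) \<and> g ` ((g ^^ m) ` carrier X) = (g ^^ m) ` carrier X"
proof -
  note lm = fgD(1)[OF X]
  interpret X: left_module R X by fact
  define K where "K n = {x \<in> carrier X. (g ^^ n) x = \<zero>\<^bsub>X\<^esub>}" for n
  define J where "J n = (g ^^ n) ` carrier X" for n
  note gn = mod_hom_funpow[OF g]
  have sK: "submodule (K n) R X" for n unfolding K_def by (rule submodule_kernel[OF lm lm gn])
  have sJ: "submodule (J n) R X" for n unfolding J_def by (rule submodule_image[OF lm lm gn submodule_carrier[OF lm]])
  have g0: "g \<zero>\<^bsub>X\<^esub> = \<zero>\<^bsub>X\<^esub>" by (rule mod_hom_zero[OF lm lm g])
  have "\<exists>n. \<forall>m\<ge>n. K m = K n"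
  proof (rule chain_condD[OF fg_chain_cond[OF X, of True] sK])
    show "{\<zero>\<^bsub>X\<^esub>} \<subseteq> K n" "K n \<subseteq> carrier X" for n using sK[of n] by (auto simp: submodule_iff[OF lm])
    show "chain_le True (K n) (K (Suc n))" for n by (auto simp: K_def g0)
  qed
  then obtain n1 where n1: "\<And>m. m \<ge> n1 \<Longrightarrow> K m = K n1" by auto
  have "\<exists>n. \<forall>m\<ge>n. J m = J n"
  proof (rule chain_condD[OF fg_chain_cond[OF X, of False] sJ])
    show "{\<zero>\<^bsub>X\<^esub>} \<subseteq> J n" "J n \<subseteq> carrier X" for n using sJ[of n] by (auto simp: submodule_iff[OF lm])
    show "chain_le False (J n) (J (Suc n))" for n
    proof -
      have "(g ^^ Suc n) x \<in> J n" if "x \<in> carrier X" for x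
        unfolding J_def funpow_Suc_right using mod_hom_closed[OF g that] by (auto simp: comp_def)
      then show ?thesis by (auto simp: J_def simp del: funpow.simps)
    qed
  qed
  then obtain n2 where n2: "\<And>m. m \<ge> n2 \<Longrightarrow> J m = J n2" by auto
  \<comment> \<open>The successor makes \<open>m\<close> positive, as \<open>fin_cone_funpow\<close>
    will require, and lets the injectivity argument split off a factor \<open>g\<close>.\<close>
  define m where "m = Suc (max n1 n2)"
  have mm: "K (m + m) = K m" "J (m + m) = J m" "J (Suc m) = J m"
    using n1[of "m + m"] n1[of m] n2[of "m + m"] n2[of m] n2[of "Suc m"] by (auto simp: m_def)
  have int: "x = \<zero>\<^bsub>X\<^esub>" if xK: "x \<in> K m" and xJ: "x \<in> J m" for x
  proof -
    obtain y where y: "y \<in> carrier X" "x = (g ^^ m) y" using xJ by (auto simp: J_def)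
    have "y \<in> K (m + m)" using xK y by (simp add: K_def funpow_add)
    then show ?thesis unfolding mm using y(2) by (simp add: K_def)
  qed
  have dec: "direct_decomp R X (K m) (J m)"
  proof (rule direct_decompI[OF lm sK sJ _ int])
    fix x assume x: "x \<in> carrier X"
    have "(g ^^ m) x \<in> J (m + m)" unfolding mm(2) by (simp add: J_def x)
    then obtain y where y: "y \<in> carrier X" "(g ^^ m) x = (g ^^ m) ((g ^^ m) y)"
      by (auto simp: J_def funpow_add)
    have gy: "(g ^^ m) y \<in> carrier X" by (rule mod_hom_closed[OF gn y(1)])
    have "(g ^^ m) (x \<ominus>\<^bsub>X\<^esub> (g ^^ m) y) = \<zero>\<^bsub>X\<^esub>"
      using mod_hom_diff[OF lm lm gn x gy, of m] y(2) mod_hom_closed[OF gn x, of m] by (simp add: a_minus_def X.M.r_neg)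
    then have "x \<ominus>\<^bsub>X\<^esub> (g ^^ m) y \<in> K m" using x gy by (simp add: K_def)
    moreover have "(g ^^ m) y \<in> J m" using y(1) by (auto simp: J_def)
    moreover have "x = (x \<ominus>\<^bsub>X\<^esub> (g ^^ m) y) \<oplus>\<^bsub>X\<^esub> (g ^^ m) y"
      using x gy by (simp add: a_minus_def X.M.a_assoc X.M.l_neg)
    ultimately show "\<exists>h\<in>K m. \<exists>k\<in>J m. x = h \<oplus>\<^bsub>X\<^esub> k" by (rule_tac bexI, rule_tac bexI)
  qed
  have gJ: "g ` J m = J m"
  proof -
    have "g ` J m = J (Suc m)" unfolding J_def by (simp add: image_image)
    then show ?thesis using mm(3) by simp
  qed
  have JX: "x \<in> carrier X" if "x \<in> J m" for x using that sJ[of m] by (auto simp: submodule_iff[OF lm])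
  have inj: "inj_on g (J m)"
  proof -
    have lJ: "left_module R (X\<lparr>carrier := J m\<rparr>)" by (rule left_module_sub[OF lm sJ])
    have hJ: "g \<in> mod_hom R (X\<lparr>carrier := J m\<rparr>) X"
      using g JX by (auto intro!: mod_homI simp: mod_hom_closed mod_hom_add mod_hom_smult)
    have "x = \<zero>\<^bsub>X\<^esub>" if "x \<in> J m" "g x = \<zero>\<^bsub>X\<^esub>" for x
    proof (rule int[OF _ that(1)])
      have "(g ^^ n) \<zero>\<^bsub>X\<^esub> = \<zero>\<^bsub>X\<^esub>" for n by (rule mod_hom_zero[OF lm lm gn])
      then have "(g ^^ m) x = \<zero>\<^bsub>X\<^esub>" unfolding m_def funpow_Suc_right using that(2) by simp
      then show "x \<in> K m" using JX[OF that(1)] by (simp add: K_def)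
    qed
    then show ?thesis using inj_on_hom_iff[OF lJ lm hJ] by simp
  qed
  have "0 < m" by (simp add: m_def)
  with dec inj gJ show ?thesis unfolding K_def J_def by (intro exI conjI)
qed

lemma indecomposable_endo:
  assumes X: "fg R X" and ind: "indecomposable R X" and g: "g \<in> mod_hom R X X"
  shows "(\<exists>m. \<forall>x\<in>carrier X. (g ^^ m) x = \<zero>\<^bsub>X\<^esub>) \<or> (inj_on g (carrier X) \<and> g ` carrier X = carrier X)"
proof -
  note lm = fgD(1)[OF X]
  interpret X: left_module R X by fact
  obtain m where m: "direct_decomp R X {x \<in> carrier X. (g ^^ m) x = \<zero>\<^bsub>X\<^esub>} ((g ^^ m) ` carrier X)"
     "inj_on g ((g ^^ m) ` carrier X)" "g ` ((g ^^ m) ` carrier X) = (g ^^ m) ` carrier X"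
    using fitting[OF X g] by auto
  have "{x \<in> carrier X. (g ^^ m) x = \<zero>\<^bsub>X\<^esub>} = {\<zero>\<^bsub>X\<^esub>} \<or> (g ^^ m) ` carrier X = {\<zero>\<^bsub>X\<^esub>}"
    using ind m(1) unfolding indecomposable_def by simp
  then show ?thesis
  proof
    assume K: "{x \<in> carrier X. (g ^^ m) x = \<zero>\<^bsub>X\<^esub>} = {\<zero>\<^bsub>X\<^esub>}"
    have "carrier X \<subseteq> (g ^^ m) ` carrier X"
    proof
      fix x assume x: "x \<in> carrier X"
      obtain h k where hk: "h \<in> {x \<in> carrier X. (g ^^ m) x = \<zero>\<^bsub>X\<^esub>}" "k \<in> (g ^^ m) ` carrier X" "x = h \<oplus>\<^bsub>X\<^esub> k"
        using direct_decompD(3)[OF lm m(1) x] by auto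
      have "k \<in> carrier X" using hk(2) mod_hom_closed[OF mod_hom_funpow[OF g]] by auto
      then have "x = k" using hk(1,3) unfolding K by simp
      then show "x \<in> (g ^^ m) ` carrier X" using hk(2) by simp
    qed
    moreover have "(g ^^ m) ` carrier X \<subseteq> carrier X"
      by (rule image_subsetI) (rule mod_hom_closed[OF mod_hom_funpow[OF g]])
    ultimately have "(g ^^ m) ` carrier X = carrier X" by (rule subset_antisym[rotated])
    then show ?thesis using m(2,3) by simp
  next
    assume "(g ^^ m) ` carrier X = {\<zero>\<^bsub>X\<^esub>}"
    then have "\<forall>x\<in>carrier X. (g ^^ m) x = \<zero>\<^bsub>X\<^esub>" by (metis imageI singletonD)
    then show ?thesis by auto
  qed
qed

text \<open>The endomorphism ring is local. If \<open>g\<close> is not bijective, it is nilpotent by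
  Fitting's lemma. A vector killed by \<open>h\<close> is fixed by \<open>g\<close>, hence zero, so
  \<open>h\<close> is injective. An injective endomorphism of a nonzero module is not nilpotent,
  hence bijective.\<close>

lemma indecomposable_local:
  assumes X: "fg R X" and ind: "indecomposable R X" and g: "g \<in> mod_hom R X X" and h: "h \<in> mod_hom R X X"
    and sum: "\<And>x. x \<in> carrier X \<Longrightarrow> g x \<oplus>\<^bsub>X\<^esub> h x = x"
  shows "(inj_on g (carrier X) \<and> g ` carrier X = carrier X) \<or> (inj_on h (carrier X) \<and> h ` carrier X = carrier X)"
proof (rule disj_imp[THEN iffD2], rule impI)
  assume ng: "\<not> (inj_on g (carrier X) \<and> g ` carrier X = carrier X)"
  note lm = fgD(1)[OF X]
  interpret X: left_module R X by fact
  obtain m where m: "\<And>x. x \<in> carrier X \<Longrightarrow> (g ^^ m) x = \<zero>\<^bsub>X\<^esub>"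
    using indecomposable_endo[OF X ind g] ng by auto
  have "x = \<zero>\<^bsub>X\<^esub>" if "x \<in> carrier X" "h x = \<zero>\<^bsub>X\<^esub>" for x
  proof -
    have "g x = x" using sum[OF that(1)] that(2) mod_hom_closed[OF g that(1)] by simp
    then have "(g ^^ m) x = x" by (induction m) simp_all
    then show ?thesis using m[OF that(1)] by simp
  qed
  then have inj: "inj_on h (carrier X)" using inj_on_hom_iff[OF lm lm h] by simp
  have "\<not> (\<exists>m. \<forall>x\<in>carrier X. (h ^^ m) x = \<zero>\<^bsub>X\<^esub>)"
  proof
    assume "\<exists>m. \<forall>x\<in>carrier X. (h ^^ m) x = \<zero>\<^bsub>X\<^esub>"
    then obtain m where m: "\<forall>x\<in>carrier X. (h ^^ m) x = \<zero>\<^bsub>X\<^esub>" by auto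
    have "inj_on (h ^^ n) (carrier X)" for n
    proof (induction n)
      case (Suc n)
      have "inj_on h ((h ^^ n) ` carrier X)"
        by (rule inj_on_subset[OF inj]) (rule image_subsetI, rule mod_hom_closed[OF mod_hom_funpow[OF h]])
      from comp_inj_on[OF Suc this] show ?case by (simp only: funpow.simps)
    qed simp
    then have "\<forall>x\<in>carrier X. x = \<zero>\<^bsub>X\<^esub>"
      using m inj_on_hom_iff[OF lm lm mod_hom_funpow[OF h, of m]] by simp
    then have "carrier X = {\<zero>\<^bsub>X\<^esub>}" by auto
    then show False using ind by (simp add: indecomposable_def)
  qed
  with indecomposable_endo[OF X ind h] show "inj_on h (carrier X) \<and> h ` carrier X = carrier X"
    by blast
qed

text \<open>The identity of \<open>Y\<close> is the sum of an endomorphism that factors through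
  \<open>X\<close> and one that factors through \<open>Z\<close>. One of them is bijective, and its
  inverse corrects the projection to a retraction.\<close>

lemma indecomposable_retract_prodm:
  assumes Y: "fg R Y" and ind: "indecomposable R Y" and X: "left_module R X" and Z: "left_module R Z"
    and r: "retract Y (X \<times>\<^sub>M Z)"
  shows "retract Y X \<or> retract Y Z"
proof -
  note lm = fgD(1)[OF Y]
  interpret Y: left_module R Y by fact
  interpret X: left_module R X by fact
  interpret Z: left_module R Z by fact
  obtain i p where ip: "i \<in> mod_hom R Y (X \<times>\<^sub>M Z)" "p \<in> mod_hom R (X \<times>\<^sub>M Z) Y" "\<And>y. y \<in> carrier Y \<Longrightarrow> p (i y) = y"
    using r unfolding retract_def by auto
  have i1: "(\<lambda>y. fst (i y)) \<in> mod_hom R Y X" and i2: "(\<lambda>y. snd (i y)) \<in> mod_hom R Y Z"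
    by (rule mod_hom_comp[OF ip(1) mod_hom_fst], rule mod_hom_comp[OF ip(1) mod_hom_snd])
  have p1: "(\<lambda>x. p (x, \<zero>\<^bsub>Z\<^esub>)) \<in> mod_hom R X Y" and p2: "(\<lambda>z. p (\<zero>\<^bsub>X\<^esub>, z)) \<in> mod_hom R Z Y"
    by (rule mod_hom_comp[OF mod_hom_inl[OF Z] ip(2)], rule mod_hom_comp[OF mod_hom_inr[OF X] ip(2)])
  have main: "retract Y M" if "i' \<in> mod_hom R Y M" "p' \<in> mod_hom R M Y"
    "inj_on (\<lambda>y. p' (i' y)) (carrier Y)" "(\<lambda>y. p' (i' y)) ` carrier Y = carrier Y" for i' p' and M :: "('a, 'm) module"
  proof -
    let ?u = "inv_into (carrier Y) (\<lambda>y. p' (i' y))"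
    have u: "?u \<in> mod_hom R Y Y" by (rule inv_into_mod_hom[OF lm mod_hom_comp[OF that(1,2)] that(3,4)])
    show ?thesis unfolding retract_def
      by (rule bexI[OF bexI[OF _ mod_hom_comp[OF that(2) u]] that(1)]) (use inv_into_f_f[OF that(3)] in auto)
  qed
  have "p (fst (i y), \<zero>\<^bsub>Z\<^esub>) \<oplus>\<^bsub>Y\<^esub> p (\<zero>\<^bsub>X\<^esub>, snd (i y)) = y" if y: "y \<in> carrier Y" for y
  proof -
    have c: "i y \<in> carrier (X \<times>\<^sub>M Z)" by (rule mod_hom_closed[OF ip(1) y])
    then have "p (fst (i y), \<zero>\<^bsub>Z\<^esub>) \<oplus>\<^bsub>Y\<^esub> p (\<zero>\<^bsub>X\<^esub>, snd (i y)) = p ((fst (i y), \<zero>\<^bsub>Z\<^esub>) \<oplus>\<^bsub>X \<times>\<^sub>M Z\<^esub> (\<zero>\<^bsub>X\<^esub>, snd (i y)))"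
      by (intro mod_hom_add[OF ip(2), symmetric]) auto
    also have "(fst (i y), \<zero>\<^bsub>Z\<^esub>) \<oplus>\<^bsub>X \<times>\<^sub>M Z\<^esub> (\<zero>\<^bsub>X\<^esub>, snd (i y)) = i y" using c by (auto simp: prod_eq_iff)
    finally show ?thesis using ip(3)[OF y] by simp
  qed
  from indecomposable_local[OF Y ind mod_hom_comp[OF i1 p1] mod_hom_comp[OF i2 p2] this]
  show ?thesis using main[OF i1 p1] main[OF i2 p2] by auto
qed

lemma indecomposable_iso:
  assumes ind: "indecomposable R X" and h: "mod_iso R X Y" and X: "left_module R X" and Y: "left_module R Y"
  shows "indecomposable R Y"
proof -
  obtain f g where f: "f \<in> mod_hom R X Y" "g \<in> mod_hom R Y X"
    "\<And>x. x \<in> carrier X \<Longrightarrow> g (f x) = x" "\<And>y. y \<in> carrier Y \<Longrightarrow> f (g y) = y"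
    using mod_isoD[OF h X] by auto
  interpret X: left_module R X by fact
  interpret Y: left_module R Y by fact
  have z: "g y = \<zero>\<^bsub>X\<^esub> \<longleftrightarrow> y = \<zero>\<^bsub>Y\<^esub>" if "y \<in> carrier Y" for y
    using mod_hom_zero[OF Y X f(2)] mod_hom_zero[OF X Y f(1)] f(4)[OF that] by metis
  show ?thesis unfolding indecomposable_def
  proof (intro conjI allI impI)
    have "carrier X \<noteq> {\<zero>\<^bsub>X\<^esub>}" using ind unfolding indecomposable_def by simp
    then obtain x where x: "x \<in> carrier X" "x \<noteq> \<zero>\<^bsub>X\<^esub>" using X.M.zero_closed by blast
    have "f x \<noteq> \<zero>\<^bsub>Y\<^esub>" using f(3)[OF x(1)] x(2) mod_hom_zero[OF Y X f(2)] by metis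
    then show "carrier Y \<noteq> {\<zero>\<^bsub>Y\<^esub>}" using mod_hom_closed[OF f(1) x(1)] by auto
  next
    fix H K assume d: "direct_decomp R Y H K"
    note dd = direct_decompD[OF Y d]
    note s = dd(1,2)[unfolded submodule_iff[OF Y]]
    have "direct_decomp R X (g ` H) (g ` K)"
    proof (rule direct_decompI[OF X submodule_image[OF Y X f(2) dd(1)] submodule_image[OF Y X f(2) dd(2)]])
      fix x assume x: "x \<in> carrier X"
      obtain h k where hk: "h \<in> H" "k \<in> K" "f x = h \<oplus>\<^bsub>Y\<^esub> k" using dd(3)[OF mod_hom_closed[OF f(1) x]] by auto
      have c: "h \<in> carrier Y" "k \<in> carrier Y" using hk s by auto
      have "x = g (h \<oplus>\<^bsub>Y\<^esub> k)" using f(3)[OF x] hk(3) by simp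
      then have "x = g h \<oplus>\<^bsub>X\<^esub> g k" using mod_hom_add[OF f(2) c] by simp
      then show "\<exists>h\<in>g ` H. \<exists>k\<in>g ` K. x = h \<oplus>\<^bsub>X\<^esub> k" using hk(1,2)
        by (intro bexI[of _ "g h"] bexI[of _ "g k"]) auto
    next
      fix x assume xH: "x \<in> g ` H" and xK: "x \<in> g ` K"
      from xH obtain h where h: "x = g h" "h \<in> H" by (rule imageE)
      from xK obtain k where k: "x = g k" "k \<in> K" by (rule imageE)
      have hk: "h \<in> H" "k \<in> K" "x = g h" "g h = g k" using h k by simp_all
      have c: "h \<in> carrier Y" "k \<in> carrier Y" using hk s by auto
      have "h = k" using f(4)[OF c(1)] f(4)[OF c(2)] hk(4) by metis
      then have "h = \<zero>\<^bsub>Y\<^esub>" using dd(4) hk by simp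
      then show "x = \<zero>\<^bsub>X\<^esub>" using hk(3) z[OF c(1)] by simp
    qed
    then have gHK: "g ` H = {\<zero>\<^bsub>X\<^esub>} \<or> g ` K = {\<zero>\<^bsub>X\<^esub>}"
      by (rule ind[unfolded indecomposable_def, THEN conjunct2, rule_format])
    have Lz: "L = {\<zero>\<^bsub>Y\<^esub>}" if gL: "g ` L = {\<zero>\<^bsub>X\<^esub>}" and L: "L \<subseteq> carrier Y" "\<zero>\<^bsub>Y\<^esub> \<in> L" for L
    proof -
      have "y = \<zero>\<^bsub>Y\<^esub>" if y: "y \<in> L" for y
      proof -
        have "g y \<in> g ` L" using y by (rule imageI)
        then have "g y = \<zero>\<^bsub>X\<^esub>" unfolding gL by simp
        then show ?thesis using z[OF subsetD[OF L(1) y]] by simp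
      qed
      then show ?thesis using L(2) by (rule eq_singletonI)
    qed
    have "H \<subseteq> carrier Y" "\<zero>\<^bsub>Y\<^esub> \<in> H" "K \<subseteq> carrier Y" "\<zero>\<^bsub>Y\<^esub> \<in> K" using s by simp_all
    then show "H = {\<zero>\<^bsub>Y\<^esub>} \<or> K = {\<zero>\<^bsub>Y\<^esub>}" using gHK Lz[of H] Lz[of K] by fast
  qed
qed

lemma indecomposable_retract_iso:
  assumes indX: "indecomposable R X" and indY: "indecomposable R Y"
    and X: "left_module R X" and Y: "left_module R Y" and r: "retract Y X"
  shows "mod_iso R Y X"
proof -
  interpret X: left_module R X by fact
  obtain i p where ip: "i \<in> mod_hom R Y X" "p \<in> mod_hom R X Y" "\<And>y. y \<in> carrier Y \<Longrightarrow> p (i y) = y"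
    using r unfolding retract_def by auto
  note d = retract_direct_decomp[OF X Y ip]
  have "i ` carrier Y \<noteq> {\<zero>\<^bsub>X\<^esub>}"
  proof
    assume a: "i ` carrier Y = {\<zero>\<^bsub>X\<^esub>}"
    have "y = \<zero>\<^bsub>Y\<^esub>" if y: "y \<in> carrier Y" for y
    proof -
      have "i y \<in> i ` carrier Y" using y by (rule imageI)
      then have "i y = \<zero>\<^bsub>X\<^esub>" unfolding a by simp
      then show ?thesis using ip(3)[OF y] mod_hom_zero[OF X Y ip(2)] by simp
    qed
    moreover have "\<zero>\<^bsub>Y\<^esub> \<in> carrier Y" using submodule_carrier[OF Y] unfolding submodule_iff[OF Y] by simp
    ultimately have "carrier Y = {\<zero>\<^bsub>Y\<^esub>}" by (rule eq_singletonI)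
    then show False using indY by (simp add: indecomposable_def)
  qed
  then have K: "{x \<in> carrier X. p x = \<zero>\<^bsub>Y\<^esub>} = {\<zero>\<^bsub>X\<^esub>}"
    using indX d(1) unfolding indecomposable_def by auto
  have "i ` carrier Y = carrier X"
  proof
    show "i ` carrier Y \<subseteq> carrier X" by (rule image_subsetI) (rule mod_hom_closed[OF ip(1)])
    show "carrier X \<subseteq> i ` carrier Y"
    proof
      fix x assume x: "x \<in> carrier X"
      obtain h k where hk: "h \<in> i ` carrier Y" "k \<in> {x \<in> carrier X. p x = \<zero>\<^bsub>Y\<^esub>}" "x = h \<oplus>\<^bsub>X\<^esub> k"
        using direct_decompD(3)[OF X d(1) x] by auto
      have "h \<in> carrier X" using hk(1) mod_hom_closed[OF ip(1)] by auto
      then have "x = h" using hk(2,3) unfolding K by simp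
      then show "x \<in> i ` carrier Y" using hk(1) by simp
    qed
  qed
  then show ?thesis using d(2) by simp
qed

subsection \<open>Direct sums of lists of modules\<close>

text \<open>Each binary product is brought back to lists by \<open>rep\<close>; otherwise the type
  would grow with the number of summands.\<close>

primrec dl :: "('a, 'a list) module list \<Rightarrow> ('a, 'a list) module" where
  "dl [] = freem 0"
| "dl (M # Ms) = rep R (M \<times>\<^sub>M dl Ms)"

lemma fg_dl: "(\<And>M. M \<in> set Ms \<Longrightarrow> fg R M) \<Longrightarrow> fg R (dl Ms)"
  by (induction Ms) (auto simp: fg_freem intro!: rep(1) fg_prodm)

lemma dl_Cons:
  assumes "fg R M" "\<And>M. M \<in> set Ms \<Longrightarrow> fg R M"
  shows "mod_iso R (dl (M # Ms)) (M \<times>\<^sub>M dl Ms)" "mod_iso R (M \<times>\<^sub>M dl Ms) (dl (M # Ms))"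
  unfolding dl.simps by (rule rep(3)[OF fg_prodm[OF assms(1) fg_dl[OF assms(2)]]], simp)
    (rule rep(2)[OF fg_prodm[OF assms(1) fg_dl[OF assms(2)]]], simp)

lemma dl_cong:
  assumes "list_all2 (mod_iso R) Ms Ns" "\<And>M. M \<in> set Ms \<Longrightarrow> fg R M" "\<And>M. M \<in> set Ns \<Longrightarrow> fg R M"
  shows "mod_iso R (dl Ms) (dl Ns)"
  using assms
proof (induction rule: list_all2_induct)
  case Nil
  show ?case by (rule mod_iso_refl)
next
  case (Cons M Ms N Ns)
  have 1: "fg R M" "\<And>M. M \<in> set Ms \<Longrightarrow> fg R M" and 2: "fg R N" "\<And>M. M \<in> set Ns \<Longrightarrow> fg R M"
    using Cons.prems by auto
  show ?case
    by (rule mod_iso_trans[OF dl_Cons(1)[OF 1] mod_iso_trans[OF mod_iso_prodm[OF Cons.hyps(1)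
            Cons.IH[OF 1(2) 2(2)] fgD(1)[OF 1(1)] fgD(1)[OF fg_dl[OF 1(2)]]] dl_Cons(2)[OF 2]]])
qed

lemma dl_append:
  assumes "\<And>M. M \<in> set Ms \<Longrightarrow> fg R M" "\<And>M. M \<in> set Ns \<Longrightarrow> fg R M"
  shows "mod_iso R (dl (Ms @ Ns)) (dl Ms \<times>\<^sub>M dl Ns)"
  using assms(1)
proof (induction Ms)
  case Nil
  have l: "left_module R (dl Ns)" by (rule fgD(1)[OF fg_dl[OF assms(2)]])
  show ?case using mod_iso_trans[OF mod_iso_prodm_freem0(2)[OF l] mod_iso_prodm_comm] by simp
next
  case (Cons M Ms)
  have M: "fg R M" "\<And>M. M \<in> set Ms \<Longrightarrow> fg R M" using Cons.prems by auto
  have MN: "\<And>M. M \<in> set (Ms @ Ns) \<Longrightarrow> fg R M" using M assms(2) by auto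
  note l = fgD(1)[OF fg_dl[OF assms(2)]] fgD(1)[OF fg_dl[OF M(2)]] fgD(1)[OF M(1)] fgD(1)[OF fg_dl[OF MN]]
  have "mod_iso R (dl (M # Ms @ Ns)) (M \<times>\<^sub>M dl (Ms @ Ns))" by (rule dl_Cons(1)[OF M(1) MN])
  from mod_iso_trans[OF this mod_iso_prodm[OF mod_iso_refl Cons.IH[OF M(2)] l(3,4)]]
  have "mod_iso R (dl (M # Ms @ Ns)) (M \<times>\<^sub>M dl Ms \<times>\<^sub>M dl Ns)" .
  from mod_iso_trans[OF this mod_iso_prodm_assoc']
  have "mod_iso R (dl (M # Ms @ Ns)) ((M \<times>\<^sub>M dl Ms) \<times>\<^sub>M dl Ns)" .
  from mod_iso_trans[OF this mod_iso_prodm[OF dl_Cons(2)[OF M] mod_iso_refl left_module_prodm[OF l(3,2)] l(1)]]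
  show ?case by simp
qed

text \<open>Turns an equality of multisets of summands, as delivered by the count of multiplicities,
  into an isomorphism of modules.\<close>

lemma dl_perm:
  assumes "mset Ms = mset Ns" "\<And>M. M \<in> set Ms \<Longrightarrow> fg R M"
  shows "mod_iso R (dl Ms) (dl Ns)"
  using assms
proof (induction Ms arbitrary: Ns)
  case Nil
  then show ?case by (simp add: mod_iso_refl)
next
  case (Cons M Ms)
  have M: "fg R M" "\<And>M. M \<in> set Ms \<Longrightarrow> fg R M" using Cons.prems by auto
  have "M \<in> set Ns" using Cons.prems(1) by (metis list.set_intros(1) set_mset_mset)
  then obtain As Bs where Ns: "Ns = As @ M # Bs" by (metis split_list)
  have ms: "mset Ms = mset (As @ Bs)" using Cons.prems(1) by (simp add: Ns)
  then have "set Ms = set As \<union> set Bs" by (metis set_append set_mset_mset)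
  then have AB: "\<And>M. M \<in> set As \<Longrightarrow> fg R M" "\<And>M. M \<in> set Bs \<Longrightarrow> fg R M" "\<And>M. M \<in> set (As @ Bs) \<Longrightarrow> fg R M"
    "\<And>X. X \<in> set (M # Bs) \<Longrightarrow> fg R X"
    using M by auto
  note l = fgD(1)[OF M(1)] fgD(1)[OF fg_dl[OF AB(1)]] fgD(1)[OF fg_dl[OF AB(2)]] fgD(1)[OF fg_dl[OF M(2)]]
     fgD(1)[OF fg_dl[OF AB(3)]] fgD(1)[OF fg_dl[OF AB(4)]]
  have "mod_iso R (dl (M # Ms)) (M \<times>\<^sub>M dl (As @ Bs))"
    by (rule mod_iso_trans[OF dl_Cons(1)[OF M] mod_iso_prodm[OF mod_iso_refl Cons.IH[OF ms M(2)] l(1,4)]])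
  from mod_iso_trans[OF this mod_iso_prodm[OF mod_iso_refl dl_append[OF AB(1,2)] l(1,5)]]
  have "mod_iso R (dl (M # Ms)) (M \<times>\<^sub>M dl As \<times>\<^sub>M dl Bs)" .
  from mod_iso_trans[OF this mod_iso_trans[OF mod_iso_prodm_assoc' mod_iso_prodm[OF mod_iso_prodm_comm
       mod_iso_refl left_module_prodm[OF l(1,2)] l(3)]]]
  have "mod_iso R (dl (M # Ms)) ((dl As \<times>\<^sub>M M) \<times>\<^sub>M dl Bs)" .
  from mod_iso_trans[OF this mod_iso_prodm_assoc]
  have "mod_iso R (dl (M # Ms)) (dl As \<times>\<^sub>M M \<times>\<^sub>M dl Bs)" .
  from mod_iso_trans[OF this mod_iso_prodm[OF mod_iso_refl dl_Cons(2)[OF M(1) AB(2)] l(2) left_module_prodm[OF l(1,3)]]]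
  have "mod_iso R (dl (M # Ms)) (dl As \<times>\<^sub>M dl (M # Bs))" .
  from mod_iso_trans[OF this mod_iso_sym[OF dl_append[OF AB(1,4)] fgD(1)[OF fg_dl]]]
  show ?case unfolding Ns using M(1) AB by auto
qed

lemma retract_dl:
  assumes "M \<in> set Ms" "\<And>M. M \<in> set Ms \<Longrightarrow> fg R M"
  shows "retract M (dl Ms)"
  using assms
proof (induction Ms)
  case (Cons N Ms)
  have N: "fg R N" "\<And>M. M \<in> set Ms \<Longrightarrow> fg R M" using Cons.prems(2) by auto
  note l = fgD(1)[OF N(1)] fgD(1)[OF fg_dl[OF N(2)]]
  have i: "retract (N \<times>\<^sub>M dl Ms) (dl (N # Ms))"
    by (rule retract_iso[OF dl_Cons(2)[OF N] left_module_prodm[OF l]])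
  show ?case
  proof (cases "M = N")
    case True
    show ?thesis unfolding True by (rule retract_trans[OF retract_prodm(1)[OF l] i])
  next
    case False
    then have "retract M (dl Ms)" using Cons.IH[OF _ N(2)] Cons.prems(1) by simp
    then show ?thesis by (rule retract_trans[OF _ retract_trans[OF retract_prodm(2)[OF l] i]])
  qed
qed simp

lemma indecomposable_retract_dl:
  assumes Y: "fg R Y" and ind: "indecomposable R Y" and r: "retract Y (dl Ms)"
    and Ms: "\<And>M. M \<in> set Ms \<Longrightarrow> fg R M"
  shows "\<exists>M\<in>set Ms. retract Y M"
  using r Ms
proof (induction Ms)
  case Nil
  have lY: "left_module R Y" by (rule fgD(1)[OF Y])
  obtain i p where ip: "i \<in> mod_hom R Y (freem 0)" "p \<in> mod_hom R (freem 0) Y" "\<And>y. y \<in> carrier Y \<Longrightarrow> p (i y) = y"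
    using Nil(1) unfolding retract_def by auto
  have "y = \<zero>\<^bsub>Y\<^esub>" if y: "y \<in> carrier Y" for y
  proof -
    have "i y = \<zero>\<^bsub>freem 0\<^esub>" using mod_hom_closed[OF ip(1) y] by simp
    then show ?thesis using ip(3)[OF y] mod_hom_zero[OF left_module_freem lY ip(2)] by simp
  qed
  then have "carrier Y = {\<zero>\<^bsub>Y\<^esub>}" using fg_zero_closed[OF Y] by (rule eq_singletonI)
  then show ?case using ind by (simp add: indecomposable_def)
next
  case (Cons N Ms)
  have N: "fg R N" "\<And>M. M \<in> set Ms \<Longrightarrow> fg R M" using Cons.prems(2) by auto
  note l = fgD(1)[OF N(1)] fgD(1)[OF fg_dl[OF N(2)]]
  have "retract Y (N \<times>\<^sub>M dl Ms)"
    by (rule retract_trans[OF Cons.prems(1) retract_iso[OF dl_Cons(1)[OF N] fgD(1)[OF fg_dl[OF Cons.prems(2)]]]])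
  from indecomposable_retract_prodm[OF Y ind l this]
  have "retract Y N \<or> retract Y (dl Ms)" .
  then show ?case using Cons.IH[OF _ N(2)] by auto
qed

text \<open>A minimal submodule without a decomposition would be indecomposable, since
  decompositions of two proper summands could be concatenated. But an indecomposable module is its
  own decomposition.\<close>

lemma ex_decomposition:
  assumes X: "fg R X"
  shows "\<exists>Ms. (\<forall>M\<in>set Ms. fg R M \<and> indecomposable R M \<and> retract M X) \<and> mod_iso R X (dl Ms)"
proof -
  note lm = fgD(1)[OF X]
  let ?Q = "\<lambda>H Ms. (\<forall>M\<in>set Ms. fg R M \<and> indecomposable R M) \<and> mod_iso R (X\<lparr>carrier := H\<rparr>) (dl Ms)"
  let ?S = "{H. submodule H R X \<and> \<not> (\<exists>Ms. ?Q H Ms)}"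
  have "?S = {}"
  proof (rule ccontr)
    assume "?S \<noteq> {}"
    then have "\<exists>H\<in>?S. \<forall>K\<in>?S. K \<subseteq> H \<longrightarrow> K = H"
    proof (rule chain_cond_minimal[OF fg_chain_cond[OF X]])
      fix H assume "H \<in> ?S"
      then show "submodule H R X \<and> {\<zero>\<^bsub>X\<^esub>} \<subseteq> H \<and> H \<subseteq> carrier X" by (simp add: submodule_iff[OF lm])
    qed
    then obtain H where HS: "H \<in> ?S" and min: "\<forall>K\<in>?S. K \<subseteq> H \<longrightarrow> K = H" by (rule bexE)
    have H: "submodule H R X" and nH: "\<And>Ms. \<not> ?Q H Ms" using HS by auto
    let ?H = "X\<lparr>carrier := H\<rparr>"
    have fH: "fg R ?H" by (rule fg_submodule[OF X H])
    note lH = fgD(1)[OF fH]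
    have "indecomposable R ?H" unfolding indecomposable_def
    proof (intro conjI allI impI)
      show "carrier ?H \<noteq> {\<zero>\<^bsub>?H\<^esub>}"
      proof
        assume z: "carrier ?H = {\<zero>\<^bsub>?H\<^esub>}"
        have "mod_iso R ?H (?H \<times>\<^sub>M freem 0)" by (rule mod_iso_prodm_freem0(2)[OF lH])
        from mod_iso_trans[OF this mod_iso_trans[OF mod_iso_prodm_comm mod_iso_prodm_zero[OF left_module_freem lH z]]]
        have "?Q H []" by simp
        then show False using nH by blast
      qed
    next
      fix H1 H2 assume d: "direct_decomp R ?H H1 H2"
      note dd = direct_decompD[OF lH d]
      have s: "submodule H1 R X" "submodule H2 R X" "H1 \<subseteq> H" "H2 \<subseteq> H"
        using dd(1,2) submodule_sub_iff[OF lm H] by auto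
      show "H1 = {\<zero>\<^bsub>?H\<^esub>} \<or> H2 = {\<zero>\<^bsub>?H\<^esub>}"
      proof (rule ccontr)
        assume a: "\<not> ?thesis"
        have "H1 \<noteq> H"
        proof
          assume "H1 = H"
          then have "H2 = {\<zero>\<^bsub>?H\<^esub>}" using dd(4) s(4) dd(2) unfolding submodule_iff[OF lH] by auto
          then show False using a by simp
        qed
        moreover have "H2 \<noteq> H"
        proof
          assume "H2 = H"
          then have "H1 = {\<zero>\<^bsub>?H\<^esub>}" using dd(4) s(3) dd(1) unfolding submodule_iff[OF lH] by auto
          then show False using a by simp
        qed
        ultimately have "H1 \<notin> ?S" "H2 \<notin> ?S" using min s by auto
        then obtain Ms Ns where 1: "?Q H1 Ms" and 2: "?Q H2 Ns" using s by auto
        have f: "\<And>M. M \<in> set Ms \<Longrightarrow> fg R M" "\<And>M. M \<in> set Ns \<Longrightarrow> fg R M"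
          "\<And>M. M \<in> set (Ms @ Ns) \<Longrightarrow> fg R M" using 1 2 by auto
        have i: "mod_iso R (X\<lparr>carrier := H1\<rparr> \<times>\<^sub>M X\<lparr>carrier := H2\<rparr>) ?H"
          using direct_decomp_iso[OF fH d] by simp
        have l: "left_module R (X\<lparr>carrier := H1\<rparr>)" "left_module R (X\<lparr>carrier := H2\<rparr>)"
          using left_module_sub[OF lm] s by auto
        have "mod_iso R ?H (X\<lparr>carrier := H1\<rparr> \<times>\<^sub>M X\<lparr>carrier := H2\<rparr>)"
          by (rule mod_iso_sym[OF i left_module_prodm[OF l]])
        from mod_iso_trans[OF this mod_iso_prodm[OF 1[THEN conjunct2] 2[THEN conjunct2] l]]
        have "mod_iso R ?H (dl Ms \<times>\<^sub>M dl Ns)" .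
        from mod_iso_trans[OF this mod_iso_sym[OF dl_append[OF f(1,2)] fgD(1)[OF fg_dl[OF f(3)]]]]
        have "mod_iso R ?H (dl (Ms @ Ns))" by simp
        then have "?Q H (Ms @ Ns)" using 1 2 by auto
        then show False using nH by blast
      qed
    qed
    moreover have "indecomposable R (rep R ?H)"
      by (rule indecomposable_iso[OF calculation rep(2)[OF fH] lH fgD(1)[OF rep(1)[OF fH]]])
    moreover have "mod_iso R ?H (dl [rep R ?H])"
      by (rule mod_iso_trans[OF rep(2)[OF fH] mod_iso_trans[OF
            mod_iso_prodm_freem0(2)[OF fgD(1)[OF rep(1)[OF fH]]] dl_Cons(2)[of _ "[]", unfolded dl.simps(1)]]])
        (auto simp: rep(1)[OF fH])
    ultimately have "?Q H [rep R ?H]" using rep(1)[OF fH] by auto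
    then show False using nH by blast
  qed
  moreover have "submodule (carrier X) R X" by (rule submodule_carrier[OF lm])
  ultimately obtain Ms where Ms: "\<forall>M\<in>set Ms. fg R M \<and> indecomposable R M" "mod_iso R X (dl Ms)" by auto
  have "retract M X" if "M \<in> set Ms" for M
    by (rule retract_trans[OF retract_dl[OF that] retract_iso[OF mod_iso_sym[OF Ms(2) lm] fgD(1)[OF fg_dl]]])
      (use Ms(1) in auto)
  then show ?thesis using Ms by auto
qed

end

section \<open>Stable fibres of endomorphisms\<close>

lemma carrier_carrier_update: "carrier (M\<lparr>carrier := H\<rparr>) = H"
  by simp

context finite_length_ring
begin

lemma pd_fin_iso: "pd_fin X \<Longrightarrow> mod_iso R X Y \<Longrightarrow> left_module R Y \<Longrightarrow> pd_fin Y"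
  unfolding pd_fin_def by (elim exE) (rule exI, rule pd_iso)

lemma pd_fin_fg: "pd_fin X \<Longrightarrow> fg R X"
  unfolding pd_fin_def by (elim exE) (rule pd_fg)

lemma pd_fin_pj: "pj X \<Longrightarrow> pd_fin X"
  unfolding pd_fin_def pd_0[symmetric] by (rule exI)

definition fibre ::
  "('a, 'b) module \<Rightarrow> ('b \<Rightarrow> 'b) \<Rightarrow> ('a, 'c) module \<Rightarrow> ('c \<Rightarrow> 'b) \<Rightarrow> ('a, 'b \<times> 'c) module" where
  "fibre X g P q = (X \<times>\<^sub>M P)\<lparr>carrier := {w \<in> carrier (X \<times>\<^sub>M P). g (fst w) \<oplus>\<^bsub>X\<^esub> q (snd w) = \<zero>\<^bsub>X\<^esub>}\<rparr>"

lemma carrier_fibre: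
  "carrier (fibre X g P q) = {w \<in> carrier (X \<times>\<^sub>M P). g (fst w) \<oplus>\<^bsub>X\<^esub> q (snd w) = \<zero>\<^bsub>X\<^esub>}"
  by (simp add: fibre_def)

lemma fibre_ops [simp]:
  "\<zero>\<^bsub>fibre X g P q\<^esub> = (\<zero>\<^bsub>X\<^esub>, \<zero>\<^bsub>P\<^esub>)"
  "u \<oplus>\<^bsub>fibre X g P q\<^esub> v = (fst u \<oplus>\<^bsub>X\<^esub> fst v, snd u \<oplus>\<^bsub>P\<^esub> snd v)"
  "a \<odot>\<^bsub>fibre X g P q\<^esub> u = (a \<odot>\<^bsub>X\<^esub> fst u, a \<odot>\<^bsub>P\<^esub> snd u)"
  by (simp_all add: fibre_def)

text \<open>
  \<open>fin_cone X g\<close> says that the cone of \<open>g\<close> in the stable category has finite projective dimension;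
  the cone is represented by the kernel of a surjection \<open>(g, q)\<close> from \<open>X \<oplus> P\<close> with \<open>P\<close> projective.
\<close>

definition fin_cone :: "('a, 'b) module \<Rightarrow> ('b \<Rightarrow> 'b) \<Rightarrow> bool" where
  "fin_cone X g \<longleftrightarrow> (\<exists>(P :: ('a, 'a list) module) q. projective R P \<and> q \<in> mod_hom R P X \<and>
     (\<forall>x\<in>carrier X. \<exists>y\<in>carrier X. \<exists>a\<in>carrier P. x = g y \<oplus>\<^bsub>X\<^esub> q a) \<and> pd_fin (fibre X g P q))"

lemma fibre_hom:
  assumes "left_module R X" "g \<in> mod_hom R X X" "q \<in> mod_hom R P X"
  shows "(\<lambda>w. g (fst w) \<oplus>\<^bsub>X\<^esub> q (snd w)) \<in> mod_hom R (X \<times>\<^sub>M P) X"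
  by (intro mod_hom_plus[OF assms(1)] mod_hom_comp[OF mod_hom_fst assms(2)] mod_hom_comp[OF mod_hom_snd assms(3)])

lemma fg_fibre:
  assumes "fg R X" "g \<in> mod_hom R X X" "fg R P" "q \<in> mod_hom R P X"
  shows "fg R (fibre X g P q)"
proof -
  note l = fgD(1)[OF assms(1)] fgD(1)[OF assms(3)]
  show ?thesis unfolding fibre_def
    by (rule fg_submodule[OF fg_prodm[OF assms(1,3)] submodule_kernel[OF left_module_prodm[OF l] l(1)
          fibre_hom[OF l(1) assms(2,4)]]])
qed

lemma fin_coneI:
  assumes X: "fg R X" and g: "g \<in> mod_hom R X X" and P: "pj P" and q: "q \<in> mod_hom R P X"
    and surj: "\<And>x. x \<in> carrier X \<Longrightarrow> \<exists>y\<in>carrier X. \<exists>a\<in>carrier P. x = g y \<oplus>\<^bsub>X\<^esub> q a"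
    and fin: "pd_fin (fibre X g P q)"
  shows "fin_cone X g"
proof -
  note fP = pj_fg[OF P]
  obtain a b where ab: "a \<in> mod_hom R P (rep R P)" "b \<in> mod_hom R (rep R P) P"
    "\<And>x. x \<in> carrier P \<Longrightarrow> b (a x) = x" "\<And>y. y \<in> carrier (rep R P) \<Longrightarrow> a (b y) = y"
    using mod_isoD[OF rep(2)[OF fP] fgD(1)[OF fP]] by auto
  have qb: "(\<lambda>x. q (b x)) \<in> mod_hom R (rep R P) X" by (rule mod_hom_comp[OF ab(2) q])
  note ac = mod_hom_closed[OF ab(1)] and bc = mod_hom_closed[OF ab(2)]
  have "mod_iso R (fibre X g P q) (fibre X g (rep R P) (\<lambda>x. q (b x)))"
  proof (rule mod_isoI2)
    show "(\<lambda>w. (fst w, a (snd w))) \<in> mod_hom R (fibre X g P q) (fibre X g (rep R P) (\<lambda>x. q (b x)))"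
      by (rule mod_homI) (auto simp: carrier_fibre ac ab(3) mod_hom_add[OF ab(1)] mod_hom_smult[OF ab(1)])
    show "(\<lambda>w. (fst w, b (snd w))) \<in> mod_hom R (fibre X g (rep R P) (\<lambda>x. q (b x))) (fibre X g P q)"
      by (rule mod_homI) (auto simp: carrier_fibre bc mod_hom_add[OF ab(2)] mod_hom_smult[OF ab(2)])
  qed (auto simp: carrier_fibre ab(3,4))
  then have "pd_fin (fibre X g (rep R P) (\<lambda>x. q (b x)))"
    by (rule pd_fin_iso[OF fin _ fgD(1)[OF fg_fibre[OF X g rep(1)[OF fP] qb]]])
  moreover have "\<exists>y\<in>carrier X. \<exists>c\<in>carrier (rep R P). x = g y \<oplus>\<^bsub>X\<^esub> q (b c)" if x: "x \<in> carrier X" for x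
  proof -
    obtain y c where yc: "y \<in> carrier X" "c \<in> carrier P" "x = g y \<oplus>\<^bsub>X\<^esub> q c" using surj[OF x] by auto
    show ?thesis
      by (rule bexI[OF bexI[OF _ ac[OF yc(2)]] yc(1)]) (simp add: ab(3)[OF yc(2)] yc(3))
  qed
  ultimately show ?thesis unfolding fin_cone_def using pj_rep[OF P] qb
    by (intro exI[of _ "rep R P"] exI[of _ "\<lambda>x. q (b x)"] conjI ballI)
qed

text \<open>As in the octahedral axiom, the fibre of the composite maps onto the fibre of
  \<open>g\<close> with kernel the fibre of \<open>h\<close>, and finite projective dimension is
  inherited by extensions.\<close>

lemma fin_cone_comp:
  assumes X: "fg R X" and g: "g \<in> mod_hom R X X" and h: "h \<in> mod_hom R X X"
    and cg: "fin_cone X g" and ch: "fin_cone X h"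
  shows "fin_cone X (\<lambda>x. g (h x))"
proof -
  note lX = fgD(1)[OF X]
  interpret X: left_module R X by fact
  obtain P q where P: "projective R P" "q \<in> mod_hom R P X"
    "\<And>x. x \<in> carrier X \<Longrightarrow> \<exists>y\<in>carrier X. \<exists>a\<in>carrier P. x = g y \<oplus>\<^bsub>X\<^esub> q a" "pd_fin (fibre X g P q)"
    using cg unfolding fin_cone_def by auto
  obtain T r where T: "projective R T" "r \<in> mod_hom R T X"
    "\<And>x. x \<in> carrier X \<Longrightarrow> \<exists>y\<in>carrier X. \<exists>a\<in>carrier T. x = h y \<oplus>\<^bsub>X\<^esub> r a" "pd_fin (fibre X h T r)"
    using ch unfolding fin_cone_def by auto
  note fP = projective_fg[OF P(1)] and fT = projective_fg[OF T(1)]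
  interpret P: left_module R P by (rule fgD(1)[OF fP])
  interpret T: left_module R T by (rule fgD(1)[OF fT])
  note gc = mod_hom_closed[OF g] and hc = mod_hom_closed[OF h] and qc = mod_hom_closed[OF P(2)] and rc = mod_hom_closed[OF T(2)]
  \<comment> \<open>Chosen so that \<open>(x, a, b)\<close> has the same value as
    \<open>(h x + r a, b)\<close> under \<open>g\<close> and \<open>q\<close>; this makes
    \<open>?t\<close> a map between the fibres.\<close>
  let ?s = "\<lambda>w. g (r (fst w)) \<oplus>\<^bsub>X\<^esub> q (snd w)"
  have s: "?s \<in> mod_hom R (T \<times>\<^sub>M P) X"
    by (intro mod_hom_plus[OF lX] mod_hom_comp[OF mod_hom_comp[OF mod_hom_fst T(2)] g] mod_hom_comp[OF mod_hom_snd P(2)])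
  have gh: "(\<lambda>x. g (h x)) \<in> mod_hom R X X" by (rule mod_hom_comp[OF h g])
  have ghr: "g (h x \<oplus>\<^bsub>X\<^esub> r a) \<oplus>\<^bsub>X\<^esub> q b = g (h x) \<oplus>\<^bsub>X\<^esub> (g (r a) \<oplus>\<^bsub>X\<^esub> q b)"
    if "x \<in> carrier X" "a \<in> carrier T" "b \<in> carrier P" for x a b
    using that by (simp add: mod_hom_add[OF g] gc hc qc rc X.M.a_assoc)
  let ?F = "fibre X (\<lambda>x. g (h x)) (T \<times>\<^sub>M P) ?s" and ?G = "fibre X g P q" and ?H = "fibre X h T r"
  have fTP: "fg R (T \<times>\<^sub>M P)" by (rule fg_prodm[OF fT fP])
  have fF: "fg R ?F" by (rule fg_fibre[OF X gh fTP s])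
  have fG: "fg R ?G" by (rule fg_fibre[OF X g fP P(2)])
  have fH: "fg R ?H" by (rule fg_fibre[OF X h fT T(2)])
  let ?t = "\<lambda>w. (h (fst w) \<oplus>\<^bsub>X\<^esub> r (fst (snd w)), snd (snd w))"
  have t: "?t \<in> mod_hom R ?F ?G"
  proof (rule mod_homI)
    show "?t w \<in> carrier ?G" if "w \<in> carrier ?F" for w
      using that by (auto simp: carrier_fibre hc rc ghr)
    show "?t (u \<oplus>\<^bsub>?F\<^esub> v) = ?t u \<oplus>\<^bsub>?G\<^esub> ?t v" if "u \<in> carrier ?F" "v \<in> carrier ?F" for u v
      using that by (auto simp: carrier_fibre hc rc mod_hom_add[OF h] mod_hom_add[OF T(2)] X.M.a_ac)
    show "?t (a \<odot>\<^bsub>?F\<^esub> u) = a \<odot>\<^bsub>?G\<^esub> ?t u" if "a \<in> carrier R" "u \<in> carrier ?F" for a u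
      using that by (auto simp: carrier_fibre hc rc mod_hom_smult[OF h] mod_hom_smult[OF T(2)] X.smult_r_distr)
  qed
  have ts: "?t ` carrier ?F = carrier ?G"
  proof
    show "?t ` carrier ?F \<subseteq> carrier ?G" by (rule image_subsetI) (rule mod_hom_closed[OF t])
    show "carrier ?G \<subseteq> ?t ` carrier ?F"
    proof
      fix v assume "v \<in> carrier ?G"
      then obtain y b where v: "v = (y, b)" "y \<in> carrier X" "b \<in> carrier P" "g y \<oplus>\<^bsub>X\<^esub> q b = \<zero>\<^bsub>X\<^esub>"
        by (auto simp: carrier_fibre)
      obtain x a where x: "x \<in> carrier X" "a \<in> carrier T" "y = h x \<oplus>\<^bsub>X\<^esub> r a" using T(3)[OF v(2)] by auto
      have "(x, a, b) \<in> carrier ?F" using v(3,4) x ghr[OF x(1,2) v(3)] by (simp add: carrier_fibre)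
      moreover have "v = ?t (x, a, b)" using v(1) x(3) by simp
      ultimately show "v \<in> ?t ` carrier ?F" by (rule rev_image_eqI)
    qed
  qed
  let ?K = "?F\<lparr>carrier := {w \<in> carrier ?F. ?t w = \<zero>\<^bsub>?G\<^esub>}\<rparr>"
  have ses: "ses ?K ?F ?G" by (rule ses_kernel[OF fF fgD(1)[OF fG] t ts])
  have g0: "g \<zero>\<^bsub>X\<^esub> = \<zero>\<^bsub>X\<^esub>" by (rule mod_hom_zero[OF lX lX g])
  have q0: "q \<zero>\<^bsub>P\<^esub> = \<zero>\<^bsub>X\<^esub>" by (rule mod_hom_zero[OF P.left_module_axioms lX P(2)])
  \<comment> \<open>\<open>?t\<close> vanishes exactly if \<open>b = 0\<close> and
    \<open>h x + r a = 0\<close>, so its kernel is a copy of the fibre of \<open>h\<close>.\<close>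
  have "mod_iso R ?H ?K"
  proof (rule mod_isoI2)
    show "(\<lambda>w. (fst w, snd w, \<zero>\<^bsub>P\<^esub>)) \<in> mod_hom R ?H ?K"
    proof (rule mod_homI)
      fix w assume "w \<in> carrier ?H"
      then obtain x a where w: "w = (x, a)" "x \<in> carrier X" "a \<in> carrier T" "h x \<oplus>\<^bsub>X\<^esub> r a = \<zero>\<^bsub>X\<^esub>"
        by (auto simp: carrier_fibre)
      have "g (h x) \<oplus>\<^bsub>X\<^esub> (g (r a) \<oplus>\<^bsub>X\<^esub> q \<zero>\<^bsub>P\<^esub>) = \<zero>\<^bsub>X\<^esub>"
        using ghr[OF w(2,3) P.M.zero_closed] w(4) g0 q0 by simp
      then show "(fst w, snd w, \<zero>\<^bsub>P\<^esub>) \<in> carrier ?K" using w by (simp add: carrier_fibre)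
    qed (auto simp: P.smult_zero_right)
    show "(\<lambda>w. (fst w, fst (snd w))) \<in> mod_hom R ?K ?H"
      by (rule mod_homI) (auto simp: carrier_fibre)
  qed (auto simp: carrier_fibre)
  then have "pd_fin ?K" by (rule pd_fin_iso[OF T(4) _ fgD(1)[OF ses_fg(1)[OF ses]]])
  then have F: "pd_fin ?F" by (rule pd_fin_extension[OF ses_tri[OF ses] _ P(4)])
  show ?thesis
  proof (rule fin_coneI[OF X gh pj_prodm[OF projective_pj[OF T(1)] projective_pj[OF P(1)]] s _ F])
    fix x assume x: "x \<in> carrier X"
    obtain y b where y: "y \<in> carrier X" "b \<in> carrier P" "x = g y \<oplus>\<^bsub>X\<^esub> q b" using P(3)[OF x] by auto
    obtain z a where z: "z \<in> carrier X" "a \<in> carrier T" "y = h z \<oplus>\<^bsub>X\<^esub> r a" using T(3)[OF y(1)] by auto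
    have "x = g (h z) \<oplus>\<^bsub>X\<^esub> ?s (a, b)" using y(3) z(3) ghr[OF z(1,2) y(2)] by simp
    moreover have "(a, b) \<in> carrier (T \<times>\<^sub>M P)" using y z by simp
    ultimately show "\<exists>y\<in>carrier X. \<exists>a\<in>carrier (T \<times>\<^sub>M P). x = g (h y) \<oplus>\<^bsub>X\<^esub> ?s a"
      using z(1) by (rule_tac bexI, rule_tac bexI)
  qed
qed

lemma fin_cone_funpow:
  assumes X: "fg R X" and g: "g \<in> mod_hom R X X" and c: "fin_cone X g"
  shows "0 < n \<Longrightarrow> fin_cone X (g ^^ n)"
proof (induction n)
  case (Suc n)
  show ?case
  proof (cases "n = 0")
    case True
    have "g ^^ Suc n = g" unfolding True by simp
    then show ?thesis using c by simp
  next
    case False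
    have "g ^^ Suc n = (\<lambda>x. g ((g ^^ n) x))" by (simp add: fun_eq_iff)
    then show ?thesis using fin_cone_comp[OF X g mod_hom_funpow[OF g] c Suc.IH] False
      by (simp only: neq0_conv)
  qed
qed simp

text \<open>The kernel of \<open>g\<close> embeds into the fibre by
  \<open>y \<mapsto> (y, 0)\<close>. The map \<open>\<rho>\<close>, which makes the kernel a direct
  summand of \<open>X\<close>, splits this embedding.\<close>

lemma fin_cone_kernel:
  assumes X: "fg R X" and g: "g \<in> mod_hom R X X" and c: "fin_cone X g"
    and r: "\<rho> \<in> mod_hom R X (X\<lparr>carrier := {x \<in> carrier X. g x = \<zero>\<^bsub>X\<^esub>}\<rparr>)"
    and r1: "\<And>x. x \<in> carrier X \<Longrightarrow> g x = \<zero>\<^bsub>X\<^esub> \<Longrightarrow> \<rho> x = x"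
  shows "pd_fin (X\<lparr>carrier := {x \<in> carrier X. g x = \<zero>\<^bsub>X\<^esub>}\<rparr>)"
proof -
  note lX = fgD(1)[OF X]
  interpret X: left_module R X by fact
  let ?Y = "X\<lparr>carrier := {x \<in> carrier X. g x = \<zero>\<^bsub>X\<^esub>}\<rparr>"
  obtain P q where P: "projective R P" "q \<in> mod_hom R P X" "pd_fin (fibre X g P q)"
    using c unfolding fin_cone_def by auto
  interpret P: left_module R P by (rule fgD(1)[OF projective_fg[OF P(1)]])
  have q0: "q \<zero>\<^bsub>P\<^esub> = \<zero>\<^bsub>X\<^esub>" by (rule mod_hom_zero[OF P.left_module_axioms lX P(2)])
  have i: "(\<lambda>y. (y, \<zero>\<^bsub>P\<^esub>)) \<in> mod_hom R ?Y (fibre X g P q)"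
    by (rule mod_homI) (auto simp: carrier_fibre q0 P.smult_zero_right)
  have p: "(\<lambda>w. \<rho> (fst w)) \<in> mod_hom R (fibre X g P q) ?Y"
    by (rule mod_hom_comp[OF _ r]) (rule mod_homI; auto simp: carrier_fibre)
  have "retract ?Y (fibre X g P q)"
    unfolding retract_def by (rule bexI[OF bexI[OF _ p] i]) (simp add: r1)
  then show ?thesis by (rule pd_fin_retract[OF _ P(3) left_module_sub[OF lX submodule_kernel[OF lX lX g]]])
qed

text \<open>The fibre of the component \<open>X \<rightarrow> X\<close> of \<open>f\<close> turns
  out to be an extension of the projective module \<open>T\<close> by a syzygy of \<open>C\<close>.
  To see this, \<open>f\<close> is completed to a surjection by a lift of a free presentation
  \<open>S\<close> of \<open>C\<close>; the kernel of the completed map is a syzygy of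
  \<open>C\<close>.\<close>

lemma fin_cone_component:
  assumes X: "fg R X" and P: "pj P" and T: "pj T" and C: "pd_fin C"
    and f: "f \<in> mod_hom R (X \<times>\<^sub>M P) (X \<times>\<^sub>M T)" and pi: "\<pi> \<in> mod_hom R (X \<times>\<^sub>M T) C"
    and inj: "inj_on f (carrier (X \<times>\<^sub>M P))" and surj: "\<pi> ` carrier (X \<times>\<^sub>M T) = carrier C"
    and ex: "f ` carrier (X \<times>\<^sub>M P) = {y \<in> carrier (X \<times>\<^sub>M T). \<pi> y = \<zero>\<^bsub>C\<^esub>}"
  shows "fin_cone X (\<lambda>x. fst (f (x, \<zero>\<^bsub>P\<^esub>)))"
proof -
  note fC = pd_fin_fg[OF C] and fP = pj_fg[OF P] and fT = pj_fg[OF T]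
  note lX = fgD(1)[OF X] and lP = fgD(1)[OF fP] and lT = fgD(1)[OF fT] and lC = fgD(1)[OF fC]
  interpret X: left_module R X by fact
  interpret P: left_module R P by fact
  interpret T: left_module R T by fact
  interpret C: left_module R C by fact
  note lXP = left_module_prodm[OF lX lP] and lXT = left_module_prodm[OF lX lT]
  interpret XP: left_module R "X \<times>\<^sub>M P" by (rule lXP)
  interpret XT: left_module R "X \<times>\<^sub>M T" by (rule lXT)
  let ?g = "\<lambda>x. fst (f (x, \<zero>\<^bsub>P\<^esub>))"
  have g: "?g \<in> mod_hom R X X"
    by (rule mod_hom_comp[OF mod_hom_comp[OF mod_hom_inl[OF lP] f] mod_hom_fst])
  have pf: "f w \<in> carrier (X \<times>\<^sub>M T)" "\<pi> (f w) = \<zero>\<^bsub>C\<^esub>" if "w \<in> carrier (X \<times>\<^sub>M P)" for w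
  proof -
    have "f w \<in> f ` carrier (X \<times>\<^sub>M P)" using that by (rule imageI)
    then show "f w \<in> carrier (X \<times>\<^sub>M T)" "\<pi> (f w) = \<zero>\<^bsub>C\<^esub>" unfolding ex by simp_all
  qed
  obtain n t where t: "t \<in> mod_hom R (freem n) C" "t ` carrier (freem n) = carrier C"
    using freem_surj[OF fC] by auto
  define S where "S = freem n"
  have S: "pj S" "fg R S" unfolding S_def by (rule pj_freem, rule fg_freem)
  note t = t[folded S_def]
  note lS = fgD(1)[OF S(2)]
  interpret S: left_module R S by (rule lS)
  let ?N = "S\<lparr>carrier := {s \<in> carrier S. t s = \<zero>\<^bsub>C\<^esub>}\<rparr>"
  have sN: "ses ?N S C" by (rule ses_kernel[OF S(2) lC t])
  have N: "pd_fin ?N" using C pd_fin_syz[OF syzI[OF S(1) sN]] by simp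
  have "\<exists>h\<in>mod_hom R S (X \<times>\<^sub>M T). \<forall>x\<in>carrier S. \<pi> (h x) = t x"
    by (rule pj_lift[OF S(1) fg_prodm[OF X fT] fC pi surj t(1)])
  then obtain u where u: "u \<in> mod_hom R S (X \<times>\<^sub>M T)" "\<And>x. x \<in> carrier S \<Longrightarrow> \<pi> (u x) = t x" by auto
  note uc = mod_hom_closed[OF u(1)]
  let ?q = "\<lambda>w. fst (f (\<zero>\<^bsub>X\<^esub>, fst w)) \<oplus>\<^bsub>X\<^esub> fst (u (snd w))"
  have q: "?q \<in> mod_hom R (P \<times>\<^sub>M S) X"
    by (intro mod_hom_plus[OF lX] mod_hom_comp[OF mod_hom_comp[OF mod_hom_comp[OF mod_hom_fst mod_hom_inr[OF lX]] f] mod_hom_fst]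
        mod_hom_comp[OF mod_hom_comp[OF mod_hom_snd u(1)] mod_hom_fst])
  \<comment> \<open>\<open>f\<close> fills the kernel of \<open>\<pi>\<close>, and \<open>u\<close>
    supplies the rest because \<open>\<pi> u = t\<close> is onto; hence \<open>?F\<close> is
    surjective.\<close>
  let ?F = "\<lambda>w. f (fst w, fst (snd w)) \<oplus>\<^bsub>X \<times>\<^sub>M T\<^esub> u (snd (snd w))"
  have F: "?F \<in> mod_hom R (X \<times>\<^sub>M P \<times>\<^sub>M S) (X \<times>\<^sub>M T)"
    by (intro mod_hom_plus[OF lXT] mod_hom_comp[OF mod_hom_Pair[OF mod_hom_fst mod_hom_comp[OF mod_hom_snd mod_hom_fst]] f]
        mod_hom_comp[OF mod_hom_comp[OF mod_hom_snd mod_hom_snd] u(1)])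
  have fstF: "fst (?F w) = ?g (fst w) \<oplus>\<^bsub>X\<^esub> ?q (snd w)" if w: "w \<in> carrier (X \<times>\<^sub>M P \<times>\<^sub>M S)" for w
  proof -
    obtain x p s where xps: "w = (x, p, s)" "x \<in> carrier X" "p \<in> carrier P" "s \<in> carrier S" using w by auto
    have m: "(x, \<zero>\<^bsub>P\<^esub>) \<in> carrier (X \<times>\<^sub>M P)" "(\<zero>\<^bsub>X\<^esub>, p) \<in> carrier (X \<times>\<^sub>M P)" using xps by auto
    have "f (x, p) = f (x, \<zero>\<^bsub>P\<^esub>) \<oplus>\<^bsub>X \<times>\<^sub>M T\<^esub> f (\<zero>\<^bsub>X\<^esub>, p)" using mod_hom_add[OF f m] xps by simp
    then show ?thesis using pf(1)[OF m(1)] pf(1)[OF m(2)] uc[OF xps(4)] unfolding xps(1)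
      by (simp add: X.M.a_assoc mem_Times_iff)
  qed
  have Fsurj: "\<exists>w\<in>carrier (X \<times>\<^sub>M P \<times>\<^sub>M S). ?F w = z" if z: "z \<in> carrier (X \<times>\<^sub>M T)" for z
  proof -
    have "\<pi> z \<in> t ` carrier S" unfolding t(2) by (rule mod_hom_closed[OF pi z])
    then obtain s where s: "\<pi> z = t s" "s \<in> carrier S" by (rule imageE)
    have "\<pi> (z \<ominus>\<^bsub>X \<times>\<^sub>M T\<^esub> u s) = \<zero>\<^bsub>C\<^esub>"
      using mod_hom_diff[OF lXT lC pi z uc[OF s(2)]] u(2)[OF s(2)] s mod_hom_closed[OF t(1) s(2)]
      by (simp add: a_minus_def C.M.r_neg)
    then have "z \<ominus>\<^bsub>X \<times>\<^sub>M T\<^esub> u s \<in> f ` carrier (X \<times>\<^sub>M P)"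
      unfolding ex using XT.M.minus_closed[OF z uc[OF s(2)]] by simp
    then obtain w where w: "z \<ominus>\<^bsub>X \<times>\<^sub>M T\<^esub> u s = f w" "w \<in> carrier (X \<times>\<^sub>M P)" by (rule imageE)
    have "(z \<ominus>\<^bsub>X \<times>\<^sub>M T\<^esub> u s) \<oplus>\<^bsub>X \<times>\<^sub>M T\<^esub> u s = z"
      unfolding a_minus_def by (simp only: XT.M.a_assoc[OF z XT.M.a_inv_closed[OF uc[OF s(2)]] uc[OF s(2)]]
          XT.M.l_neg[OF uc[OF s(2)]] XT.M.r_zero[OF z])
    then have "?F (fst w, snd w, s) = z" by (simp only: w(1) fst_conv snd_conv prod.collapse)
    moreover have "(fst w, snd w, s) \<in> carrier (X \<times>\<^sub>M P \<times>\<^sub>M S)" using w(2) s(2) by (auto simp: mem_Times_iff)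
    ultimately show ?thesis by (rule bexI)
  qed
  \<comment> \<open>It consists of the elements that \<open>?F\<close> sends into
    \<open>0 \<times> T\<close>. The second component of \<open>?F\<close> maps it onto
    \<open>T\<close>, with the kernel of \<open>?F\<close> as kernel.\<close>
  let ?Fib = "fibre X ?g (P \<times>\<^sub>M S) ?q"
  have cF: "carrier ?Fib = {w \<in> carrier (X \<times>\<^sub>M P \<times>\<^sub>M S). fst (?F w) = \<zero>\<^bsub>X\<^esub>}"
  proof (rule Set.set_eqI)
    show "w \<in> carrier ?Fib \<longleftrightarrow> w \<in> {w \<in> carrier (X \<times>\<^sub>M P \<times>\<^sub>M S). fst (?F w) = \<zero>\<^bsub>X\<^esub>}" for w
      unfolding carrier_fibre mem_Collect_eq using fstF[of w] by metis
  qed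
  have FibXPS: "?Fib = (X \<times>\<^sub>M P \<times>\<^sub>M S)\<lparr>carrier := carrier ?Fib\<rparr>" by (simp add: fibre_def)
  have fPS: "fg R (P \<times>\<^sub>M S)" by (rule fg_prodm[OF fP S(2)])
  have fFib: "fg R ?Fib" by (rule fg_fibre[OF X g fPS q])
  have sub: "carrier ?Fib \<subseteq> carrier (X \<times>\<^sub>M P \<times>\<^sub>M S)" unfolding cF by (rule Collect_restrict)
  have FF: "?F \<in> mod_hom R ?Fib (X \<times>\<^sub>M T)"
    apply (subst FibXPS) by (rule mod_hom_comp[OF mod_hom_incl[OF sub] F])
  have h: "(\<lambda>w. snd (?F w)) \<in> mod_hom R ?Fib T" by (rule mod_hom_comp[OF FF mod_hom_snd])
  have hs: "(\<lambda>w. snd (?F w)) ` carrier ?Fib = carrier T"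
  proof
    show "(\<lambda>w. snd (?F w)) ` carrier ?Fib \<subseteq> carrier T" by (rule image_subsetI) (rule mod_hom_closed[OF h])
    show "carrier T \<subseteq> (\<lambda>w. snd (?F w)) ` carrier ?Fib"
    proof
      fix v assume v: "v \<in> carrier T"
      then have "(\<zero>\<^bsub>X\<^esub>, v) \<in> carrier (X \<times>\<^sub>M T)" by simp
      from Fsurj[OF this] obtain w where w: "w \<in> carrier (X \<times>\<^sub>M P \<times>\<^sub>M S)" "?F w = (\<zero>\<^bsub>X\<^esub>, v)" by (rule bexE)
      have "w \<in> carrier ?Fib" unfolding cF mem_Collect_eq w(2) using w(1) by simp
      moreover have "v = snd (?F w)" unfolding w(2) by simp
      ultimately show "v \<in> (\<lambda>w. snd (?F w)) ` carrier ?Fib" by (rule rev_image_eqI)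
    qed
  qed
  let ?K = "?Fib\<lparr>carrier := {w \<in> carrier ?Fib. snd (?F w) = \<zero>\<^bsub>T\<^esub>}\<rparr>"
  have sK: "ses ?K ?Fib T" by (rule ses_kernel[OF fFib lT h hs])
  have KF: "w \<in> carrier ?K \<longleftrightarrow> w \<in> carrier (X \<times>\<^sub>M P \<times>\<^sub>M S) \<and> ?F w = \<zero>\<^bsub>X \<times>\<^sub>M T\<^esub>" for w
  proof -
    have "w \<in> carrier ?K \<longleftrightarrow> w \<in> carrier (X \<times>\<^sub>M P \<times>\<^sub>M S) \<and> fst (?F w) = \<zero>\<^bsub>X\<^esub> \<and> snd (?F w) = \<zero>\<^bsub>T\<^esub>"
      by (simp only: carrier_carrier_update cF mem_Collect_eq conj_assoc)
    then show ?thesis unfolding prod_eq_iff prodm_simps(2) fst_conv snd_conv .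
  qed
  have lK: "left_module R ?K" by (rule ses_lm(1)[OF sK])
  have lN: "left_module R ?N" by (rule ses_lm(1)[OF sN])
  \<comment> \<open>The kernel of \<open>?F\<close> projects isomorphically onto the kernel of
    \<open>t\<close>: for \<open>s\<close> with \<open>t s = 0\<close>, the element
    \<open>u s\<close> has a unique preimage under the injective map \<open>f\<close>.\<close>
  let ?v = "\<lambda>w. snd (snd w)"
  have v: "?v \<in> mod_hom R ?K ?N"
  proof (rule mod_homI)
    fix w assume "w \<in> carrier ?K"
    then have w: "w \<in> carrier (X \<times>\<^sub>M P \<times>\<^sub>M S)" "?F w = \<zero>\<^bsub>X \<times>\<^sub>M T\<^esub>" unfolding KF by simp_all
    then have m: "(fst w, fst (snd w)) \<in> carrier (X \<times>\<^sub>M P)" "?v w \<in> carrier S" by auto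
    have "\<zero>\<^bsub>C\<^esub> = \<pi> (?F w)" unfolding w(2) by (rule mod_hom_zero[OF lXT lC pi, symmetric])
    also have "\<dots> = t (?v w)"
      unfolding mod_hom_add[OF pi pf(1)[OF m(1)] uc[OF m(2)]] pf(2)[OF m(1)] u(2)[OF m(2)]
      using mod_hom_closed[OF t(1) m(2)] by simp
    finally show "?v w \<in> carrier ?N" using m(2) by simp
  qed simp_all
  have f0: "(x, p) = \<zero>\<^bsub>X \<times>\<^sub>M P\<^esub>" if "x \<in> carrier X" "p \<in> carrier P" "f (x, p) = \<zero>\<^bsub>X \<times>\<^sub>M T\<^esub>" for x p
    using inj[unfolded inj_on_hom_iff[OF lXP lXT f]] that by simp
  have vinj: "inj_on ?v (carrier ?K)" unfolding inj_on_hom_iff[OF lK lN v]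
  proof (intro ballI impI)
    fix w assume "w \<in> carrier ?K" and vw: "?v w = \<zero>\<^bsub>?N\<^esub>"
    then have w: "w \<in> carrier (X \<times>\<^sub>M P \<times>\<^sub>M S)" "?F w = \<zero>\<^bsub>X \<times>\<^sub>M T\<^esub>" unfolding KF by simp_all
    then have m: "(fst w, fst (snd w)) \<in> carrier (X \<times>\<^sub>M P)" by auto
    have "u (?v w) = \<zero>\<^bsub>X \<times>\<^sub>M T\<^esub>" using vw mod_hom_zero[OF lS lXT u(1)] by simp
    then have "f (fst w, fst (snd w)) = \<zero>\<^bsub>X \<times>\<^sub>M T\<^esub>"
      using w(2) XT.M.r_zero[OF pf(1)[OF m]] by (simp only:)
    then have "(fst w, fst (snd w)) = \<zero>\<^bsub>X \<times>\<^sub>M P\<^esub>" by (intro f0) (use m in simp_all)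
    then show "w = \<zero>\<^bsub>?K\<^esub>" using vw by (simp add: prod_eq_iff)
  qed
  have vsurj: "?v ` carrier ?K = carrier ?N"
  proof
    show "?v ` carrier ?K \<subseteq> carrier ?N" by (rule image_subsetI) (rule mod_hom_closed[OF v])
    show "carrier ?N \<subseteq> ?v ` carrier ?K"
    proof
      fix s assume "s \<in> carrier ?N"
      then have s: "s \<in> carrier S" "t s = \<zero>\<^bsub>C\<^esub>" by simp_all
      have "u s \<in> f ` carrier (X \<times>\<^sub>M P)" unfolding ex using uc[OF s(1)] u(2)[OF s(1)] s(2) by simp
      then obtain w where w: "u s = f w" "w \<in> carrier (X \<times>\<^sub>M P)" by (rule imageE)
      let ?w = "\<ominus>\<^bsub>X \<times>\<^sub>M P\<^esub> w"
      have w': "?w \<in> carrier (X \<times>\<^sub>M P)" by (rule XP.M.a_inv_closed[OF w(2)])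
      have "f ?w \<oplus>\<^bsub>X \<times>\<^sub>M T\<^esub> u s = \<zero>\<^bsub>X \<times>\<^sub>M T\<^esub>"
        unfolding w(1) mod_hom_minus[OF lXP lXT f w(2)] by (rule XT.M.l_neg[OF pf(1)[OF w(2)]])
      then have "?F (fst ?w, snd ?w, s) = \<zero>\<^bsub>X \<times>\<^sub>M T\<^esub>" by (simp only: fst_conv snd_conv prod.collapse)
      moreover have "(fst ?w, snd ?w, s) \<in> carrier (X \<times>\<^sub>M P \<times>\<^sub>M S)" using w' s(1) by (auto simp: mem_Times_iff)
      ultimately have "(fst ?w, snd ?w, s) \<in> carrier ?K" unfolding KF by simp
      then show "s \<in> ?v ` carrier ?K" by (rule rev_image_eqI) simp
    qed
  qed
  have "pd_fin ?K" by (rule pd_fin_iso[OF N mod_iso_sym[OF mod_isoI[OF v vinj vsurj] lK] lK])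
  then have fin: "pd_fin ?Fib" by (rule pd_fin_extension[OF ses_tri[OF sK] _ pd_fin_pj[OF T]])
  show ?thesis
  proof (rule fin_coneI[OF X g pj_prodm[OF P S(1)] q _ fin])
    fix x assume "x \<in> carrier X"
    then have "(x, \<zero>\<^bsub>T\<^esub>) \<in> carrier (X \<times>\<^sub>M T)" by simp
    from Fsurj[OF this] obtain w where w: "w \<in> carrier (X \<times>\<^sub>M P \<times>\<^sub>M S)" "?F w = (x, \<zero>\<^bsub>T\<^esub>)" by (rule bexE)
    have "x = ?g (fst w) \<oplus>\<^bsub>X\<^esub> ?q (snd w)" unfolding fstF[OF w(1), symmetric] w(2) by simp
    moreover have "fst w \<in> carrier X" "snd w \<in> carrier (P \<times>\<^sub>M S)" using w(1) by auto
    ultimately show "\<exists>y\<in>carrier X. \<exists>a\<in>carrier (P \<times>\<^sub>M S). x = ?g y \<oplus>\<^bsub>X\<^esub> ?q a"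
      by (rule_tac bexI, rule_tac bexI)
  qed
qed

text \<open>
  Splitting off the part of \<open>X\<close> on which the component \<open>X \<rightarrow> X\<close> of the first map is invertible.
\<close>

lemma ses_cancel:
  assumes X: "fg R X" and P: "pj P" and T: "pj T" and C: "pd_fin C"
    and s: "ses (X \<times>\<^sub>M P) (X \<times>\<^sub>M T) C"
  shows "\<exists>H. submodule H R X \<and> retract (X\<lparr>carrier := H\<rparr>) X \<and> pd_fin (X\<lparr>carrier := H\<rparr>) \<and>
    ses ((X\<lparr>carrier := H\<rparr>) \<times>\<^sub>M P) ((X\<lparr>carrier := H\<rparr>) \<times>\<^sub>M T) C"
proof -
  note fC = pd_fin_fg[OF C] and fP = pj_fg[OF P] and fT = pj_fg[OF T]
  note lX = fgD(1)[OF X] and lP = fgD(1)[OF fP] and lT = fgD(1)[OF fT] and lC = fgD(1)[OF fC]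
  interpret X: left_module R X by fact
  interpret P: left_module R P by fact
  interpret T: left_module R T by fact
  interpret C: left_module R C by fact
  note lXP = left_module_prodm[OF lX lP] and lXT = left_module_prodm[OF lX lT]
  interpret XP: left_module R "X \<times>\<^sub>M P" by (rule lXP)
  interpret XT: left_module R "X \<times>\<^sub>M T" by (rule lXT)
  obtain f \<pi> where f: "f \<in> mod_hom R (X \<times>\<^sub>M P) (X \<times>\<^sub>M T)" and pi: "\<pi> \<in> mod_hom R (X \<times>\<^sub>M T) C"
    and inj: "inj_on f (carrier (X \<times>\<^sub>M P))" and surj: "\<pi> ` carrier (X \<times>\<^sub>M T) = carrier C"
    and ex: "f ` carrier (X \<times>\<^sub>M P) = {y \<in> carrier (X \<times>\<^sub>M T). \<pi> y = \<zero>\<^bsub>C\<^esub>}" by (rule sesE[OF s])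
  have pf: "f w \<in> carrier (X \<times>\<^sub>M T)" "\<pi> (f w) = \<zero>\<^bsub>C\<^esub>" if "w \<in> carrier (X \<times>\<^sub>M P)" for w
  proof -
    have "f w \<in> f ` carrier (X \<times>\<^sub>M P)" using that by (rule imageI)
    then show "f w \<in> carrier (X \<times>\<^sub>M T)" "\<pi> (f w) = \<zero>\<^bsub>C\<^esub>" unfolding ex by simp_all
  qed
  define g where "g x = fst (f (x, \<zero>\<^bsub>P\<^esub>))" for x
  have g: "g \<in> mod_hom R X X" unfolding g_def
    by (rule mod_hom_comp[OF mod_hom_comp[OF mod_hom_inl[OF lP] f] mod_hom_fst])
  have cg: "fin_cone X g" unfolding g_def by (rule fin_cone_component[OF X P T C f pi inj surj ex])
  \<comment> \<open>\<open>X\<close> splits into \<open>H\<close>, where \<open>g\<close> is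
    nilpotent, and \<open>J\<close>, where \<open>g\<close> is bijective.\<close>
  obtain m where m: "0 < m" and dec0: "direct_decomp R X {x \<in> carrier X. (g ^^ m) x = \<zero>\<^bsub>X\<^esub>} ((g ^^ m) ` carrier X)"
    and ginj: "inj_on g ((g ^^ m) ` carrier X)" and gsurj: "g ` ((g ^^ m) ` carrier X) = (g ^^ m) ` carrier X"
    using fitting[OF X g] by auto
  define H where "H = {x \<in> carrier X. (g ^^ m) x = \<zero>\<^bsub>X\<^esub>}"
  define J where "J = (g ^^ m) ` carrier X"
  have dec: "direct_decomp R X H J" using dec0 by (simp add: H_def J_def)
  note dd = direct_decompD[OF lX dec]
  note sH = dd(1)[unfolded submodule_iff[OF lX]] and sJ = dd(2)[unfolded submodule_iff[OF lX]]
  have HX: "x \<in> carrier X" if "x \<in> H" for x using that sH by auto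
  have JX: "x \<in> carrier X" if "x \<in> J" for x using that sJ by auto
  let ?Y = "X\<lparr>carrier := H\<rparr>"
  obtain \<rho> where \<rho>: "\<rho> \<in> mod_hom R X ?Y" "\<And>x. x \<in> H \<Longrightarrow> \<rho> x = x" "\<And>x. x \<in> J \<Longrightarrow> \<rho> x = \<zero>\<^bsub>X\<^esub>"
    "\<And>x. x \<in> carrier X \<Longrightarrow> x \<ominus>\<^bsub>X\<^esub> \<rho> x \<in> J" using direct_decomp_proj[OF lX dec] by auto
  have \<rho>H: "\<rho> x \<in> H" if "x \<in> carrier X" for x using mod_hom_closed[OF \<rho>(1) that] by simp
  have fixJ: "x \<in> J" if "x \<in> carrier X" "\<rho> x = \<zero>\<^bsub>X\<^esub>" for x
    using \<rho>(4)[OF that(1)] that X.diff_zero by simp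
  have fixH: "x \<in> H" if "x \<in> carrier X" "x \<ominus>\<^bsub>X\<^esub> \<rho> x = \<zero>\<^bsub>X\<^esub>" for x
    using that X.diff_eq_zero_iff[OF that(1) HX[OF \<rho>H[OF that(1)]]] \<rho>H[OF that(1)] by simp
  have gH: "g x \<in> H" if "x \<in> H" for x
  proof -
    have xX: "x \<in> carrier X" and gx: "(g ^^ m) x = \<zero>\<^bsub>X\<^esub>" using that by (simp_all add: H_def)
    have "(g ^^ m) (g x) = g ((g ^^ m) x)" by (metis funpow_swap1)
    also have "\<dots> = \<zero>\<^bsub>X\<^esub>" unfolding gx by (rule mod_hom_zero[OF lX lX g])
    finally show ?thesis using mod_hom_closed[OF g xX] by (simp add: H_def)
  qed
  have gJ: "g ` J = J" "inj_on g J" using ginj gsurj by (simp_all add: J_def)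
  have gJ0: "x = \<zero>\<^bsub>X\<^esub>" if "x \<in> J" "g x = \<zero>\<^bsub>X\<^esub>" for x
    using gJ(2) that sJ mod_hom_zero[OF lX lX g] by (simp add: inj_on_def)
  have fY: "fg R ?Y" by (rule fg_submodule[OF X dd(1)])
  note lY = fgD(1)[OF fY]
  \<comment> \<open>The powers of \<open>g\<close> inherit the finiteness of the cone, and
    \<open>H\<close> is the kernel of such a power and a direct summand of \<open>X\<close>.\<close>
  have finY: "pd_fin ?Y" unfolding H_def
    by (rule fin_cone_kernel[OF X mod_hom_funpow[OF g] fin_cone_funpow[OF X g cg m]
          \<rho>(1)[unfolded H_def]]) (use \<rho>(2) in \<open>simp add: H_def\<close>)
  have ret: "retract ?Y X" by (rule direct_decomp_retract[OF lX dec])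
  note lYP = left_module_prodm[OF lY lP] and lYT = left_module_prodm[OF lY lT]
  have fYT: "fg R (?Y \<times>\<^sub>M T)" by (rule fg_prodm[OF fY fT])
  have YTsub: "w \<in> carrier (?Y \<times>\<^sub>M T) \<longleftrightarrow> w \<in> carrier (X \<times>\<^sub>M T) \<and> fst w \<in> H" for w
    using HX by (cases w) auto
  have pi': "\<pi> \<in> mod_hom R (?Y \<times>\<^sub>M T) C"
    by (rule mod_homI) (use HX in \<open>auto simp: mod_hom_closed[OF pi] mod_hom_add[OF pi, of "(_, _)" "(_, _)", simplified]
        mod_hom_smult[OF pi, of _ "(_, _)", simplified]\<close>)
  have f_split: "f (x, p) = f (x, \<zero>\<^bsub>P\<^esub>) \<oplus>\<^bsub>X \<times>\<^sub>M T\<^esub> f (\<zero>\<^bsub>X\<^esub>, p)" if "x \<in> carrier X" "p \<in> carrier P" for x p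
    using mod_hom_add[OF f, of "(x, \<zero>\<^bsub>P\<^esub>)" "(\<zero>\<^bsub>X\<^esub>, p)"] that by simp
  text \<open>Any first component can be moved into \<open>H\<close> by an element of the image of \<open>f\<close>.\<close>
  have adjust: "\<exists>y\<in>J. fst (w \<ominus>\<^bsub>X \<times>\<^sub>M T\<^esub> f (y, \<zero>\<^bsub>P\<^esub>)) \<in> H" if w: "w \<in> carrier (X \<times>\<^sub>M T)" for w
  proof -
    have fw: "fst w \<in> carrier X" using w by auto
    obtain y where y: "fst w \<ominus>\<^bsub>X\<^esub> \<rho> (fst w) = g y" "y \<in> J" using \<rho>(4)[OF fw] gJ(1) by (metis imageE)
    have yX: "y \<in> carrier X" by (rule JX[OF y(2)])
    have m: "(y, \<zero>\<^bsub>P\<^esub>) \<in> carrier (X \<times>\<^sub>M P)" using yX by simp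
    have "fst (w \<ominus>\<^bsub>X \<times>\<^sub>M T\<^esub> f (y, \<zero>\<^bsub>P\<^esub>)) = fst w \<ominus>\<^bsub>X\<^esub> g y"
      using mod_hom_diff[OF lXT lX mod_hom_fst w pf(1)[OF m]] by (simp add: g_def)
    also have "\<dots> = fst w \<ominus>\<^bsub>X\<^esub> (fst w \<ominus>\<^bsub>X\<^esub> \<rho> (fst w))" by (simp only: y(1))
    also have "\<dots> = \<rho> (fst w)" using fw HX[OF \<rho>H[OF fw]]
      by (simp add: a_minus_def X.M.minus_add X.M.r_neg1 X.M.r_neg2)
    finally show ?thesis using \<rho>H[OF fw] y(2) by (intro bexI[of _ y]) simp_all
  qed
  have surj': "\<pi> ` carrier (?Y \<times>\<^sub>M T) = carrier C"
  proof
    show "\<pi> ` carrier (?Y \<times>\<^sub>M T) \<subseteq> carrier C" by (rule image_subsetI) (rule mod_hom_closed[OF pi'])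
    show "carrier C \<subseteq> \<pi> ` carrier (?Y \<times>\<^sub>M T)"
    proof
      fix c assume c: "c \<in> carrier C"
      then have "c \<in> \<pi> ` carrier (X \<times>\<^sub>M T)" unfolding surj .
      then obtain w where w: "c = \<pi> w" "w \<in> carrier (X \<times>\<^sub>M T)" by (rule imageE)
      obtain y where y: "y \<in> J" "fst (w \<ominus>\<^bsub>X \<times>\<^sub>M T\<^esub> f (y, \<zero>\<^bsub>P\<^esub>)) \<in> H" using adjust[OF w(2)] by (rule bexE)
      have m: "(y, \<zero>\<^bsub>P\<^esub>) \<in> carrier (X \<times>\<^sub>M P)" using JX[OF y(1)] by simp
      let ?w = "w \<ominus>\<^bsub>X \<times>\<^sub>M T\<^esub> f (y, \<zero>\<^bsub>P\<^esub>)"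
      have "?w \<in> carrier (?Y \<times>\<^sub>M T)" unfolding YTsub
        using XT.M.minus_closed[OF w(2) pf(1)[OF m]] y(2) by (rule conjI)
      moreover have "c = \<pi> ?w" unfolding mod_hom_diff[OF lXT lC pi w(2) pf(1)[OF m]] pf(2)[OF m] w(1)
        using C.diff_zero[OF mod_hom_closed[OF pi w(2)]] by simp
      ultimately show "c \<in> \<pi> ` carrier (?Y \<times>\<^sub>M T)" by (rule rev_image_eqI)
    qed
  qed
  let ?K = "(?Y \<times>\<^sub>M T)\<lparr>carrier := {w \<in> carrier (?Y \<times>\<^sub>M T). \<pi> w = \<zero>\<^bsub>C\<^esub>}\<rparr>"
  have sK: "ses ?K (?Y \<times>\<^sub>M T) C" by (rule ses_kernel[OF fYT lC pi' surj'])
  \<comment> \<open>The preimage of \<open>H \<oplus> T\<close> under \<open>f\<close>, which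
    \<open>f\<close> identifies with the kernel \<open>?K\<close> of the restricted
    surjection.\<close>
  define L where "L = {w \<in> carrier (X \<times>\<^sub>M P). fst (f w) \<ominus>\<^bsub>X\<^esub> \<rho> (fst (f w)) = \<zero>\<^bsub>X\<^esub>}"
  let ?L = "(X \<times>\<^sub>M P)\<lparr>carrier := L\<rparr>"
  have L_iff: "w \<in> L \<longleftrightarrow> w \<in> carrier (X \<times>\<^sub>M P) \<and> fst (f w) \<in> H" for w
  proof -
    have "fst (f w) \<ominus>\<^bsub>X\<^esub> \<rho> (fst (f w)) = \<zero>\<^bsub>X\<^esub> \<longleftrightarrow> fst (f w) \<in> H" if "w \<in> carrier (X \<times>\<^sub>M P)"
    proof -
      have c: "fst (f w) \<in> carrier X" using pf(1)[OF that] by auto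
      show ?thesis using fixH[OF c] \<rho>(2)[of "fst (f w)"] X.diff_eq_zero_iff[OF c c] by auto
    qed
    then show ?thesis by (auto simp: L_def)
  qed
  have sL: "submodule L R (X \<times>\<^sub>M P)"
  proof -
    have "L = {w \<in> carrier (X \<times>\<^sub>M P). fst (f w) \<in> H}" using L_iff by auto
    then show ?thesis
      using submodule_preimage[OF lXP lX mod_hom_comp[OF f mod_hom_fst] dd(1)] by simp
  qed
  have lL: "left_module R ?L" by (rule left_module_sub[OF lXP sL])
  have isoK: "mod_iso R ?L ?K"
  proof (rule mod_isoI)
    show "f \<in> mod_hom R ?L ?K"
    proof (rule mod_homI)
      fix w assume "w \<in> carrier ?L"
      then have w: "w \<in> carrier (X \<times>\<^sub>M P)" "fst (f w) \<in> H" using L_iff by simp_all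
      have "f w \<in> carrier (?Y \<times>\<^sub>M T)" unfolding YTsub using pf(1)[OF w(1)] w(2) by (rule conjI)
      then show "f w \<in> carrier ?K" using pf(2)[OF w(1)] by simp
    next
      fix u v assume "u \<in> carrier ?L" "v \<in> carrier ?L"
      then have "u \<in> carrier (X \<times>\<^sub>M P)" "v \<in> carrier (X \<times>\<^sub>M P)" using L_iff by simp_all
      from mod_hom_add[OF f this] show "f (u \<oplus>\<^bsub>?L\<^esub> v) = f u \<oplus>\<^bsub>?K\<^esub> f v" by simp
    next
      fix a v assume a: "a \<in> carrier R" and "v \<in> carrier ?L"
      then have "v \<in> carrier (X \<times>\<^sub>M P)" using L_iff by simp
      from mod_hom_smult[OF f a this] show "f (a \<odot>\<^bsub>?L\<^esub> v) = a \<odot>\<^bsub>?K\<^esub> f v" by simp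
    qed
    show "inj_on f (carrier ?L)" by (rule inj_on_subset[OF inj]) (use L_iff in auto)
    show "f ` carrier ?L = carrier ?K"
    proof (rule Set.set_eqI, rule iffI)
      fix z assume "z \<in> f ` carrier ?L"
      then obtain w where w: "z = f w" "w \<in> carrier ?L" by (rule imageE)
      then have w': "w \<in> carrier (X \<times>\<^sub>M P)" "fst (f w) \<in> H" using L_iff by simp_all
      have "f w \<in> carrier (?Y \<times>\<^sub>M T)" unfolding YTsub using pf(1)[OF w'(1)] w'(2) by (rule conjI)
      then show "z \<in> carrier ?K" using pf(2)[OF w'(1)] w(1) by simp
    next
      fix z assume "z \<in> carrier ?K"
      then have z: "z \<in> carrier (?Y \<times>\<^sub>M T)" "\<pi> z = \<zero>\<^bsub>C\<^esub>" by simp_all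
      then have "z \<in> f ` carrier (X \<times>\<^sub>M P)" unfolding ex using YTsub[of z] by simp
      then obtain w where w: "z = f w" "w \<in> carrier (X \<times>\<^sub>M P)" by (rule imageE)
      have "w \<in> carrier ?L" using w(2) z(1)[unfolded YTsub] w(1) L_iff by simp
      then show "z \<in> f ` carrier ?L" by (rule rev_image_eqI) (rule w(1))
    qed
  qed
  \<comment> \<open>Since \<open>g\<close> is bijective on \<open>J\<close>, the
    \<open>J\<close>-component of an element of \<open>L\<close> exists for, and is determined by,
    any choice of the other components. Projecting it away is thus an isomorphism.\<close>
  have isoY: "mod_iso R ?L (?Y \<times>\<^sub>M P)"
  proof (rule mod_isoI)
    have hom: "(\<lambda>w. (\<rho> (fst w), snd w)) \<in> mod_hom R (X \<times>\<^sub>M P) (?Y \<times>\<^sub>M P)"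
      by (intro mod_hom_Pair mod_hom_snd mod_hom_comp[OF mod_hom_fst \<rho>(1)])
    have LXP: "L \<subseteq> carrier (X \<times>\<^sub>M P)" using L_iff by auto
    show hL: "(\<lambda>w. (\<rho> (fst w), snd w)) \<in> mod_hom R ?L (?Y \<times>\<^sub>M P)"
      by (rule mod_hom_comp[OF mod_hom_incl[OF LXP] hom])
    show "inj_on (\<lambda>w. (\<rho> (fst w), snd w)) (carrier ?L)"
      unfolding inj_on_hom_iff[OF lL lYP hL]
    proof (intro ballI impI)
      fix w assume "w \<in> carrier ?L" and z: "(\<rho> (fst w), snd w) = \<zero>\<^bsub>?Y \<times>\<^sub>M P\<^esub>"
      then have w: "w \<in> carrier (X \<times>\<^sub>M P)" "fst (f w) \<in> H" using L_iff by simp_all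
      have w0: "w = (fst w, \<zero>\<^bsub>P\<^esub>)" "\<rho> (fst w) = \<zero>\<^bsub>X\<^esub>" using z by (simp_all add: prod_eq_iff)
      have "fst w \<in> carrier X" using w(1) by auto
      then have xJ: "fst w \<in> J" using fixJ w0(2) by simp
      have "g (fst w) = fst (f w)" unfolding g_def using w0(1) by metis
      then have "g (fst w) \<in> H" using w(2) by simp
      moreover have "g (fst w) \<in> J" using gJ(1) xJ by (metis imageI)
      ultimately have "g (fst w) = \<zero>\<^bsub>X\<^esub>" by (rule dd(4))
      then have "fst w = \<zero>\<^bsub>X\<^esub>" by (rule gJ0[OF xJ])
      then show "w = \<zero>\<^bsub>?L\<^esub>" using z by (simp add: prod_eq_iff)
    qed
    show "(\<lambda>w. (\<rho> (fst w), snd w)) ` carrier ?L = carrier (?Y \<times>\<^sub>M P)"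
    proof
      show "(\<lambda>w. (\<rho> (fst w), snd w)) ` carrier ?L \<subseteq> carrier (?Y \<times>\<^sub>M P)"
        by (rule image_subsetI) (rule mod_hom_closed[OF hL])
      show "carrier (?Y \<times>\<^sub>M P) \<subseteq> (\<lambda>w. (\<rho> (fst w), snd w)) ` carrier ?L"
      proof
        fix v assume "v \<in> carrier (?Y \<times>\<^sub>M P)"
        then obtain y p where v: "v = (y, p)" "y \<in> H" "p \<in> carrier P" by auto
        have yX: "y \<in> carrier X" by (rule HX[OF v(2)])
        have m: "(y, p) \<in> carrier (X \<times>\<^sub>M P)" using yX v(3) by simp
        obtain z where z: "z \<in> J" "fst (f (y, p) \<ominus>\<^bsub>X \<times>\<^sub>M T\<^esub> f (z, \<zero>\<^bsub>P\<^esub>)) \<in> H" using adjust[OF pf(1)[OF m]] by (rule bexE)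
        have zX: "z \<in> carrier X" by (rule JX[OF z(1)])
        have mz: "(z, \<zero>\<^bsub>P\<^esub>) \<in> carrier (X \<times>\<^sub>M P)" using zX by simp
        let ?w = "(y, p) \<ominus>\<^bsub>X \<times>\<^sub>M P\<^esub> (z, \<zero>\<^bsub>P\<^esub>)"
        have "fst (f ?w) \<in> H" using z(2) unfolding mod_hom_diff[OF lXP lXT f m mz] .
        moreover have wc: "?w \<in> carrier (X \<times>\<^sub>M P)" by (rule XP.M.minus_closed[OF m mz])
        ultimately have "?w \<in> carrier ?L" using L_iff by simp
        moreover have "v = (\<rho> (fst ?w), snd ?w)"
        proof -
          have "fst ?w = y \<ominus>\<^bsub>X\<^esub> z" using mod_hom_diff[OF lXP lX mod_hom_fst m mz] by simp
          then have "\<rho> (fst ?w) = \<rho> y \<ominus>\<^bsub>?Y\<^esub> \<rho> z" using mod_hom_diff[OF lX lY \<rho>(1) yX zX] by simp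
          also have "\<dots> = y \<ominus>\<^bsub>?Y\<^esub> \<zero>\<^bsub>?Y\<^esub>" using \<rho>(2)[OF v(2)] \<rho>(3)[OF z(1)] by simp
          also have "\<dots> = y" by (rule left_module.diff_zero[OF lY]) (use v(2) in simp)
          finally have "\<rho> (fst ?w) = y" .
          moreover have "snd ?w = p"
            using mod_hom_diff[OF lXP lP mod_hom_snd m mz] P.diff_zero[OF v(3)] by simp
          ultimately show ?thesis using v(1) by simp
        qed
        ultimately show "v \<in> (\<lambda>w. (\<rho> (fst w), snd w)) ` carrier ?L" by (rule rev_image_eqI)
      qed
    qed
  qed
  have "mod_iso R (?Y \<times>\<^sub>M P) ?K" by (rule mod_iso_trans[OF mod_iso_sym[OF isoY lL] isoK])
  then have "ses (?Y \<times>\<^sub>M P) (?Y \<times>\<^sub>M T) C" by (rule ses_iso1[OF sK _ lYP])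
  then show ?thesis using dd(1) ret finY by (intro exI[of _ H] conjI)
qed

end

section \<open>Ascending chains of subgroups of a finitely generated free abelian group\<close>

text \<open>The least positive integer that occurs anywhere in the chain generates the subgroup in
  which it occurs, and all later ones: a nonzero remainder modulo it would be smaller.\<close>

lemma int_subgroup_chain:
  fixes H :: "nat \<Rightarrow> int set"
  assumes mono: "\<And>n m. n \<le> m \<Longrightarrow> H n \<subseteq> H m" and z: "\<And>n. 0 \<in> H n"
    and d: "\<And>n x y. x \<in> H n \<Longrightarrow> y \<in> H n \<Longrightarrow> x - y \<in> H n"
  shows "\<exists>n. \<forall>m\<ge>n. H m = H n"
proof (cases "\<exists>n. \<exists>x\<in>H n. x > 0")
  case False
  have "H n = {0}" for n
  proof -
    have "x = 0" if "x \<in> H n" for x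
    proof -
      have "- x \<in> H n" using d[OF z that] by simp
      then have "\<not> - x > 0" "\<not> x > 0" using that False by blast+
      then show ?thesis by simp
    qed
    then show ?thesis using z[of n] by (rule eq_singletonI)
  qed
  then show ?thesis by simp
next
  case True
  define P where "P k \<longleftrightarrow> k > 0 \<and> (\<exists>n. int k \<in> H n)" for k
  obtain n0 x0 where "x0 \<in> H n0" "x0 > 0" using True by auto
  then have "P (nat x0)" unfolding P_def by auto
  define k where "k = (LEAST k. P k)"
  have k: "P k" unfolding k_def by (rule LeastI) fact
  then obtain n where n: "k > 0" "int k \<in> H n" unfolding P_def by auto
  have neg: "- x \<in> H m" if "x \<in> H m" for x m using d[OF z that] by simp
  have add: "x + y \<in> H m" if "x \<in> H m" "y \<in> H m" for x y m using d[OF that(1) neg[OF that(2)]] by simp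
  have nmult: "int j * x \<in> H m" if "x \<in> H m" for j x m
    by (induction j) (use that z add in \<open>auto simp: algebra_simps\<close>)
  have mult: "j * x \<in> H m" if "x \<in> H m" for j x m
    using nmult[OF that, of "nat j"] neg[OF nmult[OF that, of "nat (- j)"]] by (cases "j \<ge> 0") auto
  have sub: "H m \<subseteq> H n" if "m \<ge> n" for m
  proof
    fix x assume x: "x \<in> H m"
    have "int k \<in> H m" using n(2) mono[OF that] by auto
    then have r: "x mod int k \<in> H m"
      using d[OF x mult[of "int k" m "x div int k"]] by (simp add: minus_div_mult_eq_mod)
    have "x mod int k = 0"
    proof (rule ccontr)
      assume "x mod int k \<noteq> 0"
      moreover have b: "0 \<le> x mod int k" "x mod int k < int k" using n(1) by simp_all
      ultimately have "P (nat (x mod int k))" unfolding P_def using r by auto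
      then have "k \<le> nat (x mod int k)" unfolding k_def by (rule Least_le)
      then show False using b by linarith
    qed
    then have "x = x div int k * int k" by (metis add.right_neutral div_mult_mod_eq)
    then show "x \<in> H n" using mult[OF n(2), of "x div int k"] by simp
  qed
  show ?thesis by (intro exI[of _ n] allI impI subset_antisym sub mono)
qed

text \<open>Induction on the coordinates: the image in coordinate \<open>a\<close> and the part
  vanishing there both become stationary, and together they determine a subgroup within an ascending
  chain.\<close>

lemma subgroup_chain:
  fixes G :: "nat \<Rightarrow> ('x \<Rightarrow> int) set"
  assumes "finite A"
    and "\<And>n m. n \<le> m \<Longrightarrow> G n \<subseteq> G m" "\<And>n. (\<lambda>_. 0) \<in> G n"
    "\<And>n u v. u \<in> G n \<Longrightarrow> v \<in> G n \<Longrightarrow> (\<lambda>x. u x - v x) \<in> G n"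
    "\<And>n v x. v \<in> G n \<Longrightarrow> x \<notin> A \<Longrightarrow> v x = 0"
  shows "\<exists>n. \<forall>m\<ge>n. G m = G n"
  using assms
proof (induction A arbitrary: G)
  case empty
  have "G n = {\<lambda>_. 0}" for n
  proof (rule eq_singletonI)
    show "v = (\<lambda>_. 0)" if "v \<in> G n" for v by (rule ext) (rule empty(4)[OF that], simp)
  qed (rule empty(2))
  then show ?case by simp
next
  case (insert a A)
  note mono = insert.prems(1) and z = insert.prems(2) and d = insert.prems(3) and supp = insert.prems(4)
  have "\<exists>n. \<forall>m\<ge>n. (\<lambda>v. v a) ` G m = (\<lambda>v. v a) ` G n"
  proof (rule int_subgroup_chain)
    show "0 \<in> (\<lambda>v. v a) ` G n" for n using z[of n] by (rule rev_image_eqI) simp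
    show "(\<lambda>v. v a) ` G n \<subseteq> (\<lambda>v. v a) ` G m" if "n \<le> m" for n m using mono[OF that] by (rule image_mono)
    show "x - y \<in> (\<lambda>v. v a) ` G n" if xy: "x \<in> (\<lambda>v. v a) ` G n" "y \<in> (\<lambda>v. v a) ` G n" for n x y
    proof -
      obtain u v where "u \<in> G n" "v \<in> G n" "x = u a" "y = v a" using xy by auto
      then show ?thesis using d[of u n v] by (intro image_eqI[of _ _ "\<lambda>x. u x - v x"]) auto
    qed
  qed
  then obtain n1 where n1: "\<And>m. m \<ge> n1 \<Longrightarrow> (\<lambda>v. v a) ` G m = (\<lambda>v. v a) ` G n1" by auto
  have "\<exists>n. \<forall>m\<ge>n. {v \<in> G m. v a = 0} = {v \<in> G n. v a = 0}"
  proof (rule insert.IH)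
    show "{v \<in> G n. v a = 0} \<subseteq> {v \<in> G m. v a = 0}" if "n \<le> m" for n m using mono[OF that] by auto
    show "v x = 0" if "v \<in> {v \<in> G n. v a = 0}" "x \<notin> A" for n v x
      using that supp[of v n x] by (cases "x = a") auto
    show "(\<lambda>_. 0) \<in> {v \<in> G n. v a = 0}" for n using z[of n] by simp
    show "(\<lambda>x. u x - v x) \<in> {v \<in> G n. v a = 0}" if "u \<in> {v \<in> G n. v a = 0}" "v \<in> {v \<in> G n. v a = 0}" for n u v
      using d[of u n v] that by simp
  qed
  then obtain n2 where n2: "\<And>m. m \<ge> n2 \<Longrightarrow> {v \<in> G m. v a = 0} = {v \<in> G n2. v a = 0}" by auto
  define n where "n = max n1 n2"
  have sub: "G m \<subseteq> G n" if "m \<ge> n" for m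
  proof
    fix v assume v: "v \<in> G m"
    have "(\<lambda>v. v a) ` G m = (\<lambda>v. v a) ` G n" using n1[of m] n1[of n] that by (simp add: n_def)
    moreover have "v a \<in> (\<lambda>v. v a) ` G m" using v by (rule imageI)
    ultimately have "v a \<in> (\<lambda>v. v a) ` G n" by simp
    then obtain w where w: "v a = w a" "w \<in> G n" by (rule imageE)
    have wm: "w \<in> G m" using w(2) mono[OF that] by blast
    have "(\<lambda>x. v x - w x) \<in> {v \<in> G m. v a = 0}" using d[OF v wm] w(1) by simp
    also have "\<dots> = {v \<in> G n. v a = 0}" using n2[of m] n2[of n] that by (simp add: n_def)
    finally have vw: "(\<lambda>x. v x - w x) \<in> G n" by simp
    have "(\<lambda>x. 0 - w x) \<in> G n" using d[OF z w(2)] by simp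
    from d[OF vw this] show "v \<in> G n" by simp
  qed
  show ?case by (intro exI[of _ n] allI impI subset_antisym sub mono)
qed

section \<open>The Igusa--Todorov bound\<close>

context finite_length_ring
begin

text \<open>Adding projectives turns the triangle into an exact sequence whose first two terms are
  \<open>X\<close> plus projective modules, the shape that \<open>ses_cancel\<close> expects. The
  module \<open>Y\<close> is the part of \<open>X\<close> on which the resulting endomorphism is
  nilpotent.\<close>

lemma tri_cancel:
  fixes X W :: "('a, 'a list) module"
  assumes t: "tri X X W" and W: "pd_fin W"
  shows "\<exists>Y :: ('a, 'a list) module. retract Y X \<and> fg R Y \<and> pd_fin Y \<and> tri Y Y W"
proof -
  note X = tri_fg(1)[OF t]
  obtain A B C :: "('a, 'a list) module" where s: "ses A B C" "stab X A" "stab X B" "stab W C"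
    by (rule triE[OF t])
  obtain P P' where P: "projective R P" "projective R P'" "mod_iso R (X \<times>\<^sub>M P) (A \<times>\<^sub>M P')" by (rule stabE[OF s(2)])
  obtain Q Q' where Q: "projective R Q" "projective R Q'" "mod_iso R (X \<times>\<^sub>M Q) (B \<times>\<^sub>M Q')" by (rule stabE[OF s(3)])
  note fp = projective_fg[OF P(1)] projective_fg[OF P(2)] projective_fg[OF Q(1)] projective_fg[OF Q(2)]
  note l = fgD(1)[OF X] fgD(1)[OF fp(1)] fgD(1)[OF fp(2)] fgD(1)[OF fp(3)] fgD(1)[OF fp(4)]
  \<comment> \<open>\<open>P'\<close> is added to the first two terms and \<open>Q'\<close> to the
    last two, which preserves exactness.\<close>
  have 1: "ses (A \<times>\<^sub>M P') ((B \<times>\<^sub>M P') \<times>\<^sub>M Q') (C \<times>\<^sub>M Q')"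
    by (rule ses_add_right[OF ses_add_left[OF s(1) fp(2)] fp(4)])
  have 2: "ses (X \<times>\<^sub>M P) ((B \<times>\<^sub>M P') \<times>\<^sub>M Q') (C \<times>\<^sub>M Q')"
    by (rule ses_iso1[OF 1 P(3) left_module_prodm[OF l(1,2)]])
  have BQ: "mod_iso R ((B \<times>\<^sub>M Q') \<times>\<^sub>M P') ((X \<times>\<^sub>M Q) \<times>\<^sub>M P')"
    by (rule mod_iso_prodm[OF mod_iso_sym[OF Q(3) left_module_prodm[OF l(1,4)]] mod_iso_refl
          left_module_prodm[OF ses_lm(2)[OF s(1)] l(5)] l(3)])
  have "mod_iso R ((B \<times>\<^sub>M P') \<times>\<^sub>M Q') (X \<times>\<^sub>M Q \<times>\<^sub>M P')"
    by (rule mod_iso_trans[OF mod_iso_trans[OF mod_iso_prodm_swap BQ] mod_iso_prodm_assoc])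
  from ses_iso2[OF 2 this left_module_prodm[OF l(1) left_module_prodm[OF l(4,3)]]]
  have 3: "ses (X \<times>\<^sub>M P) (X \<times>\<^sub>M Q \<times>\<^sub>M P') (C \<times>\<^sub>M Q')" .
  have CQ: "stab (C \<times>\<^sub>M Q') W"
    by (rule stab_trans[OF stab_pj_prodm[OF ses_fg(3)[OF s(1)] projective_pj[OF Q(2)]] stab_sym[OF s(4)]])
  note pP = projective_pj[OF P(1)] and pT = pj_prodm[OF projective_pj[OF Q(1)] projective_pj[OF P(2)]]
  obtain H where H: "submodule H R X" "retract (X\<lparr>carrier := H\<rparr>) X" "pd_fin (X\<lparr>carrier := H\<rparr>)"
    "ses ((X\<lparr>carrier := H\<rparr>) \<times>\<^sub>M P) ((X\<lparr>carrier := H\<rparr>) \<times>\<^sub>M Q \<times>\<^sub>M P') (C \<times>\<^sub>M Q')"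
    using ses_cancel[OF X pP pT pd_fin_stab[OF W stab_sym[OF CQ]] 3] by auto
  have fY: "fg R (X\<lparr>carrier := H\<rparr>)" by (rule fg_submodule[OF X H(1)])
  have "tri (X\<lparr>carrier := H\<rparr>) (X\<lparr>carrier := H\<rparr>) W"
    by (rule tri_stab[OF ses_tri[OF H(4)] stab_pj_prodm[OF fY pP] stab_pj_prodm[OF fY pT] CQ])
  then show ?thesis using H(2,3) fY by (intro exI[of _ "X\<lparr>carrier := H\<rparr>"] conjI)
qed

lemma tri_add_left:
  assumes "tri U V W" "fg R E" shows "tri (U \<times>\<^sub>M E) (V \<times>\<^sub>M E) W"
proof -
  obtain A B C :: "('a, 'a list) module" where s: "ses A B C" "stab U A" "stab V B" "stab W C"
    by (rule triE[OF assms(1)])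
  note E = stab_refl[OF assms(2)]
  show ?thesis
    by (rule tri_stab[OF ses_tri[OF ses_add_left[OF s(1) assms(2)]] stab_sym[OF stab_prodm[OF s(2) E]]
          stab_sym[OF stab_prodm[OF s(3) E]] stab_sym[OF s(4)]])
qed

text \<open>A syzygy chosen without regard to minimality, so statements about its iterates are made
  up to \<open>stab\<close>.\<close>

definition om :: "('a, 'a list) module \<Rightarrow> ('a, 'a list) module" where
  "om X = (SOME K. syz X K)"

lemma syz_om: "fg R X \<Longrightarrow> syz X (om X)"
  unfolding om_def by (rule someI_ex) (rule syz_exists)

lemma fg_om: "fg R X \<Longrightarrow> fg R ((om ^^ n) X)"
  by (induction n) (simp_all add: syz_fg(2)[OF syz_om])

lemma pd_om: "fg R X \<Longrightarrow> pd (n + m) X \<longleftrightarrow> pd m ((om ^^ n) X)"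
proof (induction n arbitrary: X)
  case (Suc n)
  have "pd (Suc n + m) X \<longleftrightarrow> pd (n + m) (om X)" using pd_Suc[OF syz_om[OF Suc.prems], of "n + m"] by simp
  also have "\<dots> \<longleftrightarrow> pd m ((om ^^ n) (om X))" by (rule Suc.IH[OF syz_fg(2)[OF syz_om[OF Suc.prems]]])
  finally show ?case by (simp only: funpow_Suc_right comp_apply)
qed simp

lemma pd_fin_om: "fg R X \<Longrightarrow> pd_fin ((om ^^ n) X) \<longleftrightarrow> pd_fin X"
proof (induction n)
  case (Suc n)
  have "pd_fin ((om ^^ Suc n) X) \<longleftrightarrow> pd_fin ((om ^^ n) X)"
    using pd_fin_syz[OF syz_om[OF fg_om[OF Suc.prems, of n]]] by simp
  then show ?case using Suc by simp
qed simp

section \<open>Syzygies of direct sums and their stable coincidences\<close>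

lemma syz_dl: "(\<And>M. M \<in> set Ms \<Longrightarrow> fg R M) \<Longrightarrow> syz (dl Ms) (dl (map om Ms))"
proof (induction Ms)
  case Nil
  show ?case using syzI[OF pj_freem0 ses_id_right[OF zero_mod_fg]] by simp
next
  case (Cons M Ms)
  have M: "fg R M" "\<And>M. M \<in> set Ms \<Longrightarrow> fg R M" using Cons.prems by auto
  have oM: "fg R (om M)" by (rule syz_fg(2)[OF syz_om[OF M(1)]])
  have oMs: "fg R K" if K: "K \<in> set (map om Ms)" for K
  proof -
    obtain N where N: "N \<in> set Ms" "K = om N" using K by auto
    show ?thesis unfolding N(2) by (rule syz_fg(2)[OF syz_om[OF M(2)[OF N(1)]]])
  qed
  have oMMs: "fg R K" if "K \<in> set (om M # map om Ms)" for K using that oM oMs[of K] by auto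
  have "syz (M \<times>\<^sub>M dl Ms) (om M \<times>\<^sub>M dl (map om Ms))"
    by (rule syz_prodm[OF syz_om[OF M(1)] Cons.IH[OF M(2)]])
  from syz_iso1[OF this dl_Cons(2)[OF M] fgD(1)[OF fg_dl[OF Cons.prems]]]
  have "syz (dl (M # Ms)) (om M \<times>\<^sub>M dl (map om Ms))" by simp
  from syz_iso2[OF this dl_Cons(1)[OF oM oMs] fgD(1)[OF fg_dl[OF oMMs]]]
  show ?case by simp
qed

definition syz_rel :: "nat \<Rightarrow> ('a, 'a list) module list \<Rightarrow> ('a, 'a list) module list \<Rightarrow> bool" where
  "syz_rel n Ms Ns \<longleftrightarrow> stab (dl (map (om ^^ n) Ms)) (dl (map (om ^^ n) Ns))"

lemma fg_map_om: "(\<And>M. M \<in> set Ms \<Longrightarrow> fg R M) \<Longrightarrow> K \<in> set (map (om ^^ n) Ms) \<Longrightarrow> fg R K"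
  by (auto simp: fg_om)

lemma syz_map_om:
  assumes "\<And>M. M \<in> set Ms \<Longrightarrow> fg R M"
  shows "syz (dl (map (om ^^ n) Ms)) (dl (map (om ^^ Suc n) Ms))"
proof -
  have "map (om ^^ Suc n) Ms = map om (map (om ^^ n) Ms)" by simp
  then show ?thesis using syz_dl[of "map (om ^^ n) Ms", OF fg_map_om[OF assms]] by (simp only:)
qed

lemma syz_rel_mono:
  assumes "\<And>M. M \<in> set Ms \<Longrightarrow> fg R M" "\<And>M. M \<in> set Ns \<Longrightarrow> fg R M"
  shows "syz_rel n Ms Ns \<Longrightarrow> n \<le> m \<Longrightarrow> syz_rel m Ms Ns"
proof (induction m)
  case (Suc m)
  show ?case
  proof (cases "n = Suc m")
    case False
    then have "syz_rel m Ms Ns" using Suc.prems Suc.IH by linarith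
    then show ?thesis unfolding syz_rel_def
      by (rule syz_stab[OF _ syz_map_om[OF assms(1)] syz_map_om[OF assms(2)]])
  qed (use Suc in simp)
qed simp

lemma dl_append_stab:
  assumes "\<And>M. M \<in> set Ms \<Longrightarrow> fg R M" "\<And>M. M \<in> set Ns \<Longrightarrow> fg R M"
  shows "stab (dl (Ms @ Ns)) (dl Ms \<times>\<^sub>M dl Ns)"
  by (rule stab_iso[OF dl_append[OF assms] fg_dl left_module_prodm[OF fgD(1)[OF fg_dl] fgD(1)[OF fg_dl]]])
    (use assms in auto)

lemma syz_rel_append:
  assumes fg: "\<And>M. M \<in> set Ms \<Longrightarrow> fg R M" "\<And>M. M \<in> set Ns \<Longrightarrow> fg R M"
    "\<And>M. M \<in> set Ms' \<Longrightarrow> fg R M" "\<And>M. M \<in> set Ns' \<Longrightarrow> fg R M"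
    and r: "syz_rel n Ms Ns" "syz_rel n Ms' Ns'"
  shows "syz_rel n (Ms @ Ms') (Ns @ Ns')"
  unfolding syz_rel_def map_append
  by (rule stab_trans[OF dl_append_stab[OF fg_map_om[OF fg(1)] fg_map_om[OF fg(3)]]
        stab_trans[OF stab_prodm[OF r[unfolded syz_rel_def]]
          stab_sym[OF dl_append_stab[OF fg_map_om[OF fg(2)] fg_map_om[OF fg(4)]]]]])

definition count_diff :: "('a, 'a list) module list \<Rightarrow> ('a, 'a list) module list \<Rightarrow> ('a, 'a list) module \<Rightarrow> int" where
  "count_diff Ms Ns M = int (count (mset Ms) M) - int (count (mset Ns) M)"

lemma count_diff_support:
  assumes "set Ms \<subseteq> A" "set Ns \<subseteq> A" "M \<notin> A" shows "count_diff Ms Ns M = 0"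
proof -
  have "M \<notin> set Ms" "M \<notin> set Ns" using assms by auto
  then show ?thesis by (simp add: count_diff_def count_eq_zero_iff[THEN iffD2])
qed

text \<open>
  The differences of multiplicities of direct sums whose \<open>m\<close>-th syzygies are stably isomorphic form
  a subgroup of \<open>\<int>\<^sup>A\<close>. These subgroups ascend with \<open>m\<close> and hence become stationary.
\<close>

lemma syz_rel_stabilizes:
  assumes fin: "finite A" and A: "\<And>M. M \<in> A \<Longrightarrow> fg R M"
  shows "\<exists>n. \<forall>m Ms Ns. set Ms \<subseteq> A \<longrightarrow> set Ns \<subseteq> A \<longrightarrow> syz_rel m Ms Ns \<longrightarrow>
    (\<exists>Ms' Ns'. set Ms' \<subseteq> A \<and> set Ns' \<subseteq> A \<and> syz_rel n Ms' Ns' \<and> mset (Ms @ Ns') = mset (Ns @ Ms'))"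
proof -
  define G where "G n = {v. \<exists>Ms Ns. v = count_diff Ms Ns \<and> set Ms \<subseteq> A \<and> set Ns \<subseteq> A \<and> syz_rel n Ms Ns}" for n
  have fgA: "fg R M" if "set Ms \<subseteq> A" "M \<in> set Ms" for M Ms using A that by auto
  have mono: "G n \<subseteq> G m" if nm: "n \<le> m" for n m
  proof
    fix v assume "v \<in> G n"
    then obtain Ms Ns where *: "v = count_diff Ms Ns" "set Ms \<subseteq> A" "set Ns \<subseteq> A" "syz_rel n Ms Ns"
      unfolding G_def by auto
    have "syz_rel m Ms Ns" by (rule syz_rel_mono[OF fgA[OF *(2)] fgA[OF *(3)] *(4) nm])
    then show "v \<in> G m" unfolding G_def using * by auto
  qed
  have "\<exists>n. \<forall>m\<ge>n. G m = G n"
  proof (rule subgroup_chain[OF fin mono])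
    fix n
    have "syz_rel n [] []" unfolding syz_rel_def by (simp add: stab_refl fg_freem)
    then show "(\<lambda>_. 0) \<in> G n" unfolding G_def
      by (intro CollectI exI[of _ "[]"]) (auto simp: fun_eq_iff count_diff_def)
  next
    fix n u v assume "u \<in> G n" "v \<in> G n"
    then obtain Ms Ns Ms' Ns' where *: "u = count_diff Ms Ns" "set Ms \<subseteq> A" "set Ns \<subseteq> A" "syz_rel n Ms Ns"
      "v = count_diff Ms' Ns'" "set Ms' \<subseteq> A" "set Ns' \<subseteq> A" "syz_rel n Ms' Ns'" unfolding G_def by auto
    have "syz_rel n Ns' Ms'" using *(8) unfolding syz_rel_def by (rule stab_sym)
    \<comment> \<open>Subtracting a difference exchanges its two lists, which is possible because
      stable isomorphism is symmetric.\<close>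
    then have "syz_rel n (Ms @ Ns') (Ns @ Ms')"
      by (intro syz_rel_append[OF fgA[OF *(2)] fgA[OF *(3)] fgA[OF *(7)] fgA[OF *(6)] *(4)])
    moreover have "(\<lambda>x. u x - v x) = count_diff (Ms @ Ns') (Ns @ Ms')"
      by (auto simp: fun_eq_iff *(1,5) count_diff_def)
    ultimately show "(\<lambda>x. u x - v x) \<in> G n" unfolding G_def using *
      by (intro CollectI exI[of _ "Ms @ Ns'"] exI[of _ "Ns @ Ms'"]) auto
  next
    fix n v x assume "v \<in> G n" "x \<notin> A"
    then show "v x = 0" unfolding G_def using count_diff_support by auto
  qed
  then obtain n where n: "\<And>m. m \<ge> n \<Longrightarrow> G m = G n" by auto
  have sub: "G m \<subseteq> G n" for m using mono[of m "max m n"] n[of "max m n"] by auto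
  show ?thesis
  proof (intro exI[of _ n] allI impI)
    fix m Ms Ns assume *: "set Ms \<subseteq> A" "set Ns \<subseteq> A" "syz_rel m Ms Ns"
    then have "count_diff Ms Ns \<in> G m" unfolding G_def by auto
    then have "count_diff Ms Ns \<in> G n" using sub by auto
    then obtain Ms' Ns' where 1: "count_diff Ms Ns = count_diff Ms' Ns'" "set Ms' \<subseteq> A" "set Ns' \<subseteq> A" "syz_rel n Ms' Ns'"
      unfolding G_def by auto
    \<comment> \<open>The equality of integral differences, with the negative terms moved
      across.\<close>
    have "mset (Ms @ Ns') = mset (Ns @ Ms')"
    proof (rule multiset_eqI)
      fix M
      have "count_diff Ms Ns M = count_diff Ms' Ns' M" using 1(1) by simp
      then show "count (mset (Ms @ Ns')) M = count (mset (Ns @ Ms')) M" by (simp add: count_diff_def)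
    qed
    then show "\<exists>Ms' Ns'. set Ms' \<subseteq> A \<and> set Ns' \<subseteq> A \<and> syz_rel n Ms' Ns' \<and> mset (Ms @ Ns') = mset (Ns @ Ms')"
      using 1 by auto
  qed
qed

section \<open>Uniform bounds for summands of direct sums and for cokernels\<close>

lemma pd_prodm:
  fixes X Y :: "('a, 'a list) module"
  shows "pd n X \<Longrightarrow> pd n Y \<Longrightarrow> pd n (X \<times>\<^sub>M Y)"
proof (induction n arbitrary: X Y)
  case 0
  then show ?case by (simp add: pd_0 pj_prodm)
next
  case (Suc n)
  note fg = pd_fg[OF Suc.prems(1)] pd_fg[OF Suc.prems(2)]
  have "pd n (om X \<times>\<^sub>M om Y)"
    using Suc.IH[of "om X" "om Y"] Suc.prems unfolding pd_Suc[OF syz_om[OF fg(1)]] pd_Suc[OF syz_om[OF fg(2)]] by simp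
  then show ?case using pd_Suc[OF syz_prodm[OF syz_om[OF fg(1)] syz_om[OF fg(2)]]] by simp
qed

lemma pd_dl: "(\<And>M. M \<in> set Ms \<Longrightarrow> pd n M) \<Longrightarrow> pd n (dl Ms)"
proof (induction Ms)
  case Nil
  show ?case using pd_mono[of 0 "freem 0" n] pj_freem0 by (simp add: pd_0)
next
  case (Cons M Ms)
  have p: "pd n M" "pd n (dl Ms)" using Cons by auto
  show ?case unfolding dl.simps
    by (rule pd_iso[OF pd_prodm[OF p] rep(2) fgD(1)[OF rep(1)]]) (rule fg_prodm[OF pd_fg[OF p(1)] pd_fg[OF p(2)]])+
qed

text \<open>As in the Krull-Schmidt theorem, every indecomposable summand of \<open>Y\<close> is
  isomorphic to one of finitely many modules, the indecomposable summands of the members of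
  \<open>A\<close>. The bound is a maximum over those of finite projective dimension.\<close>

lemma pd_retract_bound:
  assumes fin: "finite A" and A: "\<And>M. M \<in> A \<Longrightarrow> fg R M"
  shows "\<exists>b. \<forall>Ms (Y :: ('a, 'a list) module). set Ms \<subseteq> A \<longrightarrow> fg R Y \<longrightarrow> retract Y (dl Ms) \<longrightarrow> pd_fin Y \<longrightarrow> pd b Y"
proof -
  have "\<forall>M\<in>A. \<exists>Ks. (\<forall>K\<in>set Ks. fg R K \<and> indecomposable R K) \<and> mod_iso R M (dl Ks)"
    using ex_decomposition A by meson
  from bchoice[OF this] obtain D where
    D: "\<And>M K. M \<in> A \<Longrightarrow> K \<in> set (D M) \<Longrightarrow> fg R K \<and> indecomposable R K" "\<And>M. M \<in> A \<Longrightarrow> mod_iso R M (dl (D M))" by auto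
  define L where "L = (\<Union>M\<in>A. set (D M))"
  have finL: "finite L" unfolding L_def using fin by auto
  have "\<forall>K\<in>L. \<exists>n. pd_fin K \<longrightarrow> pd n K" unfolding pd_fin_def by auto
  from bchoice[OF this] obtain e where e: "\<And>K. K \<in> L \<Longrightarrow> pd_fin K \<Longrightarrow> pd (e K) K" by auto
  \<comment> \<open>The inserted \<open>0\<close> keeps the maximum defined if \<open>L\<close> is
    empty. On modules of infinite projective dimension the value of \<open>e\<close> is arbitrary
    and can only enlarge \<open>b\<close>.\<close>
  define b where "b = Max (insert 0 (e ` L))"
  have b: "pd b K" if "K \<in> L" "pd_fin K" for K
  proof (rule pd_mono[OF e[OF that]])
    show "e K \<le> b" unfolding b_def using finL that(1) by (intro Max_ge) auto
  qed
  show ?thesis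
  proof (intro exI[of _ b] allI impI)
    fix Ms and Y :: "('a, 'a list) module"
    assume Ms: "set Ms \<subseteq> A" and Y: "fg R Y" and r: "retract Y (dl Ms)" and f: "pd_fin Y"
    have fMs: "fg R M" if "M \<in> set Ms" for M using A Ms that by auto
    obtain Ys where Ys: "\<And>K. K \<in> set Ys \<Longrightarrow> fg R K \<and> indecomposable R K \<and> retract K Y" "mod_iso R Y (dl Ys)"
      using ex_decomposition[OF Y] by auto
    have "pd b K" if K: "K \<in> set Ys" for K
    proof -
      have K1: "fg R K" "indecomposable R K" "retract K Y" using Ys(1)[OF K] by simp_all
      note lK = fgD(1)[OF K1(1)]
      have "\<exists>M\<in>set Ms. retract K M"
        by (rule indecomposable_retract_dl[OF K1(1,2) retract_trans[OF K1(3) r] fMs])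
      then obtain M where M: "M \<in> set Ms" "retract K M" by (rule bexE)
      have MA: "M \<in> A" using M(1) Ms by auto
      have "retract K (dl (D M))" by (rule retract_trans[OF M(2) retract_iso[OF D(2)[OF MA] fgD(1)[OF A[OF MA]]]])
      then have "\<exists>N\<in>set (D M). retract K N"
        by (rule indecomposable_retract_dl[OF K1(1,2)]) (use D(1)[OF MA] in simp)
      then obtain N where N: "N \<in> set (D M)" "retract K N" by (rule bexE)
      have N1: "fg R N" "indecomposable R N" using D(1)[OF MA N(1)] by simp_all
      have i: "mod_iso R K N" by (rule indecomposable_retract_iso[OF N1(2) K1(2) fgD(1)[OF N1(1)] lK N(2)])
      have "pd_fin K" by (rule pd_fin_retract[OF K1(3) f lK])
      then have "pd_fin N" by (rule pd_fin_iso[OF _ i fgD(1)[OF N1(1)]])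
      then have "pd b N" using b N(1) MA by (auto simp: L_def)
      then show ?thesis by (rule pd_iso[OF _ mod_iso_sym[OF i lK] lK])
    qed
    then have "pd b (dl Ys)" by (rule pd_dl)
    then show "pd b Y" by (rule pd_iso[OF _ mod_iso_sym[OF Ys(2) fgD(1)[OF Y]] fgD(1)[OF Y]])
  qed
qed

text \<open>The first two terms become stably isomorphic after as many syzygies as the dimension of
  \<open>V\<close>, a number not known to be bounded. The stationary chain of subgroups replaces it
  by a fixed \<open>n\<close>, at the price of adding one common summand to both terms;
  \<open>tri_cancel\<close> then applies.\<close>

theorem igusa_todorov:
  assumes fin: "finite A" and A: "\<And>M. M \<in> A \<Longrightarrow> fg R M"
  shows "\<exists>b. \<forall>Ms Ns (V :: ('a, 'a list) module). set Ms \<subseteq> A \<longrightarrow> set Ns \<subseteq> A \<longrightarrow> tri (dl Ms) (dl Ns) V \<longrightarrow>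
    pd_fin V \<longrightarrow> pd b V"
proof -
  obtain n where n: "\<forall>m Ms Ns. set Ms \<subseteq> A \<longrightarrow> set Ns \<subseteq> A \<longrightarrow> syz_rel m Ms Ns \<longrightarrow>
    (\<exists>Ms' Ns'. set Ms' \<subseteq> A \<and> set Ns' \<subseteq> A \<and> syz_rel n Ms' Ns' \<and> mset (Ms @ Ns') = mset (Ns @ Ms'))"
    using syz_rel_stabilizes[OF fin A] by (rule exE)
  have fo: "finite ((om ^^ n) ` A)" using fin by simp
  have fgo: "fg R M" if "M \<in> (om ^^ n) ` A" for M using that by (auto simp: fg_om A)
  obtain b where b: "\<forall>Ms (Y :: ('a, 'a list) module). set Ms \<subseteq> (om ^^ n) ` A \<longrightarrow> fg R Y \<longrightarrow>
      retract Y (dl Ms) \<longrightarrow> pd_fin Y \<longrightarrow> pd b Y"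
    using pd_retract_bound[OF fo fgo] by (rule exE)
  show ?thesis
  \<comment> \<open>\<open>n\<close> syzygies, then a cokernel between modules of dimension at most
    \<open>b\<close>.\<close>
  proof (intro exI[of _ "n + Suc b"] allI impI)
    fix Ms Ns and V :: "('a, 'a list) module"
    assume Ms: "set Ms \<subseteq> A" and Ns: "set Ns \<subseteq> A" and t: "tri (dl Ms) (dl Ns) V" and V: "pd_fin V"
    have fgA: "fg R M" if "set Ls \<subseteq> A" "M \<in> set Ls" for M Ls using A that by auto
    note fV = tri_fg(3)[OF t]
    have ts: "tri (dl (map (om ^^ s) Ms)) (dl (map (om ^^ s) Ns)) ((om ^^ s) V)" for s
    proof (induction s)
      case 0
      show ?case using t by simp
    next
      case (Suc s)
      have "syz ((om ^^ s) V) ((om ^^ Suc s) V)" using syz_om[OF fg_om[OF fV, of s]] by simp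
      from tri_syz[OF Suc syz_map_om[OF fgA[OF Ms]] syz_map_om[OF fgA[OF Ns]] this] show ?case .
    qed
    obtain r where "pd r V" using V unfolding pd_fin_def by auto
    then have "pj ((om ^^ r) V)" using pd_om[OF fV, of r 0] by (simp add: pd_0)
    \<comment> \<open>Where the third term is projective, the triangle splits and the first two
      terms agree up to projectives.\<close>
    then have "syz_rel r Ms Ns" unfolding syz_rel_def by (rule tri_pj[OF ts])
    from n[rule_format, OF Ms Ns this] obtain Ms' Ns' where
      *: "set Ms' \<subseteq> A" "set Ns' \<subseteq> A" "syz_rel n Ms' Ns'" "mset (Ms @ Ns') = mset (Ns @ Ms')" by auto
    let ?o = "map (om ^^ n)"
    note f = fg_map_om[OF fgA[OF Ms]] fg_map_om[OF fgA[OF Ns]] fg_map_om[OF fgA[OF *(1)]] fg_map_om[OF fgA[OF *(2)]]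
    let ?X = "dl (?o (Ms @ Ns'))"
    have MsNs': "set (Ms @ Ns') \<subseteq> A" using Ms *(2) by simp
    have fX: "fg R ?X" by (rule fg_dl[OF fg_map_om[OF fgA[OF MsNs']]])
    have E: "fg R (dl (?o Ns'))" by (rule fg_dl[OF f(4)])
    have 1: "stab (dl (?o Ms) \<times>\<^sub>M dl (?o Ns')) ?X"
      unfolding map_append by (rule stab_sym[OF dl_append_stab[OF f(1,4)]])
    have ms: "mset (?o (Ns @ Ms')) = mset (?o (Ms @ Ns'))" unfolding mset_map *(4) by (rule refl)
    have NsMs': "set (Ns @ Ms') \<subseteq> A" using Ns *(1) by simp
    have 3: "stab (dl (?o (Ns @ Ms'))) ?X"
      by (rule stab_iso[OF dl_perm[OF ms fg_map_om[OF fgA[OF NsMs']]] fg_dl[OF fg_map_om[OF fgA[OF NsMs']]] fgD(1)[OF fX]])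
    have 4: "stab (dl (?o Ns) \<times>\<^sub>M dl (?o Ms')) (dl (?o (Ns @ Ms')))"
      unfolding map_append by (rule stab_sym[OF dl_append_stab[OF f(2,3)]])
    \<comment> \<open>\<open>Ns'\<close> and \<open>Ms'\<close> are interchangeable after
      \<open>n\<close> syzygies. With \<open>4\<close> and \<open>3\<close>, the second term,
      enlarged by the same summand as the first, becomes \<open>?X\<close> too.\<close>
    have 5: "stab (dl (?o Ns) \<times>\<^sub>M dl (?o Ns')) (dl (?o Ns) \<times>\<^sub>M dl (?o Ms'))"
      by (rule stab_prodm[OF stab_refl[OF fg_dl[OF f(2)]] stab_sym[OF *(3)[unfolded syz_rel_def]]])
    have 2: "stab (dl (?o Ns) \<times>\<^sub>M dl (?o Ns')) ?X" by (rule stab_trans[OF 5 stab_trans[OF 4 3]])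
    have tX: "tri ?X ?X ((om ^^ n) V)"
      by (rule tri_stab[OF tri_add_left[OF ts E] 1 2 stab_refl[OF fg_om[OF fV]]])
    have "pd_fin ((om ^^ n) V)" using V pd_fin_om[OF fV] by simp
    from tri_cancel[OF tX this] obtain Y :: "('a, 'a list) module" where
      Y: "retract Y ?X" "fg R Y" "pd_fin Y" "tri Y Y ((om ^^ n) V)" by auto
    have "set (?o (Ms @ Ns')) \<subseteq> (om ^^ n) ` A" using MsNs' by auto
    then have "pd b Y" by (rule b[rule_format, OF _ Y(2,1,3)])
    then have "pd (Suc b) ((om ^^ n) V)" by (intro tri_pd_cokernel[OF Y(4)])
    then show "pd (n + Suc b) V" by (simp only: pd_om[OF fV])
  qed
qed

end

section \<open>Projective covers and minimal syzygies\<close>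

context finite_length_ring
begin

lemma surj_endo_inj:
  assumes X: "fg R X" and g: "g \<in> mod_hom R X X" and s: "g ` carrier X = carrier X"
  shows "inj_on g (carrier X)"
proof -
  obtain m where m: "inj_on g ((g ^^ m) ` carrier X)" using fitting[OF X g] by auto
  have "(g ^^ n) ` carrier X = carrier X" for n
  proof (induction n)
    case (Suc n)
    have "(g ^^ Suc n) ` carrier X = g ` (g ^^ n) ` carrier X" by (simp add: image_comp)
    then show ?case by (simp only: Suc s)
  qed simp
  then show ?thesis using m by simp
qed

lemma cover_summand:
  fixes P :: "('a, 'a list) module"
  assumes P: "pj P" and X: "fg R X" and pi: "\<pi> \<in> mod_hom R P X" "\<pi> ` carrier P = carrier X"
  shows "\<exists>U L. direct_decomp R P U L \<and> (\<forall>x\<in>L. \<pi> x = \<zero>\<^bsub>X\<^esub>) \<and> projective_cover R (P\<lparr>carrier := U\<rparr>) X \<pi>"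
proof -
  note fP = pj_fg[OF P]
  note lP = fgD(1)[OF fP] and lX = fgD(1)[OF X]
  interpret P: left_module R P by fact
  let ?S = "{U. submodule U R P \<and> \<pi> ` U = carrier X}"
  have "carrier P \<in> ?S" using submodule_carrier[OF lP] pi(2) by simp
  then have "?S \<noteq> {}" by force
  then have "\<exists>U\<in>?S. \<forall>V\<in>?S. V \<subseteq> U \<longrightarrow> V = U"
  proof (rule chain_cond_minimal[OF fg_chain_cond[OF fP]])
    fix U assume "U \<in> ?S"
    then show "submodule U R P \<and> {\<zero>\<^bsub>P\<^esub>} \<subseteq> U \<and> U \<subseteq> carrier P" by (simp add: submodule_iff[OF lP])
  qed
  then obtain U where US: "U \<in> ?S" and minU: "\<forall>V\<in>?S. V \<subseteq> U \<longrightarrow> V = U" by (rule bexE)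
  have U: "submodule U R P" and piU: "\<pi> ` U = carrier X" using US by simp_all
  have min: "V = U" if "submodule V R P" "\<pi> ` V = carrier X" "V \<subseteq> U" for V
    using bspec[OF minU, of V] that by simp
  have UP: "x \<in> carrier P" if "x \<in> U" for x using U that unfolding submodule_iff[OF lP] by auto
  let ?U = "P\<lparr>carrier := U\<rparr>"
  have fU: "fg R ?U" by (rule fg_submodule[OF fP U])
  note lU = fgD(1)[OF fU]
  have incl: "(\<lambda>x. x) \<in> mod_hom R ?U P" by (rule mod_hom_incl) (use UP in auto)
  have piUh: "\<pi> \<in> mod_hom R ?U X" using mod_hom_comp[OF incl pi(1)] by simp
  obtain h where h: "h \<in> mod_hom R P ?U" "\<And>x. x \<in> carrier P \<Longrightarrow> \<pi> (h x) = \<pi> x"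
    using pj_lift[OF P fU X piUh _ pi(1)] piU by auto
  have hc: "h x \<in> U" if "x \<in> carrier P" for x using mod_hom_closed[OF h(1) that] by simp
  have hU: "h ` U = U"
  proof (rule min)
    have "h \<in> mod_hom R P P" using mod_hom_comp[OF h(1) incl] by simp
    then show "submodule (h ` U) R P" by (rule submodule_image[OF lP lP _ U])
    have "\<pi> ` (h ` U) = \<pi> ` U" unfolding image_image by (rule image_cong[OF refl h(2)[OF UP]])
    then show "\<pi> ` (h ` U) = carrier X" using piU by simp
    show "h ` U \<subseteq> U" using hc UP by auto
  qed
  have hUU: "h \<in> mod_hom R ?U ?U" using mod_hom_comp[OF incl h(1)] by simp
  have inj: "inj_on h U" using surj_endo_inj[OF fU hUU] hU by simp
  let ?L = "{x \<in> carrier P. h x = \<zero>\<^bsub>?U\<^esub>}"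
  have L: "submodule ?L R P" by (rule submodule_kernel[OF lP lU h(1)])
  have h0: "h \<zero>\<^bsub>P\<^esub> = \<zero>\<^bsub>P\<^esub>" using mod_hom_zero[OF lP lU h(1)] by simp
  have zU: "\<zero>\<^bsub>P\<^esub> \<in> U" using U unfolding submodule_iff[OF lP] by simp
  have dec: "direct_decomp R P U ?L"
  proof (rule direct_decompI[OF lP U L])
    fix x assume x: "x \<in> carrier P"
    have "h x \<in> h ` U" unfolding hU by (rule hc[OF x])
    then obtain u where u: "h x = h u" "u \<in> U" by (rule imageE)
    have uP: "u \<in> carrier P" by (rule UP[OF u(2)])
    have "h (x \<ominus>\<^bsub>P\<^esub> u) = h x \<ominus>\<^bsub>?U\<^esub> h u" by (rule mod_hom_diff[OF lP lU h(1) x uP])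
    also have "\<dots> = \<zero>\<^bsub>?U\<^esub>"
      unfolding u(1) using left_module.diff_eq_zero_iff[OF lU, of "h u" "h u"] hc[OF uP] by simp
    finally have "x \<ominus>\<^bsub>P\<^esub> u \<in> ?L" using x uP by simp
    moreover have "x = u \<oplus>\<^bsub>P\<^esub> (x \<ominus>\<^bsub>P\<^esub> u)"
      using x uP unfolding a_minus_def P.M.a_lcomm[OF uP x P.M.a_inv_closed[OF uP]] by (simp add: P.M.r_neg)
    ultimately show "\<exists>h\<in>U. \<exists>k\<in>?L. x = h \<oplus>\<^bsub>P\<^esub> k" using u(2) by (rule_tac bexI, rule_tac bexI)
  next
    fix x assume "x \<in> U" "x \<in> ?L"
    then have "h x = h \<zero>\<^bsub>P\<^esub>" "x \<in> U" using h0 by simp_all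
    then show "x = \<zero>\<^bsub>P\<^esub>" using inj zU by (simp add: inj_on_eq_iff)
  qed
  have Lpi: "\<pi> x = \<zero>\<^bsub>X\<^esub>" if "x \<in> ?L" for x
  proof -
    have "x \<in> carrier P" "h x = \<zero>\<^bsub>P\<^esub>" using that by simp_all
    then show ?thesis using h(2)[of x] mod_hom_zero[OF lP lX pi(1)] by simp
  qed
  have "pj ?U" by (rule pj_retract[OF direct_decomp_retract[OF lP dec] P lU])
  then have "projective R ?U" by (rule pj_projective)
  \<comment> \<open>If \<open>V\<close> and the kernel span \<open>U\<close>, then \<open>V\<close>
    already maps onto \<open>X\<close>, and minimality of \<open>U\<close> applies.\<close>
  moreover have "V = carrier ?U" if V: "submodule V R ?U" "V <+>\<^bsub>?U\<^esub> a_kernel ?U X \<pi> = carrier ?U" for V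
  proof -
    have V': "submodule V R P" "V \<subseteq> U" using V(1) unfolding submodule_sub_iff[OF lP U] by auto
    have "\<pi> ` V = carrier X"
    proof
      show "\<pi> ` V \<subseteq> carrier X" using V'(2) piU by auto
      show "carrier X \<subseteq> \<pi> ` V"
      proof
        fix x assume "x \<in> carrier X"
        then have "x \<in> \<pi> ` U" unfolding piU .
        then obtain u where u: "x = \<pi> u" "u \<in> U" by (rule imageE)
        have "u \<in> V <+>\<^bsub>?U\<^esub> a_kernel ?U X \<pi>" using V(2) u(2) by simp
        then obtain v w where vw: "v \<in> V" "w \<in> a_kernel ?U X \<pi>" "u = v \<oplus>\<^bsub>?U\<^esub> w" unfolding set_add_iff by auto
        have w: "w \<in> U" "\<pi> w = \<zero>\<^bsub>X\<^esub>" using vw(2) unfolding a_kernel_def' by simp_all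
        have vU: "v \<in> U" using vw(1) V'(2) by auto
        have "\<pi> u = \<pi> v \<oplus>\<^bsub>X\<^esub> \<pi> w" using vw(3) mod_hom_add[OF piUh, of v w] vU w(1) by simp
        also have "\<dots> = \<pi> v" using w(2) abelian_group.axioms(1)[OF left_module.axioms(2)[OF lX]]
            mod_hom_closed[OF piUh, of v] vU by (simp add: abelian_monoid.r_zero)
        finally show "x \<in> \<pi> ` V" using u(1) vw(1) by simp
      qed
    qed
    then show ?thesis using min[OF V'(1) _ V'(2)] by simp
  qed
  ultimately have "projective_cover R ?U X \<pi>"
    unfolding projective_cover_def using piUh piU by simp
  then show ?thesis using dec Lpi by (intro exI[of _ U] exI[of _ ?L] conjI ballI)
qed

lemma ex_projective_cover:
  assumes "fg R X" shows "\<exists>P f. projective_cover R P X f"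
proof -
  obtain n f where f: "f \<in> mod_hom R (freem n) X" "f ` carrier (freem n) = carrier X"
    using freem_surj[OF assms] by auto
  show ?thesis using cover_summand[OF pj_freem assms f] by auto
qed

lemma projective_cover_ses:
  assumes c: "projective_cover R P X f" and X: "fg R X"
  shows "ses (P\<lparr>carrier := a_kernel P X f\<rparr>) P X"
  using c ses_kernel[OF projective_fg fgD(1)[OF X]] unfolding projective_cover_def a_kernel_def' by simp

lemma projective_cover_syz:
  assumes c: "projective_cover R P X f" and X: "fg R X"
  shows "syz X (P\<lparr>carrier := a_kernel P X f\<rparr>)"
  by (rule syzI[OF projective_pj projective_cover_ses[OF c X]]) (use c in \<open>simp add: projective_cover_def\<close>)

section \<open>Minimal syzygies compared with chosen ones\<close>

lemma stab_om: "stab X Y \<Longrightarrow> stab ((om ^^ n) X) ((om ^^ n) Y)"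
proof (induction n)
  case (Suc n)
  have s: "stab ((om ^^ n) X) ((om ^^ n) Y)" by (rule Suc.IH[OF Suc.prems])
  show ?case using syz_stab[OF s syz_om[OF stab_fg(1)[OF s]] syz_om[OF stab_fg(2)[OF s]]] by simp
qed simp

lemma ex_nth_syzygy: "fg R X \<Longrightarrow> \<exists>Z. nth_syzygy R n X Z \<and> stab Z ((om ^^ n) X)"
proof (induction n arbitrary: X)
  case 0
  show ?case using nth_syzygy.zero[of R X] stab_refl[OF 0] by auto
next
  case (Suc n)
  obtain P f where c: "projective_cover R P X f" using ex_projective_cover[OF Suc.prems] by auto
  let ?K = "P\<lparr>carrier := a_kernel P X f\<rparr>"
  have K: "syz X ?K" by (rule projective_cover_syz[OF c Suc.prems])
  obtain Z where Z: "nth_syzygy R n ?K Z" "stab Z ((om ^^ n) ?K)" using Suc.IH[OF syz_fg(2)[OF K]] by auto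
  have "stab ?K (om X)" by (rule syz_stab[OF stab_refl[OF Suc.prems] K syz_om[OF Suc.prems]])
  then have "stab ((om ^^ n) ?K) ((om ^^ n) (om X))" by (rule stab_om)
  then have "stab Z ((om ^^ Suc n) X)" unfolding funpow_Suc_right comp_apply by (rule stab_trans[OF Z(2)])
  then show ?case using nth_syzygy.Suc[OF c Z(1)] by auto
qed

section \<open>Syzygy-finiteness\<close>

text \<open>The representatives in \<open>m_syzygy_finite\<close> are arbitrary records. Each one
  isomorphic to a finitely generated module is replaced by such a module, so that the general lemmas
  apply.\<close>

lemma m_syzygy_finite_fg:
  assumes "m_syzygy_finite R m C"
  shows "\<exists>F :: ('a, 'a list) module set. finite F \<and> (\<forall>N\<in>F. fg R N) \<and> (\<forall>M\<in>syzygy_cat R m C. indecomposable R M \<longrightarrow> (\<exists>N\<in>F. mod_iso R M N))"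
proof -
  obtain F :: "('a, 'a list) module set" where F: "finite F"
    "\<And>M. M \<in> syzygy_cat R m C \<Longrightarrow> indecomposable R M \<Longrightarrow> \<exists>N\<in>F. mod_iso R M N"
    using assms unfolding m_syzygy_finite_def by auto
  define G where "G = {N \<in> F. \<exists>M :: ('a, 'a list) module. fg R M \<and> mod_iso R M N}"
  have "\<forall>N\<in>G. \<exists>M :: ('a, 'a list) module. fg R M \<and> mod_iso R M N" by (simp add: G_def)
  from bchoice[OF this] obtain r :: "('a, 'a list) module \<Rightarrow> ('a, 'a list) module" where rr: "\<forall>N\<in>G. fg R (r N) \<and> mod_iso R (r N) N" by (rule exE)
  have r: "fg R (r N)" "mod_iso R (r N) N" if "N \<in> G" for N using bspec[OF rr that] by simp_all
  show ?thesis
  proof (intro exI[of _ "r ` G"] conjI ballI impI)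
    show "finite (r ` G)" using F(1) by (simp add: G_def)
    show "fg R N" if "N \<in> r ` G" for N using that r(1) by auto
    fix M assume M: "M \<in> syzygy_cat R m C" "indecomposable R M"
    then obtain N where N: "N \<in> F" "mod_iso R M N" using F(2) by auto
    have "fg R M" using M(1) by (simp add: syzygy_cat_def fg_mods_iff)
    then have NG: "N \<in> G" using N by (auto simp: G_def)
    have "mod_iso R M (r N)" by (rule mod_iso_trans[OF N(2) mod_iso_sym[OF r(2)[OF NG] fgD(1)[OF r(1)[OF NG]]]])
    then show "\<exists>N\<in>r ` G. mod_iso R M N" using NG by auto
  qed
qed

lemma ex_decomposition_over:
  assumes Z: "fg R Z" and F: "\<And>N. N \<in> F \<Longrightarrow> fg R N"
    and c: "\<And>K :: ('a, 'a list) module. fg R K \<Longrightarrow> indecomposable R K \<Longrightarrow> retract K Z \<Longrightarrow> \<exists>N\<in>F. mod_iso R K N"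
  shows "\<exists>Ms. set Ms \<subseteq> F \<and> mod_iso R Z (dl Ms)"
proof -
  obtain Ks where Ks: "\<And>K. K \<in> set Ks \<Longrightarrow> fg R K \<and> indecomposable R K \<and> retract K Z" "mod_iso R Z (dl Ks)"
    using ex_decomposition[OF Z] by auto
  have "\<forall>K\<in>set Ks. \<exists>N. N \<in> F \<and> mod_iso R K N"
  proof
    fix K assume "K \<in> set Ks"
    then have "\<exists>N\<in>F. mod_iso R K N" using c[of K] Ks(1)[of K] by simp
    then show "\<exists>N. N \<in> F \<and> mod_iso R K N" by auto
  qed
  from bchoice[OF this] obtain r :: "('a, 'a list) module \<Rightarrow> ('a, 'a list) module" where rr: "\<forall>K\<in>set Ks. r K \<in> F \<and> mod_iso R K (r K)" by (rule exE)
  have r: "r K \<in> F" "mod_iso R K (r K)" if "K \<in> set Ks" for K using bspec[OF rr that] by simp_all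
  have "mod_iso R (dl Ks) (dl (map r Ks))"
  proof (rule dl_cong)
    show "list_all2 (mod_iso R) Ks (map r Ks)" using r(2) by (simp add: list_all2_conv_all_nth)
    show "fg R M" if "M \<in> set Ks" for M using Ks(1)[OF that] by simp
    show "fg R M" if "M \<in> set (map r Ks)" for M using that F r(1) by auto
  qed
  then show ?thesis using mod_iso_trans[OF Ks(2)] r(1) by (intro exI[of _ "map r Ks"]) auto
qed

lemma m_syzygy_finite_decomposition:
  assumes "m_syzygy_finite R m C"
  shows "\<exists>F :: ('a, 'a list) module set. finite F \<and> (\<forall>N\<in>F. fg R N) \<and>
    (\<forall>X\<in>C. fg R X \<longrightarrow> (\<exists>Ms. set Ms \<subseteq> F \<and> stab (dl Ms) ((om ^^ m) X)))"
proof -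
  obtain F :: "('a, 'a list) module set" where F: "finite F" "\<And>N. N \<in> F \<Longrightarrow> fg R N"
    "\<And>M. M \<in> syzygy_cat R m C \<Longrightarrow> indecomposable R M \<Longrightarrow> \<exists>N\<in>F. mod_iso R M N"
    using m_syzygy_finite_fg[OF assms] by auto
  have "\<exists>Ms. set Ms \<subseteq> F \<and> stab (dl Ms) ((om ^^ m) X)" if X: "X \<in> C" "fg R X" for X
  proof -
    obtain Z where Z: "nth_syzygy R m X Z" "stab Z ((om ^^ m) X)" using ex_nth_syzygy[OF X(2)] by auto
    note fZ = stab_fg(1)[OF Z(2)]
    have "\<exists>Ms. set Ms \<subseteq> F \<and> mod_iso R Z (dl Ms)"
    proof (rule ex_decomposition_over[OF fZ F(2)])
      fix K :: "('a, 'a list) module" assume K: "fg R K" "indecomposable R K" "retract K Z"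
      have "direct_summand R K Z" by (rule retract_direct_summand[OF K(3) fgD(1)[OF fZ] fgD(1)[OF K(1)]])
      then have "K \<in> syzygy_cat R m C" unfolding syzygy_cat_def using K(1) X(1) Z(1) by (auto simp: fg_mods_iff)
      then show "\<exists>N\<in>F. mod_iso R K N" by (rule F(3)[OF _ K(2)])
    qed
    then obtain Ms where Ms: "set Ms \<subseteq> F" "mod_iso R Z (dl Ms)" by auto
    have "fg R (dl Ms)" by (rule fg_dl) (use Ms(1) F(2) in auto)
    then have "stab Z (dl Ms)" by (rule stab_iso[OF Ms(2) fZ fgD(1)])
    then show ?thesis using Ms(1) stab_trans[OF stab_sym _] Z(2) by (intro exI[of _ Ms] conjI) auto
  qed
  then show ?thesis using F(1,2) by (intro exI[of _ F] conjI ballI impI)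
qed

text \<open>A submodule \<open>H\<close> of a free module is a syzygy of the quotient, but perhaps
  not a minimal one. Splitting off a summand \<open>L\<close> of the free module that lies inside
  \<open>H\<close> leaves a projective cover. So each indecomposable summand of \<open>H\<close> is
  a summand of a minimal first syzygy or is projective. The result is an isomorphism, not just
  \<open>stab\<close>, since it has to survive restriction to a subring.\<close>

lemma torsionless_finite_decomposition:
  assumes "torsionless_finite R"
  shows "\<exists>F :: ('a, 'a list) module set. finite F \<and> (\<forall>N\<in>F. fg R N) \<and>
    (\<forall>n H. submodule H R (freem n) \<longrightarrow> (\<exists>Ms. set Ms \<subseteq> F \<and> mod_iso R ((freem n)\<lparr>carrier := H\<rparr>) (dl Ms)))"
proof -
  obtain F :: "('a, 'a list) module set" where F: "finite F" "\<And>N. N \<in> F \<Longrightarrow> fg R N"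
    "\<And>M. M \<in> syzygy_cat R 1 (fg_mods R) \<Longrightarrow> indecomposable R M \<Longrightarrow> \<exists>N\<in>F. mod_iso R M N"
    using m_syzygy_finite_fg[OF assms[unfolded torsionless_finite_def]] by auto
  have "\<exists>Ms. set Ms \<subseteq> F \<and> mod_iso R ((freem n)\<lparr>carrier := H\<rparr>) (dl Ms)" if H: "submodule H R (freem n)" for n H
  proof (rule ex_decomposition_over[OF fg_submodule[OF fg_freem H] F(2)])
    let ?P = "freem n"
    note lP = left_module_freem[of n]
    interpret P: left_module R ?P by (rule lP)
    let ?H = "?P\<lparr>carrier := H\<rparr>"
    have fH: "fg R ?H" by (rule fg_submodule[OF fg_freem H])
    note lH = fgD(1)[OF fH]
    obtain X :: "('a, 'a list) module" and p where X: "p \<in> mod_hom R ?P X" "left_module R X"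
      "p ` carrier ?P = carrier X" "{x \<in> carrier ?P. p x = \<zero>\<^bsub>X\<^esub>} = H" using ex_quotient[OF lP H] by auto
    have fX: "fg R X" by (rule fg_image[OF fg_freem X(2,1,3)])
    obtain U L where UL: "direct_decomp R ?P U L" "\<And>x. x \<in> L \<Longrightarrow> p x = \<zero>\<^bsub>X\<^esub>"
      "projective_cover R (?P\<lparr>carrier := U\<rparr>) X p" using cover_summand[OF pj_freem fX X(1,3)] by auto
    note dd = direct_decompD[OF lP UL(1)]
    have sU: "U \<subseteq> carrier ?P" and sL: "L \<subseteq> carrier ?P" using dd(1,2) unfolding submodule_iff[OF lP] by simp_all
    have LH: "L \<subseteq> H"
    proof
      fix x assume "x \<in> L"
      then have "x \<in> {x \<in> carrier ?P. p x = \<zero>\<^bsub>X\<^esub>}" using sL UL(2) by auto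
      then show "x \<in> H" by (simp only: X(4))
    qed
    have ker: "a_kernel (?P\<lparr>carrier := U\<rparr>) X p = U \<inter> H"
      unfolding a_kernel_def' X(4)[symmetric] using sU by auto
    have UH: "submodule (U \<inter> H) R ?P" by (rule submodule_Int[OF lP dd(1) H])
    \<comment> \<open>As \<open>L\<close> lies in \<open>H\<close>, removing the
      \<open>L\<close>-component keeps an element inside \<open>H\<close>.\<close>
    have dec: "direct_decomp R ?H (U \<inter> H) L"
    proof (rule direct_decompI[OF lH])
      show "submodule (U \<inter> H) R ?H" "submodule L R ?H"
        unfolding submodule_sub_iff[OF lP H] using UH dd(2) LH by auto
      show "\<exists>h\<in>U \<inter> H. \<exists>k\<in>L. x = h \<oplus>\<^bsub>?H\<^esub> k" if "x \<in> carrier ?H" for x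
      proof -
        have xH: "x \<in> H" using that by simp
        then have "x \<in> carrier ?P" using H unfolding submodule_iff[OF lP] by auto
        then have "\<exists>h\<in>U. \<exists>k\<in>L. x = h \<oplus>\<^bsub>?P\<^esub> k" by (rule dd(3))
        then show ?thesis
        proof (elim bexE)
          fix u l assume ul: "u \<in> U" "l \<in> L" "x = u \<oplus>\<^bsub>?P\<^esub> l"
          have c: "u \<in> carrier ?P" "l \<in> carrier ?P" using ul sU sL by auto
          have "u = x \<ominus>\<^bsub>?P\<^esub> l" unfolding ul(3) a_minus_def
            by (simp only: P.M.a_assoc[OF c P.M.a_inv_closed[OF c(2)]] P.M.r_neg[OF c(2)] P.M.r_zero[OF c(1)])
          moreover have "x \<ominus>\<^bsub>?P\<^esub> l \<in> H" by (rule submodule_diff[OF lP H xH]) (use ul(2) LH in auto)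
          ultimately have "u \<in> U \<inter> H" using ul(1) by simp
          moreover have "x = u \<oplus>\<^bsub>?H\<^esub> l" using ul(3) by simp
          ultimately show ?thesis using ul(2) by (rule_tac bexI, rule_tac bexI)
        qed
      qed
      show "x = \<zero>\<^bsub>?H\<^esub>" if "x \<in> U \<inter> H" "x \<in> L" for x using dd(4)[of x] that by simp
    qed
    have lUH: "left_module R (?P\<lparr>carrier := U \<inter> H\<rparr>)" by (rule left_module_sub[OF lP UH])
    have lL: "left_module R (?P\<lparr>carrier := L\<rparr>)" by (rule left_module_sub[OF lP dd(2)])
    have iso: "mod_iso R (?P\<lparr>carrier := U \<inter> H\<rparr> \<times>\<^sub>M ?P\<lparr>carrier := L\<rparr>) ?H"
      using direct_decomp_iso[OF fH dec] by simp
    fix K :: "('a, 'a list) module" assume K: "fg R K" "indecomposable R K" "retract K ?H"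
    have "retract K (?P\<lparr>carrier := U \<inter> H\<rparr> \<times>\<^sub>M ?P\<lparr>carrier := L\<rparr>)"
      by (rule retract_trans[OF K(3) retract_iso[OF mod_iso_sym[OF iso left_module_prodm[OF lUH lL]] lH]])
    from indecomposable_retract_prodm[OF K(1,2) lUH lL this]
    have "K \<in> syzygy_cat R 1 (fg_mods R)"
    proof
      assume "retract K (?P\<lparr>carrier := U \<inter> H\<rparr>)"
      then have "direct_summand R K (?P\<lparr>carrier := U \<inter> H\<rparr>)"
        by (rule retract_direct_summand[OF _ lUH fgD(1)[OF K(1)]])
      moreover have "nth_syzygy R 1 X (?P\<lparr>carrier := U \<inter> H\<rparr>)"
        using nth_syzygy.Suc[OF UL(3) nth_syzygy.zero] ker by simp
      ultimately show ?thesis unfolding syzygy_cat_def using K(1) fX by (auto simp: fg_mods_iff)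
    next
      assume "retract K (?P\<lparr>carrier := L\<rparr>)"
      then have "retract K ?P"
        by (rule retract_trans[OF _ direct_decomp_retract[OF lP direct_decomp_commute[OF lP UL(1)]]])
      then have "pj K" by (rule pj_retract[OF _ pj_freem fgD(1)[OF K(1)]])
      then show ?thesis unfolding syzygy_cat_def using K(1) pj_projective by (auto simp: fg_mods_iff)
    qed
    then show "\<exists>N\<in>F. mod_iso R K N" by (rule F(3)[OF _ K(2)])
  qed
  then show ?thesis using F(1,2) by (intro exI[of _ F] conjI ballI allI impI)
qed

section \<open>Finite projective resolutions\<close>

text \<open>Cutting off \<open>Q 1\<close> leaves a resolution of the kernel of \<open>d 0\<close>
  that is shorter by one.\<close>

lemma has_proj_resolution_pd:
  "has_proj_resolution R X n \<Longrightarrow> fg R X \<Longrightarrow> pd n X"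
proof (induction n arbitrary: X)
  case 0
  from 0(1)[unfolded has_proj_resolution_def] obtain Q d where
    QQ: "Q 0 = X \<and> (\<forall>i\<le>0. projective R (Q (Suc i)) \<and> d i \<in> mod_hom R (Q (Suc i)) (Q i)) \<and>
        d 0 ` carrier (Q (Suc 0)) = carrier X \<and>
        (\<forall>i<0. d (Suc i) ` carrier (Q (Suc (Suc i))) = a_kernel (Q (Suc i)) (Q i) (d i)) \<and>
        inj_on (d 0) (carrier (Q (Suc 0)))" by (elim exE)
  have Q: "projective R (Q (Suc 0))" "d 0 \<in> mod_hom R (Q (Suc 0)) X"
    "d 0 ` carrier (Q (Suc 0)) = carrier X" "inj_on (d 0) (carrier (Q (Suc 0)))"
    using QQ by auto
  have "mod_iso R (Q (Suc 0)) X" by (rule mod_isoI[OF Q(2,4,3)])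
  then show ?case unfolding pd_0 by (rule pj_iso[OF projective_pj[OF Q(1)] _ fgD(1)[OF 0(2)]])
next
  case (Suc n)
  from Suc.prems(1)[unfolded has_proj_resolution_def] obtain Q d where
    QQ: "Q 0 = X \<and> (\<forall>i\<le>Suc n. projective R (Q (Suc i)) \<and> d i \<in> mod_hom R (Q (Suc i)) (Q i)) \<and>
        d 0 ` carrier (Q (Suc 0)) = carrier X \<and>
        (\<forall>i<Suc n. d (Suc i) ` carrier (Q (Suc (Suc i))) = a_kernel (Q (Suc i)) (Q i) (d i)) \<and>
        inj_on (d (Suc n)) (carrier (Q (Suc (Suc n))))" by (elim exE)
  have Q: "Q 0 = X" "d 0 ` carrier (Q (Suc 0)) = carrier X"
    "inj_on (d (Suc n)) (carrier (Q (Suc (Suc n))))" using QQ by simp_all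
  have Q2: "projective R (Q (Suc i)) \<and> d i \<in> mod_hom R (Q (Suc i)) (Q i)" if "i \<le> Suc n" for i
    using QQ that by simp
  have Q4: "d (Suc i) ` carrier (Q (Suc (Suc i))) = a_kernel (Q (Suc i)) (Q i) (d i)" if "i < Suc n" for i
    using QQ that by simp
  let ?k = "a_kernel (Q (Suc 0)) (Q 0) (d 0)"
  let ?K = "(Q (Suc 0))\<lparr>carrier := ?k\<rparr>"
  have P: "projective R (Q (Suc 0))" and d0: "d 0 \<in> mod_hom R (Q (Suc 0)) X" using Q2[of 0] Q(1) by simp_all
  have s: "ses ?K (Q (Suc 0)) X"
    using ses_kernel[OF projective_fg[OF P] fgD(1)[OF Suc.prems(2)] d0 Q(2)] unfolding a_kernel_def' Q(1) .
  define Q' where "Q' i = (case i of 0 \<Rightarrow> ?K | Suc j \<Rightarrow> Q (Suc (Suc j)))" for i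
  have Q': "Q' 0 = ?K" "Q' (Suc i) = Q (Suc (Suc i))" for i by (simp_all add: Q'_def)
  have im: "d (Suc 0) ` carrier (Q (Suc (Suc 0))) = ?k" using Q4[of 0] by simp
  have d1: "d (Suc 0) \<in> mod_hom R (Q (Suc (Suc 0))) ?K"
  proof -
    have h: "d (Suc 0) \<in> mod_hom R (Q (Suc (Suc 0))) (Q (Suc 0))" using Q2[of "Suc 0"] by simp
    show ?thesis
    proof (rule mod_homI)
      show "d (Suc 0) x \<in> carrier ?K" if "x \<in> carrier (Q (Suc (Suc 0)))" for x
        using imageI[OF that, of "d (Suc 0)"] unfolding im by simp
    qed (simp_all add: mod_hom_add[OF h] mod_hom_smult[OF h])
  qed
  have "has_proj_resolution R ?K n" unfolding has_proj_resolution_def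
  proof (intro exI[of _ Q'] exI[of _ "\<lambda>i. d (Suc i)"] conjI allI impI)
    show "Q' 0 = ?K" by (rule Q'(1))
    show "projective R (Q' (Suc i))" if "i \<le> n" for i using Q2[of "Suc i"] that by (simp add: Q'(2))
    show "d (Suc i) \<in> mod_hom R (Q' (Suc i)) (Q' i)" if "i \<le> n" for i
    proof (cases i)
      case 0
      then show ?thesis using d1 by (simp only: Q')
    next
      case (Suc j)
      then show ?thesis using Q2[of "Suc i"] that by (simp add: Q'(2))
    qed
    show "d (Suc 0) ` carrier (Q' (Suc 0)) = carrier ?K" unfolding Q'(2) im by simp
    show "d (Suc (Suc i)) ` carrier (Q' (Suc (Suc i))) = a_kernel (Q' (Suc i)) (Q' i) (d (Suc i))" if "i < n" for i
    proof (cases i)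
      case 0
      show ?thesis unfolding 0 Q' using Q4[of "Suc 0"] that 0 by (simp add: a_kernel_def')
    next
      case (Suc j)
      show ?thesis unfolding Suc Q' using Q4[of "Suc i"] that Suc by simp
    qed
    show "inj_on (d (Suc n)) (carrier (Q' (Suc n)))" unfolding Q' by (rule Q(3))
  qed
  then have "pd n ?K" by (rule Suc.IH[OF _ ses_fg(1)[OF s]])
  then show ?case unfolding pd_Suc[OF syzI[OF projective_pj[OF P] s]] .
qed

lemma pdle_has_proj_resolution: "pdle n X \<Longrightarrow> has_proj_resolution R X n"
proof (induction n arbitrary: X)
  case 0
  \<comment> \<open>The identity of \<open>X\<close> is a resolution of length zero.\<close>
  then show ?case unfolding has_proj_resolution_def
    by (intro exI[of _ "\<lambda>_. X"] exI[of _ "\<lambda>_ x. x"]) (simp add: mod_hom_id)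
next
  case (Suc n)
  then obtain K where K: "syz X K" "pdle n K" by auto
  obtain P where P: "projective R P" "ses K P X" by (rule syzE[OF K(1)])
  obtain i p where ip: "i \<in> mod_hom R K P" "p \<in> mod_hom R P X" "inj_on i (carrier K)"
    "p ` carrier P = carrier X" "i ` carrier K = {y \<in> carrier P. p y = \<zero>\<^bsub>X\<^esub>}" by (rule sesE[OF P(2)])
  note l = ses_lm[OF P(2)]
  from Suc.IH[OF K(2), unfolded has_proj_resolution_def] obtain Q d where
    QQ: "Q 0 = K \<and> (\<forall>i\<le>n. projective R (Q (Suc i)) \<and> d i \<in> mod_hom R (Q (Suc i)) (Q i)) \<and>
        d 0 ` carrier (Q (Suc 0)) = carrier K \<and>
        (\<forall>i<n. d (Suc i) ` carrier (Q (Suc (Suc i))) = a_kernel (Q (Suc i)) (Q i) (d i)) \<and>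
        inj_on (d n) (carrier (Q (Suc n)))" by (elim exE)
  have Q: "Q 0 = K" "d 0 ` carrier (Q (Suc 0)) = carrier K" "inj_on (d n) (carrier (Q (Suc n)))"
    using QQ by simp_all
  have Q2: "projective R (Q (Suc i)) \<and> d i \<in> mod_hom R (Q (Suc i)) (Q i)" if "i \<le> n" for i
    using QQ that by simp
  have Q4: "d (Suc i) ` carrier (Q (Suc (Suc i))) = a_kernel (Q (Suc i)) (Q i) (d i)" if "i < n" for i
    using QQ that by simp
  \<comment> \<open>The presentation of \<open>X\<close> by \<open>P\<close> is spliced with the
    resolution of \<open>K\<close>: the first map of the latter is composed with the inclusion
    \<open>i\<close>.\<close>
  define Q' where "Q' j = (case j of 0 \<Rightarrow> X | Suc j \<Rightarrow> (case j of 0 \<Rightarrow> P | Suc j \<Rightarrow> Q (Suc j)))" for j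
  define d' where "d' j = (case j of 0 \<Rightarrow> p | Suc j \<Rightarrow> (case j of 0 \<Rightarrow> (\<lambda>x. i (d 0 x)) | Suc j \<Rightarrow> d (Suc j)))" for j
  have Q': "Q' 0 = X" "Q' (Suc 0) = P" "Q' (Suc (Suc j)) = Q (Suc j)" for j by (simp_all add: Q'_def)
  have d': "d' 0 = p" "d' (Suc 0) = (\<lambda>x. i (d 0 x))" "d' (Suc (Suc j)) = d (Suc j)" for j by (simp_all add: d'_def)
  have d0: "d 0 \<in> mod_hom R (Q (Suc 0)) K" using Q2[of 0] Q(1) by simp
  have i0: "i y = \<zero>\<^bsub>P\<^esub> \<longleftrightarrow> y = \<zero>\<^bsub>K\<^esub>" if "y \<in> carrier K" for y
    using ip(3)[unfolded inj_on_hom_iff[OF l(1,2) ip(1)]] that mod_hom_zero[OF l(1,2) ip(1)] by auto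
  have im1: "(\<lambda>x. i (d 0 x)) ` carrier (Q (Suc 0)) = a_kernel P X p"
  proof -
    have "(\<lambda>x. i (d 0 x)) ` carrier (Q (Suc 0)) = i ` (d 0 ` carrier (Q (Suc 0)))" by (simp add: image_image)
    also have "\<dots> = a_kernel P X p" unfolding Q(2) ip(5) a_kernel_def' by (rule refl)
    finally show ?thesis .
  qed
  have ker1: "a_kernel (Q (Suc 0)) P (\<lambda>x. i (d 0 x)) = a_kernel (Q (Suc 0)) (Q 0) (d 0)"
    unfolding a_kernel_def' Q(1) using i0 mod_hom_closed[OF d0] by auto
  show ?case unfolding has_proj_resolution_def
  proof (intro exI[of _ Q'] exI[of _ d'] conjI allI impI)
    show "Q' 0 = X" by (rule Q'(1))
    show "projective R (Q' (Suc j))" if "j \<le> Suc n" for j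
      by (cases j) (use that P(1) Q2 in \<open>simp_all add: Q'\<close>)
    show "d' j \<in> mod_hom R (Q' (Suc j)) (Q' j)" if j: "j \<le> Suc n" for j
    proof (cases j)
      case 0
      show ?thesis unfolding 0 Q' d' by (rule ip(2))
    next
      case j': (Suc k)
      show ?thesis
      proof (cases k)
        case 0
        show ?thesis unfolding j' 0 Q' d' by (rule mod_hom_comp[OF d0 ip(1)])
      next
        case (Suc k')
        show ?thesis unfolding j' Suc Q' d' using Q2[of "Suc k'"] j by (simp add: j' Suc)
      qed
    qed
    show "d' 0 ` carrier (Q' (Suc 0)) = carrier X" unfolding Q' d' by (rule ip(4))
    show "d' (Suc j) ` carrier (Q' (Suc (Suc j))) = a_kernel (Q' (Suc j)) (Q' j) (d' j)" if j: "j < Suc n" for j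
    proof (cases j)
      case 0
      show ?thesis unfolding 0 Q' d' by (rule im1)
    next
      case j': (Suc k)
      have k: "k < n" using j j' by simp
      show ?thesis
      proof (cases k)
        case 0
        show ?thesis unfolding j' 0 Q' d' ker1 using Q4[OF k] unfolding 0 .
      next
        case (Suc k')
        show ?thesis unfolding j' Suc Q' d' using Q4[OF k] unfolding Suc .
      qed
    qed
    show "inj_on (d' (Suc n)) (carrier (Q' (Suc (Suc n))))"
    proof (cases n)
      case 0
      have "inj_on (i \<circ> d 0) (carrier (Q (Suc 0)))"
        by (rule comp_inj_on) (use Q(3)[unfolded 0] Q(2) ip(3) in simp_all)
      then show ?thesis unfolding 0 Q' d' by (simp add: comp_def)
    next
      case (Suc k)
      show ?thesis unfolding Suc Q' d' using Q(3) unfolding Suc .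
    qed
  qed
qed

lemma fin_dim_finite:
  assumes "\<And>X :: ('a, 'a list) module. fg R X \<Longrightarrow> pd_fin X \<Longrightarrow> pd n X"
  shows "fin_dim R < \<infinity>"
proof -
  have "proj_dim R X \<le> enat n" if X: "X \<in> fg_mods R" "proj_dim R X < \<infinity>" for X
  proof -
    have fX: "fg R X" using X(1) by (simp add: fg_mods_iff)
    \<comment> \<open>The infimum over the empty set is infinite, so finite \<open>proj_dim\<close>
      provides a finite resolution.\<close>
    have "{n. has_proj_resolution R X n} \<noteq> {}"
    proof
      assume e: "{n. has_proj_resolution R X n} = {}"
      have "proj_dim R X = \<infinity>" unfolding proj_dim_def e by (simp add: top_enat_def)
      then show False using X(2) by simp
    qed
    then obtain m where "has_proj_resolution R X m" by auto
    then have "pd_fin X" unfolding pd_fin_def using has_proj_resolution_pd[OF _ fX] by auto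
    then have "pd n X" by (rule assms[OF fX])
    then have "has_proj_resolution R X n" using pd_pdle[OF fX] pdle_has_proj_resolution by simp
    then show ?thesis unfolding proj_dim_def by (intro INF_lower) simp
  qed
  then have "fin_dim R \<le> enat n" unfolding fin_dim_def by (intro SUP_least) simp
  then show ?thesis using enat_ord_simps(4) order_le_less_trans by blast
qed

end

section \<open>Modules over a quotient ring\<close>

text \<open>A coset acts through a chosen representative; two representatives differ by an element
  of \<open>I\<close>, which acts as zero. The additive group of \<open>Z\<close> is kept, so the
  required isomorphism is the identity.\<close>

lemma quotient_modsI:
  fixes Z :: "('a, 'a list) module"
  assumes I: "ideal I R" and Z: "fg R Z" and IZ: "\<And>a z. a \<in> I \<Longrightarrow> z \<in> carrier Z \<Longrightarrow> a \<odot>\<^bsub>Z\<^esub> z = \<zero>\<^bsub>Z\<^esub>"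
  shows "Z \<in> quotient_mods R I"
proof -
  interpret I: ideal I R by fact
  interpret Z: left_module R Z by (rule fgD(1)[OF Z])
  let ?Q = "R Quot I"
  define r where "r c = (SOME x. x \<in> carrier R \<and> c = I +>\<^bsub>R\<^esub> x)" for c
  define N :: "('a set, 'a list) module" where "N = restrict_scalars r Z"
  have N: "carrier N = carrier Z" "\<zero>\<^bsub>N\<^esub> = \<zero>\<^bsub>Z\<^esub>" "x \<oplus>\<^bsub>N\<^esub> y = x \<oplus>\<^bsub>Z\<^esub> y" "c \<odot>\<^bsub>N\<^esub> z = r c \<odot>\<^bsub>Z\<^esub> z" for x y c z
    by (simp_all add: N_def restrict_scalars_def)
  have sm: "(I +>\<^bsub>R\<^esub> x) \<odot>\<^bsub>N\<^esub> z = x \<odot>\<^bsub>Z\<^esub> z" if x: "x \<in> carrier R" and z: "z \<in> carrier Z" for x z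
  proof -
    have "r (I +>\<^bsub>R\<^esub> x) \<in> carrier R \<and> I +>\<^bsub>R\<^esub> x = I +>\<^bsub>R\<^esub> r (I +>\<^bsub>R\<^esub> x)"
      unfolding r_def by (rule someI_ex) (use x in auto)
    then have c: "r (I +>\<^bsub>R\<^esub> x) \<in> carrier R" and e: "I +>\<^bsub>R\<^esub> x = I +>\<^bsub>R\<^esub> r (I +>\<^bsub>R\<^esub> x)" by simp_all
    let ?y = "r (I +>\<^bsub>R\<^esub> x)"
    have "?y \<in> I +>\<^bsub>R\<^esub> x" using I.a_rcos_self[OF c] e by simp
    then obtain h where h: "h \<in> I" "?y = h \<oplus>\<^bsub>R\<^esub> x" unfolding a_r_coset_def' by auto
    have "?y \<odot>\<^bsub>Z\<^esub> z = h \<odot>\<^bsub>Z\<^esub> z \<oplus>\<^bsub>Z\<^esub> x \<odot>\<^bsub>Z\<^esub> z"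
      unfolding h(2) by (rule Z.smult_l_distr[OF I.Icarr[OF h(1)] x z])
    then show ?thesis using IZ[OF h(1) z] Z.smult_closed[OF x z] by (simp add: N(4))
  qed
  have cQ: "\<exists>x\<in>carrier R. c = I +>\<^bsub>R\<^esub> x" if "c \<in> carrier ?Q" for c
    using that unfolding FactRing_def A_RCOSETS_def' by auto
  have hom: "(+>\<^bsub>R\<^esub>) I \<in> ring_hom R ?Q" by (rule I.rcos_ring_hom)
  have ag: "abelian_group N"
  proof (rule abelian_groupI)
    show "\<exists>y\<in>carrier N. y \<oplus>\<^bsub>N\<^esub> x = \<zero>\<^bsub>N\<^esub>" if "x \<in> carrier N" for x
      by (rule bexI[of _ "\<ominus>\<^bsub>Z\<^esub> x"]) (use that in \<open>simp_all add: N Z.M.l_neg\<close>)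
  qed (simp_all add: N Z.M.a_ac)
  have lN: "left_module ?Q N"
  proof (intro left_module.intro left_module_axioms.intro I.quotient_is_ring ag)
    fix c z assume "c \<in> carrier ?Q" and z: "z \<in> carrier N"
    then obtain x where x: "x \<in> carrier R" "c = I +>\<^bsub>R\<^esub> x" using cQ by auto
    show "c \<odot>\<^bsub>N\<^esub> z \<in> carrier N" using x z by (simp add: sm N(1) Z.smult_closed)
  next
    fix c z w assume "c \<in> carrier ?Q" and z: "z \<in> carrier N" and w: "w \<in> carrier N"
    then obtain x where x: "x \<in> carrier R" "c = I +>\<^bsub>R\<^esub> x" using cQ by auto
    show "c \<odot>\<^bsub>N\<^esub> (z \<oplus>\<^bsub>N\<^esub> w) = c \<odot>\<^bsub>N\<^esub> z \<oplus>\<^bsub>N\<^esub> c \<odot>\<^bsub>N\<^esub> w"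
      using x z w by (simp add: sm N(1,3) Z.smult_r_distr)
  next
    fix c d z assume c: "c \<in> carrier ?Q" and d: "d \<in> carrier ?Q" and z: "z \<in> carrier N"
    obtain x where x: "x \<in> carrier R" "c = I +>\<^bsub>R\<^esub> x" using cQ[OF c] by auto
    obtain y where y: "y \<in> carrier R" "d = I +>\<^bsub>R\<^esub> y" using cQ[OF d] by auto
    have "c \<oplus>\<^bsub>?Q\<^esub> d = I +>\<^bsub>R\<^esub> (x \<oplus>\<^bsub>R\<^esub> y)" using ring_hom_add[OF hom x(1) y(1)] x(2) y(2) by simp
    then show "(c \<oplus>\<^bsub>?Q\<^esub> d) \<odot>\<^bsub>N\<^esub> z = c \<odot>\<^bsub>N\<^esub> z \<oplus>\<^bsub>N\<^esub> d \<odot>\<^bsub>N\<^esub> z"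
      using x y z by (simp add: sm N(1,3) Z.smult_l_distr)
    have "c \<otimes>\<^bsub>?Q\<^esub> d = I +>\<^bsub>R\<^esub> (x \<otimes>\<^bsub>R\<^esub> y)" using ring_hom_mult[OF hom x(1) y(1)] x(2) y(2) by simp
    then show "(c \<otimes>\<^bsub>?Q\<^esub> d) \<odot>\<^bsub>N\<^esub> z = c \<odot>\<^bsub>N\<^esub> (d \<odot>\<^bsub>N\<^esub> z)"
      using x y z by (simp add: sm N(1,3) Z.smult_assoc1 Z.smult_closed)
  next
    fix z assume "z \<in> carrier N"
    then show "\<one>\<^bsub>?Q\<^esub> \<odot>\<^bsub>N\<^esub> z = z"
      using sm[of "\<one>\<^bsub>R\<^esub>" z] ring_hom_one[OF hom] by (simp add: N(1) Z.smult_one)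
  qed
  have "fin_gen ?Q N"
  proof -
    obtain T where T: "finite T" "T \<subseteq> carrier Z" "\<And>H. submodule H R Z \<Longrightarrow> T \<subseteq> H \<Longrightarrow> H = carrier Z"
      using fgD(2)[OF Z] unfolding fin_gen_def by auto
    show ?thesis unfolding fin_gen_def
    proof (intro exI[of _ T] conjI allI impI T(1))
      show "T \<subseteq> carrier N" using T(2) by (simp add: N)
      fix H assume H: "submodule H ?Q N \<and> T \<subseteq> H"
      note sH = H[THEN conjunct1, unfolded submodule_iff[OF lN]]
      have "submodule H R Z" unfolding submodule_iff[OF Z.left_module_axioms]
      proof (intro conjI ballI)
        show "H \<subseteq> carrier Z" "\<zero>\<^bsub>Z\<^esub> \<in> H" using sH by (simp_all add: N)
        show "x \<oplus>\<^bsub>Z\<^esub> y \<in> H" if "x \<in> H" "y \<in> H" for x y using sH that by (simp add: N)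
        show "a \<odot>\<^bsub>Z\<^esub> x \<in> H" if a: "a \<in> carrier R" and x: "x \<in> H" for a x
        proof -
          have "I +>\<^bsub>R\<^esub> a \<in> carrier ?Q" by (rule ring_hom_closed[OF hom a])
          then have "(I +>\<^bsub>R\<^esub> a) \<odot>\<^bsub>N\<^esub> x \<in> H" using sH x by simp
          moreover have "x \<in> carrier Z" using sH x by (auto simp: N)
          ultimately show ?thesis using sm[OF a] by simp
        qed
      qed
      then show "H = carrier N" using T(3) H by (simp add: N)
    qed
  qed
  moreover have "mod_iso R Z (restrict_scalars (\<lambda>r. I +>\<^bsub>R\<^esub> r) N)"
    by (rule mod_isoI[of "\<lambda>x. x"]) (auto intro!: mod_homI simp: restrict_scalars_def N(1,3) sm)
  ultimately show ?thesis unfolding quotient_mods_def using lN Z by (auto simp: fg_mods_iff)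
qed

section \<open>Ring extensions\<close>

lemma restrict_left_module:
  assumes "subring B A" "left_module A M"
  shows "left_module (A\<lparr>carrier := B\<rparr>) M"
proof -
  interpret left_module A M by fact
  have "B \<subseteq> carrier A" using subringE(1)[OF assms(1)] .
  then show ?thesis
    by (intro left_module.intro left_module_axioms.intro R.subring_is_ring[OF assms(1)] M.abelian_group_axioms)
      (auto simp: subset_iff smult_closed smult_l_distr smult_r_distr smult_assoc1 smult_one)
qed

lemma restrict_mod_hom:
  "B \<subseteq> carrier A \<Longrightarrow> f \<in> mod_hom A M N \<Longrightarrow> f \<in> mod_hom (A\<lparr>carrier := B\<rparr>) M N"
  by (rule mod_homI) (auto simp: mod_hom_closed mod_hom_add mod_hom_smult subset_iff)

lemma restrict_mod_iso:
  "B \<subseteq> carrier A \<Longrightarrow> mod_iso A M N \<Longrightarrow> mod_iso (A\<lparr>carrier := B\<rparr>) M N"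
  unfolding mod_iso_def using restrict_mod_hom[of B A] by (elim bexE) (rule bexI, assumption, simp)

text \<open>Finite generation of \<open>A\<close> over the subring makes restriction of scalars
  preserve finite generation. Both interpretations are kept apart by the prefixes \<open>A\<close>
  and \<open>S\<close>.\<close>

locale finite_length_extension =
  A: finite_length_ring A + S: finite_length_ring "A\<lparr>carrier := B\<rparr>"
  for A :: "('a, 'r) ring_scheme" and B :: "'a set" +
  assumes subring: "subring B A"
    and fin_gen_ext: "fin_gen (A\<lparr>carrier := B\<rparr>) (self_mod A)"
begin

abbreviation S where "S \<equiv> A\<lparr>carrier := B\<rparr>"

lemma B_sub: "B \<subseteq> carrier A" by (rule subringE(1)[OF subring])

lemma restrict_fg:
  assumes "fg A M" shows "fg S M"
proof -
  note lM = fgD(1)[OF assms]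
  note lS = restrict_left_module[OF subring lM]
  interpret M: left_module A M by (rule lM)
  have lA: "left_module S (self_mod A)" by (rule restrict_left_module[OF subring left_module_self[OF A.ring_axioms]])
  obtain T where T: "finite T" "T \<subseteq> carrier A" "\<And>H. submodule H S (self_mod A) \<Longrightarrow> T \<subseteq> H \<Longrightarrow> H = carrier A"
    using fin_gen_ext unfolding fin_gen_def by auto
  obtain G where G: "finite G" "G \<subseteq> carrier M" "\<And>H. submodule H A M \<Longrightarrow> G \<subseteq> H \<Longrightarrow> H = carrier M"
    using fgD(2)[OF assms] unfolding fin_gen_def by auto
  let ?G = "(\<lambda>(t, g). t \<odot>\<^bsub>M\<^esub> g) ` (T \<times> G)"
  have "fin_gen S M" unfolding fin_gen_def
  proof (intro exI[of _ ?G] conjI allI impI)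
    show "finite ?G" using T(1) G(1) by simp
    show "?G \<subseteq> carrier M" using T(2) G(2) by (auto simp: subset_iff M.smult_closed)
    fix H assume H: "submodule H S M \<and> ?G \<subseteq> H"
    note sH = H[THEN conjunct1, unfolded submodule_iff[OF lS]]
    have aG: "a \<odot>\<^bsub>M\<^esub> g \<in> H" if a: "a \<in> carrier A" and g: "g \<in> G" for a g
    proof -
      have gM: "g \<in> carrier M" using g G(2) by auto
      have "(\<lambda>a. a \<odot>\<^bsub>M\<^esub> g) \<in> mod_hom S (self_mod A) M"
        by (rule restrict_mod_hom[OF B_sub hom_self_mod[OF lM gM]])
      from submodule_preimage[OF lA lS this H[THEN conjunct1]]
      have s: "submodule {a \<in> carrier (self_mod A). a \<odot>\<^bsub>M\<^esub> g \<in> H} S (self_mod A)" .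
      have "{a \<in> carrier (self_mod A). a \<odot>\<^bsub>M\<^esub> g \<in> H} = carrier A"
        by (rule T(3)[OF s]) (use T(2) H g in auto)
      then show ?thesis using a by auto
    qed
    \<comment> \<open>The largest \<open>A\<close>-submodule inside \<open>H\<close>. It contains
      the generators \<open>G\<close>, hence is all of \<open>M\<close>.\<close>
    let ?H = "{x \<in> carrier M. \<forall>a\<in>carrier A. a \<odot>\<^bsub>M\<^esub> x \<in> H}"
    have "submodule ?H A M" unfolding submodule_iff[OF lM]
    proof (intro conjI ballI)
      show "\<zero>\<^bsub>M\<^esub> \<in> ?H" using sH by (simp add: M.smult_zero_right)
      show "x \<oplus>\<^bsub>M\<^esub> y \<in> ?H" if "x \<in> ?H" "y \<in> ?H" for x y using that sH by (simp add: M.smult_r_distr)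
      show "a \<odot>\<^bsub>M\<^esub> x \<in> ?H" if "a \<in> carrier A" "x \<in> ?H" for a x
        using that by (simp add: M.smult_closed M.smult_assoc1[symmetric])
    qed simp
    then have e: "?H = carrier M" by (rule G(3)) (use G(2) aG in auto)
    have "carrier M \<subseteq> H"
    proof
      fix x assume x: "x \<in> carrier M"
      then have "x \<in> ?H" unfolding e .
      then have "\<one>\<^bsub>A\<^esub> \<odot>\<^bsub>M\<^esub> x \<in> H" by simp
      then show "x \<in> H" using x by (simp add: M.smult_one)
    qed
    then show "H = carrier M" using sH by auto
  qed
  then show ?thesis using lS by (simp add: fg_def)
qed

text \<open>\<open>rep\<close>, and with it \<open>dl\<close>, depends on the ring, so the two
  direct sums agree only up to isomorphism.\<close>

lemma dl_restrict: "(\<And>M. M \<in> set Ms \<Longrightarrow> fg A M) \<Longrightarrow> mod_iso S (A.dl Ms) (S.dl Ms)"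
proof (induction Ms)
  case Nil
  have "(\<lambda>x. x) \<in> mod_hom S (A.freem 0) (S.freem 0)" by (rule mod_homI) auto
  then show ?case unfolding A.dl.simps S.dl.simps by (rule mod_isoI) auto
next
  case (Cons M Ms)
  have M: "fg A M" "\<And>M. M \<in> set Ms \<Longrightarrow> fg A M" using Cons.prems by auto
  have MS: "fg S M" "\<And>M. M \<in> set Ms \<Longrightarrow> fg S M" by (rule restrict_fg[OF M(1)], rule restrict_fg[OF M(2)])
  have l: "left_module S (A.dl Ms)" by (rule fgD(1)[OF restrict_fg[OF A.fg_dl[OF M(2)]]])
  show ?case
    by (rule mod_iso_trans[OF restrict_mod_iso[OF B_sub A.dl_Cons(1)[OF M]]
          mod_iso_trans[OF mod_iso_prodm[OF mod_iso_refl Cons.IH[OF M(2)] fgD(1)[OF MS(1)] l] S.dl_Cons(2)[OF MS]]])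
qed

text \<open>A homomorphism on a free module is determined by the images of the unit vectors, and the
  same images define a map on the free module over the large ring. This is how matrices over the
  subring act on vectors over \<open>A\<close>.\<close>

lemma extend_hom:
  assumes N: "left_module A N"
  shows "f \<in> mod_hom S (S.freem n) N \<Longrightarrow> \<exists>F\<in>mod_hom A (A.freem n) N. \<forall>x\<in>carrier (S.freem n). F x = f x"
proof (induction n arbitrary: f)
  case 0
  have z: "f [] = \<zero>\<^bsub>N\<^esub>"
    using mod_hom_zero[OF S.left_module_freem restrict_left_module[OF subring N] 0] by simp
  show ?case by (rule bexI[OF _ mod_hom_const_zero[OF N]]) (simp add: z)
next
  case (Suc n)
  interpret N: left_module A N by (rule N)
  note one = subringE(3)[OF subring] and zero = subringE(2)[OF subring]
  let ?e = "\<one>\<^bsub>A\<^esub> # replicate n \<zero>\<^bsub>A\<^esub>"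
  have e: "?e \<in> carrier (S.freem (Suc n))" using one zero by auto
  have "(\<lambda>xs. \<zero>\<^bsub>A\<^esub> # xs) \<in> mod_hom S (S.freem n) (S.freem (Suc n))"
    using zero B_sub by (intro mod_homI) (auto simp: subset_iff)
  from Suc.IH[OF mod_hom_comp[OF this Suc.prems]] obtain F where
    F: "F \<in> mod_hom A (A.freem n) N" "\<And>xs. xs \<in> carrier (S.freem n) \<Longrightarrow> F xs = f (\<zero>\<^bsub>A\<^esub> # xs)" by auto
  have fe: "f ?e \<in> carrier N" by (rule mod_hom_closed[OF Suc.prems e])
  have hd: "hd \<in> mod_hom A (A.freem (Suc n)) (self_mod A)" and tl: "tl \<in> mod_hom A (A.freem (Suc n)) (A.freem n)"
    by (auto intro!: mod_homI simp: length_Suc_conv subset_iff)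
  let ?F = "\<lambda>xs. hd xs \<odot>\<^bsub>N\<^esub> f ?e \<oplus>\<^bsub>N\<^esub> F (tl xs)"
  show ?case
  proof (rule bexI[of _ ?F], rule ballI)
    show "?F \<in> mod_hom A (A.freem (Suc n)) N"
      by (intro mod_hom_plus[OF N] mod_hom_comp[OF hd hom_self_mod[OF N fe]] mod_hom_comp[OF tl F(1)])
    fix xs assume xs: "xs \<in> carrier (S.freem (Suc n))"
    then obtain y ys where y: "xs = y # ys" "y \<in> B" "ys \<in> carrier (S.freem n)" by (auto simp: length_Suc_conv)
    have yA: "y \<in> carrier A" using y(2) B_sub by auto
    have ysA: "set ys \<subseteq> carrier A" "length ys = n" using y(3) B_sub by auto
    have m: "y \<odot>\<^bsub>S.freem (Suc n)\<^esub> ?e \<in> carrier (S.freem (Suc n))" "\<zero>\<^bsub>A\<^esub> # ys \<in> carrier (S.freem (Suc n))"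
      using y zero yA by (auto simp: map_replicate_const)
    have "xs = y \<odot>\<^bsub>S.freem (Suc n)\<^esub> ?e \<oplus>\<^bsub>S.freem (Suc n)\<^esub> (\<zero>\<^bsub>A\<^esub> # ys)"
      using y(1) yA ysA by (auto intro!: nth_equalityI simp: subset_iff)
    then have "f xs = f (y \<odot>\<^bsub>S.freem (Suc n)\<^esub> ?e) \<oplus>\<^bsub>N\<^esub> f (\<zero>\<^bsub>A\<^esub> # ys)"
      using mod_hom_add[OF Suc.prems m] by simp
    also have "f (y \<odot>\<^bsub>S.freem (Suc n)\<^esub> ?e) = y \<odot>\<^bsub>N\<^esub> f ?e"
      by (rule mod_hom_smult[OF Suc.prems _ e]) (use y(2) in simp)
    finally show "?F xs = f xs" using y(1) F(2)[OF y(3)] by simp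
  qed
qed

end

section \<open>Second syzygies over the subring\<close>

lemma (in ring) left_ideal_iff: "left_ideal J R \<longleftrightarrow> submodule J R (self_mod R)"
proof
  have lr: "left_module R (self_mod R)" by (rule left_module_self) (rule ring_axioms)
  show "submodule J R (self_mod R)" if J: "left_ideal J R"
  proof -
    interpret additive_subgroup J R using J by (simp add: left_ideal_def)
    show ?thesis unfolding submodule_iff[OF lr] using J a_subset by (simp add: left_ideal_def)
  qed
  show "left_ideal J R" if J: "submodule J R (self_mod R)"
  proof -
    have "subgroup J (add_monoid R)"
    proof (rule add.subgroupI)
      have "a_inv (self_mod R) = a_inv R" by (simp add: fun_eq_iff a_inv_def m_inv_def self_mod_def)
      then show "\<ominus> x \<in> J" if "x \<in> J" for x using submodule_minus[OF lr J that] by simp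
    qed (use J in \<open>auto simp: submodule_iff[OF lr]\<close>)
    then show ?thesis using J by (simp add: left_ideal_def additive_subgroup_def submodule_iff[OF lr])
  qed
qed

context finite_length_ring
begin

lemma projective_cover_kernel_radical:
  assumes c: "projective_cover R P X f" and X: "fg R X" and h: "h \<in> mod_hom R P (self_mod R)"
    and y: "y \<in> a_kernel P X f"
  shows "h y \<in> jacobson_radical R"
proof -
  note cc = c[unfolded projective_cover_def]
  have lP: "left_module R P" by (rule fgD(1)[OF projective_fg]) (use cc in simp)
  have lr: "left_module R (self_mod R)" by (rule fgD(1)[OF fg_self])
  have f: "f \<in> mod_hom R P X" using cc by simp
  interpret P: left_module R P by fact
  interpret r: left_module R "self_mod R" by (rule lr)
  have sK: "submodule (a_kernel P X f) R P"
    unfolding a_kernel_def' by (rule submodule_kernel[OF lP fgD(1)[OF X] f])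
  note K = sK[unfolded submodule_iff[OF lP]]
  have yP: "y \<in> carrier P" using y K by auto
  have hy: "h y \<in> carrier (self_mod R)" by (rule mod_hom_closed[OF h yP])
  have "h y \<in> L" if L: "maximal_left_ideal L R" for L
  proof (rule ccontr)
    assume nL: "h y \<notin> L"
    have sL: "submodule L R (self_mod R)" using L by (simp add: maximal_left_ideal_def left_ideal_iff)
    note cy = submodule_cyclic[OF lr hy]
    let ?M = "L <+>\<^bsub>self_mod R\<^esub> cyclic R (self_mod R) (h y)"
    have "left_ideal ?M R" unfolding left_ideal_iff by (rule submodule_sum[OF lr sL cy(1)])
    moreover have "L \<subseteq> ?M" "?M \<noteq> L" using subset_set_add[OF lr sL cy(1)] cy(2) nL by auto
    ultimately have M: "?M = carrier R" using L unfolding maximal_left_ideal_def by auto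
    let ?U = "{u \<in> carrier P. h u \<in> L}"
    have sU: "submodule ?U R P" by (rule submodule_preimage[OF lP lr h sL])
    have "carrier P \<subseteq> ?U <+>\<^bsub>P\<^esub> a_kernel P X f"
    proof
      fix u assume u: "u \<in> carrier P"
      have "h u \<in> ?M" unfolding M using mod_hom_closed[OF h u] by simp
      then obtain l b where lb: "l \<in> L" "b \<in> carrier R" "h u = l \<oplus>\<^bsub>self_mod R\<^esub> b \<odot>\<^bsub>self_mod R\<^esub> h y"
        unfolding set_add_iff cyclic_def by auto
      have lR: "l \<in> carrier (self_mod R)" using lb(1) sL by (auto simp: submodule_iff[OF lr])
      have by': "b \<odot>\<^bsub>P\<^esub> y \<in> a_kernel P X f" using K lb(2) y by simp
      have byP: "b \<odot>\<^bsub>P\<^esub> y \<in> carrier P" by (rule P.smult_closed[OF lb(2) yP])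
      have bhy: "b \<odot>\<^bsub>self_mod R\<^esub> h y \<in> carrier (self_mod R)" by (rule r.smult_closed[OF lb(2) hy])
      have "h (u \<ominus>\<^bsub>P\<^esub> b \<odot>\<^bsub>P\<^esub> y) = h u \<ominus>\<^bsub>self_mod R\<^esub> b \<odot>\<^bsub>self_mod R\<^esub> h y"
        unfolding mod_hom_diff[OF lP lr h u byP] mod_hom_smult[OF h lb(2) yP] by (rule refl)
      also have "\<dots> = l" unfolding lb(3) a_minus_def
        by (simp only: r.M.a_assoc[OF lR bhy r.M.a_inv_closed[OF bhy]] r.M.r_neg[OF bhy] r.M.r_zero[OF lR])
      finally have "u \<ominus>\<^bsub>P\<^esub> b \<odot>\<^bsub>P\<^esub> y \<in> ?U" using lb(1) u byP by simp
      moreover have "u = (u \<ominus>\<^bsub>P\<^esub> b \<odot>\<^bsub>P\<^esub> y) \<oplus>\<^bsub>P\<^esub> b \<odot>\<^bsub>P\<^esub> y"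
        using u byP by (simp add: a_minus_def P.M.a_assoc P.M.l_neg)
      ultimately show "u \<in> ?U <+>\<^bsub>P\<^esub> a_kernel P X f" unfolding set_add_iff using by' by (rule_tac bexI, rule_tac bexI)
    qed
    moreover have "?U <+>\<^bsub>P\<^esub> a_kernel P X f \<subseteq> carrier P"
      by (rule set_add_least[OF lP submodule_carrier[OF lP]]) (use K in auto)
    ultimately have "?U <+>\<^bsub>P\<^esub> a_kernel P X f = carrier P" by simp
    then have "?U = carrier P" using cc sU by simp
    then have "y \<in> ?U" using yP by simp
    then show False using nL by simp
  qed
  then show ?thesis unfolding jacobson_radical_def using hy by simp
qed

lemma mod_hom_nth: "j < n \<Longrightarrow> (\<lambda>v. v ! j) \<in> mod_hom R (freem n) (self_mod R)"
  by (rule mod_homI) (auto simp: subset_iff)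

lemma tri_om: "tri U V W \<Longrightarrow> tri ((om ^^ s) U) ((om ^^ s) V) ((om ^^ s) W)"
proof (induction s)
  case (Suc s)
  have t: "tri ((om ^^ s) U) ((om ^^ s) V) ((om ^^ s) W)" by (rule Suc.IH[OF Suc.prems])
  show ?case using tri_syz[OF t syz_om[OF tri_fg(1)[OF t]] syz_om[OF tri_fg(2)[OF t]] syz_om[OF tri_fg(3)[OF t]]] by simp
qed simp

lemma stab_dl_om:
  assumes "\<And>M. M \<in> set Ms \<Longrightarrow> fg R M"
  shows "stab ((om ^^ s) (dl Ms)) (dl (map (om ^^ s) Ms))"
proof (induction s)
  case 0
  show ?case using stab_refl[OF fg_dl[OF assms]] by simp
next
  case (Suc s)
  from syz_stab[OF Suc syz_om[OF stab_fg(1)[OF Suc]] syz_map_om[OF assms]]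
  show ?case by (simp add: comp_def)
qed

end

context finite_length_extension
begin

text \<open>
  \<open>H\<close> consists of the elements of \<open>V\<close> with coordinates in \<open>I rad(B)\<close>. It is an \<open>A\<close>-submodule because
  the \<open>B\<close>-linear maps cutting out \<open>V\<close> are given by matrices and hence extend to \<open>A\<^sup>n\<close>.
\<close>

lemma second_syzygy:
  fixes X :: "('a, 'a list) module"
  assumes X: "fg S X" and I: "ideal I S" and left: "left_ideal (I \<cdot>\<^bsub>S\<^esub> jacobson_radical S) A"
  shows "\<exists>(K :: ('a, 'a list) module) (Y :: ('a, 'a list) module) n H V. S.syz X K \<and> S.syz K Y \<and>
    submodule H A (A.freem n) \<and> submodule V S (S.freem n) \<and> H \<subseteq> V \<and>
    mod_iso S Y ((S.freem n)\<lparr>carrier := V\<rparr>) \<and> (\<forall>a\<in>I. \<forall>v\<in>V. a \<odot>\<^bsub>S.freem n\<^esub> v \<in> H)"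
proof -
  let ?J = "jacobson_radical S"
  let ?IJ = "I \<cdot>\<^bsub>S\<^esub> ?J"
  interpret I: ideal I S by fact
  have J: "?J \<subseteq> B" by (auto simp: jacobson_radical_def)
  have IB: "x \<in> B" if "x \<in> I" for x using I.Icarr[OF that] by simp
  have IJB: "x \<in> B" if "x \<in> ?IJ" for x
    using that
  proof (induction rule: ideal_prod.induct)
    case (prod i j)
    then show ?case using S.m_closed[of i j] IB J by auto
  next
    case (sum s1 s2)
    then show ?case using S.a_closed[of s1 s2] by simp
  qed
  interpret IJ: additive_subgroup ?IJ A using left by (simp add: left_ideal_def)
  have IJl: "a \<otimes>\<^bsub>A\<^esub> x \<in> ?IJ" if "a \<in> carrier A" "x \<in> ?IJ" for a x using left that by (simp add: left_ideal_def)
  \<comment> \<open>Any surjection from a free module serves here. What matters is that the first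
    syzygy sits inside a free module, so that the next differential is given by a matrix.\<close>
  obtain n0 \<pi> where pi: "\<pi> \<in> mod_hom S (S.freem n0) X" "\<pi> ` carrier (S.freem n0) = carrier X"
    using S.freem_surj[OF X] by auto
  let ?K = "(S.freem n0)\<lparr>carrier := {x \<in> carrier (S.freem n0). \<pi> x = \<zero>\<^bsub>X\<^esub>}\<rparr>"
  have sesK: "S.ses ?K (S.freem n0) X" by (rule S.ses_kernel[OF S.fg_freem fgD(1)[OF X] pi])
  have K: "S.syz X ?K" by (rule S.syzI[OF S.pj_freem sesK])
  have fK: "fg S ?K" by (rule S.ses_fg(1)[OF sesK])
  \<comment> \<open>At this stage a projective cover is taken, since its kernel has coordinates in
    the radical.\<close>
  obtain P f where c: "projective_cover S P ?K f" using S.ex_projective_cover[OF fK] by auto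
  let ?Y = "P\<lparr>carrier := a_kernel P ?K f\<rparr>"
  have Y: "S.syz ?K ?Y" by (rule S.projective_cover_syz[OF c fK])
  have P: "projective S P" and f: "f \<in> mod_hom S P ?K" using c by (simp_all add: projective_cover_def)
  have lP: "left_module S P" by (rule fgD(1)[OF S.projective_fg[OF P]])
  obtain n where "S.retract P (S.freem n)" using S.pj_retract_freem[OF S.projective_pj[OF P]] by auto
  then obtain i p where ip: "i \<in> mod_hom S P (S.freem n)" "p \<in> mod_hom S (S.freem n) P"
    "\<And>y. y \<in> carrier P \<Longrightarrow> p (i y) = y" unfolding S.retract_def by auto
  have freem_sub: "x \<in> carrier (A.freem k)" if "x \<in> carrier (S.freem k)" for x k using that B_sub by auto
  \<comment> \<open>\<open>?e\<close> is the idempotent that realizes \<open>P\<close> inside the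
    free module, and \<open>?d\<close> is the differential precomposed with the projection to
    \<open>P\<close>. The second syzygy consists of the fixed points of \<open>?e\<close> killed by
    \<open>?d\<close>.\<close>
  let ?d = "\<lambda>v. f (p v)" and ?e = "\<lambda>v. i (p v)"
  have dK: "?d \<in> mod_hom S (S.freem n) ?K" by (rule mod_hom_comp[OF ip(2) f])
  have eS: "?e \<in> mod_hom S (S.freem n) (S.freem n)" by (rule mod_hom_comp[OF ip(2,1)])
  have d: "?d \<in> mod_hom S (S.freem n) (A.freem n0)"
  proof (rule mod_homI)
    show "?d v \<in> carrier (A.freem n0)" if "v \<in> carrier (S.freem n)" for v
      by (rule freem_sub) (use mod_hom_closed[OF dK that] in simp)
    show "?d (v \<oplus>\<^bsub>S.freem n\<^esub> w) = ?d v \<oplus>\<^bsub>A.freem n0\<^esub> ?d w" if "v \<in> carrier (S.freem n)" "w \<in> carrier (S.freem n)" for v w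
      using mod_hom_add[OF dK that] by simp
    show "?d (a \<odot>\<^bsub>S.freem n\<^esub> v) = a \<odot>\<^bsub>A.freem n0\<^esub> ?d v" if "a \<in> carrier S" "v \<in> carrier (S.freem n)" for a v
      using mod_hom_smult[OF dK that] by simp
  qed
  have e: "?e \<in> mod_hom S (S.freem n) (A.freem n)"
  proof (rule mod_homI)
    show "?e v \<in> carrier (A.freem n)" if "v \<in> carrier (S.freem n)" for v
      by (rule freem_sub) (rule mod_hom_closed[OF eS that])
    show "?e (v \<oplus>\<^bsub>S.freem n\<^esub> w) = ?e v \<oplus>\<^bsub>A.freem n\<^esub> ?e w" if "v \<in> carrier (S.freem n)" "w \<in> carrier (S.freem n)" for v w
      using mod_hom_add[OF eS that] by simp
    show "?e (a \<odot>\<^bsub>S.freem n\<^esub> v) = a \<odot>\<^bsub>A.freem n\<^esub> ?e v" if "a \<in> carrier S" "v \<in> carrier (S.freem n)" for a v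
      using mod_hom_smult[OF eS that] by simp
  qed
  obtain D where D: "D \<in> mod_hom A (A.freem n) (A.freem n0)" "\<And>v. v \<in> carrier (S.freem n) \<Longrightarrow> D v = ?d v"
    using extend_hom[OF A.left_module_freem d] by auto
  obtain E where E: "E \<in> mod_hom A (A.freem n) (A.freem n)" "\<And>v. v \<in> carrier (S.freem n) \<Longrightarrow> E v = ?e v"
    using extend_hom[OF A.left_module_freem e] by auto
  let ?ker = "a_kernel P ?K f"
  have sker: "submodule ?ker S P" unfolding a_kernel_def' by (rule submodule_kernel[OF lP fgD(1)[OF fK] f])
  have kerP: "y \<in> carrier P" if "y \<in> ?ker" for y using that by (simp add: a_kernel_def')
  define V where "V = i ` ?ker"
  have sV: "submodule V S (S.freem n)" unfolding V_def by (rule submodule_image[OF lP S.left_module_freem ip(1) sker])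
  note V = sV[unfolded submodule_iff[OF S.left_module_freem]]
  have V_iff: "v \<in> V \<longleftrightarrow> v \<in> carrier (S.freem n) \<and> ?e v = v \<and> ?d v = replicate n0 \<zero>\<^bsub>A\<^esub>" for v
  proof
    assume "v \<in> V"
    then obtain y where y: "v = i y" "y \<in> ?ker" unfolding V_def by (rule imageE)
    have "p v = y" using ip(3)[OF kerP[OF y(2)]] y(1) by simp
    then show "v \<in> carrier (S.freem n) \<and> ?e v = v \<and> ?d v = replicate n0 \<zero>\<^bsub>A\<^esub>"
      using mod_hom_closed[OF ip(1) kerP[OF y(2)]] y by (simp add: a_kernel_def')
  next
    assume v: "v \<in> carrier (S.freem n) \<and> ?e v = v \<and> ?d v = replicate n0 \<zero>\<^bsub>A\<^esub>"
    have "p v \<in> carrier P" by (rule mod_hom_closed[OF ip(2)]) (use v in blast)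
    then have "p v \<in> ?ker" using v by (simp add: a_kernel_def')
    then show "v \<in> V" unfolding V_def by (rule rev_image_eqI) (use v in simp)
  qed
  \<comment> \<open>Each coordinate is a linear functional on \<open>P\<close>, so
    \<open>projective_cover_kernel_radical\<close> applies.\<close>
  have VJ: "set v \<subseteq> ?J" if vV: "v \<in> V" for v
  proof
    fix x assume "x \<in> set v"
    then obtain j where j: "j < length v" "x = v ! j" by (auto simp: in_set_conv_nth)
    obtain y where y: "v = i y" "y \<in> ?ker" using vV unfolding V_def by (rule imageE)
    have "length v = n" using V vV by auto
    then have "(\<lambda>y. i y ! j) \<in> mod_hom S P (self_mod S)" using mod_hom_comp[OF ip(1) S.mod_hom_nth] j(1) by simp
    from S.projective_cover_kernel_radical[OF c fK this y(2)] show "x \<in> ?J" using j(2) y(1) by simp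
  qed
  define H where "H = {v \<in> V. set v \<subseteq> ?IJ}"
  \<comment> \<open>The conditions are now \<open>A\<close>-linear equations together with
    coordinates in \<open>?IJ\<close>, a left ideal of \<open>A\<close>. Vectors with such
    coordinates automatically lie over \<open>B\<close>, so closure under \<open>A\<close> becomes
    visible.\<close>
  have H_iff: "v \<in> H \<longleftrightarrow> v \<in> carrier (A.freem n) \<and> set v \<subseteq> ?IJ \<and> E v = v \<and> D v = \<zero>\<^bsub>A.freem n0\<^esub>" for v
  proof -
    have "v \<in> carrier (S.freem n) \<longleftrightarrow> v \<in> carrier (A.freem n)" if "set v \<subseteq> ?IJ"
      using that IJB B_sub by auto
    then show ?thesis unfolding H_def mem_Collect_eq V_iff using D(2)[of v] E(2)[of v] by auto
  qed
  have "submodule H A (A.freem n)" unfolding submodule_iff[OF A.left_module_freem]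
  proof (intro conjI ballI)
    show "H \<subseteq> carrier (A.freem n)" using H_iff by auto
    show "\<zero>\<^bsub>A.freem n\<^esub> \<in> H" unfolding H_iff
      using mod_hom_zero[OF A.left_module_freem A.left_module_freem E(1)]
        mod_hom_zero[OF A.left_module_freem A.left_module_freem D(1)] by auto
  next
    fix v w assume "v \<in> H" "w \<in> H"
    then have v: "v \<in> carrier (A.freem n)" "set v \<subseteq> ?IJ" "E v = v" "D v = \<zero>\<^bsub>A.freem n0\<^esub>"
      and w: "w \<in> carrier (A.freem n)" "set w \<subseteq> ?IJ" "E w = w" "D w = \<zero>\<^bsub>A.freem n0\<^esub>" unfolding H_iff by simp_all
    have "v \<oplus>\<^bsub>A.freem n\<^esub> w \<in> carrier (A.freem n)" "\<zero>\<^bsub>A.freem n0\<^esub> \<oplus>\<^bsub>A.freem n0\<^esub> \<zero>\<^bsub>A.freem n0\<^esub> = \<zero>\<^bsub>A.freem n0\<^esub>"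
      using submodule_carrier[OF A.left_module_freem] submodule_zero[OF A.left_module_freem] v(1) w(1)
      unfolding submodule_iff[OF A.left_module_freem] by auto
    moreover have "set (v \<oplus>\<^bsub>A.freem n\<^esub> w) \<subseteq> ?IJ"
      using v(2) w(2) by (auto simp: set_zip subset_iff)
    ultimately show "v \<oplus>\<^bsub>A.freem n\<^esub> w \<in> H" unfolding H_iff mod_hom_add[OF E(1) v(1) w(1)] mod_hom_add[OF D(1) v(1) w(1)]
        v(3,4) w(3,4) by (intro conjI refl)
  next
    fix a v assume a: "a \<in> carrier A" and "v \<in> H"
    then have v: "v \<in> carrier (A.freem n)" "set v \<subseteq> ?IJ" "E v = v" "D v = \<zero>\<^bsub>A.freem n0\<^esub>" unfolding H_iff by simp_all
    have "a \<odot>\<^bsub>A.freem n\<^esub> v \<in> carrier (A.freem n)" "a \<odot>\<^bsub>A.freem n0\<^esub> \<zero>\<^bsub>A.freem n0\<^esub> = \<zero>\<^bsub>A.freem n0\<^esub>"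
      using left_module.smult_closed[OF A.left_module_freem a v(1)] left_module.smult_zero_right[OF A.left_module_freem a] .
    moreover have "set (a \<odot>\<^bsub>A.freem n\<^esub> v) \<subseteq> ?IJ" using v(2) IJl[OF a] by auto
    ultimately show "a \<odot>\<^bsub>A.freem n\<^esub> v \<in> H" unfolding H_iff mod_hom_smult[OF E(1) a v(1)] mod_hom_smult[OF D(1) a v(1)]
        v(3,4) by (intro conjI refl)
  qed
  moreover have "\<forall>a\<in>I. \<forall>v\<in>V. a \<odot>\<^bsub>S.freem n\<^esub> v \<in> H"
  proof (intro ballI)
    fix a v assume a: "a \<in> I" and v: "v \<in> V"
    have "a \<odot>\<^bsub>S.freem n\<^esub> v \<in> V" using V v IB[OF a] by simp
    moreover have "set (a \<odot>\<^bsub>S.freem n\<^esub> v) \<subseteq> ?IJ"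
      using VJ[OF v] ideal_prod.prod[OF a, of _ ?J S] by auto
    ultimately show "a \<odot>\<^bsub>S.freem n\<^esub> v \<in> H" by (simp add: H_def)
  qed
  moreover have "mod_iso S ?Y ((S.freem n)\<lparr>carrier := V\<rparr>)"
  proof (rule mod_isoI)
    show "i \<in> mod_hom S ?Y ((S.freem n)\<lparr>carrier := V\<rparr>)"
      by (rule mod_hom_restrict[OF ip(1)]) (use kerP in \<open>auto simp: V_def\<close>)
    show "inj_on i (carrier ?Y)" by (rule inj_on_inverseI[of _ p]) (use ip(3) kerP in simp)
    show "i ` carrier ?Y = carrier ((S.freem n)\<lparr>carrier := V\<rparr>)" by (simp add: V_def)
  qed
  moreover have "H \<subseteq> V" by (auto simp: H_def)
  ultimately show ?thesis using K Y sV by (intro exI conjI)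
qed

text \<open>The bound is \<open>m + b + 2\<close>: two for the passage to the second syzygy,
  \<open>m\<close> from syzygy-finiteness, and \<open>b\<close> from \<open>igusa_todorov\<close>
  applied to a finite set that does not depend on the module.\<close>

theorem fin_dim_extension:
  assumes I: "ideal I S" and left: "left_ideal (I \<cdot>\<^bsub>S\<^esub> jacobson_radical S) A"
    and syz: "syzygy_finite S (quotient_mods S I)" and tf: "torsionless_finite A"
  shows "fin_dim S < \<infinity>"
proof -
  obtain FA :: "('a, 'a list) module set" where FA: "finite FA" "\<forall>N\<in>FA. fg A N"
    "\<forall>n H. submodule H A (A.freem n) \<longrightarrow> (\<exists>Ms. set Ms \<subseteq> FA \<and> mod_iso A ((A.freem n)\<lparr>carrier := H\<rparr>) (A.dl Ms))"
    using A.torsionless_finite_decomposition[OF tf] by (elim exE conjE)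
  obtain m where m: "m_syzygy_finite S m (quotient_mods S I)" using syz by (auto simp: syzygy_finite_def)
  obtain FB :: "('a, 'a list) module set" where FB: "finite FB" "\<forall>N\<in>FB. fg S N"
    "\<forall>X\<in>quotient_mods S I. fg S X \<longrightarrow> (\<exists>Ms. set Ms \<subseteq> FB \<and> S.stab (S.dl Ms) ((S.om ^^ m) X))"
    using S.m_syzygy_finite_decomposition[OF m] by (elim exE conjE)
  have FAS: "fg S N" if "N \<in> FA" for N by (rule restrict_fg) (use FA(2) that in simp)
  \<comment> \<open>The modules that occur after rotation: \<open>m\<close>-th syzygies of the
    summands of \<open>H\<close>, and first syzygies of the summands representing the
    \<open>m\<close>-th syzygy of the quotient. The extra \<open>om\<close> comes from the
    rotation.\<close>
  let ?N = "S.om ` FB \<union> (S.om ^^ m) ` FA"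
  have fin: "finite ?N" using FA(1) FB(1) by simp
  have fgN: "fg S M" if "M \<in> ?N" for M
    using that
  proof
    assume "M \<in> S.om ` FB"
    then obtain N where N: "M = S.om N" "N \<in> FB" by (rule imageE)
    show ?thesis unfolding N(1) by (rule S.syz_fg(2)[OF S.syz_om]) (use FB(2) N(2) in simp)
  next
    assume "M \<in> (S.om ^^ m) ` FA"
    then obtain N where N: "M = (S.om ^^ m) N" "N \<in> FA" by (rule imageE)
    show ?thesis unfolding N(1) by (rule S.fg_om[OF FAS[OF N(2)]])
  qed
  obtain b where b: "\<forall>Ms Ns (V :: ('a, 'a list) module). set Ms \<subseteq> ?N \<longrightarrow> set Ns \<subseteq> ?N \<longrightarrow>
    S.tri (S.dl Ms) (S.dl Ns) V \<longrightarrow> S.pd_fin V \<longrightarrow> S.pd b V"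
    using S.igusa_todorov[OF fin fgN] by (rule exE)
  show ?thesis
  proof (rule S.fin_dim_finite)
    fix X :: "('a, 'a list) module" assume X: "fg S X" and pX: "S.pd_fin X"
    obtain K Y :: "('a, 'a list) module" and n H V where K: "S.syz X K" and Y: "S.syz K Y" and
      H: "submodule H A (A.freem n)" and V: "submodule V S (S.freem n)" and HV: "H \<subseteq> V" and
      i: "mod_iso S Y ((S.freem n)\<lparr>carrier := V\<rparr>)" and IV: "\<forall>a\<in>I. \<forall>v\<in>V. a \<odot>\<^bsub>S.freem n\<^esub> v \<in> H"
      using second_syzygy[OF X I left] by (elim exE conjE)
    let ?V = "(S.freem n)\<lparr>carrier := V\<rparr>" and ?H = "(S.freem n)\<lparr>carrier := H\<rparr>"
    note lF = S.left_module_freem[of n]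
    have HA: "(A.freem n)\<lparr>carrier := H\<rparr> = ?H" by (simp add: A.freem_def S.freem_def)
    have fV: "fg S ?V" by (rule S.fg_submodule[OF S.fg_freem V])
    note lV = fgD(1)[OF fV]
    have HS: "submodule H S ?V" unfolding submodule_iff[OF lV]
      using H[unfolded submodule_iff[OF A.left_module_freem]] HV B_sub by auto
    obtain Z :: "('a, 'a list) module" and p where Z: "p \<in> mod_hom S ?V Z" "left_module S Z"
      "p ` carrier ?V = carrier Z" "{x \<in> carrier ?V. p x = \<zero>\<^bsub>Z\<^esub>} = H" using ex_quotient[OF lV HS] by auto
    have fZ: "fg S Z" by (rule fg_image[OF fV Z(2,1,3)])
    have ses: "S.ses ?H ?V Z" using S.ses_kernel[OF fV Z(2,1,3)] unfolding Z(4) by simp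
    \<comment> \<open>\<open>I\<close> carries \<open>V\<close> into \<open>H\<close>, so it
      annihilates the quotient \<open>Z\<close>, to which syzygy-finiteness then applies.\<close>
    have "a \<odot>\<^bsub>Z\<^esub> z = \<zero>\<^bsub>Z\<^esub>" if a: "a \<in> I" and z: "z \<in> carrier Z" for a z
    proof -
      obtain v where v: "z = p v" "v \<in> carrier ?V" using z unfolding Z(3)[symmetric] by (rule imageE)
      have "a \<in> carrier S" using ideal.Icarr[OF I a] .
      then have "a \<odot>\<^bsub>Z\<^esub> z = p (a \<odot>\<^bsub>?V\<^esub> v)" unfolding v(1) by (rule mod_hom_smult[OF Z(1) _ v(2), symmetric])
      moreover have "a \<odot>\<^bsub>?V\<^esub> v \<in> H" using bspec[OF bspec[OF IV a], of v] v(2) by simp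
      then have "p (a \<odot>\<^bsub>?V\<^esub> v) = \<zero>\<^bsub>Z\<^esub>" unfolding Z(4)[symmetric] by simp
      ultimately show ?thesis by simp
    qed
    then have "Z \<in> quotient_mods S I" by (rule quotient_modsI[OF I fZ])
    then obtain Ns where Ns: "set Ns \<subseteq> FB" "S.stab (S.dl Ns) ((S.om ^^ m) Z)" using FB(3) fZ by auto
    obtain Ms where Ms: "set Ms \<subseteq> FA" "mod_iso A ?H (A.dl Ms)" using FA(3) H HA by metis
    have fMs: "fg A M" if "M \<in> set Ms" for M using Ms(1) FA(2) that by auto
    have fMsS: "fg S M" if "M \<in> set Ms" for M by (rule restrict_fg[OF fMs[OF that]])
    have fNs: "fg S M" if "M \<in> set Ns" for M using Ns(1) FB(2) that by auto
    have "mod_iso S ?H (S.dl Ms)" by (rule mod_iso_trans[OF restrict_mod_iso[OF B_sub Ms(2)] dl_restrict[OF fMs]])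
    then have "S.stab ?H (S.dl Ms)" by (rule S.stab_iso[OF _ S.ses_fg(1)[OF ses] fgD(1)[OF S.fg_dl[OF fMsS]]])
    then have t0: "S.tri (S.dl Ms) ?V Z"
      by (rule S.tri_stab[OF S.ses_tri[OF ses] _ S.stab_refl[OF fV] S.stab_refl[OF fZ]])
    have t1: "S.tri (S.dl (map (S.om ^^ m) Ms)) ((S.om ^^ m) ?V) (S.dl Ns)"
      by (rule S.tri_stab[OF S.tri_om[OF t0] S.stab_dl_om[OF fMsS] S.stab_refl[OF S.fg_om[OF fV]] S.stab_sym[OF Ns(2)]])
    \<comment> \<open>Rotation puts the term of finite projective dimension last, where
      \<open>igusa_todorov\<close> bounds it.\<close>
    have t2: "S.tri (S.dl (map S.om Ns)) (S.dl (map (S.om ^^ m) Ms)) ((S.om ^^ m) ?V)"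
      by (rule S.tri_rotate[OF t1 S.syz_dl[OF fNs]])
    have "S.pd_fin Y" using pX S.pd_fin_syz[OF K] S.pd_fin_syz[OF Y] by simp
    then have "S.pd_fin ((S.om ^^ m) ?V)" using S.pd_fin_iso[OF _ i lV] S.pd_fin_om[OF fV] by simp
    moreover have "set (map S.om Ns) \<subseteq> ?N" "set (map (S.om ^^ m) Ms) \<subseteq> ?N" using Ns(1) Ms(1) by auto
    ultimately have "S.pd b ((S.om ^^ m) ?V)" using b[rule_format, OF _ _ t2] by simp
    then have "S.pd (m + b) ?V" unfolding S.pd_om[OF fV] .
    then have "S.pd (m + b) Y"
      by (rule S.pd_iso[OF _ mod_iso_sym[OF i fgD(1)[OF S.syz_fg(2)[OF Y]]] fgD(1)[OF S.syz_fg(2)[OF Y]]])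
    then show "S.pd (Suc (Suc (m + b))) X" unfolding S.pd_Suc[OF K] S.pd_Suc[OF Y] .
  qed
qed

end

section \<open>Artin algebras as rings of finite length\<close>

lemma finite_length_ring_artin_algebra:
  assumes "artin_algebra k A" shows "finite_length_ring A"
  by (intro finite_length_ring.intro finite_length_ring_axioms.intro artin_algebra_chain_cond[OF assms])
    (use assms in \<open>simp add: artin_algebra_def\<close>)

text \<open>\<open>B\<close> contains the scalar multiples of the unit, so
  \<open>B\<close>-submodules of \<open>A\<close> are submodules over the base ring. Generators of
  \<open>A\<close> over the base ring therefore generate it over \<open>B\<close>.\<close>

lemma finite_length_extension_artin:
  assumes "artin_extension k B A" shows "finite_length_extension A B"
proof -
  have A: "artin_algebra k A" and B: "artin_algebra k (A\<lparr>carrier := B\<rparr>)" and sub: "subring B A"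
    and kB: "submodule B k A" using assms by (simp_all add: artin_extension_def)
  interpret A: finite_length_ring A by (rule finite_length_ring_artin_algebra[OF A])
  have bil: "\<And>c x y. c \<in> carrier k \<Longrightarrow> x \<in> carrier A \<Longrightarrow> y \<in> carrier A \<Longrightarrow> (c \<odot>\<^bsub>A\<^esub> x) \<otimes>\<^bsub>A\<^esub> y = c \<odot>\<^bsub>A\<^esub> (x \<otimes>\<^bsub>A\<^esub> y)"
    and kmod: "module k A" and fk: "fin_gen k A" using A by (auto simp: artin_algebra_def)
  interpret m: module k A by fact
  have lk: "left_module k A"
    by (intro left_module.intro left_module_axioms.intro m.ring_axioms A.abelian_group_axioms)
      (auto simp: m.smult_l_distr m.smult_r_distr m.smult_assoc1)
  let ?S = "A\<lparr>carrier := B\<rparr>"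
  have lS: "left_module ?S (self_mod A)" by (rule restrict_left_module[OF sub left_module_self[OF A.ring_axioms]])
  obtain T where T: "finite T" "T \<subseteq> carrier A" "\<And>H. submodule H k A \<Longrightarrow> T \<subseteq> H \<Longrightarrow> H = carrier A"
    using fk unfolding fin_gen_def by auto
  have "fin_gen ?S (self_mod A)" unfolding fin_gen_def
  proof (intro exI[of _ T] conjI allI impI T(1))
    show "T \<subseteq> carrier (self_mod A)" using T(2) by simp
    fix H assume H: "submodule H ?S (self_mod A) \<and> T \<subseteq> H"
    note sH = H[THEN conjunct1, unfolded submodule_iff[OF lS]]
    have "submodule H k A" unfolding submodule_iff[OF lk]
    proof (intro conjI ballI)
      show "H \<subseteq> carrier A" "\<zero>\<^bsub>A\<^esub> \<in> H" using sH by simp_all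
      show "x \<oplus>\<^bsub>A\<^esub> y \<in> H" if "x \<in> H" "y \<in> H" for x y using sH that by simp
      show "c \<odot>\<^bsub>A\<^esub> x \<in> H" if c: "c \<in> carrier k" and x: "x \<in> H" for c x
      proof -
        have "c \<odot>\<^bsub>A\<^esub> \<one>\<^bsub>A\<^esub> \<in> B" by (rule submodule.smult_closed[OF kB c subringE(3)[OF sub]])
        then have "(c \<odot>\<^bsub>A\<^esub> \<one>\<^bsub>A\<^esub>) \<otimes>\<^bsub>A\<^esub> x \<in> H" using sH x by simp
        moreover have "x \<in> carrier A" using sH x by auto
        ultimately show ?thesis using bil[OF c A.one_closed] by simp
      qed
    qed
    then show "H = carrier (self_mod A)" using T(3) H by simp
  qed
  then show ?thesis
    by (intro finite_length_extension.intro finite_length_extension_axioms.intro A.finite_length_ring_axioms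
        finite_length_ring_artin_algebra[OF B] sub)
qed

theorem theorem1p3:
  fixes k :: "'k ring"
    and A :: "('k, 'a) module"
    and B I :: "'a set"
  assumes ext: "artin_extension k B A"
    and ideal: "ideal I (A\<lparr>carrier := B\<rparr>)"
    and left: "left_ideal (I \<cdot>\<^bsub>A\<lparr>carrier := B\<rparr>\<^esub> jacobson_radical (A\<lparr>carrier := B\<rparr>)) A"
    and syz: "syzygy_finite (A\<lparr>carrier := B\<rparr>) (quotient_mods (A\<lparr>carrier := B\<rparr>) I)"
    and tf: "torsionless_finite A"
  shows "fin_dim (A\<lparr>carrier := B\<rparr>) < \<infinity>"
  by (rule finite_length_extension.fin_dim_extension[OF finite_length_extension_artin[OF ext] ideal left syz tf])

end
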